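(* Let $X$ be a smooth connected algebraic variety over an algebraically closed field $k$, and let $Y$ be a locally Cohen-Macaulay multiple structure on $X$ which is of free type. Let $I\subset\mathcal{O}_Y$ be the ideal sheaf of $X$ in $Y$, let $m$ be the integer with $I^m\neq 0$ and $I^{m+1}=0$, and let $\mathcal{A}_\ell=\mathcal{A}_\ell(Y)$, $\mathcal{M}_\ell=\mathcal{M}_\ell(Y)$ ($0\le \ell\le m$) be the $\mathcal{O}_X$-modules associated to $Y$ as defined in the context. Then $Y$ is Gorenstein if and only if the following three conditions are all fulfilled: (a) $\mathcal{A}_m$ and $\mathcal{M}_m$ are line bundles on $X$; (b) $\mathcal{A}_m=\mathcal{M}_m$; (c) for all $0\le \ell\le m$ the canonical maps $$\mathcal{A}_\ell \longrightarrow \mathcal{H}om_{\mathcal{O}_X}(\mathcal{M}_{m-\ell},\mathcal{M}_m)\cong \mathcal{M}_{m-\ell}^\vee\otimes \mathcal{M}_m$$ induced by multiplication are isomorphisms.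
   Context: Let $X$ be a smooth connected algebraic variety over an algebraically closed field $k$. A locally Cohen-Macaulay scheme $Y$ (over $k$) is called a multiple structure on $X$ if its underlying reduced scheme $Y_{\mathrm{red}}$ is $X$. Let $I\subset\mathcal{O}_Y$ be the ideal sheaf of $X$ in $Y$ and let $m$ be the integer such that $I^m\neq 0$, $I^{m+1}=0$. All colon (annihilator) ideals below are taken in $\mathcal{O}_Y$, and $I^0=\mathcal{O}_Y$. For $0\le \ell\le m+1$ put $$I_\ell = 0:I^{\,m+1-\ell},\qquad J_\ell = 0:I_{m+1-\ell}=0:(0:I^\ell).$$ These are decreasing filtrations of $\mathcal{O}_Y$ with $I_0=J_0=\mathcal{O}_Y$, $I_{m+1}=J_{m+1}=0$, and $J_\ell\subset I_\ell$. For $0\le\ell\le m$ define $$\mathcal{M}_\ell(Y)=I_\ell/I_{\ell+1},\qquad \mathcal{A}_\ell(Y)=J_\ell/J_{\ell+1}.$$ The inclusions $J_\ell\subset I_\ell$ induce canonical maps $\mathcal{A}_\ell(Y)\to\mathcal{M}_\ell(Y)$. In particular $\mathcal{A}_m(Y)=J_m$ and $\mathcal{M}_m(Y)=I_m$, with $J_m\subset I_m\subset\mathcal{O}_Y$. The equality $\mathcal{A}_m=\mathcal{M}_m$ is understood with respect to this canonical inclusion. The sum $\mathcal{A}(Y)=\bigoplus_{\ell=0}^m\mathcal{A}_\ell(Y)$ is a graded $\mathcal{O}_X$-algebra and $\mathcal{M}(Y)=\bigoplus_{\ell=0}^m\mathcal{M}_\ell(Y)$ is a graded $\mathcal{A}(Y)$-module,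 with operations induced by multiplication in $\mathcal{O}_Y$. In particular multiplication gives maps $\mathcal{A}_\ell\otimes\mathcal{M}_{m-\ell}\to\mathcal{M}_m$. The canonical maps $\mathcal{A}_\ell\to\mathcal{H}om_{\mathcal{O}_X}(\mathcal{M}_{m-\ell},\mathcal{M}_m)$ are the ones adjoint to these. $Y$ is called of free type if all the graded pieces $\mathcal{A}_0(Y),\dots,\mathcal{A}_m(Y),\mathcal{M}_0(Y),\dots,\mathcal{M}_m(Y)$ are locally free $\mathcal{O}_X$-modules. $Y$ is Gorenstein if all its local rings are Gorenstein. For a locally free sheaf $\mathcal{E}$ on $X$, $\mathcal{E}^\vee=\mathcal{H}om_{\mathcal{O}_X}(\mathcal{E},\mathcal{O}_X)$. *)

theory Defs
  imports
    "HOL-Analysis.Function_Topology"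
    "HOL-Library.Extended_Nat"
    "HOL-Algebra.Algebra"
begin

section \<open>Commutative algebra\<close>

subsection \<open>Noetherian local rings: dimension, depth, regularity, Cohen-Macaulayness\<close>

definition noetherian_local_ring :: "'a ring \<Rightarrow> bool" where
  "noetherian_local_ring R \<longleftrightarrow> cring R \<and> noetherian_ring R \<and> (\<exists>!M. maximalideal M R)"

definition krull_dim :: "'a ring \<Rightarrow> enat" where
  "krull_dim R = Sup {enat n | n. \<exists>P :: nat \<Rightarrow> 'a set.
     (\<forall>i\<le>n. primeideal (P i) R) \<and> (\<forall>i<n. P i \<subset> P (Suc i))}"

definition regular_sequence :: "'a ring \<Rightarrow> 'a list \<Rightarrow> bool" where
  "regular_sequence R xs \<longleftrightarrow>
     set xs \<subseteq> carrier R \<and>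
     (\<forall>i<length xs. \<forall>a\<in>carrier R.
        xs ! i \<otimes>\<^bsub>R\<^esub> a \<in> genideal R (set (take i xs)) \<longrightarrow> a \<in> genideal R (set (take i xs))) \<and>
     genideal R (set xs) \<noteq> carrier R"

definition depth :: "'a ring \<Rightarrow> enat" where
  "depth R = Sup {enat (length xs) | xs. regular_sequence R xs}"

definition cohen_macaulay_local_ring :: "'a ring \<Rightarrow> bool" where
  "cohen_macaulay_local_ring R \<longleftrightarrow> noetherian_local_ring R \<and> depth R = krull_dim R"

definition regular_local_ring :: "'a ring \<Rightarrow> bool" where
  "regular_local_ring R \<longleftrightarrow> noetherian_local_ring R \<and>
     (\<exists>S \<subseteq> carrier R. finite S \<and> maximalideal (genideal R S) R \<and> enat (card S) = krull_dim R)"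

subsection \<open>Injective dimension and Gorenstein local rings\<close>

definition mod_hom :: "'a ring \<Rightarrow> ('a, 'm) module \<Rightarrow> ('a, 'n) module \<Rightarrow> ('m \<Rightarrow> 'n) set" where
  "mod_hom R M N = {f \<in> carrier M \<rightarrow> carrier N.
     (\<forall>x\<in>carrier M. \<forall>y\<in>carrier M. f (x \<oplus>\<^bsub>M\<^esub> y) = f x \<oplus>\<^bsub>N\<^esub> f y) \<and>
     (\<forall>a\<in>carrier R. \<forall>x\<in>carrier M. f (a \<odot>\<^bsub>M\<^esub> x) = a \<odot>\<^bsub>N\<^esub> f x)}"

definition mod_ker :: "('a, 'm) module \<Rightarrow> ('a, 'n) module \<Rightarrow> ('m \<Rightarrow> 'n) \<Rightarrow> 'm set" where
  "mod_ker M N f = {x \<in> carrier M. f x = \<zero>\<^bsub>N\<^esub>}"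

definition injective_module :: "'a ring \<Rightarrow> ('a, 'm) module \<Rightarrow> bool" where
  "injective_module R E \<longleftrightarrow> Module.module R E \<and>
     (\<forall>(M :: ('a, 'm) module) (N :: ('a, 'm) module) f g.
        Module.module R M \<and> Module.module R N \<and>
        f \<in> mod_hom R M N \<and> inj_on f (carrier M) \<and> g \<in> mod_hom R M E \<longrightarrow>
        (\<exists>h \<in> mod_hom R N E. \<forall>x\<in>carrier M. h (f x) = g x))"

definition injective_resolution ::
  "'a ring \<Rightarrow> ('a, 'n) module \<Rightarrow> (nat \<Rightarrow> ('a, 'm) module) \<Rightarrow> ('n \<Rightarrow> 'm) \<Rightarrow> (nat \<Rightarrow> 'm \<Rightarrow> 'm) \<Rightarrow> bool"
  where
  "injective_resolution R M E e d \<longleftrightarrow>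
     (\<forall>i. injective_module R (E i)) \<and>
     e \<in> mod_hom R M (E 0) \<and> inj_on e (carrier M) \<and>
     (\<forall>i. d i \<in> mod_hom R (E i) (E (Suc i))) \<and>
     e ` carrier M = mod_ker (E 0) (E 1) (d 0) \<and>
     (\<forall>i. d i ` carrier (E i) = mod_ker (E (Suc i)) (E (Suc (Suc i))) (d (Suc i)))"

definition self_module :: "'a ring \<Rightarrow> ('a, 'a) module" where
  "self_module R = \<lparr>carrier = carrier R, monoid.mult = monoid.mult R, monoid.one = monoid.one R,
     ring.zero = ring.zero R, ring.add = ring.add R, module.smult = monoid.mult R\<rparr>"

text \<open>
  A term of HOL cannot quantify over modules on arbitrary types, so injective modules are taken
  with elements in the type \<open>'a list set\<close>.  This loses nothing for a ring \<open>R\<close> with elements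
  in \<open>'a\<close>: every ideal of \<open>R\<close> embeds into that type, so injectivity tested there is injectivity
  (Baer); and every \<open>R\<close>-module with elements in that type embeds into an injective one with
  elements in it (if \<open>T\<close> is \<open>'a list set\<close>, then there are no more functions
  from \<open>'a\<close> to \<open>T\<close> than elements of \<open>T\<close>), so injective resolutions exist
  and a finite one exists in that type whenever one exists at all.
\<close>

definition finite_self_injective_dimension :: "'a ring \<Rightarrow> bool" where
  "finite_self_injective_dimension R \<longleftrightarrow>
     (\<exists>(E :: nat \<Rightarrow> ('a, 'a list set) module) e d n.
        injective_resolution R (self_module R) E e d \<and> (\<forall>i>n. carrier (E i) = {\<zero>\<^bsub>E i\<^esub>}))"

definition gorenstein_local_ring :: "'a ring \<Rightarrow> bool" where
  "gorenstein_local_ring R \<longleftrightarrow> noetherian_local_ring R \<and> finite_self_injective_dimension R"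

subsection \<open>Powers of ideals and localization at a prime\<close>

primrec ideal_pow :: "'a ring \<Rightarrow> 'a set \<Rightarrow> nat \<Rightarrow> 'a set" where
  "ideal_pow R I 0 = carrier R"
| "ideal_pow R I (Suc n) = ideal_prod R (ideal_pow R I n) I"

definition loc_frac :: "'a ring \<Rightarrow> 'a set \<Rightarrow> 'a \<Rightarrow> 'a \<Rightarrow> ('a \<times> 'a) set" where
  "loc_frac R P a s = {(b, t). b \<in> carrier R \<and> t \<in> carrier R - P \<and>
     (\<exists>u \<in> carrier R - P. u \<otimes>\<^bsub>R\<^esub> (a \<otimes>\<^bsub>R\<^esub> t) = u \<otimes>\<^bsub>R\<^esub> (b \<otimes>\<^bsub>R\<^esub> s))}"

definition localization :: "'a ring \<Rightarrow> 'a set \<Rightarrow> ('a \<times> 'a) set ring" where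
  "localization R P = \<lparr>
     carrier = {loc_frac R P a s | a s. a \<in> carrier R \<and> s \<in> carrier R - P},
     monoid.mult = (\<lambda>A B. THE C. \<exists>a\<in>carrier R. \<exists>s\<in>carrier R - P. \<exists>b\<in>carrier R. \<exists>t\<in>carrier R - P.
       A = loc_frac R P a s \<and> B = loc_frac R P b t \<and> C = loc_frac R P (a \<otimes>\<^bsub>R\<^esub> b) (s \<otimes>\<^bsub>R\<^esub> t)),
     monoid.one = loc_frac R P \<one>\<^bsub>R\<^esub> \<one>\<^bsub>R\<^esub>,
     ring.zero = loc_frac R P \<zero>\<^bsub>R\<^esub> \<one>\<^bsub>R\<^esub>,
     ring.add = (\<lambda>A B. THE C. \<exists>a\<in>carrier R. \<exists>s\<in>carrier R - P. \<exists>b\<in>carrier R. \<exists>t\<in>carrier R - P.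
       A = loc_frac R P a s \<and> B = loc_frac R P b t \<and>
       C = loc_frac R P ((a \<otimes>\<^bsub>R\<^esub> t) \<oplus>\<^bsub>R\<^esub> (b \<otimes>\<^bsub>R\<^esub> s)) (s \<otimes>\<^bsub>R\<^esub> t))\<rparr>"

section \<open>Schemes\<close>

subsection \<open>Ringed spaces\<close>

text \<open>
  \<open>sect Z U\<close> and \<open>restr Z U V\<close> are meaningful only for open \<open>V \<subseteq> U\<close>.
\<close>

record ('p, 'r) ringed_space =
  space_of :: "'p topology"
  sect :: "'p set \<Rightarrow> 'r ring"
  restr :: "'p set \<Rightarrow> 'p set \<Rightarrow> 'r \<Rightarrow> 'r"

definition opens_in :: "('p, 'r) ringed_space \<Rightarrow> 'p set \<Rightarrow> 'p set set" where
  "opens_in Z U = {V. openin (space_of Z) V \<and> V \<subseteq> U}"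

definition nhds_in :: "('p, 'r) ringed_space \<Rightarrow> 'p set \<Rightarrow> 'p \<Rightarrow> 'p set set" where
  "nhds_in Z U x = {V. openin (space_of Z) V \<and> x \<in> V \<and> V \<subseteq> U}"

definition is_ringed_space :: "('p, 'r) ringed_space \<Rightarrow> bool" where
  "is_ringed_space Z \<longleftrightarrow>
     (\<forall>U. openin (space_of Z) U \<longrightarrow> cring (sect Z U)) \<and>
     (\<forall>U V. openin (space_of Z) U \<and> V \<in> opens_in Z U \<longrightarrow> restr Z U V \<in> ring_hom (sect Z U) (sect Z V)) \<and>
     (\<forall>U. openin (space_of Z) U \<longrightarrow> (\<forall>s\<in>carrier (sect Z U). restr Z U U s = s)) \<and>
     (\<forall>U V W. openin (space_of Z) U \<and> V \<in> opens_in Z U \<and> W \<in> opens_in Z V \<longrightarrow>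
        (\<forall>s\<in>carrier (sect Z U). restr Z V W (restr Z U V s) = restr Z U W s)) \<and>
     (\<forall>\<U>. (\<forall>V\<in>\<U>. openin (space_of Z) V) \<longrightarrow>
        (\<forall>s\<in>carrier (sect Z (\<Union>\<U>)). \<forall>t\<in>carrier (sect Z (\<Union>\<U>)).
           (\<forall>V\<in>\<U>. restr Z (\<Union>\<U>) V s = restr Z (\<Union>\<U>) V t) \<longrightarrow> s = t)) \<and>
     (\<forall>\<U> s. (\<forall>V\<in>\<U>. openin (space_of Z) V \<and> s V \<in> carrier (sect Z V)) \<and>
        (\<forall>V\<in>\<U>. \<forall>W\<in>\<U>. restr Z V (V \<inter> W) (s V) = restr Z W (V \<inter> W) (s W)) \<longrightarrow>
        (\<exists>t\<in>carrier (sect Z (\<Union>\<U>)). \<forall>V\<in>\<U>. restr Z (\<Union>\<U>) V t = s V))"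

definition open_subspace :: "('p, 'r) ringed_space \<Rightarrow> 'p set \<Rightarrow> ('p, 'r) ringed_space" where
  "open_subspace Z U = Z\<lparr>space_of := subtopology (space_of Z) U\<rparr>"

definition ringed_space_iso ::
  "('p, 'r) ringed_space \<Rightarrow> ('q, 's) ringed_space \<Rightarrow> ('p \<Rightarrow> 'q) \<Rightarrow> ('q set \<Rightarrow> 's \<Rightarrow> 'r) \<Rightarrow> bool" where
  "ringed_space_iso Z T f \<phi> \<longleftrightarrow>
     homeomorphic_map (space_of Z) (space_of T) f \<and>
     (\<forall>V. openin (space_of T) V \<longrightarrow>
        \<phi> V \<in> ring_iso (sect T V) (sect Z {x \<in> topspace (space_of Z). f x \<in> V})) \<and>
     (\<forall>V W. openin (space_of T) V \<and> W \<in> opens_in T V \<longrightarrow> (\<forall>s\<in>carrier (sect T V).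
        \<phi> W (restr T V W s) =
        restr Z {x \<in> topspace (space_of Z). f x \<in> V} {x \<in> topspace (space_of Z). f x \<in> W} (\<phi> V s)))"

definition germ :: "('p, 'r) ringed_space \<Rightarrow> 'p \<Rightarrow> 'p set \<Rightarrow> 'r \<Rightarrow> ('p set \<times> 'r) set" where
  "germ Z x U s = {(V, t). openin (space_of Z) V \<and> x \<in> V \<and> t \<in> carrier (sect Z V) \<and>
     (\<exists>W \<in> nhds_in Z (U \<inter> V) x. restr Z U W s = restr Z V W t)}"

definition stalk :: "('p, 'r) ringed_space \<Rightarrow> 'p \<Rightarrow> ('p set \<times> 'r) set ring" where
  "stalk Z x = \<lparr>
     carrier = {germ Z x U s | U s. openin (space_of Z) U \<and> x \<in> U \<and> s \<in> carrier (sect Z U)},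
     monoid.mult = (\<lambda>A B. THE C. \<exists>U s t. openin (space_of Z) U \<and> x \<in> U \<and>
       s \<in> carrier (sect Z U) \<and> t \<in> carrier (sect Z U) \<and>
       A = germ Z x U s \<and> B = germ Z x U t \<and> C = germ Z x U (s \<otimes>\<^bsub>sect Z U\<^esub> t)),
     monoid.one = germ Z x (topspace (space_of Z)) \<one>\<^bsub>sect Z (topspace (space_of Z))\<^esub>,
     ring.zero = germ Z x (topspace (space_of Z)) \<zero>\<^bsub>sect Z (topspace (space_of Z))\<^esub>,
     ring.add = (\<lambda>A B. THE C. \<exists>U s t. openin (space_of Z) U \<and> x \<in> U \<and>
       s \<in> carrier (sect Z U) \<and> t \<in> carrier (sect Z U) \<and>
       A = germ Z x U s \<and> B = germ Z x U t \<and> C = germ Z x U (s \<oplus>\<^bsub>sect Z U\<^esub> t))\<rparr>"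

subsection \<open>Spectra and schemes\<close>

definition zariski :: "'a ring \<Rightarrow> 'a set topology" where
  "zariski R = topology_generated_by {{P. primeideal P R \<and> f \<notin> P} | f. f \<in> carrier R}"

definition Spec :: "'a ring \<Rightarrow> ('a set, 'a set \<Rightarrow> ('a \<times> 'a) set) ringed_space" where
  "Spec R = \<lparr>
     space_of = zariski R,
     sect = (\<lambda>U. \<lparr>
       carrier = {s \<in> extensional U.
         \<forall>P\<in>U. \<exists>V. openin (zariski R) V \<and> P \<in> V \<and> V \<subseteq> U \<and>
           (\<exists>a\<in>carrier R. \<exists>f\<in>carrier R. \<forall>Q\<in>V. f \<notin> Q \<and> s Q = loc_frac R Q a f)},
       monoid.mult = (\<lambda>s t. \<lambda>P\<in>U. s P \<otimes>\<^bsub>localization R P\<^esub> t P),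
       monoid.one = (\<lambda>P\<in>U. \<one>\<^bsub>localization R P\<^esub>),
       ring.zero = (\<lambda>P\<in>U. \<zero>\<^bsub>localization R P\<^esub>),
       ring.add = (\<lambda>s t. \<lambda>P\<in>U. s P \<oplus>\<^bsub>localization R P\<^esub> t P)\<rparr>),
     restr = (\<lambda>U V s. restrict s V)\<rparr>"

text \<open>
  In the next definition \<open>R\<close> may be taken on the type of sections of \<open>Z\<close>, because it is necessarily
  isomorphic to \<open>sect Z U\<close>.
\<close>

definition affine_open :: "('p, 'r) ringed_space \<Rightarrow> 'p set \<Rightarrow> bool" where
  "affine_open Z U \<longleftrightarrow> openin (space_of Z) U \<and>
     (\<exists>(R :: 'r ring) f \<phi>. cring R \<and> ringed_space_iso (open_subspace Z U) (Spec R) f \<phi>)"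

definition is_scheme :: "('p, 'r) ringed_space \<Rightarrow> bool" where
  "is_scheme Z \<longleftrightarrow> is_ringed_space Z \<and>
     (\<forall>x\<in>topspace (space_of Z). \<exists>U. x \<in> U \<and> affine_open Z U)"

definition locally_noetherian :: "('p, 'r) ringed_space \<Rightarrow> bool" where
  "locally_noetherian Z \<longleftrightarrow>
     (\<forall>x\<in>topspace (space_of Z). \<exists>U. x \<in> U \<and> affine_open Z U \<and> noetherian_ring (sect Z U))"

definition locally_cohen_macaulay :: "('p, 'r) ringed_space \<Rightarrow> bool" where
  "locally_cohen_macaulay Z \<longleftrightarrow> locally_noetherian Z \<and>
     (\<forall>x\<in>topspace (space_of Z). cohen_macaulay_local_ring (stalk Z x))"

definition gorenstein :: "('p, 'r) ringed_space \<Rightarrow> bool" where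
  "gorenstein Z \<longleftrightarrow> (\<forall>x\<in>topspace (space_of Z). gorenstein_local_ring (stalk Z x))"

definition reduced :: "('p, 'r) ringed_space \<Rightarrow> bool" where
  "reduced Z \<longleftrightarrow> (\<forall>U. openin (space_of Z) U \<longrightarrow>
     (\<forall>s\<in>carrier (sect Z U). \<forall>n::nat. s [^]\<^bsub>sect Z U\<^esub> n = \<zero>\<^bsub>sect Z U\<^esub> \<longrightarrow> s = \<zero>\<^bsub>sect Z U\<^esub>))"

subsection \<open>Varieties\<close>

text \<open>
  A scheme over \<open>k\<close> is a scheme \<open>Z\<close> with a ring homomorphism \<open>\<kappa>\<close> from \<open>k\<close> to its ring of global
  sections.
\<close>

definition is_scheme_over :: "'k ring \<Rightarrow> ('p, 'r) ringed_space \<Rightarrow> ('k \<Rightarrow> 'r) \<Rightarrow> bool" where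
  "is_scheme_over k Z \<kappa> \<longleftrightarrow> is_scheme Z \<and> \<kappa> \<in> ring_hom k (sect Z (topspace (space_of Z)))"

definition finite_type_over :: "'k ring \<Rightarrow> ('p, 'r) ringed_space \<Rightarrow> ('k \<Rightarrow> 'r) \<Rightarrow> bool" where
  "finite_type_over k Z \<kappa> \<longleftrightarrow>
     (\<exists>\<U>. finite \<U> \<and> \<Union>\<U> = topspace (space_of Z) \<and>
        (\<forall>U\<in>\<U>. affine_open Z U \<and>
           (\<exists>S \<subseteq> carrier (sect Z U). finite S \<and>
              generate_ring (sect Z U) ((\<lambda>a. restr Z (topspace (space_of Z)) U (\<kappa> a)) ` carrier k \<union> S) =
              carrier (sect Z U))))"

text \<open>
  Separatedness over an affine base: the diagonal is a closed immersion.  Over a product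
  of affine open sets \<open>U\<close>, \<open>V\<close> this means that \<open>U \<inter> V\<close> is affine and that the tensor product of the
  rings of \<open>U\<close> and \<open>V\<close> maps onto the ring of \<open>U \<inter> V\<close>; the image of that map is the subring
  generated by the two rings.
\<close>

definition is_separated :: "('p, 'r) ringed_space \<Rightarrow> bool" where
  "is_separated Z \<longleftrightarrow>
     (\<forall>U V. affine_open Z U \<and> affine_open Z V \<longrightarrow>
        affine_open Z (U \<inter> V) \<and>
        generate_ring (sect Z (U \<inter> V))
          (restr Z U (U \<inter> V) ` carrier (sect Z U) \<union> restr Z V (U \<inter> V) ` carrier (sect Z V)) =
        carrier (sect Z (U \<inter> V)))"

text \<open>
  Smoothness is nonsingularity, i.e. regularity of all local rings; the base field
  is algebraically closed in the application.
\<close>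

definition smooth_connected_variety :: "'k ring \<Rightarrow> ('p, 'r) ringed_space \<Rightarrow> ('k \<Rightarrow> 'r) \<Rightarrow> bool" where
  "smooth_connected_variety k Z \<kappa> \<longleftrightarrow>
     is_scheme_over k Z \<kappa> \<and> reduced Z \<and> is_separated Z \<and> finite_type_over k Z \<kappa> \<and>
     connected_space (space_of Z) \<and>
     (\<forall>x\<in>topspace (space_of Z). regular_local_ring (stalk Z x))"

section \<open>Sheaves of modules\<close>

record ('p, 'r, 'm) mod_sheaf =
  msect :: "'p set \<Rightarrow> ('r, 'm) module"
  mrestr :: "'p set \<Rightarrow> 'p set \<Rightarrow> 'm \<Rightarrow> 'm"

definition mod_sheaf_iso ::
  "('p, 'r) ringed_space \<Rightarrow> ('p, 'r, 'm) mod_sheaf \<Rightarrow> ('p, 'r, 'n) mod_sheaf \<Rightarrow>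
   ('p set \<Rightarrow> 'm \<Rightarrow> 'n) \<Rightarrow> bool" where
  "mod_sheaf_iso Z F G \<theta> \<longleftrightarrow>
     (\<forall>U. openin (space_of Z) U \<longrightarrow>
        \<theta> U \<in> mod_hom (sect Z U) (msect F U) (msect G U) \<and>
        bij_betw (\<theta> U) (carrier (msect F U)) (carrier (msect G U)) \<and>
        (\<forall>V\<in>opens_in Z U. \<forall>s\<in>carrier (msect F U).
           \<theta> V (mrestr F U V s) = mrestr G U V (\<theta> U s)))"

definition free_mod_sheaf ::
  "('p, 'r) ringed_space \<Rightarrow> nat \<Rightarrow> ('p, 'r, nat \<Rightarrow> 'r) mod_sheaf" where
  "free_mod_sheaf Z n = \<lparr>
     msect = (\<lambda>U. \<lparr>
       carrier = {..<n} \<rightarrow>\<^sub>E carrier (sect Z U), monoid.mult = undefined, monoid.one = undefined,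
       ring.zero = (\<lambda>i\<in>{..<n}. \<zero>\<^bsub>sect Z U\<^esub>),
       ring.add = (\<lambda>v w. \<lambda>i\<in>{..<n}. v i \<oplus>\<^bsub>sect Z U\<^esub> w i),
       module.smult = (\<lambda>a v. \<lambda>i\<in>{..<n}. a \<otimes>\<^bsub>sect Z U\<^esub> v i)\<rparr>),
     mrestr = (\<lambda>U V v. \<lambda>i\<in>{..<n}. restr Z U V (v i))\<rparr>"

definition locally_free :: "('p, 'r) ringed_space \<Rightarrow> ('p, 'r, 'm) mod_sheaf \<Rightarrow> bool" where
  "locally_free Z F \<longleftrightarrow> (\<forall>x\<in>topspace (space_of Z). \<exists>U. openin (space_of Z) U \<and> x \<in> U \<and>
     (\<exists>n \<theta>. mod_sheaf_iso (open_subspace Z U) (free_mod_sheaf Z n) F \<theta>))"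

definition line_bundle :: "('p, 'r) ringed_space \<Rightarrow> ('p, 'r, 'm) mod_sheaf \<Rightarrow> bool" where
  "line_bundle Z F \<longleftrightarrow> (\<forall>x\<in>topspace (space_of Z). \<exists>U. openin (space_of Z) U \<and> x \<in> U \<and>
     (\<exists>\<theta>. mod_sheaf_iso (open_subspace Z U) (free_mod_sheaf Z 1) F \<theta>))"

text \<open>
  A section of the sheaf of homomorphisms over \<open>U\<close> is a morphism of the restrictions to \<open>U\<close>,
  i.e. a compatible family of homomorphisms indexed by the open subsets of \<open>U\<close>.
\<close>

definition hom_sheaf ::
  "('p, 'r) ringed_space \<Rightarrow> ('p, 'r, 'm) mod_sheaf \<Rightarrow> ('p, 'r, 'n) mod_sheaf \<Rightarrow>
   ('p, 'r, 'p set \<Rightarrow> 'm \<Rightarrow> 'n) mod_sheaf" where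
  "hom_sheaf Z F G = \<lparr>
     msect = (\<lambda>U. \<lparr>
       carrier = {\<phi> \<in> extensional (opens_in Z U).
         (\<forall>V\<in>opens_in Z U.
            \<phi> V \<in> mod_hom (sect Z V) (msect F V) (msect G V) \<inter> extensional (carrier (msect F V)) \<and>
            (\<forall>W\<in>opens_in Z V. \<forall>s\<in>carrier (msect F V).
               \<phi> W (mrestr F V W s) = mrestr G V W (\<phi> V s)))},
       monoid.mult = undefined, monoid.one = undefined,
       ring.zero = (\<lambda>V\<in>opens_in Z U. \<lambda>s\<in>carrier (msect F V). \<zero>\<^bsub>msect G V\<^esub>),
       ring.add = (\<lambda>\<phi> \<psi>. \<lambda>V\<in>opens_in Z U. \<lambda>s\<in>carrier (msect F V). \<phi> V s \<oplus>\<^bsub>msect G V\<^esub> \<psi> V s),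
       module.smult = (\<lambda>a \<phi>. \<lambda>V\<in>opens_in Z U. \<lambda>s\<in>carrier (msect F V). restr Z U V a \<odot>\<^bsub>msect G V\<^esub> \<phi> V s)\<rparr>),
     mrestr = (\<lambda>U V \<phi>. restrict \<phi> (opens_in Z V))\<rparr>"

subsection \<open>Ideal sheaves and their quotients\<close>

text \<open>
  An ideal sheaf of \<open>Y\<close> is given by its sections over each open set, as a subset of \<open>sect Y U\<close>.
\<close>

definition zero_ideal_sheaf :: "('p, 'r) ringed_space \<Rightarrow> ('p set \<Rightarrow> 'r set) \<Rightarrow> bool" where
  "zero_ideal_sheaf Y F \<longleftrightarrow> (\<forall>U. openin (space_of Y) U \<longrightarrow> F U = {\<zero>\<^bsub>sect Y U\<^esub>})"

definition ideal_sheaf_pow ::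
  "('p, 'r) ringed_space \<Rightarrow> ('p set \<Rightarrow> 'r set) \<Rightarrow> nat \<Rightarrow> 'p set \<Rightarrow> 'r set" where
  "ideal_sheaf_pow Y F n U = {s \<in> carrier (sect Y U).
     \<forall>x\<in>U. \<exists>V\<in>nhds_in Y U x. restr Y U V s \<in> ideal_pow (sect Y V) (F V) n}"

definition ann_sheaf :: "('p, 'r) ringed_space \<Rightarrow> ('p set \<Rightarrow> 'r set) \<Rightarrow> 'p set \<Rightarrow> 'r set" where
  "ann_sheaf Y F U = {s \<in> carrier (sect Y U).
     \<forall>V\<in>opens_in Y U. \<forall>t\<in>F V. restr Y U V s \<otimes>\<^bsub>sect Y V\<^esub> t = \<zero>\<^bsub>sect Y V\<^esub>}"

definition ideal_stalk ::
  "('p, 'r) ringed_space \<Rightarrow> ('p set \<Rightarrow> 'r set) \<Rightarrow> 'p \<Rightarrow> ('p set \<times> 'r) set set" where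
  "ideal_stalk Y F x = {germ Y x U s | U s. openin (space_of Y) U \<and> x \<in> U \<and> s \<in> F U}"

text \<open>
  For a surjection \<open>\<pi>\<close> from the structure sheaf of \<open>Y\<close> to that of \<open>Z\<close> (on the same space) and ideal
  sheaves \<open>G \<subseteq> F\<close> of \<open>Y\<close> such that the kernel of \<open>\<pi>\<close> times \<open>F\<close> lies in \<open>G\<close>, this is the sheaf \<open>F/G\<close>
  as a sheaf of modules over \<open>Z\<close>.  It is the sheafification of the presheaf of quotients, realized
  as usual: a section is a function assigning to each point an element of the
  quotient of stalks, which is locally induced by a section of \<open>F\<close>.
  A section \<open>a\<close> of \<open>Z\<close> acts through any local lift of \<open>a\<close> to \<open>Y\<close>.
\<close>

definition quot_sheaf ::
  "('p, 's) ringed_space \<Rightarrow> ('p, 'r) ringed_space \<Rightarrow> ('p set \<Rightarrow> 'r \<Rightarrow> 's) \<Rightarrow>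
   ('p set \<Rightarrow> 'r set) \<Rightarrow> ('p set \<Rightarrow> 'r set) \<Rightarrow> ('p, 's, 'p \<Rightarrow> ('p set \<times> 'r) set set) mod_sheaf" where
  "quot_sheaf Z Y \<pi> F G = \<lparr>
     msect = (\<lambda>U. \<lparr>
       carrier = {\<sigma> \<in> extensional U. \<forall>x\<in>U. \<exists>V\<in>nhds_in Y U x. \<exists>s\<in>F V. \<forall>y\<in>V.
         \<sigma> y = ideal_stalk Y G y +>\<^bsub>stalk Y y\<^esub> germ Y y V s},
       monoid.mult = undefined, monoid.one = undefined,
       ring.zero = (\<lambda>x\<in>U. ideal_stalk Y G x),
       ring.add = (\<lambda>\<sigma> \<tau>. \<lambda>x\<in>U. set_add (stalk Y x) (\<sigma> x) (\<tau> x)),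
       module.smult = (\<lambda>a \<sigma>. \<lambda>x\<in>U. set_add (stalk Y x)
         {germ Y x V b \<otimes>\<^bsub>stalk Y x\<^esub> t | V b t. V \<in> nhds_in Y U x \<and> b \<in> carrier (sect Y V) \<and>
            \<pi> V b = restr Z U V a \<and> t \<in> \<sigma> x}
         (ideal_stalk Y G x))\<rparr>),
     mrestr = (\<lambda>U V \<sigma>. restrict \<sigma> V)\<rparr>"

section \<open>Multiple structures\<close>

definition sheaf_of_rings_hom ::
  "('p, 'r) ringed_space \<Rightarrow> ('p, 's) ringed_space \<Rightarrow> ('p set \<Rightarrow> 'r \<Rightarrow> 's) \<Rightarrow> bool" where
  "sheaf_of_rings_hom Y Z \<pi> \<longleftrightarrow>
     (\<forall>U. openin (space_of Y) U \<longrightarrow>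
        \<pi> U \<in> ring_hom (sect Y U) (sect Z U) \<and>
        (\<forall>V\<in>opens_in Y U. \<forall>s\<in>carrier (sect Y U). \<pi> V (restr Y U V s) = restr Z U V (\<pi> U s)))"

definition kernel_sheaf ::
  "('p, 'r) ringed_space \<Rightarrow> ('p, 's) ringed_space \<Rightarrow> ('p set \<Rightarrow> 'r \<Rightarrow> 's) \<Rightarrow> 'p set \<Rightarrow> 'r set" where
  "kernel_sheaf Y Z \<pi> U = a_kernel (sect Y U) (sect Z U) (\<pi> U)"

definition nilradical_sheaf :: "('p, 'r) ringed_space \<Rightarrow> 'p set \<Rightarrow> 'r set" where
  "nilradical_sheaf Y U = {s \<in> carrier (sect Y U).
     \<forall>x\<in>U. \<exists>V\<in>nhds_in Y U x. \<exists>n::nat. restr Y U V s [^]\<^bsub>sect Y V\<^esub> n = \<zero>\<^bsub>sect Y V\<^esub>}"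

text \<open>
  The reduced scheme of \<open>Y\<close> has the same underlying space as \<open>Y\<close> and the quotient of the structure
  sheaf by the nilradical as its structure sheaf.  That it is \<open>Z\<close> is expressed by a surjective
  morphism \<open>\<pi>\<close> of sheaves of rings whose kernel is the nilradical.
\<close>

definition is_reduced_scheme_of ::
  "('p, 's) ringed_space \<Rightarrow> ('p, 'r) ringed_space \<Rightarrow> ('p set \<Rightarrow> 'r \<Rightarrow> 's) \<Rightarrow> bool" where
  "is_reduced_scheme_of Z Y \<pi> \<longleftrightarrow>
     space_of Z = space_of Y \<and> sheaf_of_rings_hom Y Z \<pi> \<and>
     (\<forall>U. openin (space_of Y) U \<longrightarrow> (\<forall>s\<in>carrier (sect Z U). \<forall>x\<in>U.
        \<exists>V\<in>nhds_in Y U x. restr Z U V s \<in> \<pi> V ` carrier (sect Y V))) \<and>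
     (\<forall>U. openin (space_of Y) U \<longrightarrow> kernel_sheaf Y Z \<pi> U = nilradical_sheaf Y U)"

definition multiple_structure ::
  "'k ring \<Rightarrow> ('p, 's) ringed_space \<Rightarrow> ('k \<Rightarrow> 's) \<Rightarrow> ('p, 'r) ringed_space \<Rightarrow> ('k \<Rightarrow> 'r) \<Rightarrow>
   ('p set \<Rightarrow> 'r \<Rightarrow> 's) \<Rightarrow> bool" where
  "multiple_structure k Z \<kappa>Z Y \<kappa>Y \<pi> \<longleftrightarrow>
     is_scheme_over k Y \<kappa>Y \<and> locally_cohen_macaulay Y \<and> is_reduced_scheme_of Z Y \<pi> \<and>
     (\<forall>a\<in>carrier k. \<pi> (topspace (space_of Y)) (\<kappa>Y a) = \<kappa>Z a)"

subsection \<open>The two filtrations and their graded pieces\<close>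

text \<open>
  In the following, \<open>I\<close> is the ideal sheaf of \<open>Z\<close> in \<open>Y\<close> and \<open>m\<close> the integer with
  \<open>I^m \<noteq> 0\<close>, \<open>I^(m+1) = 0\<close>.
\<close>

definition I_filt ::
  "('p, 'r) ringed_space \<Rightarrow> ('p set \<Rightarrow> 'r set) \<Rightarrow> nat \<Rightarrow> nat \<Rightarrow> 'p set \<Rightarrow> 'r set" where
  "I_filt Y I m l = ann_sheaf Y (ideal_sheaf_pow Y I (m + 1 - l))"

definition J_filt ::
  "('p, 'r) ringed_space \<Rightarrow> ('p set \<Rightarrow> 'r set) \<Rightarrow> nat \<Rightarrow> nat \<Rightarrow> 'p set \<Rightarrow> 'r set" where
  "J_filt Y I m l = ann_sheaf Y (I_filt Y I m (m + 1 - l))"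

definition M_piece ::
  "('p, 's) ringed_space \<Rightarrow> ('p, 'r) ringed_space \<Rightarrow> ('p set \<Rightarrow> 'r \<Rightarrow> 's) \<Rightarrow> nat \<Rightarrow> nat \<Rightarrow>
   ('p, 's, 'p \<Rightarrow> ('p set \<times> 'r) set set) mod_sheaf" where
  "M_piece Z Y \<pi> m l = (let I = kernel_sheaf Y Z \<pi> in
     quot_sheaf Z Y \<pi> (I_filt Y I m l) (I_filt Y I m (Suc l)))"

definition A_piece ::
  "('p, 's) ringed_space \<Rightarrow> ('p, 'r) ringed_space \<Rightarrow> ('p set \<Rightarrow> 'r \<Rightarrow> 's) \<Rightarrow> nat \<Rightarrow> nat \<Rightarrow>
   ('p, 's, 'p \<Rightarrow> ('p set \<times> 'r) set set) mod_sheaf" where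
  "A_piece Z Y \<pi> m l = (let I = kernel_sheaf Y Z \<pi> in
     quot_sheaf Z Y \<pi> (J_filt Y I m l) (J_filt Y I m (Suc l)))"

definition free_type ::
  "('p, 's) ringed_space \<Rightarrow> ('p, 'r) ringed_space \<Rightarrow> ('p set \<Rightarrow> 'r \<Rightarrow> 's) \<Rightarrow> nat \<Rightarrow> bool" where
  "free_type Z Y \<pi> m \<longleftrightarrow>
     (\<forall>l\<le>m. locally_free Z (A_piece Z Y \<pi> m l) \<and> locally_free Z (M_piece Z Y \<pi> m l))"

text \<open>
  The canonical map from \<open>A_piece\<close> to \<open>M_piece\<close> in degree \<open>l\<close>: the coset of \<open>s\<close> modulo the \<open>J\<close>-filtration
  is sent to the coset of \<open>s\<close> modulo the \<open>I\<close>-filtration.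
\<close>

definition A_to_M ::
  "('p, 's) ringed_space \<Rightarrow> ('p, 'r) ringed_space \<Rightarrow> ('p set \<Rightarrow> 'r \<Rightarrow> 's) \<Rightarrow> nat \<Rightarrow> nat \<Rightarrow>
   'p set \<Rightarrow> ('p \<Rightarrow> ('p set \<times> 'r) set set) \<Rightarrow> ('p \<Rightarrow> ('p set \<times> 'r) set set)" where
  "A_to_M Z Y \<pi> m l U \<alpha> =
     (\<lambda>x\<in>U. set_add (stalk Y x) (\<alpha> x) (ideal_stalk Y (I_filt Y (kernel_sheaf Y Z \<pi>) m (Suc l)) x))"

text \<open>
  The map from \<open>A_piece\<close> in degree \<open>l\<close> to the sheaf of homomorphisms between the \<open>M_piece\<close> in degrees
  \<open>m - l\<close> and \<open>m\<close>: the coset of \<open>s\<close> acts by sending the coset of \<open>t\<close> to the coset of \<open>s t\<close>.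
\<close>

definition mult_map ::
  "('p, 's) ringed_space \<Rightarrow> ('p, 'r) ringed_space \<Rightarrow> ('p set \<Rightarrow> 'r \<Rightarrow> 's) \<Rightarrow> nat \<Rightarrow> nat \<Rightarrow>
   'p set \<Rightarrow> ('p \<Rightarrow> ('p set \<times> 'r) set set) \<Rightarrow>
   'p set \<Rightarrow> ('p \<Rightarrow> ('p set \<times> 'r) set set) \<Rightarrow> ('p \<Rightarrow> ('p set \<times> 'r) set set)" where
  "mult_map Z Y \<pi> m l U \<alpha> =
     (\<lambda>V\<in>opens_in Z U. \<lambda>\<mu>\<in>carrier (msect (M_piece Z Y \<pi> m (m - l)) V). \<lambda>x\<in>V.
        set_add (stalk Y x)
          {s \<otimes>\<^bsub>stalk Y x\<^esub> t | s t. s \<in> \<alpha> x \<and> t \<in> \<mu> x}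
          (ideal_stalk Y (I_filt Y (kernel_sheaf Y Z \<pi>) m (Suc m)) x))"

end

theory Submission
  imports Defs
begin

text \<open>
 Let \<open>B\<close> be a stalk of \<open>Y\<close>, \<open>I\<close> the ideal of \<open>X\<close> in it, \<open>A = B/I\<close> and \<open>F l\<close> the stalk of the ideal sheaf
 written \<open>I\<^sub>l\<close> in the context.  The quotients \<open>F l / F (l + 1)\<close> are free over the regular ring \<open>A\<close>, so that
 \<open>B\<close> has a finite chain of ideals with quotients \<open>A\<close>, and extending homomorphisms from ideals to a module
 reduces to the single ideal \<open>I\<close>.  Being Gorenstein means having finite injective dimension over itself,
 and this is equivalent to \<open>Ext\<^sup>1(A, B) = 0\<close>, i.e. to every homomorphism \<open>I \<rightarrow> B\<close> being a multiplication.

 If \<open>B\<close> has an injective resolution of finite length, homomorphisms from \<open>I\<close> extend to each of its cosyzygies,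
 from the last one back to \<open>B\<close>.  Conversely, resolve \<open>B\<close> by the injective modules \<open>Hom\<^sub>k(B, -)\<close>; if
 \<open>Ext\<^sup>1(A, B) = 0\<close> the \<open>I\<close>-torsion of the resolution is exact, and since \<open>A\<close> is regular its cosyzygy number
 \<open>dim A\<close> is injective over \<open>A\<close>; by the chain, the corresponding cosyzygy of \<open>B\<close> is injective.

 If homomorphisms from all \<open>F l\<close> to \<open>B\<close> are multiplications, then \<open>F m\<close> has rank one and the maps in (c) are
 bijective.  In the other direction a generator of \<open>F m\<close> and the isomorphisms (c) yield, for a local basis of
 \<open>F l / F (l + 1)\<close>, a dual system of multipliers, which extends homomorphisms step by step down to
 \<open>F 1 = I\<close>.  As \<open>F 1 = I\<close>, by connectedness of \<open>X\<close>, condition (b) always holds.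
\<close>

section \<open>Modules and extension of homomorphisms\<close>

text \<open>Ext is never formed as a group: each long exact sequence is replaced by an explicit
  correction of a lift, and injectivity by Baer's criterion, which frees it from the type over which
  \<open>injective_module\<close> quantifies. The base field makes the resolution of B concrete:
  Hom_k(B, M) is injective because k is a field, M embeds into it by a map split over k, and the
  cokernel is again a set of maps B -> M, so that all terms can be coded in the prescribed type. The
  injectivity over A of cosyzygy number dim A comes from trading cosyzygies of the target for
  syzygies of the source, whose number a regular system of parameters bounds. Since regularity
  compares the number of generators of the maximal ideal with the Krull dimension, a form of Krull's
  principal ideal theorem is what produces the regular sequence. On the sheaf side the obstacle is
  that annihilators need not commute with stalks; the local bases of the graded pieces supply the
  finite generation that repairs this.\<close>

definition adjoin :: "'a ring => ('a, 'm) module => 'm set => 'm => 'm set" where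
 "adjoin R N W u = {w \<oplus>\<^bsub>N\<^esub> r \<odot>\<^bsub>N\<^esub> u | w r. w \<in> W \<and> r \<in> carrier R}"

abbreviation sub_mod :: "('a, 'm) module => 'm set => ('a, 'm) module" where
 "sub_mod N W \<equiv> N\<lparr>carrier := W\<rparr>"

lemma mod_homI:
 assumes "!!x. x \<in> carrier M ==> f x \<in> carrier N"
  and "!!x y. x \<in> carrier M ==> y \<in> carrier M ==> f (x \<oplus>\<^bsub>M\<^esub> y) = f x \<oplus>\<^bsub>N\<^esub> f y"
  and "!!a x. a \<in> carrier R ==> x \<in> carrier M ==> f (a \<odot>\<^bsub>M\<^esub> x) = a \<odot>\<^bsub>N\<^esub> f x"
 shows "f \<in> mod_hom R M N"
 using assms by (auto simp: mod_hom_def)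

lemma mod_homD:
 assumes "f \<in> mod_hom R M N"
 shows "!!x. x \<in> carrier M ==> f x \<in> carrier N"
  and "!!x y. x \<in> carrier M ==> y \<in> carrier M ==> f (x \<oplus>\<^bsub>M\<^esub> y) = f x \<oplus>\<^bsub>N\<^esub> f y"
  and "!!a x. a \<in> carrier R ==> x \<in> carrier M ==> f (a \<odot>\<^bsub>M\<^esub> x) = a \<odot>\<^bsub>N\<^esub> f x"
 using assms by (auto simp: mod_hom_def)

lemma mod_hom_zero:
 fixes R (structure) assumes "module R M" "module R N" "f \<in> mod_hom R M N"
 shows "f \<zero>\<^bsub>M\<^esub> = \<zero>\<^bsub>N\<^esub>"
proof -
 interpret M: module R M by fact
 interpret N: module R N by fact
 have "f \<zero>\<^bsub>M\<^esub> = f (\<zero> \<odot>\<^bsub>M\<^esub> \<zero>\<^bsub>M\<^esub>)" by simp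
 also have "\<dots> = \<zero> \<odot>\<^bsub>N\<^esub> f \<zero>\<^bsub>M\<^esub>" by (rule mod_homD(3)[OF assms(3)]) simp_all
 also have "\<dots> = \<zero>\<^bsub>N\<^esub>" using mod_homD(1)[OF assms(3)] by simp
 finally show ?thesis .
qed

lemma mod_hom_minus:
 assumes "module R M" "module R N" "f \<in> mod_hom R M N" "x \<in> carrier M"
 shows "f (\<ominus>\<^bsub>M\<^esub> x) = \<ominus>\<^bsub>N\<^esub> f x"
proof -
 interpret M: module R M by fact
 interpret N: module R N by fact
 have fx: "f x \<in> carrier N" "f (\<ominus>\<^bsub>M\<^esub> x) \<in> carrier N"
  using mod_homD(1)[OF assms(3)] assms(4) by auto
 have "f (\<ominus>\<^bsub>M\<^esub> x) \<oplus>\<^bsub>N\<^esub> f x = f (\<ominus>\<^bsub>M\<^esub> x \<oplus>\<^bsub>M\<^esub> x)"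
  using mod_homD(2)[OF assms(3)] assms(4) by simp
 also have "\<dots> = \<zero>\<^bsub>N\<^esub>" using assms by (simp add: M.M.l_neg mod_hom_zero)
 finally show ?thesis using fx by (simp add: N.M.minus_equality)
qed

lemma mod_hom_diff:
 assumes "module R M" "module R N" "f \<in> mod_hom R M N" "x \<in> carrier M" "y \<in> carrier M"
 shows "f (x \<ominus>\<^bsub>M\<^esub> y) = f x \<ominus>\<^bsub>N\<^esub> f y"
proof -
 interpret M: module R M by fact
 show ?thesis unfolding a_minus_def
  using assms mod_homD(2)[OF assms(3)] mod_hom_minus[OF assms(1-3)] by simp
qed

lemma a_inv_sub [simp]:
 assumes "module R N" "submodule W R N" "x \<in> W"
 shows "\<ominus>\<^bsub>sub_mod N W\<^esub> x = \<ominus>\<^bsub>N\<^esub> x"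
proof -
 interpret N: module R N by fact
 interpret W: module R "sub_mod N W" by (rule submodule.submodule_is_module[OF assms(2,1)])
 have "x \<in> carrier N" using N.submoduleE(1)[OF assms(2)] assms(3) by auto
 moreover have "\<ominus>\<^bsub>sub_mod N W\<^esub> x \<in> W" using W.M.a_inv_closed[of x] assms(3) by simp
 moreover have "\<ominus>\<^bsub>sub_mod N W\<^esub> x \<oplus>\<^bsub>N\<^esub> x = \<zero>\<^bsub>N\<^esub>"
  using W.M.l_neg[of x] assms(3) by simp
 ultimately show ?thesis using N.submoduleE(1)[OF assms(2)]
  by (metis N.M.minus_equality subsetD)
qed

lemma mod_hom_sub_minus:
 assumes "module R N" "submodule W R N" "module R E"
  "f \<in> mod_hom R (sub_mod N W) E" "x \<in> W"
 shows "f (\<ominus>\<^bsub>N\<^esub> x) = \<ominus>\<^bsub>E\<^esub> f x"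
 using mod_hom_minus[OF submodule.submodule_is_module[OF assms(2,1)] assms(3,4), of x]
  a_inv_sub[OF assms(1,2,5)] assms(5) by simp

lemma mod_hom_sub_zero:
 assumes "module R N" "submodule W R N" "module R E"
  "f \<in> mod_hom R (sub_mod N W) E"
 shows "f \<zero>\<^bsub>N\<^esub> = \<zero>\<^bsub>E\<^esub>"
 using mod_hom_zero[OF submodule.submodule_is_module[OF assms(2,1)] assms(3,4)] by simp

lemma mod_hom_sub_diff:
 assumes "module R N" "submodule W R N" "module R E"
  "f \<in> mod_hom R (sub_mod N W) E" "x \<in> W" "y \<in> W"
 shows "f (x \<ominus>\<^bsub>N\<^esub> y) = f x \<ominus>\<^bsub>E\<^esub> f y"
proof -
 interpret N: module R N by fact
 show ?thesis unfolding a_minus_def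
  using assms mod_homD(2)[OF assms(4)] mod_hom_sub_minus[OF assms(1-4)] N.submoduleE(3)[OF assms(2)]
  by simp
qed

lemma submodule_zero: "module R N ==> submodule W R N ==> \<zero>\<^bsub>N\<^esub> \<in> W"
proof -
 assume N: "module R N" and W: "submodule W R N"
 interpret N: module R N by fact
 note W' = N.submoduleE[OF W]
 obtain w where "w \<in> W" using W'(2) by blast
 then show "\<zero>\<^bsub>N\<^esub> \<in> W" using W'(1) W'(3)[of w] W'(5)[of w "\<ominus>\<^bsub>N\<^esub> w"] N.M.r_neg[of w] by auto
qed

lemma adjoin_submodule:
 fixes R (structure) assumes "module R N" "submodule W R N" "u \<in> carrier N"
 shows "submodule (adjoin R N W u) R N"
proof -
 interpret N: module R N by fact
 note W = N.submoduleE[OF assms(2)]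
 have c: "w \<in> W ==> w \<in> carrier N" for w using W(1) by auto
 show ?thesis
 proof (rule N.submoduleI)
  show "adjoin R N W u \<subseteq> carrier N" using c assms(3) by (auto simp: adjoin_def)
  show "\<zero>\<^bsub>N\<^esub> \<in> adjoin R N W u"
   unfolding adjoin_def using submodule_zero[OF assms(1,2)] assms(3)
   by (auto intro!: exI[of _ "\<zero>\<^bsub>N\<^esub>"] exI[of _ "\<zero>"])
 next
  fix a assume "a \<in> adjoin R N W u"
  then obtain w r where a: "a = w \<oplus>\<^bsub>N\<^esub> r \<odot>\<^bsub>N\<^esub> u" "w \<in> W" "r \<in> carrier R" by (auto simp: adjoin_def)
  have "\<ominus>\<^bsub>N\<^esub> a = \<ominus>\<^bsub>N\<^esub> w \<oplus>\<^bsub>N\<^esub> (\<ominus> r) \<odot>\<^bsub>N\<^esub> u"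
   using a c assms(3) by (simp add: N.smult_l_minus N.M.minus_add)
  then show "\<ominus>\<^bsub>N\<^esub> a \<in> adjoin R N W u"
   unfolding adjoin_def using W(3)[OF a(2)] a(3) by blast
 next
  fix a b assume "a \<in> adjoin R N W u" "b \<in> adjoin R N W u"
  then obtain w r w' r' where a: "a = w \<oplus>\<^bsub>N\<^esub> r \<odot>\<^bsub>N\<^esub> u" "w \<in> W" "r \<in> carrier R"
   and b: "b = w' \<oplus>\<^bsub>N\<^esub> r' \<odot>\<^bsub>N\<^esub> u" "w' \<in> W" "r' \<in> carrier R" by (auto simp: adjoin_def)
  have "a \<oplus>\<^bsub>N\<^esub> b = (w \<oplus>\<^bsub>N\<^esub> w') \<oplus>\<^bsub>N\<^esub> (r \<oplus> r') \<odot>\<^bsub>N\<^esub> u"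
   using a b c assms(3) by (simp add: N.smult_l_distr N.M.a_ac)
  then show "a \<oplus>\<^bsub>N\<^esub> b \<in> adjoin R N W u"
   unfolding adjoin_def using W(5)[OF a(2) b(2)] a(3) b(3) by blast
 next
  fix s a assume s: "s \<in> carrier R" and "a \<in> adjoin R N W u"
  then obtain w r where a: "a = w \<oplus>\<^bsub>N\<^esub> r \<odot>\<^bsub>N\<^esub> u" "w \<in> W" "r \<in> carrier R" by (auto simp: adjoin_def)
  have "s \<odot>\<^bsub>N\<^esub> a = s \<odot>\<^bsub>N\<^esub> w \<oplus>\<^bsub>N\<^esub> (s \<otimes> r) \<odot>\<^bsub>N\<^esub> u"
   using a c assms(3) s by (simp add: N.smult_r_distr N.smult_assoc1)
  then show "s \<odot>\<^bsub>N\<^esub> a \<in> adjoin R N W u"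
   unfolding adjoin_def using W(4)[OF s a(2)] a(3) s by blast
 qed
qed

lemma adjoin_superset:
 fixes R (structure) assumes "module R N" "submodule W R N" "u \<in> carrier N"
 shows "W \<subseteq> adjoin R N W u" "u \<in> adjoin R N W u"
proof -
 interpret N: module R N by fact
 note W = N.submoduleE[OF assms(2)]
 show "W \<subseteq> adjoin R N W u"
 proof
  fix w assume "w \<in> W"
  then show "w \<in> adjoin R N W u"
   unfolding adjoin_def using W(1) assms(3) by (auto intro!: exI[of _ w] exI[of _ "\<zero>"])
 qed
 show "u \<in> adjoin R N W u"
  unfolding adjoin_def using submodule_zero[OF assms(1,2)] assms(3)
  by (auto intro!: exI[of _ "\<zero>\<^bsub>N\<^esub>"] exI[of _ "\<one>"])
qed

lemma adjoin_least:
 assumes "module R N" "submodule V R N" "W \<subseteq> V" "u \<in> V"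
 shows "adjoin R N W u \<subseteq> V"
proof -
 interpret N: module R N by fact
 note V = N.submoduleE[OF assms(2)]
 show ?thesis using V(4,5) assms(3,4) by (auto simp: adjoin_def)
qed

text \<open>Partial homomorphisms are handled as graphs: the union of a chain of graphs is the plain
  union of sets, and single-valuedness has to be required only over zero, since graphs are
  submodules of the product.\<close>

definition module_graph :: "'a ring => ('a, 'n) module => ('a, 'm) module => ('n \<times> 'm) set => bool" where
 "module_graph R N E \<Gamma> \<longleftrightarrow> \<Gamma> \<subseteq> carrier N \<times> carrier E \<and> (\<zero>\<^bsub>N\<^esub>, \<zero>\<^bsub>E\<^esub>) \<in> \<Gamma> \<and>
  (\<forall>x y x' y'. (x, y) \<in> \<Gamma> --> (x', y') \<in> \<Gamma> --> (x \<oplus>\<^bsub>N\<^esub> x', y \<oplus>\<^bsub>E\<^esub> y') \<in> \<Gamma>) \<and>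
  (\<forall>a x y. a \<in> carrier R --> (x, y) \<in> \<Gamma> --> (a \<odot>\<^bsub>N\<^esub> x, a \<odot>\<^bsub>E\<^esub> y) \<in> \<Gamma>) \<and>
  (\<forall>y. (\<zero>\<^bsub>N\<^esub>, y) \<in> \<Gamma> --> y = \<zero>\<^bsub>E\<^esub>)"

lemma module_graphD:
 assumes "module_graph R N E \<Gamma>"
 shows "(x, y) \<in> \<Gamma> ==> x \<in> carrier N" "(x, y) \<in> \<Gamma> ==> y \<in> carrier E" "(\<zero>\<^bsub>N\<^esub>, \<zero>\<^bsub>E\<^esub>) \<in> \<Gamma>"
  "(x, y) \<in> \<Gamma> ==> (x', y') \<in> \<Gamma> ==> (x \<oplus>\<^bsub>N\<^esub> x', y \<oplus>\<^bsub>E\<^esub> y') \<in> \<Gamma>"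
  "a \<in> carrier R ==> (x, y) \<in> \<Gamma> ==> (a \<odot>\<^bsub>N\<^esub> x, a \<odot>\<^bsub>E\<^esub> y) \<in> \<Gamma>"
  "(\<zero>\<^bsub>N\<^esub>, y) \<in> \<Gamma> ==> y = \<zero>\<^bsub>E\<^esub>"
 using assms unfolding module_graph_def by blast+

context
 fixes R :: "'a ring" (structure) and N :: "('a, 'n) module" and E :: "('a, 'm) module"
 assumes N: "module R N" and E: "module R E"
begin

interpretation N: module R N by (rule N)
interpretation E: module R E by (rule E)

lemma module_graph_unique:
 assumes \<Gamma>: "module_graph R N E \<Gamma>" and xy: "(x, y) \<in> \<Gamma>" "(x, y') \<in> \<Gamma>" shows "y = y'"
proof -
 note G = module_graphD[OF \<Gamma>]
 have c: "x \<in> carrier N" "y \<in> carrier E" "y' \<in> carrier E" using G(1,2) xy by auto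
 have "(x \<oplus>\<^bsub>N\<^esub> (\<ominus> \<one>) \<odot>\<^bsub>N\<^esub> x, y \<oplus>\<^bsub>E\<^esub> (\<ominus> \<one>) \<odot>\<^bsub>E\<^esub> y') \<in> \<Gamma>"
  by (rule G(4)[OF xy(1) G(5)[OF _ xy(2)]]) simp
 then have "y \<ominus>\<^bsub>E\<^esub> y' = \<zero>\<^bsub>E\<^esub>" using G(6) c by (simp add: a_minus_def N.smult_l_minus E.smult_l_minus N.M.r_neg)
 then show ?thesis using E.M.minus_equality[of y "\<ominus>\<^bsub>E\<^esub> y'"] c by (simp add: a_minus_def)
qed

lemma module_graph_hom:
 assumes \<Gamma>: "module_graph R N E \<Gamma>"
 obtains g where "g \<in> mod_hom R (sub_mod N (Domain \<Gamma>)) E" "!!x y. (x, y) \<in> \<Gamma> ==> g x = y"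
proof -
 note G = module_graphD[OF \<Gamma>]
 define g where "g x = (THE y. (x, y) \<in> \<Gamma>)" for x
 have g: "g x = y" if "(x, y) \<in> \<Gamma>" for x y
  unfolding g_def using that module_graph_unique[OF \<Gamma>] by (intro the_equality) auto
 have "g \<in> mod_hom R (sub_mod N (Domain \<Gamma>)) E"
  by (rule mod_homI) (auto simp: g G(2) intro!: g[OF G(4)] g[OF G(5)])
 then show ?thesis using that g by blast
qed

lemma hom_module_graph:
 assumes W: "submodule W R N" and f: "f \<in> mod_hom R (sub_mod N W) E"
 shows "module_graph R N E {(w, f w) | w. w \<in> W}"
 using N.submoduleE(1,4,5)[OF W] submodule_zero[OF N W] mod_homD[OF f] mod_hom_sub_zero[OF N W E f]
 unfolding module_graph_def by auto

text \<open>Sending u to e is consistent when the multiples of u that already have a value obey it;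
  \<open>compat\<close> thus keeps the fibre over zero trivial, which is all that single-valuedness
  of a graph asks.\<close>

lemma module_graph_adjoin:
 assumes \<Gamma>: "module_graph R N E \<Gamma>" and u: "u \<in> carrier N" and e: "e \<in> carrier E"
  and compat: "!!r y. r \<in> carrier R ==> (r \<odot>\<^bsub>N\<^esub> u, y) \<in> \<Gamma> ==> y = r \<odot>\<^bsub>E\<^esub> e"
  and \<Gamma>'_def: "\<Gamma>' = {(x \<oplus>\<^bsub>N\<^esub> r \<odot>\<^bsub>N\<^esub> u, y \<oplus>\<^bsub>E\<^esub> r \<odot>\<^bsub>E\<^esub> e) | x y r. (x, y) \<in> \<Gamma> \<and> r \<in> carrier R}"
 shows "module_graph R N E \<Gamma>'" "\<Gamma> \<subseteq> \<Gamma>'" "(u, e) \<in> \<Gamma>'"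
proof -
 note G = module_graphD[OF \<Gamma>]
 have I: "(x \<oplus>\<^bsub>N\<^esub> r \<odot>\<^bsub>N\<^esub> u, y \<oplus>\<^bsub>E\<^esub> r \<odot>\<^bsub>E\<^esub> e) \<in> \<Gamma>'" if "(x, y) \<in> \<Gamma>" "r \<in> carrier R" for x y r
  using that unfolding \<Gamma>'_def by blast
 have sub: "(x, y) \<in> \<Gamma>'" if "(x, y) \<in> \<Gamma>" for x y using I[OF that, of "\<zero>"] G(1,2)[OF that] u e by simp
 then show "\<Gamma> \<subseteq> \<Gamma>'" by auto
 show "(u, e) \<in> \<Gamma>'" using I[OF G(3), of "\<one>"] u e by simp
 show "module_graph R N E \<Gamma>'"
  unfolding module_graph_def
 proof (intro conjI allI impI)
  show "\<Gamma>' \<subseteq> carrier N \<times> carrier E" using G(1,2) u e by (auto simp: \<Gamma>'_def)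
  show "(\<zero>\<^bsub>N\<^esub>, \<zero>\<^bsub>E\<^esub>) \<in> \<Gamma>'" by (rule sub[OF G(3)])
 next
  fix p q p' q' assume "(p, q) \<in> \<Gamma>'" "(p', q') \<in> \<Gamma>'"
  then obtain x y r x' y' r' where *: "(x, y) \<in> \<Gamma>" "r \<in> carrier R" "(x', y') \<in> \<Gamma>" "r' \<in> carrier R"
   "p = x \<oplus>\<^bsub>N\<^esub> r \<odot>\<^bsub>N\<^esub> u" "q = y \<oplus>\<^bsub>E\<^esub> r \<odot>\<^bsub>E\<^esub> e" "p' = x' \<oplus>\<^bsub>N\<^esub> r' \<odot>\<^bsub>N\<^esub> u" "q' = y' \<oplus>\<^bsub>E\<^esub> r' \<odot>\<^bsub>E\<^esub> e"
   unfolding \<Gamma>'_def by blast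
  show "(p \<oplus>\<^bsub>N\<^esub> p', q \<oplus>\<^bsub>E\<^esub> q') \<in> \<Gamma>'"
   using I[OF G(4)[OF *(1,3)] N.R.a_closed[OF *(2,4)]] * G(1,2)[OF *(1)] G(1,2)[OF *(3)] u e
   by (simp add: N.smult_l_distr E.smult_l_distr N.M.a_ac E.M.a_ac)
 next
  fix a p q assume a: "a \<in> carrier R" and "(p, q) \<in> \<Gamma>'"
  then obtain x y r where *: "(x, y) \<in> \<Gamma>" "r \<in> carrier R" "p = x \<oplus>\<^bsub>N\<^esub> r \<odot>\<^bsub>N\<^esub> u" "q = y \<oplus>\<^bsub>E\<^esub> r \<odot>\<^bsub>E\<^esub> e"
   unfolding \<Gamma>'_def by blast
  show "(a \<odot>\<^bsub>N\<^esub> p, a \<odot>\<^bsub>E\<^esub> q) \<in> \<Gamma>'"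
   using I[OF G(5)[OF a *(1)] N.R.m_closed[OF a *(2)]] * G(1,2)[OF *(1)] u e a
   by (simp add: N.smult_r_distr E.smult_r_distr N.smult_assoc1 E.smult_assoc1)
 next
  fix q assume "(\<zero>\<^bsub>N\<^esub>, q) \<in> \<Gamma>'"
  then obtain x y r where *: "(x, y) \<in> \<Gamma>" "r \<in> carrier R" "\<zero>\<^bsub>N\<^esub> = x \<oplus>\<^bsub>N\<^esub> r \<odot>\<^bsub>N\<^esub> u" "q = y \<oplus>\<^bsub>E\<^esub> r \<odot>\<^bsub>E\<^esub> e"
   unfolding \<Gamma>'_def by blast
  have "x = (\<ominus> r) \<odot>\<^bsub>N\<^esub> u"
   using *(2,3) G(1)[OF *(1)] u N.M.minus_equality[of x "r \<odot>\<^bsub>N\<^esub> u"] by (simp add: N.smult_l_minus)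
  then have "y = (\<ominus> r) \<odot>\<^bsub>E\<^esub> e" using compat[of "\<ominus> r" y] *(1,2) by simp
  then show "q = \<zero>\<^bsub>E\<^esub>" using * e by (simp add: E.smult_l_minus E.M.l_neg)
 qed
qed

lemma extend_hom_one_step:
 assumes W: "submodule W R N"
  and f: "f \<in> mod_hom R (sub_mod N W) E" and u: "u \<in> carrier N" and e: "e \<in> carrier E"
  and compat: "!!r. r \<in> carrier R ==> r \<odot>\<^bsub>N\<^esub> u \<in> W ==> f (r \<odot>\<^bsub>N\<^esub> u) = r \<odot>\<^bsub>E\<^esub> e"
 obtains g where "g \<in> mod_hom R (sub_mod N (adjoin R N W u)) E" "!!w. w \<in> W ==> g w = f w" "g u = e"
proof -
 define \<Gamma> where "\<Gamma> = {(x \<oplus>\<^bsub>N\<^esub> r \<odot>\<^bsub>N\<^esub> u, y \<oplus>\<^bsub>E\<^esub> r \<odot>\<^bsub>E\<^esub> e) | x y r. (x, y) \<in> {(w, f w) | w. w \<in> W} \<and> r \<in> carrier R}"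
 have G: "module_graph R N E \<Gamma>" "{(w, f w) | w. w \<in> W} \<subseteq> \<Gamma>" "(u, e) \<in> \<Gamma>"
  by (rule module_graph_adjoin[OF hom_module_graph[OF W f] u e _ \<Gamma>_def]; use compat in auto)+
 obtain g where g: "g \<in> mod_hom R (sub_mod N (Domain \<Gamma>)) E" "!!x y. (x, y) \<in> \<Gamma> ==> g x = y"
  by (rule module_graph_hom[OF G(1)]) blast
 have "Domain \<Gamma> = adjoin R N W u" by (auto simp: \<Gamma>_def adjoin_def Domain_iff)
 with g(1) have "g \<in> mod_hom R (sub_mod N (adjoin R N W u)) E" by simp
 then show ?thesis by (rule that) (use g(2) G(2,3) in auto)
qed

end

text \<open>Since R is free, this is the vanishing of Ext^1(R/\<aa>, E) for an ideal \<aa>: a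
  homomorphism defined on the ideal extends to R, where it is multiplication by its value at
  1.\<close>

definition hom_extends :: "'a ring => 'a set => ('a, 'm) module => bool" where
 "hom_extends R \<aa> E \<longleftrightarrow> (\<forall>f \<in> mod_hom R (sub_mod (self_module R) \<aa>) E.
  \<exists>e\<in>carrier E. \<forall>a\<in>\<aa>. f a = a \<odot>\<^bsub>E\<^esub> e)"

definition baer :: "'a ring => ('a, 'm) module => bool" where
 "baer R E \<longleftrightarrow> (\<forall>\<aa>. ideal \<aa> R --> hom_extends R \<aa> E)"

lemma hom_extendsD:
 assumes "hom_extends R \<aa> E" "f \<in> mod_hom R (sub_mod (self_module R) \<aa>) E"
 shows "\<exists>e\<in>carrier E. \<forall>a\<in>\<aa>. f a = a \<odot>\<^bsub>E\<^esub> e"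
 using assms by (simp add: hom_extends_def)

lemma self_module_simps [simp]:
 fixes R (structure) shows "carrier (self_module R) = carrier R" "\<zero>\<^bsub>self_module R\<^esub> = \<zero>"
 "x \<oplus>\<^bsub>self_module R\<^esub> y = x \<oplus> y" "a \<odot>\<^bsub>self_module R\<^esub> x = a \<otimes> x"
 by (simp_all add: self_module_def)

lemma self_module_minus [simp]:
 "\<ominus>\<^bsub>self_module R\<^esub> x = \<ominus>\<^bsub>R\<^esub> x"
 by (simp add: a_inv_def m_inv_def)

lemma self_module_is_module:
 fixes R :: "'a ring" assumes "cring R" shows "module R (self_module R)"
proof -
 interpret cring R by fact
 have "abelian_group (self_module R)"
 proof (rule abelian_groupI)
  show "\<exists>y\<in>carrier (self_module R). y \<oplus>\<^bsub>self_module R\<^esub> x = \<zero>\<^bsub>self_module R\<^esub>" if "x \<in> carrier (self_module R)" for x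
   using that l_neg[of x] by auto
 qed (auto simp: a_ac)
 then show ?thesis by (intro moduleI assms) (auto simp: l_distr r_distr m_assoc)
qed

lemma idealI':
 fixes R :: "'a ring" (structure)
 assumes R: "cring R" and a: "\<aa> \<subseteq> carrier R" "\<zero> \<in> \<aa>"
  "!!x y. x \<in> \<aa> ==> y \<in> \<aa> ==> x \<oplus> y \<in> \<aa>" "!!r x. r \<in> carrier R ==> x \<in> \<aa> ==> r \<otimes> x \<in> \<aa>"
 shows "ideal \<aa> R"
proof -
 interpret cring R by (rule R)
 have m: "\<ominus> x \<in> \<aa>" if "x \<in> \<aa>" for x using a(4)[of "\<ominus> \<one>" x] that a(1) by (auto simp: l_minus)
 then have "inv\<^bsub>add_monoid R\<^esub> x \<in> \<aa>" if "x \<in> \<aa>" for x using that by (simp add: a_inv_def)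
 moreover have "x \<otimes> r \<in> \<aa>" if "r \<in> carrier R" "x \<in> \<aa>" for r x
  using a(1,4) that by (simp add: m_comm subset_iff)
 ultimately show ?thesis by (intro idealI ring_axioms subgroup.intro) (use a in auto)
qed

lemma submodule_self_iff:
 fixes R :: "'a ring" assumes "cring R" shows "submodule \<aa> R (self_module R) \<longleftrightarrow> ideal \<aa> R"
proof -
 interpret cring R by fact
 interpret S: module R "self_module R" by (rule self_module_is_module[OF assms])
 show ?thesis
 proof
  assume a: "submodule \<aa> R (self_module R)"
  show "ideal \<aa> R"
   by (rule idealI'[OF assms]) (use S.submoduleE[OF a] submodule_zero[OF S.module_axioms a] in auto)
 next
  assume "ideal \<aa> R"
  then interpret ideal \<aa> R .
  show "submodule \<aa> R (self_module R)" by (rule S.submoduleI) (auto intro: I_l_closed)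
 qed
qed

text \<open>Baer's criterion, by Zorn's lemma on graphs: a graph of maximal domain must be defined
  everywhere, because at any u a compatible value exists. The types of N and E are unrelated here,
  unlike in \<open>injective_module\<close>.\<close>

lemma baer_extension:
 fixes N :: "('a, 'n) module" and E :: "('a, 'm) module"
 assumes N: "module R N" and E: "module R E" and W: "submodule W R N"
  and baer: "baer R E" and f: "f \<in> mod_hom R (sub_mod N W) E"
 obtains g where "g \<in> mod_hom R N E" "!!w. w \<in> W ==> g w = f w"
proof -
 interpret N: module R N by fact
 let ?f = "{(w, f w) | w. w \<in> W}"
 define \<G> where "\<G> = {\<Gamma>. module_graph R N E \<Gamma> \<and> ?f \<subseteq> \<Gamma>}"
 have "\<exists>M\<in>\<G>. \<forall>H\<in>\<G>. M \<subseteq> H --> H = M"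
 proof (rule subset_Zorn_nonempty)
  show "\<G> \<noteq> {}" using hom_module_graph[OF N E W f] unfolding \<G>_def by blast
  fix \<C> assume ne: "\<C> \<noteq> {}" and ch: "subset.chain \<G> \<C>"
  have G: "module_graph R N E G" "?f \<subseteq> G" if "G \<in> \<C>" for G
   using ch that unfolding subset.chain_def \<G>_def by blast+
  have two: "\<exists>G\<in>\<C>. p \<in> G \<and> q \<in> G" if "p \<in> \<Union>\<C>" "q \<in> \<Union>\<C>" for p q
  proof -
   from that obtain G G' where "G \<in> \<C>" "p \<in> G" "G' \<in> \<C>" "q \<in> G'" by (elim UnionE)
   moreover have "G \<subseteq> G' \<or> G' \<subseteq> G" using ch calculation(1,3) unfolding subset.chain_def by blast
   ultimately show ?thesis by blast
  qed
  have "module_graph R N E (\<Union>\<C>)"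
   unfolding module_graph_def
  proof (intro conjI allI impI)
   show "\<Union>\<C> \<subseteq> carrier N \<times> carrier E" using G(1) unfolding module_graph_def by blast
   show "(\<zero>\<^bsub>N\<^esub>, \<zero>\<^bsub>E\<^esub>) \<in> \<Union>\<C>" using ne G(1) module_graphD(3) by blast
   fix x y x' y' assume "(x, y) \<in> \<Union>\<C>" "(x', y') \<in> \<Union>\<C>"
   then obtain G where "G \<in> \<C>" "(x, y) \<in> G" "(x', y') \<in> G" using two by blast
   then show "(x \<oplus>\<^bsub>N\<^esub> x', y \<oplus>\<^bsub>E\<^esub> y') \<in> \<Union>\<C>" using module_graphD(4)[OF G(1)] by blast
  next
   fix a x y assume "a \<in> carrier R" "(x, y) \<in> \<Union>\<C>"
   then show "(a \<odot>\<^bsub>N\<^esub> x, a \<odot>\<^bsub>E\<^esub> y) \<in> \<Union>\<C>" using module_graphD(5)[OF G(1)] by blast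
  next
   fix y assume "(\<zero>\<^bsub>N\<^esub>, y) \<in> \<Union>\<C>"
   then show "y = \<zero>\<^bsub>E\<^esub>" using module_graphD(6)[OF G(1)] by blast
  qed
  then show "\<Union>\<C> \<in> \<G>" using ne G(2) unfolding \<G>_def by blast
 qed
 then obtain \<Gamma> where M: "\<Gamma> \<in> \<G>" and max0: "\<forall>H\<in>\<G>. \<Gamma> \<subseteq> H --> H = \<Gamma>" ..
 have \<Gamma>: "module_graph R N E \<Gamma>" "?f \<subseteq> \<Gamma>" using M by (simp_all add: \<G>_def)
 have max: "H = \<Gamma>" if "module_graph R N E H" "\<Gamma> \<subseteq> H" for H
  using max0 that \<Gamma>(2) by (simp add: \<G>_def)
 note G = module_graphD[OF \<Gamma>(1)]
 obtain g where g: "g \<in> mod_hom R (sub_mod N (Domain \<Gamma>)) E" "!!x y. (x, y) \<in> \<Gamma> ==> g x = y"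
  using module_graph_hom[OF N E \<Gamma>(1)] by blast
 have gG: "(x, g x) \<in> \<Gamma>" if "x \<in> Domain \<Gamma>" for x using that g(2) by auto
 have "u \<in> Domain \<Gamma>" if u: "u \<in> carrier N" for u
 proof -
  \<comment> \<open>The scalars that move u into the present domain form an ideal, and the values at
    the multiples of u form a homomorphism on it; the element e by which it multiplies is an
    admissible value at u.\<close>
  define \<aa> where "\<aa> = {r \<in> carrier R. r \<odot>\<^bsub>N\<^esub> u \<in> Domain \<Gamma>}"
  have D: "\<zero>\<^bsub>N\<^esub> \<in> Domain \<Gamma>" "!!x y. x \<in> Domain \<Gamma> ==> y \<in> Domain \<Gamma> ==> x \<oplus>\<^bsub>N\<^esub> y \<in> Domain \<Gamma>"
   "!!a x. a \<in> carrier R ==> x \<in> Domain \<Gamma> ==> a \<odot>\<^bsub>N\<^esub> x \<in> Domain \<Gamma>" using G(3,4,5) by blast+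
  have "ideal \<aa> R"
   by (rule idealI'[OF N.R.cring_axioms]) (insert u D, auto simp: \<aa>_def N.smult_l_distr N.smult_assoc1)
  moreover have "(\<lambda>r. g (r \<odot>\<^bsub>N\<^esub> u)) \<in> mod_hom R (sub_mod (self_module R) \<aa>) E"
   by (rule mod_homI) (insert mod_homD[OF g(1)] u, auto simp: \<aa>_def N.smult_l_distr N.smult_assoc1)
  ultimately obtain e where e: "e \<in> carrier E" "!!r. r \<in> \<aa> ==> g (r \<odot>\<^bsub>N\<^esub> u) = r \<odot>\<^bsub>E\<^esub> e"
   using baer hom_extendsD unfolding baer_def by metis
  define \<Gamma>' where "\<Gamma>' = {(x \<oplus>\<^bsub>N\<^esub> r \<odot>\<^bsub>N\<^esub> u, y \<oplus>\<^bsub>E\<^esub> r \<odot>\<^bsub>E\<^esub> e) | x y r. (x, y) \<in> \<Gamma> \<and> r \<in> carrier R}"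
  have compat: "y = r \<odot>\<^bsub>E\<^esub> e" if "r \<in> carrier R" "(r \<odot>\<^bsub>N\<^esub> u, y) \<in> \<Gamma>" for r y
   using e(2)[of r] g(2)[OF that(2)] that by (auto simp: \<aa>_def)
  note adj = module_graph_adjoin[OF N E \<Gamma>(1) u e(1) compat \<Gamma>'_def]
  have "\<Gamma>' = \<Gamma>" by (rule max[OF adj(1,2)])
  then show ?thesis using adj(3) by blast
 qed
 then have "Domain \<Gamma> = carrier N" using G(1) by blast
 then have "g \<in> mod_hom R N E" using g(1) by (simp add: mod_hom_def)
 then show ?thesis using that g(2) \<Gamma>(2) by blast
qed

lemma noetherian_maximal_ideal_in:
 assumes "noetherian_ring R" "\<T> \<noteq> {}" "!!\<aa>. \<aa> \<in> \<T> ==> ideal \<aa> R"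
 obtains M where "M \<in> \<T>" "!!H. H \<in> \<T> ==> M \<subseteq> H ==> H = M"
proof -
 interpret noetherian_ring R by fact
 have "\<exists>M\<in>\<T>. \<forall>H\<in>\<T>. M \<subseteq> H --> H = M"
 proof (rule subset_Zorn_nonempty[OF assms(2)])
  fix \<C> assume "\<C> \<noteq> {}" "subset.chain \<T> \<C>"
  moreover have "subset.chain {I. ideal I R} \<C>" "\<C> \<subseteq> \<T>"
   using calculation(2) assms(3) unfolding subset.chain_def by blast+
  ultimately show "\<Union>\<C> \<in> \<T>" using ideal_chain_is_trivial by blast
 qed
 then show ?thesis using that by blast
qed

section \<open>Ideals, colon ideals and chains of ideals with quotients R/I\<close>

abbreviation ideal_mod :: "'a ring => 'a set => ('a, 'a) module" where
 "ideal_mod R \<aa> \<equiv> sub_mod (self_module R) \<aa>"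

abbreviation adjoin_ideal :: "'a ring => 'a set => 'a => 'a set" where
 "adjoin_ideal R \<aa> s \<equiv> adjoin R (self_module R) \<aa> s"

text \<open>Multiplication by s identifies R modulo this ideal with the quotient by \<aa> of the
  ideal generated by \<aa> and s; this is how the quotients in a chain are recognised as copies of
  R/I.\<close>

definition colon :: "'a ring => 'a set => 'a => 'a set" where
 "colon R \<aa> s = {r \<in> carrier R. r \<otimes>\<^bsub>R\<^esub> s \<in> \<aa>}"

lemma adjoin_ideal_ideal:
 assumes "cring R" "ideal \<aa> R" "s \<in> carrier R"
 shows "ideal (adjoin_ideal R \<aa> s) R" "\<aa> \<subseteq> adjoin_ideal R \<aa> s" "s \<in> adjoin_ideal R \<aa> s"
 using adjoin_submodule[OF self_module_is_module[OF assms(1)], of \<aa> s]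
  adjoin_superset[OF self_module_is_module[OF assms(1)], of \<aa> s] assms
 by (auto simp: submodule_self_iff)

lemma adjoin_ideal_least:
 assumes "cring R" "ideal \<bb> R" "\<aa> \<subseteq> \<bb>" "s \<in> \<bb>"
 shows "adjoin_ideal R \<aa> s \<subseteq> \<bb>"
 using adjoin_least[OF self_module_is_module[OF assms(1)], of \<bb> \<aa> s] assms
 by (auto simp: submodule_self_iff)

lemma adjoin_idealE:
 fixes R (structure) assumes "x \<in> adjoin_ideal R \<aa> s"
 obtains w r where "w \<in> \<aa>" "r \<in> carrier R" "x = w \<oplus> r \<otimes> s"
 using assms unfolding adjoin_def self_module_simps by blast

lemma colon_ideal:
 assumes "cring R" "ideal \<aa> R" "s \<in> carrier R"
 shows "ideal (colon R \<aa> s) R" "\<aa> \<subseteq> colon R \<aa> s"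
proof -
 interpret R: cring R by fact
 interpret a: ideal \<aa> R by fact
 show "ideal (colon R \<aa> s) R"
  by (rule idealI'[OF assms(1)]) (insert assms(3), auto simp: colon_def R.l_distr R.m_assoc a.I_l_closed)
 show "\<aa> \<subseteq> colon R \<aa> s" using assms(3) by (auto simp: colon_def a.I_r_closed a.Icarr)
qed

lemma colon_hom:
 fixes R (structure) assumes "cring R" "f \<in> mod_hom R (ideal_mod R \<aa>) C" "ideal \<aa> R" "s \<in> carrier R" "\<bb> \<subseteq> colon R \<aa> s"
 shows "(\<lambda>r. f (r \<otimes> s)) \<in> mod_hom R (ideal_mod R \<bb>) C"
proof -
 interpret R: cring R by fact
 show ?thesis
 proof (rule mod_homI; simp)
  fix x assume "x \<in> \<bb>" then have x: "x \<in> carrier R" "x \<otimes> s \<in> \<aa>" using assms(5) by (auto simp: colon_def)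
  then show "f (x \<otimes> s) \<in> carrier C" using mod_homD(1)[OF assms(2)] by simp
  show "f (a \<otimes> x \<otimes> s) = a \<odot>\<^bsub>C\<^esub> f (x \<otimes> s)" if "a \<in> carrier R" for a
   using mod_homD(3)[OF assms(2) that, of "x \<otimes> s"] x that assms(4) by (simp add: R.m_assoc)
  fix y assume "y \<in> \<bb>" then have y: "y \<in> carrier R" "y \<otimes> s \<in> \<aa>" using assms(5) by (auto simp: colon_def)
  show "f ((x \<oplus> y) \<otimes> s) = f (x \<otimes> s) \<oplus>\<^bsub>C\<^esub> f (y \<otimes> s)"
   using mod_homD(2)[OF assms(2), of "x \<otimes> s" "y \<otimes> s"] x y assms(4) by (simp add: R.l_distr)
 qed
qed

lemma extend_ideal_hom_one_step:
 assumes R: "cring R" and C: "module R C" and a: "ideal \<aa> R"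
  and f: "f \<in> mod_hom R (ideal_mod R \<aa>) C" and s: "s \<in> carrier R" and e: "e \<in> carrier C"
  and compat: "!!r. r \<in> colon R \<aa> s ==> f (r \<otimes>\<^bsub>R\<^esub> s) = r \<odot>\<^bsub>C\<^esub> e"
 obtains g where "g \<in> mod_hom R (ideal_mod R (adjoin_ideal R \<aa> s)) C" "!!w. w \<in> \<aa> ==> g w = f w" "g s = e"
 using extend_hom_one_step[OF self_module_is_module[OF R] C _ f, of s e] a s e compat R
 unfolding submodule_self_iff[OF R] self_module_simps colon_def by auto

text \<open>
 The chain relation holds between \<open>\<aa>\<close> and \<open>\<bb>\<close> if \<open>\<bb>/\<aa>\<close> has a finite filtration with all
 quotients isomorphic to \<open>R/I\<close>.
\<close>

inductive quotient_chain :: "'a ring => 'a set => 'a set => 'a set => bool" for R I \<aa> where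
 refl: "quotient_chain R I \<aa> \<aa>"
| step: "quotient_chain R I \<aa> \<bb> ==> s \<in> carrier R ==> colon R \<bb> s = I ==>
  quotient_chain R I \<aa> (adjoin_ideal R \<bb> s)"

lemma quotient_chain_trans:
 assumes "quotient_chain R I \<bb> \<cc>" "quotient_chain R I \<aa> \<bb>"
 shows "quotient_chain R I \<aa> \<cc>"
 using assms by (induction) (auto intro: quotient_chain.step)

lemma quotient_chain_ideal:
 assumes "quotient_chain R I \<aa> \<bb>" "cring R" "ideal \<aa> R"
 shows "ideal \<bb> R \<and> \<aa> \<subseteq> \<bb>"
 using assms by induction (auto dest: adjoin_ideal_ideal)

text \<open>When s is adjoined, the values at those multiples of s that lie in the smaller ideal
  form a homomorphism on the colon ideal, and this ideal is I at each step; so the hypothesis on I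
  alone provides a value at s.\<close>

lemma quotient_chain_hom_extension:
 fixes R (structure) assumes "quotient_chain R I \<aa> \<bb>" and R: "cring R" and C: "module R C"
  and I: "hom_extends R I C" and a: "ideal \<aa> R" and f: "f \<in> mod_hom R (ideal_mod R \<aa>) C"
 shows "\<exists>g \<in> mod_hom R (ideal_mod R \<bb>) C. \<forall>x\<in>\<aa>. g x = f x"
 using assms(1)
proof induction
 case refl
 then show ?case using f by blast
next
 case (step \<bb> s)
 then obtain g where g: "g \<in> mod_hom R (ideal_mod R \<bb>) C" "!!x. x \<in> \<aa> ==> g x = f x" by blast
 have b: "ideal \<bb> R" "\<aa> \<subseteq> \<bb>" using quotient_chain_ideal[OF step(1) R a] by auto
 have "(\<lambda>r. g (r \<otimes> s)) \<in> mod_hom R (ideal_mod R I) C"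
  using colon_hom[OF R g(1) b(1) step(2)] step(3) by simp
 then obtain e where "e \<in> carrier C" "\<forall>r\<in>I. g (r \<otimes> s) = r \<odot>\<^bsub>C\<^esub> e"
  using hom_extendsD[OF I] by metis
 then obtain h where "h \<in> mod_hom R (ideal_mod R (adjoin_ideal R \<bb> s)) C" "!!w. w \<in> \<bb> ==> h w = g w"
  by (metis extend_ideal_hom_one_step[OF R C b(1) g(1) step(2), of e] step(3))
 then show ?case using g b by (metis subsetD)
qed

lemma mod_hom_carrier_eq:
 fixes R (structure) assumes "cring R" "module R C" "g \<in> mod_hom R (ideal_mod R (carrier R)) C" "x \<in> carrier R"
 shows "g x = x \<odot>\<^bsub>C\<^esub> g \<one>"
proof -
 interpret cring R by fact
 show ?thesis using mod_homD(3)[OF assms(3), of x "\<one>"] assms(4) by simp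
qed

lemma quotient_chain_hom_extends:
 fixes R (structure) assumes "quotient_chain R I \<aa> (carrier R)" and R: "cring R" and C: "module R C"
  and I: "hom_extends R I C" and a: "ideal \<aa> R"
 shows "hom_extends R \<aa> C"
 unfolding hom_extends_def
proof
 interpret a: ideal \<aa> R by fact
 fix f assume "f \<in> mod_hom R (ideal_mod R \<aa>) C"
 then obtain g where g: "g \<in> mod_hom R (ideal_mod R (carrier R)) C" "!!x. x \<in> \<aa> ==> g x = f x"
  using quotient_chain_hom_extension[OF assms] by blast
 show "\<exists>e\<in>carrier C. \<forall>x\<in>\<aa>. f x = x \<odot>\<^bsub>C\<^esub> e"
 proof (intro bexI ballI)
  show "g \<one> \<in> carrier C" using mod_homD(1)[OF g(1)] by simp
  show "f x = x \<odot>\<^bsub>C\<^esub> g \<one>" if "x \<in> \<aa>" for x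
   using mod_hom_carrier_eq[OF R C g(1) a.Icarr[OF that]] unfolding g(2)[OF that] .
 qed
qed

section \<open>Dimension shifting along kernels and cokernels\<close>

lemma mod_ker_submodule:
 assumes "module R M" "module R N" "f \<in> mod_hom R M N"
 shows "submodule (mod_ker M N f) R M"
proof -
 interpret M: module R M by fact
 interpret N: module R N by fact
 show ?thesis
  by (rule M.submoduleI)
   (insert mod_hom_zero[OF assms] mod_hom_minus[OF assms] mod_homD[OF assms(3)], auto simp: mod_ker_def)
qed

lemma mod_image_submodule:
 assumes "module R M" "module R N" "f \<in> mod_hom R M N"
 shows "submodule (f ` carrier M) R N"
proof -
 interpret M: module R M by fact
 interpret N: module R N by fact
 note f = mod_homD[OF assms(3)]
 show ?thesis
 proof (rule N.submoduleI)
  show "f ` carrier M \<subseteq> carrier N" using f(1) by auto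
  show "\<zero>\<^bsub>N\<^esub> \<in> f ` carrier M" using mod_hom_zero[OF assms] by (metis M.M.zero_closed imageI)
  show "\<ominus>\<^bsub>N\<^esub> a \<in> f ` carrier M" if "a \<in> f ` carrier M" for a
   using that mod_hom_minus[OF assms] by (auto intro: rev_image_eqI)
  show "a \<oplus>\<^bsub>N\<^esub> b \<in> f ` carrier M" if "a \<in> f ` carrier M" "b \<in> f ` carrier M" for a b
   using that by clarsimp (metis f(2) M.M.a_closed imageI)
  show "a \<odot>\<^bsub>N\<^esub> b \<in> f ` carrier M" if "a \<in> carrier R" "b \<in> f ` carrier M" for a b
   using that by clarsimp (metis f(3) M.smult_closed imageI)
 qed
qed

text \<open>
 Dimension shifting downwards: \<open>u\<close> generates a copy of \<open>R/I\<close> inside \<open>R\<close>, so a homomorphism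
 from \<open>R/I\<close> to \<open>E'\<close> extends to \<open>R\<close> along it, and lifts to \<open>E\<close>.
\<close>

lemma hom_extends_kernel:
 fixes R (structure) assumes R: "cring R" and E: "module R E" and E': "module R E'" and \<delta>: "\<delta> \<in> mod_hom R E E'"
  and IE: "hom_extends R I E" and IE': "hom_extends R I (sub_mod E' (\<delta> ` carrier E))"
  and I: "ideal I R" and u: "u \<in> carrier R" "colon R {\<zero>} u = I"
  and chain: "quotient_chain R I (adjoin_ideal R {\<zero>} u) (carrier R)"
 shows "hom_extends R I (sub_mod E (mod_ker E E' \<delta>))"
 unfolding hom_extends_def
proof
 interpret R: cring R by fact
 interpret E: module R E by fact
 interpret E': module R E' by fact
 interpret I: ideal I R by fact
 let ?D = "sub_mod E' (\<delta> ` carrier E)"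
 interpret D: module R ?D
  by (rule submodule.submodule_is_module[OF mod_image_submodule[OF E E' \<delta>] E'])
 note \<delta>' = mod_homD[OF \<delta>]
 fix f assume f: "f \<in> mod_hom R (ideal_mod R I) (sub_mod E (mod_ker E E' \<delta>))"
 have "f \<in> mod_hom R (ideal_mod R I) E" using f by (auto simp: mod_hom_def mod_ker_def)
 then obtain e where e: "e \<in> carrier E" "!!c. c \<in> I ==> f c = c \<odot>\<^bsub>E\<^esub> e"
  using hom_extendsD[OF IE] by metis
 have k: "c \<odot>\<^bsub>E'\<^esub> \<delta> e = \<zero>\<^bsub>E'\<^esub>" if "c \<in> I" for c
  using that mod_homD(1)[OF f, of c] e \<delta>'(3)[OF I.Icarr[OF that] e(1)] by (simp add: mod_ker_def)
 have z: "ideal {\<zero>} R" by (rule R.zeroideal)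
 have "(\<lambda>_. \<zero>\<^bsub>E'\<^esub>) \<in> mod_hom R (ideal_mod R {\<zero>}) ?D"
  by (rule mod_homI) (use D.M.zero_closed in auto)
 note h0 = this
 obtain g where g: "g \<in> mod_hom R (ideal_mod R (adjoin_ideal R {\<zero>} u)) ?D"
   "!!w. w \<in> {\<zero>} ==> g w = \<zero>\<^bsub>E'\<^esub>" "g u = \<delta> e"
  by (rule extend_ideal_hom_one_step[OF R D.module_axioms z h0 u(1), of "\<delta> e"]) (use u(2) k e in auto)
 note au = adjoin_ideal_ideal[OF R z u(1)]
 have "hom_extends R (adjoin_ideal R {\<zero>} u) ?D"
  by (rule quotient_chain_hom_extends[OF chain R D.module_axioms IE' au(1)])
 then obtain e0 where "e0 \<in> carrier ?D" "\<forall>a\<in>adjoin_ideal R {\<zero>} u. g a = a \<odot>\<^bsub>?D\<^esub> e0"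
  using hom_extendsD[OF _ g(1)] by blast
 then obtain e' where e': "e' \<in> carrier E" "\<delta> e = u \<odot>\<^bsub>E'\<^esub> \<delta> e'" using g(3) au(3) by auto
 have ue: "u \<odot>\<^bsub>E\<^esub> e' \<in> carrier E" using u e' by simp
 \<comment> \<open>The correction u e' moves e into the kernel of \<delta>, and because I
   annihilates u it changes none of the products c e with c in I.\<close>
 have d: "\<delta> (e \<ominus>\<^bsub>E\<^esub> u \<odot>\<^bsub>E\<^esub> e') = \<zero>\<^bsub>E'\<^esub>"
  using mod_hom_diff[OF E E' \<delta> e(1) ue] e' \<delta>' u e by (simp add: E'.M.r_neg a_minus_def)
 show "\<exists>e\<in>carrier (sub_mod E (mod_ker E E' \<delta>)). \<forall>a\<in>I. f a = a \<odot>\<^bsub>sub_mod E (mod_ker E E' \<delta>)\<^esub> e"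
 proof (intro bexI ballI)
  show "e \<ominus>\<^bsub>E\<^esub> u \<odot>\<^bsub>E\<^esub> e' \<in> carrier (sub_mod E (mod_ker E E' \<delta>))" using d e ue by (simp add: mod_ker_def)
  fix c assume c: "c \<in> I"
  then have "c \<otimes> u = \<zero>" "c \<in> carrier R" using u(2) by (auto simp: colon_def)
  then have "c \<odot>\<^bsub>E\<^esub> (u \<odot>\<^bsub>E\<^esub> e') = \<zero>\<^bsub>E\<^esub>" using E.smult_assoc1[of c u e'] u e' by simp
  then show "f c = c \<odot>\<^bsub>sub_mod E (mod_ker E E' \<delta>)\<^esub> (e \<ominus>\<^bsub>E\<^esub> u \<odot>\<^bsub>E\<^esub> e')"
   using e c ue \<open>c \<in> carrier R\<close> by (simp add: a_minus_def E.smult_r_distr E.smult_r_minus)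
 qed
qed

text \<open>Lifting along the surjection \<delta> works for \<bb> as for a projective module: the
  chain makes \<bb> an iterated extension of copies of R/I, and Ext^1(R/I, -) vanishes on the kernel
  of \<delta>.\<close>

lemma quotient_chain_hom_lift:
 fixes R (structure) assumes "quotient_chain R I {\<zero>} \<bb>" and R: "cring R" and E: "module R E" and C: "module R C"
  and \<delta>: "\<delta> \<in> mod_hom R E C" and surj: "\<delta> ` carrier E = carrier C"
  and IK: "hom_extends R I (sub_mod E (mod_ker E C \<delta>))"
  and f: "f \<in> mod_hom R (ideal_mod R \<bb>) C"
 shows "\<exists>g \<in> mod_hom R (ideal_mod R \<bb>) E. \<forall>x\<in>\<bb>. \<delta> (g x) = f x"
 using assms(1) f
proof (induction arbitrary: f)
 case refl
 interpret R: cring R by fact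
 interpret E: module R E by fact
 have "f \<zero> = \<zero>\<^bsub>C\<^esub>"
  using mod_hom_sub_zero[OF self_module_is_module[OF R] _ C refl] R.zeroideal submodule_self_iff[OF R] by auto
 moreover have "(\<lambda>_. \<zero>\<^bsub>E\<^esub>) \<in> mod_hom R (ideal_mod R {\<zero>}) E"
  by (rule mod_homI) auto
 ultimately show ?case using mod_hom_zero[OF E C \<delta>] by (intro bexI[of _ "\<lambda>_. \<zero>\<^bsub>E\<^esub>"]) auto
next
 case (step \<bb> s)
 interpret R: cring R by fact
 interpret E: module R E by fact
 interpret C: module R C by fact
 note \<delta>' = mod_homD[OF \<delta>]
 note s = step(2)
 have b: "ideal \<bb> R" using quotient_chain_ideal[OF step(1) R R.zeroideal] by auto
 note ad = adjoin_ideal_ideal[OF R b s]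
 have f: "f \<in> mod_hom R (ideal_mod R (adjoin_ideal R \<bb> s)) C" by fact
 note f' = mod_homD[OF f, simplified]
 have "f \<in> mod_hom R (ideal_mod R \<bb>) C" using f ad(2) by (auto simp: mod_hom_def subset_iff)
 then obtain g where g: "g \<in> mod_hom R (ideal_mod R \<bb>) E" "!!x. x \<in> \<bb> ==> \<delta> (g x) = f x"
  using step(4) by blast
 obtain e where e: "e \<in> carrier E" "\<delta> e = f s" using f'(1)[OF ad(3)] surj by (metis imageE)
 have cI: "c \<in> carrier R" "c \<otimes> s \<in> \<bb>" if "c \<in> I" for c using that step(3) by (auto simp: colon_def)
 have h: "(\<lambda>r. g (r \<otimes> s)) \<in> mod_hom R (ideal_mod R I) E"
  using colon_hom[OF R g(1) b s] step(3) by simp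
 \<comment> \<open>An arbitrary preimage e of f s disagrees with the lift g already chosen by k,
   which takes values in the kernel; there k is multiplication by some \<gamma>, and e + \<gamma> is
   the compatible preimage.\<close>
 define k where "k c = g (c \<otimes> s) \<ominus>\<^bsub>E\<^esub> c \<odot>\<^bsub>E\<^esub> e" for c
 have "k \<in> mod_hom R (ideal_mod R I) (sub_mod E (mod_ker E C \<delta>))"
 proof (rule mod_homI; simp)
  note h' = mod_homD[OF h, simplified]
  fix x assume x: "x \<in> I"
  have "\<delta> (k x) = \<zero>\<^bsub>C\<^esub>"
   unfolding k_def using mod_hom_diff[OF E C \<delta> h'(1)[OF x], of "x \<odot>\<^bsub>E\<^esub> e"] cI[OF x] e g(2) \<delta>'(3) f'(1,3) ad(3)
   by (simp add: C.M.r_neg a_minus_def)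
  then show "k x \<in> mod_ker E C \<delta>" using h'(1)[OF x] e cI[OF x] by (simp add: k_def mod_ker_def)
  show "k (a \<otimes> x) = a \<odot>\<^bsub>E\<^esub> k x" if "a \<in> carrier R" for a
   using h'(1,3) x that e cI[OF x]
   by (simp add: k_def a_minus_def E.smult_assoc1 E.smult_r_distr E.smult_r_minus)
  fix y assume y: "y \<in> I"
  show "k (x \<oplus> y) = k x \<oplus>\<^bsub>E\<^esub> k y"
   using h'(1,2) x y e cI[OF x] cI[OF y]
   by (simp add: k_def a_minus_def E.smult_l_distr E.M.minus_add E.M.a_ac)
 qed
 then obtain \<gamma> where \<gamma>: "\<gamma> \<in> mod_ker E C \<delta>" "!!c. c \<in> I ==> k c = c \<odot>\<^bsub>E\<^esub> \<gamma>"
  using hom_extendsD[OF IK] by fastforce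
 have \<gamma>E: "\<gamma> \<in> carrier E" "\<delta> \<gamma> = \<zero>\<^bsub>C\<^esub>" using \<gamma> by (auto simp: mod_ker_def)
 have comp: "g (r \<otimes> s) = r \<odot>\<^bsub>E\<^esub> (e \<oplus>\<^bsub>E\<^esub> \<gamma>)" if "r \<in> colon R \<bb> s" for r
 proof -
  have r: "r \<in> I" using that step(3) by simp
  have gr: "g (r \<otimes> s) \<in> carrier E" using mod_homD(1)[OF g(1)] cI[OF r] by simp
  have "g (r \<otimes> s) = k r \<oplus>\<^bsub>E\<^esub> r \<odot>\<^bsub>E\<^esub> e"
   unfolding k_def a_minus_def using gr e cI[OF r] by (simp add: E.M.a_assoc E.M.l_neg)
  then show ?thesis using \<gamma>(2)[OF r] \<gamma>E cI[OF r] e by (simp add: E.smult_r_distr E.M.a_comm)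
 qed
 obtain g' where g': "g' \<in> mod_hom R (ideal_mod R (adjoin_ideal R \<bb> s)) E" "!!w. w \<in> \<bb> ==> g' w = g w"
   "g' s = e \<oplus>\<^bsub>E\<^esub> \<gamma>"
  using extend_ideal_hom_one_step[OF R E b g(1) s, of "e \<oplus>\<^bsub>E\<^esub> \<gamma>"] comp e \<gamma>E by auto
 have "\<delta> (g' x) = f x" if x: "x \<in> adjoin_ideal R \<bb> s" for x
 proof -
  obtain w r where w: "w \<in> \<bb>" "r \<in> carrier R" "x = w \<oplus> r \<otimes> s"
   using adjoin_idealE[OF x] by blast
  have ws: "w \<in> adjoin_ideal R \<bb> s" "r \<otimes> s \<in> adjoin_ideal R \<bb> s"
   using w ad ideal.I_l_closed[OF ad(1)] by auto
  note g'' = mod_homD[OF g'(1), simplified]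
  have "\<delta> (g' x) = \<delta> (g w) \<oplus>\<^bsub>C\<^esub> r \<odot>\<^bsub>C\<^esub> \<delta> (e \<oplus>\<^bsub>E\<^esub> \<gamma>)"
   using w g''(1)[OF ws(1)] g''(2)[OF ws] g''(3)[OF w(2) ad(3)] g' \<delta>' e \<gamma>E by simp
  also have "\<dots> = f w \<oplus>\<^bsub>C\<^esub> r \<odot>\<^bsub>C\<^esub> f s" using w g(2) e \<gamma>E \<delta>'(2) f'(1)[OF ad(3)] by simp
  also have "\<dots> = f x" using w f'(2)[OF ws] f'(3)[OF w(2) ad(3)] by simp
  finally show ?thesis .
 qed
 then show ?case using g'(1) by blast
qed

text \<open>In the long exact sequence Ext^1(R/I, C) stands between Ext^1(R/I, E) and Ext^2(R/I, K)
  = Ext^1(I, K), K being the kernel. The latter vanishes because I is itself filtered by copies of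
  R/I: a homomorphism I -> C lifts to E and is a multiplication there.\<close>

lemma hom_extends_cokernel:
 assumes "quotient_chain R I {\<zero>\<^bsub>R\<^esub>} I" and R: "cring R" and I: "ideal I R"
  and E: "module R E" and C: "module R C"
  and \<delta>: "\<delta> \<in> mod_hom R E C" and surj: "\<delta> ` carrier E = carrier C"
  and IE: "hom_extends R I E" and IK: "hom_extends R I (sub_mod E (mod_ker E C \<delta>))"
 shows "hom_extends R I C"
 unfolding hom_extends_def
proof
 interpret I: ideal I R by fact
 fix f assume f: "f \<in> mod_hom R (ideal_mod R I) C"
 obtain g where g: "g \<in> mod_hom R (ideal_mod R I) E" "!!x. x \<in> I ==> \<delta> (g x) = f x"
  using quotient_chain_hom_lift[OF assms(1) R E C \<delta> surj IK f] by blast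
 obtain e where e: "e \<in> carrier E" "!!x. x \<in> I ==> g x = x \<odot>\<^bsub>E\<^esub> e" using hom_extendsD[OF IE g(1)] by blast
 show "\<exists>e\<in>carrier C. \<forall>a\<in>I. f a = a \<odot>\<^bsub>C\<^esub> e"
 proof (intro bexI ballI)
  show "\<delta> e \<in> carrier C" using mod_homD(1)[OF \<delta> e(1)] .
  show "f a = a \<odot>\<^bsub>C\<^esub> \<delta> e" if "a \<in> I" for a
   using g(2)[OF that] e(2)[OF that] mod_homD(3)[OF \<delta> I.Icarr[OF that] e(1)] by simp
 qed
qed

text \<open>Here \<open>rel\<close> expresses injectivity over R/I of the I-torsion of C, and
  \<open>nil\<close> is the form of nilpotency of I that a maximal extension needs: some s outside a
  proper ideal with I s inside it. The map induced on the colon ideal by s is a multiplication on I;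
  subtracting that multiplication leaves a map to which \<open>rel\<close> applies.\<close>

lemma baer_of_hom_extends:
 fixes R (structure) assumes R: "cring R" and noeth: "noetherian_ring R" and C: "module R C" and I: "ideal I R"
  and IC: "hom_extends R I C"
  and rel: "!!\<bb> f. ideal \<bb> R ==> I \<subseteq> \<bb> ==> f \<in> mod_hom R (ideal_mod R \<bb>) C ==>
   (!!c. c \<in> I ==> f c = \<zero>\<^bsub>C\<^esub>) ==> \<exists>e\<in>carrier C. \<forall>b\<in>\<bb>. f b = b \<odot>\<^bsub>C\<^esub> e"
  and nil: "!!\<aa>. ideal \<aa> R ==> \<aa> \<noteq> carrier R ==> \<exists>s\<in>carrier R - \<aa>. \<forall>c\<in>I. c \<otimes> s \<in> \<aa>"
 shows "baer R C"
 unfolding baer_def hom_extends_def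
proof (intro allI impI ballI)
 interpret C: module R C by fact
 interpret I: ideal I R by fact
 fix \<aa> f assume a: "ideal \<aa> R" and f: "f \<in> mod_hom R (ideal_mod R \<aa>) C"
 define \<T> where "\<T> = {\<bb>. ideal \<bb> R \<and> \<aa> \<subseteq> \<bb> \<and> (\<exists>g\<in>mod_hom R (ideal_mod R \<bb>) C. \<forall>x\<in>\<aa>. g x = f x)}"
 have "\<aa> \<in> \<T>" using a f by (auto simp: \<T>_def)
 then have ne: "\<T> \<noteq> {}" by blast
 obtain \<bb> where b: "\<bb> \<in> \<T>" and max: "!!H. H \<in> \<T> ==> \<bb> \<subseteq> H ==> H = \<bb>"
  by (rule noetherian_maximal_ideal_in[OF noeth ne]) (auto simp: \<T>_def)
 from b have bi: "ideal \<bb> R" "\<aa> \<subseteq> \<bb>" and "\<exists>g\<in>mod_hom R (ideal_mod R \<bb>) C. \<forall>x\<in>\<aa>. g x = f x"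
  by (simp_all add: \<T>_def)
 then obtain g where g: "g \<in> mod_hom R (ideal_mod R \<bb>) C" and gf: "!!x. x \<in> \<aa> ==> g x = f x" by blast
 have "\<bb> = carrier R"
 proof (rule ccontr)
  assume "\<bb> \<noteq> carrier R"
  then obtain s where s: "s \<in> carrier R" "s \<notin> \<bb>" "!!c. c \<in> I ==> c \<otimes> s \<in> \<bb>" using nil[OF bi(1)] by blast
  let ?c = "colon R \<bb> s"
  have Ic: "I \<subseteq> ?c" using s(3) by (auto simp: colon_def I.Icarr)
  note ci = colon_ideal[OF R bi(1) s(1)]
  interpret c: ideal ?c R by (rule ci(1))
  have h: "(\<lambda>r. g (r \<otimes> s)) \<in> mod_hom R (ideal_mod R ?c) C"
   by (rule colon_hom[OF R g bi(1) s(1)]) simp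
  note h' = mod_homD[OF h, simplified]
  have "(\<lambda>r. g (r \<otimes> s)) \<in> mod_hom R (ideal_mod R I) C"
   by (rule colon_hom[OF R g bi(1) s(1) Ic])
  then obtain \<gamma> where \<gamma>: "\<gamma> \<in> carrier C" "!!c. c \<in> I ==> g (c \<otimes> s) = c \<odot>\<^bsub>C\<^esub> \<gamma>"
   using hom_extendsD[OF IC] by metis
  define k where "k r = g (r \<otimes> s) \<ominus>\<^bsub>C\<^esub> r \<odot>\<^bsub>C\<^esub> \<gamma>" for r
  have "k \<in> mod_hom R (ideal_mod R ?c) C"
  proof (rule mod_homI; simp)
   fix x assume x: "x \<in> ?c"
   show "k x \<in> carrier C" using h'(1)[OF x] c.Icarr[OF x] \<gamma> by (simp add: k_def)
   show "k (a \<otimes> x) = a \<odot>\<^bsub>C\<^esub> k x" if "a \<in> carrier R" for a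
    using h'(1,3) x that \<gamma> c.Icarr[OF x]
    by (simp add: k_def a_minus_def C.smult_assoc1 C.smult_r_distr C.smult_r_minus)
   fix y assume y: "y \<in> ?c"
   show "k (x \<oplus> y) = k x \<oplus>\<^bsub>C\<^esub> k y"
    using h'(1,2) x y \<gamma> c.Icarr[OF x] c.Icarr[OF y]
    by (simp add: k_def a_minus_def C.smult_l_distr C.M.minus_add C.M.a_ac)
  qed
  moreover have "k c = \<zero>\<^bsub>C\<^esub>" if "c \<in> I" for c
   using \<gamma> that by (simp add: k_def a_minus_def C.M.r_neg I.Icarr)
  ultimately obtain e where e: "e \<in> carrier C" "!!r. r \<in> ?c ==> k r = r \<odot>\<^bsub>C\<^esub> e"
   using rel[OF ci(1) Ic] by metis
  have comp: "g (r \<otimes> s) = r \<odot>\<^bsub>C\<^esub> (e \<oplus>\<^bsub>C\<^esub> \<gamma>)" if r: "r \<in> ?c" for r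
  proof -
   have "g (r \<otimes> s) = k r \<oplus>\<^bsub>C\<^esub> r \<odot>\<^bsub>C\<^esub> \<gamma>"
    unfolding k_def a_minus_def using h'(1)[OF r] \<gamma> c.Icarr[OF r] by (simp add: C.M.a_assoc C.M.l_neg)
   then show ?thesis using e r \<gamma> c.Icarr[OF r] by (simp add: C.smult_r_distr)
  qed
  obtain g' where g': "g' \<in> mod_hom R (ideal_mod R (adjoin_ideal R \<bb> s)) C" "!!w. w \<in> \<bb> ==> g' w = g w"
    "g' s = e \<oplus>\<^bsub>C\<^esub> \<gamma>"
   by (rule extend_ideal_hom_one_step[OF R C bi(1) g s(1), of "e \<oplus>\<^bsub>C\<^esub> \<gamma>"]) (use comp e \<gamma> in auto)
  note ad = adjoin_ideal_ideal[OF R bi(1) s(1)]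
  have "adjoin_ideal R \<bb> s \<in> \<T>" using ad g' bi gf unfolding \<T>_def by (intro CollectI conjI bexI[of _ g']) (auto simp: subset_iff)
  then show False using max ad s by blast
 qed
 with g have g: "g \<in> mod_hom R (ideal_mod R (carrier R)) C" by simp
 interpret a: ideal \<aa> R by (rule a)
 show "\<exists>e\<in>carrier C. \<forall>a\<in>\<aa>. f a = a \<odot>\<^bsub>C\<^esub> e"
 proof (intro bexI ballI)
  show "g \<one> \<in> carrier C" using mod_homD(1)[OF g] by simp
  show "f x = x \<odot>\<^bsub>C\<^esub> g \<one>" if "x \<in> \<aa>" for x
   using mod_hom_carrier_eq[OF R C g a.Icarr[OF that]] unfolding gf[OF that] .
 qed
qed

section \<open>Injective resolutions\<close>

text \<open>Injective modules are prescribed to have elements in \<open>'a list set\<close>; modules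
  built on functions, or R itself, are copied into that type along an injection.\<close>

definition transport_mod :: "('n => 'm) => ('a, 'n) module => ('a, 'm) module" where
 "transport_mod j M = \<lparr>carrier = j ` carrier M, monoid.mult = undefined, monoid.one = undefined,
  ring.zero = j \<zero>\<^bsub>M\<^esub>,
  ring.add = (\<lambda>x y. j (the_inv_into (carrier M) j x \<oplus>\<^bsub>M\<^esub> the_inv_into (carrier M) j y)),
  module.smult = (\<lambda>a x. j (a \<odot>\<^bsub>M\<^esub> the_inv_into (carrier M) j x))\<rparr>"

lemma transport_mod_simps:
 assumes "inj_on j (carrier M)"
 shows "carrier (transport_mod j M) = j ` carrier M" "\<zero>\<^bsub>transport_mod j M\<^esub> = j \<zero>\<^bsub>M\<^esub>"
  and "x \<in> carrier M ==> y \<in> carrier M ==> j x \<oplus>\<^bsub>transport_mod j M\<^esub> j y = j (x \<oplus>\<^bsub>M\<^esub> y)"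
  and "x \<in> carrier M ==> a \<odot>\<^bsub>transport_mod j M\<^esub> j x = j (a \<odot>\<^bsub>M\<^esub> x)"
 using assms by (simp_all add: transport_mod_def the_inv_into_f_f)

lemma transport_mod_is_module:
 assumes M: "module R M" and j: "inj_on j (carrier M)"
 shows "module R (transport_mod j M)"
proof -
 interpret M: module R M by fact
 note s = transport_mod_simps[OF j]
 have "abelian_group (transport_mod j M)"
 proof (rule abelian_groupI; (unfold s(1,2))?)
  fix x y z assume "x \<in> j ` carrier M" "y \<in> j ` carrier M" "z \<in> j ` carrier M"
  then show "x \<oplus>\<^bsub>transport_mod j M\<^esub> y \<oplus>\<^bsub>transport_mod j M\<^esub> z =
    x \<oplus>\<^bsub>transport_mod j M\<^esub> (y \<oplus>\<^bsub>transport_mod j M\<^esub> z)"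
   by (auto simp: s(3,4) M.M.a_assoc)
 next
  fix x y assume "x \<in> j ` carrier M" "y \<in> j ` carrier M"
  then show "x \<oplus>\<^bsub>transport_mod j M\<^esub> y \<in> j ` carrier M"
   "x \<oplus>\<^bsub>transport_mod j M\<^esub> y = y \<oplus>\<^bsub>transport_mod j M\<^esub> x"
   by (auto simp: s(3,4) M.M.a_comm)
 next
  fix x assume "x \<in> j ` carrier M"
  then obtain y where y: "x = j y" "y \<in> carrier M" by blast
  show "j \<zero>\<^bsub>M\<^esub> \<oplus>\<^bsub>transport_mod j M\<^esub> x = x" using y by (simp add: s(3))
  show "\<exists>z\<in>j ` carrier M. z \<oplus>\<^bsub>transport_mod j M\<^esub> x = j \<zero>\<^bsub>M\<^esub>"
   using y by (intro bexI[of _ "j (\<ominus>\<^bsub>M\<^esub> y)"]) (simp_all add: s(3) M.M.l_neg)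
 qed simp
 then show ?thesis
  by (intro moduleI M.R.cring_axioms)
   (auto simp: s M.smult_l_distr M.smult_r_distr M.smult_assoc1)
qed

lemma transport_mod_hom:
 assumes "inj_on j (carrier M)"
 shows "j \<in> mod_hom R M (transport_mod j M)"
 by (rule mod_homI) (simp_all add: transport_mod_simps[OF assms])

lemma transport_mod_inv_hom:
 assumes M: "module R M" and j: "inj_on j (carrier M)"
 shows "the_inv_into (carrier M) j \<in> mod_hom R (transport_mod j M) M"
proof -
 interpret M: module R M by fact
 show ?thesis
  by (rule mod_homI) (auto simp: transport_mod_simps[OF j] the_inv_into_f_f[OF j])
qed

lemma mod_hom_comp:
 assumes "f \<in> mod_hom R M N" "g \<in> mod_hom R N P"
 shows "(\<lambda>x. g (f x)) \<in> mod_hom R M P"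
 by (rule mod_homI) (simp_all add: mod_homD[OF assms(1)] mod_homD[OF assms(2)])

text \<open>\<open>injective_module\<close> tests only modules whose elements have the same type as
  those of E, so the ideal and R are first copied there as singletons of one-element lists.\<close>

lemma injective_module_imp_baer:
 fixes R :: "'a ring" (structure) and E :: "('a, 'a list set) module"
 assumes R: "cring R" and inj: "injective_module R E"
 shows "baer R E"
 unfolding baer_def hom_extends_def
proof (intro allI impI ballI)
 fix \<aa> f assume a: "ideal \<aa> R" and f: "f \<in> mod_hom R (ideal_mod R \<aa>) E"
 interpret a: ideal \<aa> R by (rule a)
 define j :: "'a => 'a list set" where "j x = {[x]}" for x
 have j: "inj_on j A" for A by (auto simp: inj_on_def j_def)
 have S: "module R (self_module R)" by (rule self_module_is_module[OF R])
 have A: "module R (ideal_mod R \<aa>)"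
  using submodule.submodule_is_module[OF _ S] a submodule_self_iff[OF R] by blast
 let ?M = "transport_mod j (ideal_mod R \<aa>)" and ?N = "transport_mod j (self_module R)"
 have m: "module R ?M" "module R ?N"
  using transport_mod_is_module[OF A j] transport_mod_is_module[OF S j] .
 have incl: "(\<lambda>x. x) \<in> mod_hom R ?M ?N"
  by (rule mod_homI) (insert a.Icarr, auto simp: transport_mod_simps[of j "self_module R", OF j]
   transport_mod_simps[of j "ideal_mod R \<aa>", OF j])
 define g where "g x = f (the_inv_into \<aa> j x)" for x
 have "the_inv_into \<aa> j \<in> mod_hom R ?M (ideal_mod R \<aa>)" using transport_mod_inv_hom[OF A j] by simp
 then have g: "g \<in> mod_hom R ?M E" unfolding g_def by (rule mod_hom_comp[OF _ f])
 have "\<exists>h \<in> mod_hom R ?N E. \<forall>x\<in>carrier ?M. h x = g x"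
  using inj m incl g unfolding injective_module_def by (elim conjE allE[of _ ?M] allE[of _ ?N] allE[of _ "\<lambda>x. x"] allE[of _ g]) simp
 then obtain h where h: "h \<in> mod_hom R ?N E" "!!x. x \<in> carrier ?M ==> h x = g x" by blast
 have hj: "(\<lambda>r. h (j r)) \<in> mod_hom R (self_module R) E"
  by (rule mod_hom_comp[OF transport_mod_hom[OF j] h(1)])
 show "\<exists>e\<in>carrier E. \<forall>x\<in>\<aa>. f x = x \<odot>\<^bsub>E\<^esub> e"
 proof (intro bexI ballI)
  show "h (j \<one>) \<in> carrier E" using mod_homD(1)[OF hj] by simp
  fix x assume x: "x \<in> \<aa>"
  then have "f x = h (j x)" using h(2)[of "j x"] by (simp add: g_def transport_mod_simps[OF j] the_inv_into_f_f[OF j])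
  then show "f x = x \<odot>\<^bsub>E\<^esub> h (j \<one>)" using mod_homD(3)[OF hj, of x "\<one>"] x a.Icarr by simp
 qed
qed

lemma injective_resolution_hom_extends:
 fixes R :: "'a ring" (structure) and E :: "nat => ('a, 'a list set) module"
 assumes R: "cring R" and res: "injective_resolution R (self_module R) E e d"
  and fin: "!!i. i > n ==> carrier (E i) = {\<zero>\<^bsub>E i\<^esub>}"
  and I: "ideal I R" and u: "u \<in> carrier R" "colon R {\<zero>} u = I"
  and chain: "quotient_chain R I (adjoin_ideal R {\<zero>} u) (carrier R)"
 shows "hom_extends R I (self_module R)"
proof -
 interpret R: cring R by fact
 interpret I: ideal I R by fact
 have inj: "injective_module R (E i)" for i using res by (simp add: injective_resolution_def)
 then have E: "module R (E i)" for i by (simp add: injective_module_def)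
 have baer: "hom_extends R I (E i)" for i
  using injective_module_imp_baer[OF R inj] I by (simp add: baer_def)
 have d: "d i \<in> mod_hom R (E i) (E (Suc i))"
  and ex: "d i ` carrier (E i) = mod_ker (E (Suc i)) (E (Suc (Suc i))) (d (Suc i))" for i
  using res by (simp_all add: injective_resolution_def)
 \<comment> \<open>The kernel of \<open>d i\<close> is cosyzygy number i. The step passes to it from
   cosyzygy i + 1, which by exactness is the image of \<open>d i\<close>.\<close>
 define P where "P i = hom_extends R I (sub_mod (E i) (mod_ker (E i) (E (Suc i)) (d i)))" for i
 have step: "P i" if "P (Suc i)" for i
  unfolding P_def
  by (rule hom_extends_kernel[OF R E E d baer _ I u chain]) (use that ex P_def in simp)
 \<comment> \<open>Degree n + 1 is the first in which the bound makes the module zero, so that every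
   homomorphism into it is multiplication by zero.\<close>
 have "P (Suc n)"
  unfolding P_def hom_extends_def
 proof (intro ballI)
  interpret En: module R "E (Suc n)" by (rule E)
  fix f assume f: "f \<in> mod_hom R (ideal_mod R I) (sub_mod (E (Suc n)) (mod_ker (E (Suc n)) (E (Suc (Suc n))) (d (Suc n))))"
  have z: "d (Suc n) \<zero>\<^bsub>E (Suc n)\<^esub> = \<zero>\<^bsub>E (Suc (Suc n))\<^esub>" by (rule mod_hom_zero[OF E E d])
  have "f c = \<zero>\<^bsub>E (Suc n)\<^esub>" if "c \<in> I" for c
   using mod_homD(1)[OF f, of c] that fin[of "Suc n"] by (auto simp: mod_ker_def)
  then show "\<exists>y\<in>carrier (sub_mod (E (Suc n)) (mod_ker (E (Suc n)) (E (Suc (Suc n))) (d (Suc n)))).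
   \<forall>a\<in>I. f a = a \<odot>\<^bsub>sub_mod (E (Suc n)) (mod_ker (E (Suc n)) (E (Suc (Suc n))) (d (Suc n)))\<^esub> y"
   using z by (intro bexI[of _ "\<zero>\<^bsub>E (Suc n)\<^esub>"]) (auto simp: mod_ker_def I.Icarr)
 qed
 have "P 0" by (rule inc_induct[of 0 "Suc n" P]) (use \<open>P (Suc n)\<close> step in auto)
 have e: "e \<in> mod_hom R (self_module R) (E 0)" "inj_on e (carrier R)"
   "e ` carrier R = mod_ker (E 0) (E 1) (d 0)"
  using res by (simp_all add: injective_resolution_def)
 note e' = mod_homD[OF e(1), simplified]
 show ?thesis
  unfolding hom_extends_def
 proof
  fix f assume f: "f \<in> mod_hom R (ideal_mod R I) (self_module R)"
  note f' = mod_homD[OF f, simplified]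
  have "(\<lambda>x. e (f x)) \<in> mod_hom R (ideal_mod R I) (sub_mod (E 0) (mod_ker (E 0) (E (Suc 0)) (d 0)))"
   by (rule mod_homI) (use e' f' e(3) in auto)
  from hom_extendsD[OF \<open>P 0\<close>[unfolded P_def] this]
  obtain y where "y \<in> e ` carrier R" "!!a. a \<in> I ==> e (f a) = a \<odot>\<^bsub>E 0\<^esub> y"
   using e(3) by auto
  then obtain r where r: "r \<in> carrier R" "!!a. a \<in> I ==> e (f a) = a \<odot>\<^bsub>E 0\<^esub> e r" by blast
  have "f a = a \<otimes> r" if "a \<in> I" for a
   using r(2)[OF that] e'(3)[OF I.Icarr[OF that] r(1)] f'(1)[OF that] e(2) r(1) I.Icarr[OF that]
   by (simp add: inj_on_def)
  then show "\<exists>y\<in>carrier (self_module R). \<forall>a\<in>I. f a = a \<odot>\<^bsub>self_module R\<^esub> y"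
   using r(1) by auto
 qed
qed

section \<open>Coinduced modules\<close>

lemma baer_imp_injective_module:
 fixes E :: "('a, 'm) module"
 assumes E: "module R E" and baer: "baer R E"
 shows "injective_module R E"
 unfolding injective_module_def
proof (intro conjI allI impI E)
 fix M N :: "('a, 'm) module" and f g
 assume "module R M \<and> module R N \<and> f \<in> mod_hom R M N \<and> inj_on f (carrier M) \<and> g \<in> mod_hom R M E"
 then have M: "module R M" and N: "module R N" and f: "f \<in> mod_hom R M N" and inj: "inj_on f (carrier M)"
  and g: "g \<in> mod_hom R M E" by auto
 interpret M: module R M by fact
 note f' = mod_homD[OF f] and g' = mod_homD[OF g]
 define h where "h x = g (the_inv_into (carrier M) f x)" for x
 have hf: "h (f x) = g x" if "x \<in> carrier M" for x using inj that by (simp add: h_def the_inv_into_f_f)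
 have "h \<in> mod_hom R (sub_mod N (f ` carrier M)) E"
 proof (rule mod_homI; clarsimp)
  fix x assume x: "x \<in> carrier M"
  show "h (f x) \<in> carrier E" using x hf g' by simp
  show "h (a \<odot>\<^bsub>N\<^esub> f x) = a \<odot>\<^bsub>E\<^esub> h (f x)" if "a \<in> carrier R" for a
   using hf[of "a \<odot>\<^bsub>M\<^esub> x"] x that hf f' g' by simp
  fix y assume y: "y \<in> carrier M"
  show "h (f x \<oplus>\<^bsub>N\<^esub> f y) = h (f x) \<oplus>\<^bsub>E\<^esub> h (f y)"
   using hf[of "x \<oplus>\<^bsub>M\<^esub> y"] x y hf f' g' by simp
 qed
 then obtain H where H: "H \<in> mod_hom R N E" "!!w. w \<in> f ` carrier M ==> H w = h w"
  using baer_extension[OF N E mod_image_submodule[OF M N f] baer] by blast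
 show "\<exists>h\<in>mod_hom R N E. \<forall>x\<in>carrier M. h (f x) = g x"
  by (rule bexI[OF _ H(1)]) (simp add: H(2) hf)
qed

definition restrict_scalars :: "('k => 'a) => ('a, 'm) module => ('k, 'm) module" where
 "restrict_scalars \<kappa> M = \<lparr>carrier = carrier M, monoid.mult = undefined, monoid.one = undefined,
  ring.zero = ring.zero M, ring.add = ring.add M, module.smult = (\<lambda>c. module.smult M (\<kappa> c))\<rparr>"

lemma restrict_scalars_simps [simp]:
 "carrier (restrict_scalars \<kappa> M) = carrier M" "\<zero>\<^bsub>restrict_scalars \<kappa> M\<^esub> = \<zero>\<^bsub>M\<^esub>"
 "x \<oplus>\<^bsub>restrict_scalars \<kappa> M\<^esub> y = x \<oplus>\<^bsub>M\<^esub> y" "c \<odot>\<^bsub>restrict_scalars \<kappa> M\<^esub> x = \<kappa> c \<odot>\<^bsub>M\<^esub> x"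
 by (simp_all add: restrict_scalars_def)

lemma restrict_scalars_module:
 fixes k :: "'k ring" and R :: "'a ring"
 assumes k: "cring k" and \<kappa>: "\<kappa> \<in> ring_hom k R" and M: "module R M"
 shows "Module.module k (restrict_scalars \<kappa> M)"
proof -
 interpret M: module R M by fact
 have "abelian_group (restrict_scalars \<kappa> M)"
  by (rule abelian_groupI) (auto simp: M.M.a_ac intro: bexI[of _ "\<ominus>\<^bsub>M\<^esub> _"] M.M.l_neg)
 then show ?thesis
  by (intro moduleI k)
   (auto simp: ring_hom_closed[OF \<kappa>] ring_hom_add[OF \<kappa>] ring_hom_mult[OF \<kappa>] ring_hom_one[OF \<kappa>]
    M.smult_l_distr M.smult_r_distr M.smult_assoc1)
qed

lemma field_imp_baer:
 assumes k: "field k" and V: "Module.module k V"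
 shows "baer k V"
 unfolding baer_def hom_extends_def
proof (intro allI impI ballI)
 interpret k: field k by fact
 interpret V: module k V by fact
 fix \<aa> f assume a: "ideal \<aa> k" and f: "f \<in> mod_hom k (ideal_mod k \<aa>) V"
 consider "\<aa> = {\<zero>\<^bsub>k\<^esub>}" | "\<aa> = carrier k" using k.all_ideals a by auto
 then show "\<exists>e\<in>carrier V. \<forall>a\<in>\<aa>. f a = a \<odot>\<^bsub>V\<^esub> e"
 proof cases
  case 1
  have "f \<zero>\<^bsub>k\<^esub> = \<zero>\<^bsub>V\<^esub>"
   using mod_hom_sub_zero[OF self_module_is_module[OF k.cring_axioms] _ V f] a submodule_self_iff[OF k.cring_axioms]
   by simp
  then show ?thesis using 1 by (intro bexI[of _ "\<zero>\<^bsub>V\<^esub>"]) auto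
 next
  case 2
  have "f \<one>\<^bsub>k\<^esub> \<in> carrier V" using mod_homD(1)[OF f] 2 by simp
  then show ?thesis using 2 mod_hom_carrier_eq[OF k.cring_axioms V f[unfolded 2]] by blast
 qed
qed

definition coind_carrier :: "'k ring => ('k => 'a) => 'a ring => ('a, 'm) module => ('a => 'm) set" where
 "coind_carrier k \<kappa> R M =
  mod_hom k (restrict_scalars \<kappa> (self_module R)) (restrict_scalars \<kappa> M) \<inter> extensional (carrier R)"

text \<open>This is Hom_k(R, M) with R acting on the argument, the right adjoint of restricting
  scalars from R to k; that is why it is injective over R when k is a field.\<close>

definition coind_mod :: "'k ring => ('k => 'a) => 'a ring => ('a, 'm) module => ('a, 'a => 'm) module" where
 "coind_mod k \<kappa> R M = \<lparr>carrier = coind_carrier k \<kappa> R M,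
  monoid.mult = undefined, monoid.one = undefined,
  ring.zero = (\<lambda>c\<in>carrier R. \<zero>\<^bsub>M\<^esub>), ring.add = (\<lambda>g h. \<lambda>c\<in>carrier R. g c \<oplus>\<^bsub>M\<^esub> h c),
  module.smult = (\<lambda>b h. \<lambda>c\<in>carrier R. h (b \<otimes>\<^bsub>R\<^esub> c))\<rparr>"

text \<open>
 The embedding of \<open>M\<close> into the coinduced module \<open>Hom\<^sub>k(R, M)\<close> is split over \<open>k\<close> by
 evaluation at 1.  The maps that vanish at 1 therefore represent the cokernel,
 with the action corrected so as to stay among them.
\<close>

definition cosyzygy_mod :: "'k ring => ('k => 'a) => 'a ring => ('a, 'm) module => ('a, 'a => 'm) module" where
 "cosyzygy_mod k \<kappa> R M = \<lparr>carrier = {h \<in> coind_carrier k \<kappa> R M. h \<one>\<^bsub>R\<^esub> = \<zero>\<^bsub>M\<^esub>},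
  monoid.mult = undefined, monoid.one = undefined,
  ring.zero = (\<lambda>c\<in>carrier R. \<zero>\<^bsub>M\<^esub>), ring.add = (\<lambda>g h. \<lambda>c\<in>carrier R. g c \<oplus>\<^bsub>M\<^esub> h c),
  module.smult = (\<lambda>b h. \<lambda>c\<in>carrier R. h (b \<otimes>\<^bsub>R\<^esub> c) \<ominus>\<^bsub>M\<^esub> c \<odot>\<^bsub>M\<^esub> h b)\<rparr>"

locale coinduction = M?: module R M for R :: "'a ring" (structure) and M :: "('a, 'm) module" +
 fixes k :: "'k ring" and \<kappa> :: "'k => 'a"
 assumes k: "field k" and \<kappa>: "\<kappa> \<in> ring_hom k R"
begin

interpretation k: field k by (rule k)

abbreviation "E \<equiv> coind_mod k \<kappa> R M"
abbreviation "C \<equiv> cosyzygy_mod k \<kappa> R M"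

lemma \<kappa>_closed [simp]: "c \<in> carrier k ==> \<kappa> c \<in> carrier R"
 by (rule ring_hom_closed[OF \<kappa>])

lemma coind_carrierI:
 assumes "!!x. x \<in> carrier R ==> h x \<in> carrier M"
  and "!!x y. x \<in> carrier R ==> y \<in> carrier R ==> h (x \<oplus> y) = h x \<oplus>\<^bsub>M\<^esub> h y"
  and "!!c x. c \<in> carrier k ==> x \<in> carrier R ==> h (\<kappa> c \<otimes> x) = \<kappa> c \<odot>\<^bsub>M\<^esub> h x"
 shows "(\<lambda>x\<in>carrier R. h x) \<in> coind_carrier k \<kappa> R M"
 using assms by (auto simp: coind_carrier_def mod_hom_def)

lemma coind_carrierD:
 assumes "h \<in> coind_carrier k \<kappa> R M"
 shows "!!x. x \<in> carrier R ==> h x \<in> carrier M"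
  and "!!x y. x \<in> carrier R ==> y \<in> carrier R ==> h (x \<oplus> y) = h x \<oplus>\<^bsub>M\<^esub> h y"
  and "!!c x. c \<in> carrier k ==> x \<in> carrier R ==> h (\<kappa> c \<otimes> x) = \<kappa> c \<odot>\<^bsub>M\<^esub> h x"
  and "h \<in> extensional (carrier R)"
 using assms by (auto simp: coind_carrier_def mod_hom_def)

lemma coind_ext:
 assumes "g \<in> extensional (carrier R)" "h \<in> extensional (carrier R)" "!!x. x \<in> carrier R ==> g x = h x"
 shows "g = h"
 using assms by (rule extensionalityI)

lemma coind_add_closed:
 assumes "g \<in> coind_carrier k \<kappa> R M" "h \<in> coind_carrier k \<kappa> R M"
 shows "(\<lambda>c\<in>carrier R. g c \<oplus>\<^bsub>M\<^esub> h c) \<in> coind_carrier k \<kappa> R M"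
 by (rule coind_carrierI)
  (simp_all add: coind_carrierD(1-3)[OF assms(1)] coind_carrierD(1-3)[OF assms(2)] M.smult_r_distr M.M.a_ac)

lemma coind_minus_closed:
 assumes "g \<in> coind_carrier k \<kappa> R M"
 shows "(\<lambda>c\<in>carrier R. \<ominus>\<^bsub>M\<^esub> g c) \<in> coind_carrier k \<kappa> R M"
 by (rule coind_carrierI) (simp_all add: coind_carrierD(1-3)[OF assms] M.smult_r_minus M.M.minus_add)

lemma coind_zero_closed: "(\<lambda>c\<in>carrier R. \<zero>\<^bsub>M\<^esub>) \<in> coind_carrier k \<kappa> R M"
 by (rule coind_carrierI) simp_all

lemma coind_smult_closed:
 assumes "h \<in> coind_carrier k \<kappa> R M" "b \<in> carrier R"
 shows "(\<lambda>c\<in>carrier R. h (b \<otimes> c)) \<in> coind_carrier k \<kappa> R M"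
proof (rule coind_carrierI)
 note h = coind_carrierD(1-3)[OF assms(1)]
 fix x assume x: "x \<in> carrier R"
 show "h (b \<otimes> x) \<in> carrier M" using h x assms by simp
 show "h (b \<otimes> (x \<oplus> y)) = h (b \<otimes> x) \<oplus>\<^bsub>M\<^esub> h (b \<otimes> y)" if "y \<in> carrier R" for y
  using h x that assms by (simp add: r_distr)
 show "h (b \<otimes> (\<kappa> c \<otimes> x)) = \<kappa> c \<odot>\<^bsub>M\<^esub> h (b \<otimes> x)" if "c \<in> carrier k" for c
  using h(3)[of c "b \<otimes> x"] x that assms by (simp add: m_lcomm)
qed

lemma cosyz_smult_closed:
 assumes "h \<in> coind_carrier k \<kappa> R M" "b \<in> carrier R" "y \<in> carrier M"
 shows "(\<lambda>c\<in>carrier R. h (b \<otimes> c) \<ominus>\<^bsub>M\<^esub> c \<odot>\<^bsub>M\<^esub> y) \<in> coind_carrier k \<kappa> R M"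
proof -
 have "(\<lambda>c\<in>carrier R. c \<odot>\<^bsub>M\<^esub> (\<ominus>\<^bsub>M\<^esub> y)) \<in> coind_carrier k \<kappa> R M"
  by (rule coind_carrierI) (insert assms, simp_all add: M.smult_l_distr M.smult_assoc1)
 from coind_add_closed[OF coind_smult_closed[OF assms(1,2)] this]
 show ?thesis using assms(3) by (simp add: a_minus_def M.smult_r_minus cong: restrict_cong)
qed

lemma coind_mod_is_module: "module R E"
proof -
 note c = coind_carrierD(1)
 have "abelian_group E"
 proof (rule abelian_groupI)
  fix x assume x: "x \<in> carrier E"
  then have x': "x \<in> coind_carrier k \<kappa> R M" by (simp add: coind_mod_def)
  show "\<zero>\<^bsub>E\<^esub> \<oplus>\<^bsub>E\<^esub> x = x"
   by (rule coind_ext) (insert x' c, auto simp: coind_mod_def coind_carrierD(4))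
  show "\<exists>y\<in>carrier E. y \<oplus>\<^bsub>E\<^esub> x = \<zero>\<^bsub>E\<^esub>"
   using coind_minus_closed[OF x'] c[OF x']
   by (intro bexI[of _ "\<lambda>c\<in>carrier R. \<ominus>\<^bsub>M\<^esub> x c"]) (auto simp: coind_mod_def M.M.l_neg intro!: restrict_ext)
 qed (auto simp: coind_mod_def coind_add_closed coind_zero_closed c M.M.a_ac intro!: restrict_ext)
 then show ?thesis
 proof (intro moduleI)
  show "cring R" by (rule M.R.cring_axioms)
  show "\<one> \<odot>\<^bsub>E\<^esub> x = x" if "x \<in> carrier E" for x
   by (rule coind_ext) (insert that c, auto simp: coind_mod_def coind_carrierD(4))
  show "(a \<oplus> b) \<odot>\<^bsub>E\<^esub> x = a \<odot>\<^bsub>E\<^esub> x \<oplus>\<^bsub>E\<^esub> b \<odot>\<^bsub>E\<^esub> x"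
   if "a \<in> carrier R" "b \<in> carrier R" "x \<in> carrier E" for a b x
   using that by (auto simp: coind_mod_def l_distr coind_carrierD(2) intro!: restrict_ext)
 qed (auto simp: coind_mod_def coind_smult_closed m_ac intro!: restrict_ext)
qed

text \<open>By adjunction f is determined by the k-linear map x -> f x 1 on \<aa>, and over the
  field k this map extends to R. The extension is the element of Hom_k(R, M) by which f
  multiplies.\<close>

lemma coind_mod_baer: "baer R E"
 unfolding baer_def hom_extends_def
proof (intro allI impI ballI)
 fix \<aa> f assume a: "ideal \<aa> R" and f: "f \<in> mod_hom R (ideal_mod R \<aa>) E"
 interpret a: ideal \<aa> R by (rule a)
 note f' = mod_homD[OF f, simplified]
 have fE: "f x \<in> coind_carrier k \<kappa> R M" if "x \<in> \<aa>" for x using f'(1)[OF that] by (simp add: coind_mod_def)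
 let ?K = "restrict_scalars \<kappa> (self_module R)" and ?V = "restrict_scalars \<kappa> M"
 have K: "module k ?K" "module k ?V"
  using restrict_scalars_module[OF k.cring_axioms \<kappa>] self_module_is_module[OF M.R.cring_axioms] M.module_axioms by auto
 interpret K: module k ?K by (rule K)
 have aK: "submodule \<aa> k ?K"
 proof (rule K.submoduleI)
  have "\<ominus>\<^bsub>?K\<^esub> x = \<ominus> x" if "x \<in> carrier R" for x
   by (rule K.M.minus_equality) (insert that, simp_all add: M.R.l_neg)
  then show "\<ominus>\<^bsub>?K\<^esub> x \<in> \<aa>" if "x \<in> \<aa>" for x using that a.Icarr by simp
 qed (auto simp: a.I_l_closed a.Icarr)
 have h0: "(\<lambda>x. f x \<one>) \<in> mod_hom k (sub_mod ?K \<aa>) ?V"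
 proof (rule mod_homI; simp)
  fix x assume x: "x \<in> \<aa>"
  show "f x \<one> \<in> carrier M" using coind_carrierD(1)[OF fE[OF x]] by simp
  show "f (\<kappa> c \<otimes> x) \<one> = \<kappa> c \<odot>\<^bsub>M\<^esub> f x \<one>" if "c \<in> carrier k" for c
   using f'(3)[OF \<kappa>_closed[OF that] x] coind_carrierD(3)[OF fE[OF x] that, of "\<one>"] that by (simp add: coind_mod_def)
  show "f (x \<oplus> y) \<one> = f x \<one> \<oplus>\<^bsub>M\<^esub> f y \<one>" if "y \<in> \<aa>" for y
   using f'(2)[OF x that] by (simp add: coind_mod_def)
 qed
 obtain H where H: "H \<in> mod_hom k ?K ?V" "!!x. x \<in> \<aa> ==> H x = f x \<one>"
  by (rule baer_extension[OF K aK field_imp_baer[OF k K(2)] h0]) blast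
 have e: "restrict H (carrier R) \<in> coind_carrier k \<kappa> R M"
  by (rule coind_carrierI) (use mod_homD[OF H(1)] in auto)
 show "\<exists>e\<in>carrier E. \<forall>x\<in>\<aa>. f x = x \<odot>\<^bsub>E\<^esub> e"
 proof (intro bexI ballI)
  show "restrict H (carrier R) \<in> carrier E" using e by (simp add: coind_mod_def)
  fix x assume x: "x \<in> \<aa>"
  show "f x = x \<odot>\<^bsub>E\<^esub> restrict H (carrier R)"
  proof (rule coind_ext)
   show "f x \<in> extensional (carrier R)" using fE[OF x] by (rule coind_carrierD)
   show "x \<odot>\<^bsub>E\<^esub> restrict H (carrier R) \<in> extensional (carrier R)" by (simp add: coind_mod_def)
   fix c assume c: "c \<in> carrier R"
   have "f x c = f (c \<otimes> x) \<one>" using f'(3)[OF c x] c by (simp add: coind_mod_def)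
   also have "\<dots> = H (x \<otimes> c)" using H(2)[OF a.I_l_closed[OF x c]] x c a.Icarr by (simp add: m_comm)
   finally show "f x c = (x \<odot>\<^bsub>E\<^esub> restrict H (carrier R)) c" using c x a.Icarr by (simp add: coind_mod_def)
  qed
 qed
qed

lemma minus_minus_cancel:
 assumes "p \<in> carrier M" "q \<in> carrier M" "z \<in> carrier M"
 shows "p \<ominus>\<^bsub>M\<^esub> q = (p \<ominus>\<^bsub>M\<^esub> z) \<ominus>\<^bsub>M\<^esub> (q \<ominus>\<^bsub>M\<^esub> z)"
proof -
 have "(p \<ominus>\<^bsub>M\<^esub> z) \<ominus>\<^bsub>M\<^esub> (q \<ominus>\<^bsub>M\<^esub> z) = (p \<ominus>\<^bsub>M\<^esub> q) \<oplus>\<^bsub>M\<^esub> (\<ominus>\<^bsub>M\<^esub> z \<oplus>\<^bsub>M\<^esub> z)"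
  using assms by (simp add: a_minus_def M.M.minus_add M.M.a_ac)
 then show ?thesis using assms by (simp add: M.M.l_neg)
qed

lemma cosyzygy_mod_is_module: "module R C"
proof -
 note c = coind_carrierD(1)
 have "abelian_group C"
 proof (rule abelian_groupI)
  fix x assume x: "x \<in> carrier C"
  then have x': "x \<in> coind_carrier k \<kappa> R M" "x \<one> = \<zero>\<^bsub>M\<^esub>" by (simp_all add: cosyzygy_mod_def)
  show "\<zero>\<^bsub>C\<^esub> \<oplus>\<^bsub>C\<^esub> x = x"
   by (rule coind_ext) (insert x' c, auto simp: cosyzygy_mod_def coind_carrierD(4))
  show "\<exists>y\<in>carrier C. y \<oplus>\<^bsub>C\<^esub> x = \<zero>\<^bsub>C\<^esub>"
   using coind_minus_closed[OF x'(1)] c[OF x'(1)] x'(2)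
   by (intro bexI[of _ "\<lambda>c\<in>carrier R. \<ominus>\<^bsub>M\<^esub> x c"]) (auto simp: cosyzygy_mod_def M.M.l_neg intro!: restrict_ext)
 qed (auto simp: cosyzygy_mod_def coind_add_closed coind_zero_closed c M.M.a_ac intro!: restrict_ext)
 then show ?thesis
 proof (intro moduleI)
  show "cring R" by (rule M.R.cring_axioms)
  show "\<one> \<odot>\<^bsub>C\<^esub> x = x" if "x \<in> carrier C" for x
   by (rule coind_ext) (insert that c, auto simp: cosyzygy_mod_def a_minus_def coind_carrierD(4))
  fix a b x assume a: "a \<in> carrier R" and b: "b \<in> carrier R" and x: "x \<in> carrier C"
  then have x': "x \<in> coind_carrier k \<kappa> R M" "x \<one> = \<zero>\<^bsub>M\<^esub>" by (simp_all add: cosyzygy_mod_def)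
  note xd = coind_carrierD[OF x'(1)]
  show "a \<odot>\<^bsub>C\<^esub> x \<in> carrier C"
   using cosyz_smult_closed[OF x'(1) a xd(1)[OF a]] a x' xd(1)[OF a]
   by (simp add: cosyzygy_mod_def a_minus_def M.M.r_neg)
  show "(a \<oplus> b) \<odot>\<^bsub>C\<^esub> x = a \<odot>\<^bsub>C\<^esub> x \<oplus>\<^bsub>C\<^esub> b \<odot>\<^bsub>C\<^esub> x"
   using a b xd(1,2) by (auto simp: cosyzygy_mod_def l_distr M.smult_r_distr a_minus_def M.M.minus_add M.M.a_ac intro!: restrict_ext)
  show "(a \<otimes> b) \<odot>\<^bsub>C\<^esub> x = a \<odot>\<^bsub>C\<^esub> (b \<odot>\<^bsub>C\<^esub> x)"
  proof -
   \<comment> \<open>Associativity of the corrected action: on the right the two occurrences of the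
     term (a c) x(b) cancel.\<close>
   have "x (a \<otimes> b \<otimes> c) \<ominus>\<^bsub>M\<^esub> c \<odot>\<^bsub>M\<^esub> x (a \<otimes> b) =
     (x (b \<otimes> (a \<otimes> c)) \<ominus>\<^bsub>M\<^esub> (a \<otimes> c) \<odot>\<^bsub>M\<^esub> x b) \<ominus>\<^bsub>M\<^esub> c \<odot>\<^bsub>M\<^esub> (x (b \<otimes> a) \<ominus>\<^bsub>M\<^esub> a \<odot>\<^bsub>M\<^esub> x b)"
    if c: "c \<in> carrier R" for c
   proof -
    have 1: "c \<odot>\<^bsub>M\<^esub> (x (b \<otimes> a) \<ominus>\<^bsub>M\<^esub> a \<odot>\<^bsub>M\<^esub> x b) = c \<odot>\<^bsub>M\<^esub> x (a \<otimes> b) \<ominus>\<^bsub>M\<^esub> (a \<otimes> c) \<odot>\<^bsub>M\<^esub> x b"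
     using a b c xd(1) by (simp add: a_minus_def M.smult_r_distr M.smult_r_minus M.smult_assoc1[symmetric] m_comm)
    have 2: "x (b \<otimes> (a \<otimes> c)) = x (a \<otimes> b \<otimes> c)" using a b c by (simp add: m_ac)
    show ?thesis unfolding 1 2 by (rule minus_minus_cancel) (use a b c xd(1) in auto)
   qed
   then show ?thesis using a b by (auto simp: cosyzygy_mod_def intro!: restrict_ext)
  qed
  fix y assume "y \<in> carrier C"
  then have y': "y \<in> coind_carrier k \<kappa> R M" by (simp_all add: cosyzygy_mod_def)
  show "a \<odot>\<^bsub>C\<^esub> (x \<oplus>\<^bsub>C\<^esub> y) = a \<odot>\<^bsub>C\<^esub> x \<oplus>\<^bsub>C\<^esub> a \<odot>\<^bsub>C\<^esub> y"
   using a xd(1) coind_carrierD(1)[OF y']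
   by (auto simp: cosyzygy_mod_def M.smult_r_distr a_minus_def M.M.minus_add M.M.a_ac intro!: restrict_ext)
 qed
qed

definition unit_map :: "'m => 'a => 'm" where "unit_map y = (\<lambda>c\<in>carrier R. c \<odot>\<^bsub>M\<^esub> y)"
text \<open>The k-linear projection of Hom_k(R, M) onto the maps that vanish at 1, along the image
  of \<open>unit_map\<close>.\<close>

definition cosyz_map :: "('a => 'm) => 'a => 'm" where "cosyz_map h = (\<lambda>c\<in>carrier R. h c \<ominus>\<^bsub>M\<^esub> c \<odot>\<^bsub>M\<^esub> h \<one>)"

lemma unit_map_hom: "unit_map \<in> mod_hom R M E"
proof (rule mod_homI)
 fix x assume x: "x \<in> carrier M"
 show "unit_map x \<in> carrier E"
  unfolding coind_mod_def unit_map_def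
  by simp (rule coind_carrierI; use x in \<open>simp add: M.smult_l_distr M.smult_assoc1\<close>)
 show "unit_map (a \<odot>\<^bsub>M\<^esub> x) = a \<odot>\<^bsub>E\<^esub> unit_map x" if "a \<in> carrier R" for a
  using x that by (auto simp: coind_mod_def unit_map_def M.smult_assoc1[symmetric] m_comm intro!: restrict_ext)
 show "unit_map (x \<oplus>\<^bsub>M\<^esub> y) = unit_map x \<oplus>\<^bsub>E\<^esub> unit_map y" if "y \<in> carrier M" for y
  using x that by (auto simp: coind_mod_def unit_map_def M.smult_r_distr intro!: restrict_ext)
qed

lemma unit_map_inj: "inj_on unit_map (carrier M)"
proof (rule inj_onI)
 fix x y assume xy: "x \<in> carrier M" "y \<in> carrier M" and eq: "unit_map x = unit_map y"
 show "x = y" using fun_cong[OF eq, of "\<one>"] xy by (simp add: unit_map_def)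
qed

lemma cosyz_map_hom: "cosyz_map \<in> mod_hom R E C"
proof (rule mod_homI)
 fix x assume "x \<in> carrier E"
 then have x: "x \<in> coind_carrier k \<kappa> R M" by (simp add: coind_mod_def)
 note xd = coind_carrierD[OF x]
 show "cosyz_map x \<in> carrier C"
  using cosyz_smult_closed[OF x M.R.one_closed, of "x \<one>"] xd(1)
  by (simp add: cosyzygy_mod_def cosyz_map_def a_minus_def M.M.r_neg cong: restrict_cong)
 show "cosyz_map (a \<odot>\<^bsub>E\<^esub> x) = a \<odot>\<^bsub>C\<^esub> cosyz_map x" if a: "a \<in> carrier R" for a
 proof -
  have "x (a \<otimes> c) \<ominus>\<^bsub>M\<^esub> c \<odot>\<^bsub>M\<^esub> x a =
    (x (a \<otimes> c) \<ominus>\<^bsub>M\<^esub> (a \<otimes> c) \<odot>\<^bsub>M\<^esub> x \<one>) \<ominus>\<^bsub>M\<^esub> c \<odot>\<^bsub>M\<^esub> (x a \<ominus>\<^bsub>M\<^esub> a \<odot>\<^bsub>M\<^esub> x \<one>)" if c: "c \<in> carrier R" for c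
  proof -
   have 1: "c \<odot>\<^bsub>M\<^esub> (x a \<ominus>\<^bsub>M\<^esub> a \<odot>\<^bsub>M\<^esub> x \<one>) = c \<odot>\<^bsub>M\<^esub> x a \<ominus>\<^bsub>M\<^esub> (a \<otimes> c) \<odot>\<^bsub>M\<^esub> x \<one>"
    using a c xd(1) by (simp add: a_minus_def M.smult_r_distr M.smult_r_minus M.smult_assoc1[symmetric] m_comm)
   show ?thesis unfolding 1 by (rule minus_minus_cancel) (use a c xd(1) in auto)
  qed
  then show ?thesis using a by (auto simp: coind_mod_def cosyzygy_mod_def cosyz_map_def intro!: restrict_ext)
 qed
 fix y assume "y \<in> carrier E"
 then have y: "y \<in> coind_carrier k \<kappa> R M" by (simp add: coind_mod_def)
 show "cosyz_map (x \<oplus>\<^bsub>E\<^esub> y) = cosyz_map x \<oplus>\<^bsub>C\<^esub> cosyz_map y"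
  using xd(1) coind_carrierD(1)[OF y]
  by (auto simp: coind_mod_def cosyzygy_mod_def cosyz_map_def M.smult_r_distr a_minus_def M.M.minus_add M.M.a_ac intro!: restrict_ext)
qed

lemma cosyz_map_surj: "cosyz_map ` carrier E = carrier C"
proof
 show "cosyz_map ` carrier E \<subseteq> carrier C" using mod_homD(1)[OF cosyz_map_hom] by blast
 show "carrier C \<subseteq> cosyz_map ` carrier E"
 proof
  fix h assume "h \<in> carrier C"
  then have h: "h \<in> coind_carrier k \<kappa> R M" "h \<one> = \<zero>\<^bsub>M\<^esub>" by (simp_all add: cosyzygy_mod_def)
  have "cosyz_map h = h"
   using coind_carrierD(1,4)[OF h(1)] h(2) by (auto simp: cosyz_map_def a_minus_def intro!: coind_ext)
  moreover have "h \<in> carrier E" using h(1) by (simp add: coind_mod_def)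
  ultimately show "h \<in> cosyz_map ` carrier E" by (metis imageI)
 qed
qed

lemma cosyz_map_ker: "mod_ker E C cosyz_map = unit_map ` carrier M"
proof
 show "mod_ker E C cosyz_map \<subseteq> unit_map ` carrier M"
 proof
  fix h assume "h \<in> mod_ker E C cosyz_map"
  then have h: "h \<in> coind_carrier k \<kappa> R M" "cosyz_map h = (\<lambda>c\<in>carrier R. \<zero>\<^bsub>M\<^esub>)"
   by (simp_all add: mod_ker_def coind_mod_def cosyzygy_mod_def)
  note hd = coind_carrierD[OF h(1)]
  have hc: "h c = c \<odot>\<^bsub>M\<^esub> h \<one>" if "c \<in> carrier R" for c
  proof -
   have "h c \<oplus>\<^bsub>M\<^esub> \<ominus>\<^bsub>M\<^esub> (c \<odot>\<^bsub>M\<^esub> h \<one>) = \<zero>\<^bsub>M\<^esub>"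
    using fun_cong[OF h(2), of c] that by (simp add: cosyz_map_def a_minus_def)
   then have "\<ominus>\<^bsub>M\<^esub> (\<ominus>\<^bsub>M\<^esub> (c \<odot>\<^bsub>M\<^esub> h \<one>)) = h c" using that hd(1) by (intro M.M.minus_equality) auto
   then show ?thesis using that hd(1) by simp
  qed
  have "unit_map (h \<one>) = h"
  proof (rule coind_ext[OF _ hd(4)])
   show "unit_map (h \<one>) c = h c" if "c \<in> carrier R" for c
    unfolding hc[OF that] unit_map_def using that by simp
  qed (simp add: unit_map_def)
  then have "h = unit_map (h \<one>)" by simp
  then show "h \<in> unit_map ` carrier M" using hd(1) by blast
 qed
 show "unit_map ` carrier M \<subseteq> mod_ker E C cosyz_map"
  using mod_homD(1)[OF unit_map_hom]
  by (auto simp: mod_ker_def cosyz_map_def unit_map_def cosyzygy_mod_def a_minus_def M.M.r_neg intro!: restrict_ext)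
qed

end

section \<open>Splicing short exact sequences into an injective resolution\<close>

definition short_exact :: "'a ring => ('a, 'm) module => ('a, 'n) module => ('a, 'p) module =>
  ('m => 'n) => ('n => 'p) => bool" where
 "short_exact R C E D \<iota> \<delta> \<longleftrightarrow> \<iota> \<in> mod_hom R C E \<and> inj_on \<iota> (carrier C) \<and> \<delta> \<in> mod_hom R E D \<and>
  \<delta> ` carrier E = carrier D \<and> mod_ker E D \<delta> = \<iota> ` carrier C"

lemma short_exactD:
 assumes "short_exact R C E D \<iota> \<delta>"
 shows "\<iota> \<in> mod_hom R C E" "inj_on \<iota> (carrier C)" "\<delta> \<in> mod_hom R E D"
  "\<delta> ` carrier E = carrier D" "mod_ker E D \<delta> = \<iota> ` carrier C"
 using assms by (auto simp: short_exact_def)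

lemma injective_resolution_splice:
 fixes E :: "nat => ('a, 'm) module" and C :: "nat => ('a, 'm) module"
 assumes C: "!!i. module R (C i)" and E: "!!i. injective_module R (E i)"
  and ex: "!!i. short_exact R (C i) (E i) (C (Suc i)) (\<iota> i) (\<delta> i)"
  and j: "j \<in> mod_hom R M (C 0)" "bij_betw j (carrier M) (carrier (C 0))"
 shows "injective_resolution R M E (\<lambda>x. \<iota> 0 (j x)) (\<lambda>i x. \<iota> (Suc i) (\<delta> i x))"
proof -
 note ex' = short_exactD[OF ex]
 have Em: "module R (E i)" for i using E by (simp add: injective_module_def)
 have ker: "mod_ker (E i) (E (Suc i)) (\<lambda>x. \<iota> (Suc i) (\<delta> i x)) = \<iota> i ` carrier (C i)" for i
 proof -
  have "\<iota> (Suc i) (\<delta> i x) = \<zero>\<^bsub>E (Suc i)\<^esub> \<longleftrightarrow> \<delta> i x = \<zero>\<^bsub>C (Suc i)\<^esub>" if "x \<in> carrier (E i)" for x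
  proof -
   interpret CS: module R "C (Suc i)" by (rule C)
   have "\<delta> i x \<in> carrier (C (Suc i))" using ex'(4)[of i] that by blast
   then show ?thesis
    using mod_hom_zero[OF C Em ex'(1)[of "Suc i"]] ex'(2)[of "Suc i"] CS.M.zero_closed by (metis inj_onD)
  qed
  then show ?thesis using ex'(5)[of i] by (auto simp: mod_ker_def)
 qed
 have im: "(\<lambda>x. \<iota> (Suc i) (\<delta> i x)) ` carrier (E i) = \<iota> (Suc i) ` carrier (C (Suc i))" for i
  using ex'(4)[of i] by (metis image_image)
 have je: "(\<lambda>x. \<iota> 0 (j x)) ` carrier M = \<iota> 0 ` carrier (C 0)"
  using j(2) by (metis bij_betw_imp_surj_on image_image)
 have inj: "inj_on (\<lambda>x. \<iota> 0 (j x)) (carrier M)"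
  using comp_inj_on[of j "carrier M" "\<iota> 0"] j(2) ex'(2)[of 0] by (simp add: bij_betw_def comp_def)
 show ?thesis
  unfolding injective_resolution_def
  using E mod_hom_comp[OF j(1) ex'(1)] mod_hom_comp[OF ex'(3) ex'(1)] ker im je inj by simp
qed

lemma baer_transport:
 assumes M: "module R M" and j: "inj_on j (carrier M)" and I: "hom_extends R \<aa> M"
 shows "hom_extends R \<aa> (transport_mod j M)"
 unfolding hom_extends_def
proof
 fix f assume f: "f \<in> mod_hom R (ideal_mod R \<aa>) (transport_mod j M)"
 obtain e where e: "e \<in> carrier M" "!!a. a \<in> \<aa> ==> the_inv_into (carrier M) j (f a) = a \<odot>\<^bsub>M\<^esub> e"
  using hom_extendsD[OF I mod_hom_comp[OF f transport_mod_inv_hom[OF M j]]] by blast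
 note s = transport_mod_simps[OF j]
 show "\<exists>e\<in>carrier (transport_mod j M). \<forall>a\<in>\<aa>. f a = a \<odot>\<^bsub>transport_mod j M\<^esub> e"
 proof (intro bexI ballI)
  show "j e \<in> carrier (transport_mod j M)" using e s by simp
  fix a assume a: "a \<in> \<aa>"
  have "f a \<in> j ` carrier M" using mod_homD(1)[OF f] a s by simp
  then have "f a = j (the_inv_into (carrier M) j (f a))" using j by (simp add: f_the_inv_into_f)
  then show "f a = a \<odot>\<^bsub>transport_mod j M\<^esub> j e" using e a s by simp
 qed
qed

text \<open>A function into sets of lists becomes one set of lists by putting the argument in front
  of each list; this is why the type \<open>'a list set\<close> is closed under forming coinduced
  modules.\<close>

definition encode :: "('a => 'a list set) => 'a list set" where
 "encode h = {a # w | a w. w \<in> h a}"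

lemma inj_encode: "inj_on encode A"
proof (rule inj_onI)
 fix g h :: "'a => 'a list set" assume eq: "encode g = encode h"
 have "w \<in> g a \<longleftrightarrow> w \<in> h a" for a w
  using eq[THEN eqset_imp_iff, of "a # w"] by (simp add: encode_def)
 then show "g = h" by blast
qed

primrec cosyzygy :: "'k ring => ('k => 'a) => 'a ring => nat => ('a, 'a list set) module" where
 "cosyzygy k \<kappa> R 0 = transport_mod (\<lambda>a. {[a]}) (self_module R)"
| "cosyzygy k \<kappa> R (Suc i) = transport_mod encode (cosyzygy_mod k \<kappa> R (cosyzygy k \<kappa> R i))"

definition envelope :: "'k ring => ('k => 'a) => 'a ring => nat => ('a, 'a list set) module" where
 "envelope k \<kappa> R i = transport_mod encode (coind_mod k \<kappa> R (cosyzygy k \<kappa> R i))"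

definition envelope_in :: "'k ring => ('k => 'a) => 'a ring => nat => 'a list set => 'a list set" where
 "envelope_in k \<kappa> R i y = encode (coinduction.unit_map R (cosyzygy k \<kappa> R i) y)"

definition envelope_out :: "'k ring => ('k => 'a) => 'a ring => nat => 'a list set => 'a list set" where
 "envelope_out k \<kappa> R i x = encode (coinduction.cosyz_map R (cosyzygy k \<kappa> R i)
  (the_inv_into (carrier (coind_mod k \<kappa> R (cosyzygy k \<kappa> R i))) encode x))"

lemma short_exact_transport:
 assumes "module R M" "module R E" "module R C"
  and ex: "short_exact R M E C \<iota> \<delta>" and j: "inj_on j (carrier E)" and l: "inj_on l (carrier C)"
 shows "short_exact R M (transport_mod j E) (transport_mod l C)
  (\<lambda>x. j (\<iota> x)) (\<lambda>x. l (\<delta> (the_inv_into (carrier E) j x)))"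
proof -
 note ex' = short_exactD[OF ex]
 interpret C: module R C by fact
 note sj = transport_mod_simps[OF j] and sl = transport_mod_simps[OF l]
 have "inj_on (\<lambda>x. j (\<iota> x)) (carrier M)"
  using comp_inj_on[OF ex'(2) inj_on_subset[OF j]] mod_homD(1)[OF ex'(1)] by (auto simp: comp_def image_subset_iff)
 moreover have "(\<lambda>x. l (\<delta> (the_inv_into (carrier E) j x))) ` carrier (transport_mod j E) = carrier (transport_mod l C)"
  using ex'(4) unfolding sj sl image_image by (simp add: the_inv_into_f_f[OF j] image_image[symmetric] cong: image_cong)
 moreover have "mod_ker (transport_mod j E) (transport_mod l C) (\<lambda>x. l (\<delta> (the_inv_into (carrier E) j x))) = (\<lambda>x. j (\<iota> x)) ` carrier M"
 proof -
  have "l (\<delta> (the_inv_into (carrier E) j (j x))) = l \<zero>\<^bsub>C\<^esub> \<longleftrightarrow> \<delta> x = \<zero>\<^bsub>C\<^esub>" if "x \<in> carrier E" for x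
   using that mod_homD(1)[OF ex'(3) that] l by (simp add: the_inv_into_f_f[OF j] inj_on_eq_iff)
  then have "mod_ker (transport_mod j E) (transport_mod l C) (\<lambda>x. l (\<delta> (the_inv_into (carrier E) j x))) = j ` mod_ker E C \<delta>"
   unfolding mod_ker_def sj sl by auto
  then show ?thesis unfolding ex'(5) image_image .
 qed
 ultimately show ?thesis
  unfolding short_exact_def
  using mod_hom_comp[OF ex'(1) transport_mod_hom[OF j]]
   mod_hom_comp[OF mod_hom_comp[OF transport_mod_inv_hom[OF assms(2) j] ex'(3)] transport_mod_hom[OF l]]
  by blast
qed

lemma inj_singleton_list: "inj_on (\<lambda>a. {[a]}) A"
 by (auto simp: inj_on_def)

lemma cosyzygy_is_module:
 assumes "cring R" "field k" "\<kappa> \<in> ring_hom k R"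
 shows "module R (cosyzygy k \<kappa> R i)"
proof (induction i)
 case 0
 show ?case
  by (simp add: transport_mod_is_module[OF self_module_is_module[OF assms(1)] inj_singleton_list])
next
 case (Suc i)
 interpret coinduction R "cosyzygy k \<kappa> R i" k \<kappa>
  by (intro coinduction.intro coinduction_axioms.intro Suc assms)
 show ?case
  by (simp add: transport_mod_is_module[OF cosyzygy_mod_is_module inj_encode])
qed

lemma cosyzygy_envelope:
 assumes "cring R" "field k" "\<kappa> \<in> ring_hom k R"
 shows "module R (envelope k \<kappa> R i)" "baer R (envelope k \<kappa> R i)"
  and "short_exact R (cosyzygy k \<kappa> R i) (envelope k \<kappa> R i) (cosyzygy k \<kappa> R (Suc i))
   (envelope_in k \<kappa> R i) (envelope_out k \<kappa> R i)"
proof -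
 interpret coinduction R "cosyzygy k \<kappa> R i" k \<kappa>
  by (intro coinduction.intro coinduction_axioms.intro cosyzygy_is_module assms)
 show "module R (envelope k \<kappa> R i)"
  by (simp add: envelope_def transport_mod_is_module[OF coind_mod_is_module inj_encode])
 show "baer R (envelope k \<kappa> R i)"
  using baer_transport[OF coind_mod_is_module inj_encode] coind_mod_baer
  by (simp add: envelope_def baer_def)
 have "short_exact R (cosyzygy k \<kappa> R i) E C unit_map cosyz_map"
  unfolding short_exact_def using unit_map_hom unit_map_inj cosyz_map_hom cosyz_map_surj cosyz_map_ker by blast
 from short_exact_transport[OF M.module_axioms coind_mod_is_module cosyzygy_mod_is_module this inj_encode inj_encode]
 show "short_exact R (cosyzygy k \<kappa> R i) (envelope k \<kappa> R i) (cosyzygy k \<kappa> R (Suc i))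
   (envelope_in k \<kappa> R i) (envelope_out k \<kappa> R i)"
  by (simp add: envelope_def envelope_in_def[abs_def] envelope_out_def[abs_def])
qed

lemma zero_sub_module:
 assumes "module R M"
 shows "module R (sub_mod M {\<zero>\<^bsub>M\<^esub>})" "baer R (sub_mod M {\<zero>\<^bsub>M\<^esub>})"
proof -
 interpret M: module R M by fact
 have "submodule {\<zero>\<^bsub>M\<^esub>} R M" by (rule M.submoduleI) auto
 then show "module R (sub_mod M {\<zero>\<^bsub>M\<^esub>})" using submodule.submodule_is_module assms by blast
 show "baer R (sub_mod M {\<zero>\<^bsub>M\<^esub>})"
  unfolding baer_def hom_extends_def
  using ideal.Icarr by (fastforce dest: mod_homD(1))
qed

text \<open>An injective cosyzygy ends the resolution: it serves as its own envelope in degree n,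
  and zero modules follow.\<close>

lemma finite_self_injective_dimensionI:
 fixes R :: "'a ring"
 assumes R: "cring R" and k: "field k" and \<kappa>: "\<kappa> \<in> ring_hom k R" and C: "baer R (cosyzygy k \<kappa> R n)"
 shows "finite_self_injective_dimension R"
proof -
 let ?Z = "sub_mod (cosyzygy k \<kappa> R 0) {\<zero>\<^bsub>cosyzygy k \<kappa> R 0\<^esub>}"
 define C' where "C' i = (if i \<le> n then cosyzygy k \<kappa> R i else ?Z)" for i
 define E' where "E' i = (if i < n then envelope k \<kappa> R i else C' i)" for i
 define \<iota> where "\<iota> i = (if i < n then envelope_in k \<kappa> R i else (\<lambda>x. x))" for i
 define \<delta> where "\<delta> i = (if i < n then envelope_out k \<kappa> R i else (\<lambda>x. \<zero>\<^bsub>?Z\<^esub>))" for i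
 note Cm = cosyzygy_is_module[OF R k \<kappa>]
 note Z = zero_sub_module[OF Cm[of 0]]
 have Cm': "module R (C' i)" for i using Cm Z by (simp add: C'_def)
 have baer: "baer R (E' i)" and Em: "module R (E' i)" for i
 proof -
  consider "i < n" | "i = n" | "i > n" by linarith
  then show "baer R (E' i)" "module R (E' i)"
   using cosyzygy_envelope[OF R k \<kappa>] C Z Cm by (cases; simp add: E'_def C'_def)+
 qed
 have ex: "short_exact R (C' i) (E' i) (C' (Suc i)) (\<iota> i) (\<delta> i)" for i
 proof (cases "i < n")
  case True
  then show ?thesis using cosyzygy_envelope(3)[OF R k \<kappa>] by (simp add: C'_def E'_def \<iota>_def \<delta>_def)
 next
  case False
  interpret C: module R "C' i" by (rule Cm')
  interpret Z: module R ?Z by (rule Z)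
  have "(\<lambda>x. \<zero>\<^bsub>?Z\<^esub>) ` carrier (C' i) = {\<zero>\<^bsub>?Z\<^esub>}" using C.M.zero_closed by blast
  moreover have "C' (Suc i) = ?Z" "E' i = C' i" using False by (simp_all add: C'_def E'_def)
  moreover have "(\<lambda>x. \<zero>\<^bsub>?Z\<^esub>) \<in> mod_hom R (C' i) ?Z"
  proof (rule mod_homI)
   show "\<zero>\<^bsub>?Z\<^esub> = \<zero>\<^bsub>?Z\<^esub> \<oplus>\<^bsub>?Z\<^esub> \<zero>\<^bsub>?Z\<^esub>" by (rule Z.M.l_zero[OF Z.M.zero_closed, symmetric])
   show "\<zero>\<^bsub>?Z\<^esub> = a \<odot>\<^bsub>?Z\<^esub> \<zero>\<^bsub>?Z\<^esub>" if "a \<in> carrier R" for a by (rule Z.smult_r_null[OF that, symmetric])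
  qed simp
  moreover have "(\<lambda>x. x) \<in> mod_hom R (C' i) (C' i)" by (rule mod_homI) simp_all
  ultimately show ?thesis
   using False by (simp add: short_exact_def \<iota>_def \<delta>_def mod_ker_def)
 qed
 have inj: "injective_module R (E' i)" for i by (rule baer_imp_injective_module[OF Em baer])
 let ?j = "\<lambda>a. {[a]}"
 have j: "?j \<in> mod_hom R (self_module R) (C' 0)" "bij_betw ?j (carrier (self_module R)) (carrier (C' 0))"
  using transport_mod_hom[where M = "self_module R" and R = R and j = ?j, OF inj_singleton_list]
  by (auto simp: C'_def bij_betw_def inj_singleton_list transport_mod_simps(1)[OF inj_singleton_list])
 have "carrier (E' i) = {\<zero>\<^bsub>E' i\<^esub>}" if "i > n" for i using that by (simp add: E'_def C'_def)
 then show ?thesis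
  unfolding finite_self_injective_dimension_def
  using injective_resolution_splice[OF Cm' inj ex j] by blast
qed

section \<open>Change of rings along a surjection\<close>

text \<open>This is Hom_R(A, C), realised as the elements of C killed by the kernel of \<phi>. A
  scalar acts through the lift that \<open>SOME\<close> picks; by \<open>descend_smult\<close> every
  lift gives the same result.\<close>

definition descend :: "('a => 'b) => 'a ring => 'b ring => ('a, 'm) module => ('b, 'm) module" where
 "descend \<phi> R A C = \<lparr>carrier = {c \<in> carrier C. \<forall>x\<in>carrier R. \<phi> x = \<zero>\<^bsub>A\<^esub> --> x \<odot>\<^bsub>C\<^esub> c = \<zero>\<^bsub>C\<^esub>},
  monoid.mult = undefined, monoid.one = undefined, ring.zero = ring.zero C, ring.add = ring.add C,
  module.smult = (\<lambda>a c. (SOME r. r \<in> carrier R \<and> \<phi> r = a) \<odot>\<^bsub>C\<^esub> c)\<rparr>"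

lemma descend_simps [simp]:
 "\<zero>\<^bsub>descend \<phi> R A C\<^esub> = \<zero>\<^bsub>C\<^esub>" "x \<oplus>\<^bsub>descend \<phi> R A C\<^esub> y = x \<oplus>\<^bsub>C\<^esub> y"
 by (simp_all add: descend_def)

locale surjective_ring_hom = R?: cring R + A?: cring A for R :: "'a ring" (structure) and A :: "'b ring" +
 fixes \<phi> :: "'a => 'b"
 assumes hom: "\<phi> \<in> ring_hom R A" and surj: "\<phi> ` carrier R = carrier A"
begin

definition K :: "'a set" where "K = {x \<in> carrier R. \<phi> x = \<zero>\<^bsub>A\<^esub>}"

lemma \<phi>_simps [simp]:
 "x \<in> carrier R ==> \<phi> x \<in> carrier A" "x \<in> carrier R ==> y \<in> carrier R ==> \<phi> (x \<oplus> y) = \<phi> x \<oplus>\<^bsub>A\<^esub> \<phi> y"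
 "x \<in> carrier R ==> y \<in> carrier R ==> \<phi> (x \<otimes> y) = \<phi> x \<otimes>\<^bsub>A\<^esub> \<phi> y" "\<phi> \<one> = \<one>\<^bsub>A\<^esub>"
 using hom by (auto simp: ring_hom_closed ring_hom_add ring_hom_mult ring_hom_one)

lemma \<phi>_ring_hom_cring: "ring_hom_cring R A \<phi>"
 by (intro ring_hom_cring.intro ring_hom_cring_axioms.intro R.cring_axioms A.cring_axioms hom)

lemma \<phi>_zero [simp]: "\<phi> \<zero> = \<zero>\<^bsub>A\<^esub>" and \<phi>_minus [simp]: "x \<in> carrier R ==> \<phi> (\<ominus> x) = \<ominus>\<^bsub>A\<^esub> \<phi> x"
proof -
 interpret ring_hom_cring R A \<phi> by (rule \<phi>_ring_hom_cring)
 show "\<phi> \<zero> = \<zero>\<^bsub>A\<^esub>" "x \<in> carrier R ==> \<phi> (\<ominus> x) = \<ominus>\<^bsub>A\<^esub> \<phi> x" by simp_all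
qed

lemma K_ideal: "ideal K R"
 by (rule idealI'[OF R.cring_axioms]) (auto simp: K_def)

lemma eq_imp_diff_in_K:
 assumes "r \<in> carrier R" "s \<in> carrier R" "\<phi> r = \<phi> s"
 shows "r \<ominus> s \<in> K"
 using assms by (simp add: K_def a_minus_def A.r_neg)

lemma descend_carrier: "carrier (descend \<phi> R A C) = {c \<in> carrier C. \<forall>x\<in>K. x \<odot>\<^bsub>C\<^esub> c = \<zero>\<^bsub>C\<^esub>}"
 by (auto simp: descend_def K_def)

lemma descend_smult:
 assumes C: "module R C" and c: "c \<in> carrier (descend \<phi> R A C)" and r: "r \<in> carrier R"
 shows "\<phi> r \<odot>\<^bsub>descend \<phi> R A C\<^esub> c = r \<odot>\<^bsub>C\<^esub> c"
proof -
 interpret C: module R C by fact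
 define s where "s = (SOME s. s \<in> carrier R \<and> \<phi> s = \<phi> r)"
 have s: "s \<in> carrier R \<and> \<phi> s = \<phi> r" unfolding s_def by (rule someI[of _ r]) (use r in simp)
 have c': "c \<in> carrier C" using c by (simp add: descend_carrier)
 have "(s \<ominus> r) \<odot>\<^bsub>C\<^esub> c = \<zero>\<^bsub>C\<^esub>"
  using c eq_imp_diff_in_K[of s r] s r by (simp add: descend_carrier)
 then have "s \<odot>\<^bsub>C\<^esub> c \<oplus>\<^bsub>C\<^esub> \<ominus>\<^bsub>C\<^esub> (r \<odot>\<^bsub>C\<^esub> c) = \<zero>\<^bsub>C\<^esub>"
  using s r c' by (simp add: a_minus_def C.smult_l_distr C.smult_l_minus)
 then have "s \<odot>\<^bsub>C\<^esub> c = r \<odot>\<^bsub>C\<^esub> c"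
  using s r c' by (metis C.M.add.inv_closed C.M.minus_equality C.M.minus_minus C.smult_closed)
 then show ?thesis by (simp add: descend_def s_def)
qed

lemma surjE:
 assumes "a \<in> carrier A" obtains r where "r \<in> carrier R" "a = \<phi> r"
 using assms surj by blast

lemma descend_mod:
 assumes C: "module R C"
 shows "Module.module A (descend \<phi> R A C)"
proof -
 interpret C: module R C by fact
 interpret K: ideal K R by (rule K_ideal)
 let ?D = "descend \<phi> R A C"
 have "abelian_group ?D"
 proof (rule abelian_groupI)
  fix x assume x: "x \<in> carrier ?D"
  show "\<exists>y\<in>carrier ?D. y \<oplus>\<^bsub>?D\<^esub> x = \<zero>\<^bsub>?D\<^esub>"
   using x by (intro bexI[of _ "\<ominus>\<^bsub>C\<^esub> x"]) (auto simp: descend_carrier C.M.l_neg C.smult_r_minus K.Icarr)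
 qed (auto simp: descend_carrier C.M.a_ac C.smult_r_distr K.Icarr)
 then show ?thesis
 proof (rule moduleI[OF A.cring_axioms])
  have cl: "c \<in> carrier C" if "c \<in> carrier ?D" for c using that by (simp add: descend_carrier)
  show "\<one>\<^bsub>A\<^esub> \<odot>\<^bsub>?D\<^esub> x = x" if "x \<in> carrier ?D" for x
   using descend_smult[OF C that R.one_closed] cl[OF that] by simp
  fix a x assume a: "a \<in> carrier A" and x: "x \<in> carrier ?D"
  obtain r where r: "r \<in> carrier R" "a = \<phi> r" using surjE[OF a] .
  show ax: "a \<odot>\<^bsub>?D\<^esub> x \<in> carrier ?D"
  proof -
   have "y \<odot>\<^bsub>C\<^esub> (r \<odot>\<^bsub>C\<^esub> x) = \<zero>\<^bsub>C\<^esub>" if "y \<in> K" for y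
    using C.smult_assoc1[of y r x] x r K.I_r_closed[OF that r(1)] K.Icarr[OF that] by (auto simp: descend_carrier)
   then show ?thesis using descend_smult[OF C x r(1)] r x by (simp add: descend_carrier)
  qed
  show "a \<odot>\<^bsub>?D\<^esub> (x \<oplus>\<^bsub>?D\<^esub> y) = a \<odot>\<^bsub>?D\<^esub> x \<oplus>\<^bsub>?D\<^esub> a \<odot>\<^bsub>?D\<^esub> y" if y: "y \<in> carrier ?D" for y
  proof -
   have "x \<oplus>\<^bsub>C\<^esub> y \<in> carrier ?D" using x y by (auto simp: descend_carrier C.smult_r_distr K.Icarr)
   then show ?thesis
    using descend_smult[OF C _ r(1)] x y r cl by (simp add: C.smult_r_distr)
  qed
  fix b assume b: "b \<in> carrier A"
  obtain s where s: "s \<in> carrier R" "b = \<phi> s" using surjE[OF b] .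
  have bx: "b \<odot>\<^bsub>?D\<^esub> x = s \<odot>\<^bsub>C\<^esub> x" using descend_smult[OF C x s(1)] s by simp
  have bxD: "s \<odot>\<^bsub>C\<^esub> x \<in> carrier ?D"
  proof -
   have "y \<odot>\<^bsub>C\<^esub> (s \<odot>\<^bsub>C\<^esub> x) = \<zero>\<^bsub>C\<^esub>" if "y \<in> K" for y
    using C.smult_assoc1[of y s x] x s K.I_r_closed[OF that s(1)] K.Icarr[OF that] by (auto simp: descend_carrier)
   then show ?thesis using s x by (simp add: descend_carrier)
  qed
  show "(a \<otimes>\<^bsub>A\<^esub> b) \<odot>\<^bsub>?D\<^esub> x = a \<odot>\<^bsub>?D\<^esub> (b \<odot>\<^bsub>?D\<^esub> x)"
   using descend_smult[OF C x, of "r \<otimes> s"] descend_smult[OF C bxD r(1)] bx r s cl[OF x] by (simp add: C.smult_assoc1)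
  show "(a \<oplus>\<^bsub>A\<^esub> b) \<odot>\<^bsub>?D\<^esub> x = a \<odot>\<^bsub>?D\<^esub> x \<oplus>\<^bsub>?D\<^esub> b \<odot>\<^bsub>?D\<^esub> x"
   using descend_smult[OF C x, of "r \<oplus> s"] descend_smult[OF C x r(1)] bx r s cl[OF x] by (simp add: C.smult_l_distr)
 qed
qed

lemma descend_hom:
 assumes C: "module R C" and D: "module R D" and f: "f \<in> mod_hom R C D"
 shows "f \<in> mod_hom A (descend \<phi> R A C) (descend \<phi> R A D)"
proof (rule mod_homI)
 interpret K: ideal K R by (rule K_ideal)
 note f' = mod_homD[OF f]
 fix x assume x: "x \<in> carrier (descend \<phi> R A C)"
 then have x': "x \<in> carrier C" by (simp add: descend_carrier)
 show fx: "f x \<in> carrier (descend \<phi> R A D)"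
  using x f'(1) f'(3)[symmetric] mod_hom_zero[OF C D f] K.Icarr by (auto simp: descend_carrier)
 show "f (a \<odot>\<^bsub>descend \<phi> R A C\<^esub> x) = a \<odot>\<^bsub>descend \<phi> R A D\<^esub> f x" if a: "a \<in> carrier A" for a
 proof -
  obtain r where r: "r \<in> carrier R" "a = \<phi> r" using surjE[OF a] .
  then show ?thesis using descend_smult[OF C x r(1)] descend_smult[OF D fx r(1)] f'(3)[OF r(1) x'] by simp
 qed
 show "f (x \<oplus>\<^bsub>descend \<phi> R A C\<^esub> y) = f x \<oplus>\<^bsub>descend \<phi> R A D\<^esub> f y" if "y \<in> carrier (descend \<phi> R A C)" for y
  using f'(2) x' that by (simp add: descend_carrier)
qed

text \<open>Taking K-torsion is left exact; surjectivity is where Ext^1(A, C) = 0 enters. For a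
  preimage e of a torsion element, x -> x e maps K into C and so is multiplication by some \<gamma>;
  e minus the image of \<gamma> is a torsion preimage.\<close>

lemma descend_short_exact:
 assumes C: "module R C" and E: "module R E" and D: "module R D"
  and ex: "short_exact R C E D \<iota> \<delta>" and KC: "hom_extends R K C"
 shows "short_exact A (descend \<phi> R A C) (descend \<phi> R A E) (descend \<phi> R A D) \<iota> \<delta>"
proof -
 interpret C: module R C by fact
 interpret E: module R E by fact
 interpret D: module R D by fact
 interpret K: ideal K R by (rule K_ideal)
 note ex' = short_exactD[OF ex]
 note i = descend_hom[OF C E ex'(1)] and d = descend_hom[OF E D ex'(3)]
 note i' = mod_homD[OF ex'(1)] and d' = mod_homD[OF ex'(3)]
 have lift: "c \<in> \<delta> ` carrier (descend \<phi> R A E)" if c: "c \<in> carrier (descend \<phi> R A D)" for c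
 proof -
  have c': "c \<in> carrier D" "!!x. x \<in> K ==> x \<odot>\<^bsub>D\<^esub> c = \<zero>\<^bsub>D\<^esub>" using c by (auto simp: descend_carrier)
  then obtain e where e: "e \<in> carrier E" "\<delta> e = c" using ex'(4) by (metis imageE)
  define f where "f x = the_inv_into (carrier C) \<iota> (x \<odot>\<^bsub>E\<^esub> e)" for x
  have xe: "x \<odot>\<^bsub>E\<^esub> e \<in> \<iota> ` carrier C" if "x \<in> K" for x
   unfolding ex'(5)[symmetric] using that c' e d'(3) K.Icarr by (simp add: mod_ker_def)
  have f: "f x \<in> carrier C" "\<iota> (f x) = x \<odot>\<^bsub>E\<^esub> e" if "x \<in> K" for x
   using xe[OF that] by (simp_all add: f_def the_inv_into_into[OF ex'(2)] f_the_inv_into_f[OF ex'(2)])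
  have eqI: "p = q" if "\<iota> p = \<iota> q" "p \<in> carrier C" "q \<in> carrier C" for p q
   using ex'(2) that by (auto dest: inj_onD)
  have "f \<in> mod_hom R (ideal_mod R K) C"
  proof (rule mod_homI; simp)
   fix x assume x: "x \<in> K"
   show "f x \<in> carrier C" using f x by simp
   show "f (a \<otimes> x) = a \<odot>\<^bsub>C\<^esub> f x" if "a \<in> carrier R" for a
    by (rule eqI) (insert f x that K.I_l_closed K.Icarr i' e, simp_all add: E.smult_assoc1)
   show "f (x \<oplus> y) = f x \<oplus>\<^bsub>C\<^esub> f y" if "y \<in> K" for y
    by (rule eqI) (insert f x that K.Icarr i' e, simp_all add: E.smult_l_distr)
  qed
  then obtain \<gamma> where \<gamma>: "\<gamma> \<in> carrier C" "!!x. x \<in> K ==> f x = x \<odot>\<^bsub>C\<^esub> \<gamma>" using hom_extendsD[OF KC] by blast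
  have k: "\<delta> (\<iota> \<gamma>) = \<zero>\<^bsub>D\<^esub>" using ex'(5) \<gamma>(1) by (auto simp: mod_ker_def)
  have "x \<odot>\<^bsub>E\<^esub> (e \<ominus>\<^bsub>E\<^esub> \<iota> \<gamma>) = \<zero>\<^bsub>E\<^esub>" if x: "x \<in> K" for x
  proof -
   have "x \<odot>\<^bsub>E\<^esub> \<iota> \<gamma> = x \<odot>\<^bsub>E\<^esub> e" using f(2)[OF x] \<gamma>(2)[OF x] i'(3)[OF K.Icarr[OF x] \<gamma>(1)] by simp
   then show ?thesis using e i'(1)[OF \<gamma>(1)] K.Icarr[OF x]
    by (simp add: a_minus_def E.smult_r_distr E.smult_r_minus E.M.r_neg)
  qed
  then have "e \<ominus>\<^bsub>E\<^esub> \<iota> \<gamma> \<in> carrier (descend \<phi> R A E)" using e i'(1)[OF \<gamma>(1)] by (simp add: descend_carrier)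
  moreover have "\<delta> (e \<ominus>\<^bsub>E\<^esub> \<iota> \<gamma>) = c"
   using mod_hom_diff[OF E D ex'(3) e(1) i'(1)[OF \<gamma>(1)]] k e c' by (simp add: a_minus_def)
  ultimately show ?thesis by blast
 qed
 have "mod_ker (descend \<phi> R A E) (descend \<phi> R A D) \<delta> = \<iota> ` carrier (descend \<phi> R A C)"
 proof
  show "\<iota> ` carrier (descend \<phi> R A C) \<subseteq> mod_ker (descend \<phi> R A E) (descend \<phi> R A D) \<delta>"
   using mod_homD(1)[OF i] ex'(5) by (auto simp: mod_ker_def descend_carrier)
  show "mod_ker (descend \<phi> R A E) (descend \<phi> R A D) \<delta> \<subseteq> \<iota> ` carrier (descend \<phi> R A C)"
  proof
   fix e assume "e \<in> mod_ker (descend \<phi> R A E) (descend \<phi> R A D) \<delta>"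
   then have e: "e \<in> mod_ker E D \<delta>" "!!x. x \<in> K ==> x \<odot>\<^bsub>E\<^esub> e = \<zero>\<^bsub>E\<^esub>" by (auto simp: mod_ker_def descend_carrier)
   then obtain c where c: "c \<in> carrier C" "e = \<iota> c" using ex'(5) by auto
   have "x \<odot>\<^bsub>C\<^esub> c = \<zero>\<^bsub>C\<^esub>" if x: "x \<in> K" for x
   proof -
    have "\<iota> (x \<odot>\<^bsub>C\<^esub> c) = \<iota> \<zero>\<^bsub>C\<^esub>"
     using e(2)[OF x] c i'(3)[OF K.Icarr[OF x] c(1)] mod_hom_zero[OF C E ex'(1)] by simp
    then show ?thesis using ex'(2) c K.Icarr[OF x] by (auto dest: inj_onD)
   qed
   then show "e \<in> \<iota> ` carrier (descend \<phi> R A C)" using c by (auto simp: descend_carrier)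
  qed
 qed
 moreover have "inj_on \<iota> (carrier (descend \<phi> R A C))"
  by (rule inj_on_subset[OF ex'(2)]) (auto simp: descend_carrier)
 moreover have "\<delta> ` carrier (descend \<phi> R A E) = carrier (descend \<phi> R A D)"
  using lift mod_homD(1)[OF d] by blast
 ultimately show ?thesis unfolding short_exact_def using i d by blast
qed

lemma preimage_ideal:
 assumes "ideal \<bb> A"
 shows "ideal {r \<in> carrier R. \<phi> r \<in> \<bb>} R" "K \<subseteq> {r \<in> carrier R. \<phi> r \<in> \<bb>}"
proof -
 interpret b: ideal \<bb> A by fact
 show "ideal {r \<in> carrier R. \<phi> r \<in> \<bb>} R"
  by (rule idealI'[OF R.cring_axioms]) (auto intro: b.I_l_closed)
 show "K \<subseteq> {r \<in> carrier R. \<phi> r \<in> \<bb>}" by (auto simp: K_def)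
qed

lemma image_ideal:
 assumes "ideal \<bb> R"
 shows "ideal (\<phi> ` \<bb>) A"
proof -
 interpret b: ideal \<bb> R by fact
 show ?thesis
 proof (rule idealI'[OF A.cring_axioms])
  show "\<phi> ` \<bb> \<subseteq> carrier A" using b.Icarr by auto
  show "\<zero>\<^bsub>A\<^esub> \<in> \<phi> ` \<bb>" using \<phi>_zero b.zero_closed by (metis imageI)
  show "x \<oplus>\<^bsub>A\<^esub> y \<in> \<phi> ` \<bb>" if "x \<in> \<phi> ` \<bb>" "y \<in> \<phi> ` \<bb>" for x y
   using that b.Icarr by (auto simp flip: \<phi>_simps)
  fix a x assume "a \<in> carrier A" "x \<in> \<phi> ` \<bb>"
  then obtain r y where "r \<in> carrier R" "a = \<phi> r" "y \<in> \<bb>" "x = \<phi> y" using surj by blast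
  then show "a \<otimes>\<^bsub>A\<^esub> x \<in> \<phi> ` \<bb>" using b.Icarr b.I_l_closed[of y r] \<phi>_simps(3)[of r y] by (metis imageI)
 qed
qed

text \<open>Hom_R(A, -) preserves injectivity: f is pulled back to the preimage of \<bb> in R, where
  it is multiplication by some e, and e is torsion because f vanishes at 0.\<close>

lemma descend_baer:
 assumes E: "module R E" and baer: "baer R E"
 shows "baer A (descend \<phi> R A E)"
 unfolding baer_def hom_extends_def
proof (intro allI impI ballI)
 fix \<bb> f assume b: "ideal \<bb> A" and f: "f \<in> mod_hom A (ideal_mod A \<bb>) (descend \<phi> R A E)"
 interpret b: ideal \<bb> A by (rule b)
 let ?p = "{r \<in> carrier R. \<phi> r \<in> \<bb>}"
 note f' = mod_homD[OF f, simplified]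
 note p = preimage_ideal[OF b]
 have fE: "f x \<in> carrier E" if "x \<in> \<bb>" for x using f'(1)[OF that] by (simp add: descend_carrier)
 have "(\<lambda>r. f (\<phi> r)) \<in> mod_hom R (ideal_mod R ?p) E"
 proof (rule mod_homI; simp add: fE f'(2); clarify)
  fix a x assume a: "a \<in> carrier R" and x: "x \<in> carrier R" "\<phi> x \<in> \<bb>"
  have "f (\<phi> a \<otimes>\<^bsub>A\<^esub> \<phi> x) = \<phi> a \<odot>\<^bsub>descend \<phi> R A E\<^esub> f (\<phi> x)" using f'(3) a x by simp
  then show "f (\<phi> a \<otimes>\<^bsub>A\<^esub> \<phi> x) = a \<odot>\<^bsub>E\<^esub> f (\<phi> x)" using descend_smult[OF E f'(1)[OF x(2)] a] by simp
 qed
 then obtain e where e: "e \<in> carrier E" "!!r. r \<in> ?p ==> f (\<phi> r) = r \<odot>\<^bsub>E\<^esub> e"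
  using baer p(1) unfolding baer_def hom_extends_def by meson
 have "f \<zero>\<^bsub>A\<^esub> = \<zero>\<^bsub>E\<^esub>"
  using mod_hom_sub_zero[OF self_module_is_module[OF A.cring_axioms] _ descend_mod[OF E] f] b
   submodule_self_iff[OF A.cring_axioms] by simp
 then have "x \<odot>\<^bsub>E\<^esub> e = \<zero>\<^bsub>E\<^esub>" if "x \<in> K" for x
  using e(2)[OF subsetD[OF p(2) that]] that unfolding K_def by simp
 then have eD: "e \<in> carrier (descend \<phi> R A E)" using e by (simp add: descend_carrier)
 show "\<exists>e\<in>carrier (descend \<phi> R A E). \<forall>a\<in>\<bb>. f a = a \<odot>\<^bsub>descend \<phi> R A E\<^esub> e"
 proof (intro bexI ballI)
  fix a assume a: "a \<in> \<bb>"
  obtain r where r: "r \<in> carrier R" "a = \<phi> r" using surjE[OF b.Icarr[OF a]] .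
  show "f a = a \<odot>\<^bsub>descend \<phi> R A E\<^esub> e" using e(2)[of r] r a descend_smult[OF E eD r(1)] by simp
 qed (rule eD)
qed

text \<open>A homomorphism that vanishes on K factors through the image ideal in A, and K kills its
  values, so it lives over A. This supplies the condition \<open>rel\<close> of
  \<open>baer_of_hom_extends\<close>.\<close>

lemma hom_of_descend_baer:
 assumes C: "module R C" and baer: "baer A (descend \<phi> R A C)"
  and b: "ideal \<bb> R" "K \<subseteq> \<bb>" and f: "f \<in> mod_hom R (ideal_mod R \<bb>) C"
  and fK: "!!x. x \<in> K ==> f x = \<zero>\<^bsub>C\<^esub>"
 shows "\<exists>e\<in>carrier C. \<forall>b\<in>\<bb>. f b = b \<odot>\<^bsub>C\<^esub> e"
proof -
 interpret C: module R C by fact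
 interpret K: ideal K R by (rule K_ideal)
 interpret b: ideal \<bb> R by fact
 note f' = mod_homD[OF f, simplified]
 define g where "g a = f (SOME r. r \<in> \<bb> \<and> \<phi> r = a)" for a
 have g: "g (\<phi> r) = f r" if r: "r \<in> \<bb>" for r
 proof -
  define s where "s = (SOME s. s \<in> \<bb> \<and> \<phi> s = \<phi> r)"
  have s: "s \<in> \<bb> \<and> \<phi> s = \<phi> r" unfolding s_def by (rule someI[of _ r]) (use r in simp)
  have "s \<ominus> r \<in> K" using eq_imp_diff_in_K s r b.Icarr by blast
  then have "f s \<ominus>\<^bsub>C\<^esub> f r = \<zero>\<^bsub>C\<^esub>"
   using mod_hom_sub_diff[OF self_module_is_module[OF R.cring_axioms] _ C f, of s r] fK s r b(1)
    submodule_self_iff[OF R.cring_axioms] by (simp add: a_minus_def)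
  then have "f s = f r" using f'(1) s r unfolding a_minus_def
   by (metis C.M.add.inv_closed C.M.minus_equality C.M.minus_minus)
  then show ?thesis by (simp add: g_def s_def)
 qed
 have fD: "f r \<in> carrier (descend \<phi> R A C)" if r: "r \<in> \<bb>" for r
 proof -
  have "x \<odot>\<^bsub>C\<^esub> f r = \<zero>\<^bsub>C\<^esub>" if x: "x \<in> K" for x
   using f'(3)[OF K.Icarr[OF x] r] fK[OF K.I_r_closed[OF x b.Icarr[OF r]]] by simp
  then show ?thesis using f'(1)[OF r] by (simp add: descend_carrier)
 qed
 have "g \<in> mod_hom A (ideal_mod A (\<phi> ` \<bb>)) (descend \<phi> R A C)"
 proof (rule mod_homI; clarsimp)
  fix r assume r: "r \<in> \<bb>"
  show "g (\<phi> r) \<in> carrier (descend \<phi> R A C)" using g fD r by simp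
  show "g (\<phi> r \<oplus>\<^bsub>A\<^esub> \<phi> s) = g (\<phi> r) \<oplus>\<^bsub>C\<^esub> g (\<phi> s)" if s: "s \<in> \<bb>" for s
   using g[of "r \<oplus> s"] g r s f'(2) b.Icarr by simp
  fix a assume "a \<in> carrier A"
  then obtain t where t: "t \<in> carrier R" "a = \<phi> t" using surjE by blast
  show "g (a \<otimes>\<^bsub>A\<^esub> \<phi> r) = a \<odot>\<^bsub>descend \<phi> R A C\<^esub> g (\<phi> r)"
   using g[of "t \<otimes> r"] g r f'(3) b.Icarr b.I_l_closed t descend_smult[OF C fD[OF r] t(1)] by simp
 qed
 then obtain e where e: "e \<in> carrier (descend \<phi> R A C)" "!!r. r \<in> \<bb> ==> g (\<phi> r) = \<phi> r \<odot>\<^bsub>descend \<phi> R A C\<^esub> e"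
  using hom_extendsD[OF baer[unfolded baer_def, rule_format, OF image_ideal[OF b(1)]]] by blast
 show ?thesis
 proof (intro bexI ballI)
  show "e \<in> carrier C" using e by (simp add: descend_carrier)
  show "f r = r \<odot>\<^bsub>C\<^esub> e" if "r \<in> \<bb>" for r
   using e(2)[OF that] g[OF that] descend_smult[OF C e(1) b.Icarr[OF that]] by simp
 qed
qed

end

section \<open>Free modules and regular sequences\<close>

definition free_mod :: "'a ring => nat => ('a, nat => 'a) module" where
 "free_mod R n = \<lparr>carrier = {..<n} \<rightarrow>\<^sub>E carrier R, monoid.mult = undefined, monoid.one = undefined,
  ring.zero = (\<lambda>i\<in>{..<n}. \<zero>\<^bsub>R\<^esub>), ring.add = (\<lambda>v w. \<lambda>i\<in>{..<n}. v i \<oplus>\<^bsub>R\<^esub> w i),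
  module.smult = (\<lambda>a v. \<lambda>i\<in>{..<n}. a \<otimes>\<^bsub>R\<^esub> v i)\<rparr>"

primrec lin_comb :: "('a, 'm) module => (nat => 'm) => (nat => 'a) => nat => 'm" where
 "lin_comb M g v 0 = \<zero>\<^bsub>M\<^esub>"
| "lin_comb M g v (Suc n) = lin_comb M g v n \<oplus>\<^bsub>M\<^esub> v n \<odot>\<^bsub>M\<^esub> g n"

primrec adjoin_seq :: "'a ring => ('a, 'm) module => 'm set => (nat => 'm) => nat => 'm set" where
 "adjoin_seq R N W g 0 = W"
| "adjoin_seq R N W g (Suc n) = adjoin R N (adjoin_seq R N W g n) (g n)"

lemma free_mod_simps:
 fixes R (structure) shows "carrier (free_mod R n) = {..<n} \<rightarrow>\<^sub>E carrier R"
 "\<zero>\<^bsub>free_mod R n\<^esub> = (\<lambda>i\<in>{..<n}. \<zero>)"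
 "v \<oplus>\<^bsub>free_mod R n\<^esub> w = (\<lambda>i\<in>{..<n}. v i \<oplus> w i)"
 "a \<odot>\<^bsub>free_mod R n\<^esub> v = (\<lambda>i\<in>{..<n}. a \<otimes> v i)"
 by (simp_all add: free_mod_def)

lemma free_mod_is_module:
 fixes R :: "'a ring" (structure) assumes "cring R" shows "module R (free_mod R n)"
proof -
 interpret cring R by fact
 have "abelian_group (free_mod R n)"
 proof (rule abelian_groupI)
  fix x assume x: "x \<in> carrier (free_mod R n)"
  show "\<exists>y\<in>carrier (free_mod R n). y \<oplus>\<^bsub>free_mod R n\<^esub> x = \<zero>\<^bsub>free_mod R n\<^esub>"
   using x by (intro bexI[of _ "\<lambda>i\<in>{..<n}. \<ominus> x i"]) (auto simp: free_mod_simps PiE_iff l_neg intro!: restrict_ext)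
  show "\<zero>\<^bsub>free_mod R n\<^esub> \<oplus>\<^bsub>free_mod R n\<^esub> x = x"
   using x by (auto simp: free_mod_simps PiE_iff intro!: extensionalityI[of _ "{..<n}"])
 qed (auto simp: free_mod_simps PiE_iff a_ac intro!: restrict_ext)
 then show ?thesis
 proof (rule moduleI[OF assms])
  show "\<one> \<odot>\<^bsub>free_mod R n\<^esub> x = x" if "x \<in> carrier (free_mod R n)" for x
   using that by (auto simp: free_mod_simps PiE_iff intro!: extensionalityI[of _ "{..<n}"])
 qed (auto simp: free_mod_simps PiE_iff l_distr r_distr m_assoc intro!: restrict_ext)
qed

lemma free_mod_minus:
 fixes R :: "'a ring" (structure) assumes R: "cring R" and v: "v \<in> carrier (free_mod R n)"
 shows "\<ominus>\<^bsub>free_mod R n\<^esub> v = (\<lambda>i\<in>{..<n}. \<ominus> v i)"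
proof -
 interpret R: cring R by fact
 interpret F: module R "free_mod R n" by (rule free_mod_is_module[OF R])
 show ?thesis
  by (rule F.M.minus_equality) (insert v, auto simp: free_mod_simps PiE_iff R.l_neg intro!: restrict_ext)
qed

lemma free_mod_ideal_submodule:
 fixes R :: "'a ring" assumes R: "cring R" and q: "ideal \<qq> R"
 shows "submodule ({..<n} \<rightarrow>\<^sub>E \<qq>) R (free_mod R n)"
proof -
 interpret q: ideal \<qq> R by fact
 interpret F: module R "free_mod R n" by (rule free_mod_is_module[OF R])
 show ?thesis
 proof (rule F.submoduleI)
  show sub: "{..<n} \<rightarrow>\<^sub>E \<qq> \<subseteq> carrier (free_mod R n)"
   unfolding free_mod_simps(1) by (rule PiE_mono) (rule q.a_subset)
  show "\<ominus>\<^bsub>free_mod R n\<^esub> a \<in> {..<n} \<rightarrow>\<^sub>E \<qq>" if "a \<in> {..<n} \<rightarrow>\<^sub>E \<qq>" for a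
   unfolding free_mod_minus[OF R subsetD[OF sub that]] using that by (simp add: PiE_iff)
 qed (simp_all add: free_mod_simps PiE_iff q.I_l_closed)
qed

context
 fixes R :: "'a ring" (structure) and N :: "('a, 'm) module" and W
 assumes N: "module R N" and W: "submodule W R N"
begin

interpretation N: module R N by (rule N)

lemma lin_comb_closed:
 assumes "!!i. i < n ==> g i \<in> W" "!!i. i < n ==> v i \<in> carrier R"
 shows "lin_comb N g v n \<in> W"
 using assms by (induction n) (auto simp: submodule_zero[OF N W] N.submoduleE(4,5)[OF W])

lemma adjoin_seq_submodule:
 assumes "!!i. i < n ==> g i \<in> carrier N"
 shows "submodule (adjoin_seq R N W g n) R N" "W \<subseteq> adjoin_seq R N W g n"
  and "i < n ==> g i \<in> adjoin_seq R N W g n"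
proof -
 have *: "submodule (adjoin_seq R N W g n) R N \<and> W \<subseteq> adjoin_seq R N W g n \<and> (\<forall>i<n. g i \<in> adjoin_seq R N W g n)"
  using assms
 proof (induction n)
  case 0 then show ?case using W by simp
 next
  case (Suc n)
  then have "submodule (adjoin_seq R N W g n) R N" by simp
  from adjoin_superset[OF N this, of "g n"] adjoin_submodule[OF N this, of "g n"] Suc
  show ?case by (auto simp: less_Suc_eq)
 qed
 then show "submodule (adjoin_seq R N W g n) R N" "W \<subseteq> adjoin_seq R N W g n"
  "i < n ==> g i \<in> adjoin_seq R N W g n" by auto
qed

lemma adjoin_seq_least:
 assumes "submodule V R N" "W \<subseteq> V" "!!i. i < n ==> g i \<in> V"
 shows "adjoin_seq R N W g n \<subseteq> V"
 using assms(3)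
proof (induction n)
 case 0 then show ?case using assms(2) by simp
next
 case (Suc n)
 then show ?case using adjoin_least[OF N assms(1)] by simp
qed

end

lemma lin_comb_cong:
 "(!!i. i < n ==> v i = w i) ==> (!!i. i < n ==> g i = h i) ==> lin_comb N g v n = lin_comb N h w n"
 by (induction n) auto

lemma zero_submodule: "module R N ==> submodule {\<zero>\<^bsub>N\<^esub>} R N"
proof -
 assume "module R N"
 then interpret N: module R N .
 show ?thesis by (rule N.submoduleI) auto
qed

context
 fixes R :: "'a ring" (structure) and M :: "('a, 'm) module"
 assumes M: "module R M"
begin

interpretation module R M by (rule M)

lemma lin_comb_carrier:
 assumes "!!i. i < n ==> g i \<in> carrier M" "!!i. i < n ==> v i \<in> carrier R"
 shows "lin_comb M g v n \<in> carrier M"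
 using assms by (induction n) auto

lemma lin_comb_add:
 assumes "!!i. i < n ==> g i \<in> carrier M" "!!i. i < n ==> v i \<in> carrier R" "!!i. i < n ==> w i \<in> carrier R"
 shows "lin_comb M g (\<lambda>i. v i \<oplus> w i) n = lin_comb M g v n \<oplus>\<^bsub>M\<^esub> lin_comb M g w n"
 using assms by (induction n) (simp_all add: lin_comb_carrier smult_l_distr M.a_ac)

lemma lin_comb_smult:
 assumes "!!i. i < n ==> g i \<in> carrier M" "!!i. i < n ==> v i \<in> carrier R" "a \<in> carrier R"
 shows "lin_comb M g (\<lambda>i. a \<otimes> v i) n = a \<odot>\<^bsub>M\<^esub> lin_comb M g v n"
 using assms by (induction n) (simp_all add: lin_comb_carrier smult_r_distr smult_assoc1)

lemma lin_comb_split: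
 assumes "!!i. i < n ==> g i \<in> carrier M" "!!i. i < n ==> v i \<in> carrier R" "j < n"
 shows "lin_comb M g v n = lin_comb M g (v(j := \<zero>)) n \<oplus>\<^bsub>M\<^esub> v j \<odot>\<^bsub>M\<^esub> g j"
 using assms
proof (induction n)
 case (Suc n)
 define w where "w = v(j := \<zero>)"
 have w: "w j = \<zero>" "!!i. i \<noteq> j ==> w i = v i" by (auto simp: w_def)
 have "lin_comb M g v (Suc n) = lin_comb M g w (Suc n) \<oplus>\<^bsub>M\<^esub> v j \<odot>\<^bsub>M\<^esub> g j"
 proof (cases "j = n")
  case True
  then have "lin_comb M g w n = lin_comb M g v n" using w(2) by (intro lin_comb_cong) auto
  then show ?thesis using True Suc.prems lin_comb_carrier[of n g v] w(1) by simp
 next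
  case False
  then have "lin_comb M g v n = lin_comb M g w n \<oplus>\<^bsub>M\<^esub> v j \<odot>\<^bsub>M\<^esub> g j"
   unfolding w_def by (intro Suc.IH) (use Suc.prems False in auto)
  moreover have "lin_comb M g w n \<in> carrier M"
   by (rule lin_comb_carrier) (insert Suc.prems, auto simp: w_def)
  ultimately show ?thesis using False Suc.prems w(2)[of n] by (simp add: M.a_ac)
 qed
 then show ?case by (simp only: w_def)
qed simp

lemma lin_comb_hom:
 assumes "!!i. i < n ==> g i \<in> carrier M"
 shows "(\<lambda>v. lin_comb M g v n) \<in> mod_hom R (free_mod R n) M"
proof (rule mod_homI)
 fix v assume v: "v \<in> carrier (free_mod R n)"
 then have v': "i < n ==> v i \<in> carrier R" for i by (auto simp: free_mod_simps)
 show "lin_comb M g v n \<in> carrier M" using lin_comb_carrier assms v' by simp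
 show "lin_comb M g (a \<odot>\<^bsub>free_mod R n\<^esub> v) n = a \<odot>\<^bsub>M\<^esub> lin_comb M g v n" if "a \<in> carrier R" for a
  using lin_comb_smult[of n g v a] assms v' that
   lin_comb_cong[of n "a \<odot>\<^bsub>free_mod R n\<^esub> v" "\<lambda>i. a \<otimes> v i" g g M] by (simp add: free_mod_simps)
 fix w assume "w \<in> carrier (free_mod R n)"
 then have w': "i < n ==> w i \<in> carrier R" for i by (auto simp: free_mod_simps)
 show "lin_comb M g (v \<oplus>\<^bsub>free_mod R n\<^esub> w) n = lin_comb M g v n \<oplus>\<^bsub>M\<^esub> lin_comb M g w n"
  using lin_comb_add[of n g v w] assms v' w'
   lin_comb_cong[of n "v \<oplus>\<^bsub>free_mod R n\<^esub> w" "\<lambda>i. v i \<oplus> w i" g g M] by (simp add: free_mod_simps)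
qed

lemma hom_lin_comb:
 assumes C: "module R C" and W: "submodule W R M" and f: "f \<in> mod_hom R (sub_mod M W) C"
  and "!!i. i < n ==> g i \<in> W" "!!i. i < n ==> v i \<in> carrier R"
 shows "f (lin_comb M g v n) = lin_comb C (\<lambda>i. f (g i)) v n"
 using assms(4,5)
proof (induction n)
 case 0 then show ?case using mod_hom_sub_zero[OF M W C f] by simp
next
 case (Suc n)
 note f' = mod_homD[OF f, simplified]
 have "lin_comb M g v n \<in> W" using lin_comb_closed[OF M W] Suc.prems by simp
 then show ?case using Suc f' submoduleE(4)[OF W] by simp
qed

lemma adjoin_seq_lin_comb:
 assumes "k \<in> adjoin_seq R M {\<zero>\<^bsub>M\<^esub>} g n" "!!i. i < n ==> g i \<in> carrier M"
 shows "\<exists>v \<in> carrier (free_mod R n). lin_comb M g v n = k"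
 using assms
proof (induction n arbitrary: k)
 case 0 then show ?case by (auto simp: free_mod_simps)
next
 case (Suc n)
 then obtain w r where w: "w \<in> adjoin_seq R M {\<zero>\<^bsub>M\<^esub>} g n" "r \<in> carrier R" "k = w \<oplus>\<^bsub>M\<^esub> r \<odot>\<^bsub>M\<^esub> g n"
  by (auto simp: adjoin_def)
 then obtain v where v: "v \<in> carrier (free_mod R n)" "lin_comb M g v n = w" using Suc by auto
 have "lin_comb M g (v(n := r)) n = lin_comb M g v n" by (intro lin_comb_cong) auto
 then have "lin_comb M g (v(n := r)) (Suc n) = k" using v w by simp
 moreover have "v(n := r) \<in> carrier (free_mod R (Suc n))"
  using v(1) w(2) by (auto simp: free_mod_simps PiE_iff extensional_def less_Suc_eq)
 ultimately show ?case by blast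
qed

end

section \<open>Finite and minimal generation of submodules of free modules\<close>

lemma noetherian_ideal_adjoin_seq:
 fixes R :: "'a ring" (structure)
 assumes R: "cring R" and noeth: "noetherian_ring R" and a: "ideal \<aa> R"
 obtains c n where "!!i. i < n ==> c i \<in> \<aa>" "\<aa> = adjoin_seq R (self_module R) {\<zero>} c n"
proof -
 interpret R: cring R by fact
 interpret a: ideal \<aa> R by fact
 obtain S where S: "S \<subseteq> carrier R" "finite S" "\<aa> = genideal R S"
  using noetherian_ring.finetely_gen[OF noeth a] by blast
 obtain n :: nat and c where c: "S = c ` {i. i < n}" using finite_imp_nat_seg_image_inj_on[OF S(2)] by blast
 have ca: "c i \<in> \<aa>" if "i < n" for i using that c S R.genideal_self by blast
 note SM = self_module_is_module[OF R]
 have z: "submodule {\<zero>} R (self_module R)" using zero_submodule[OF SM] by simp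
 let ?A = "adjoin_seq R (self_module R) {\<zero>} c n"
 have cR: "c i \<in> carrier (self_module R)" if "i < n" for i using ca[OF that] a.Icarr by simp
 have "?A \<subseteq> \<aa>" by (rule adjoin_seq_least[OF SM z]) (use a ca submodule_self_iff[OF R] in auto)
 moreover have "\<aa> \<subseteq> ?A"
 proof -
  have "ideal ?A R" using adjoin_seq_submodule(1)[OF SM z cR] submodule_self_iff[OF R] by simp
  moreover have "S \<subseteq> ?A" using adjoin_seq_submodule(3)[OF SM z cR] c by auto
  ultimately show ?thesis using R.genideal_minimal S(3) by simp
 qed
 ultimately show ?thesis using that ca by blast
qed

lemma adjoin_seq_append:
 "adjoin_seq R N (adjoin_seq R N W g n) h s = adjoin_seq R N W (\<lambda>i. if i < n then g i else h (i - n)) (n + s)"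
proof (induction s)
 case 0
 have "j \<le> n ==> adjoin_seq R N W g j = adjoin_seq R N W (\<lambda>i. if i < n then g i else h (i - n)) j" for j
  by (induction j) auto
 then show ?case by simp
qed simp

text \<open>K is filtered by the last coordinate allowed to be nonzero. At each step the values of
  that coordinate form an ideal, and lifts of its generators together with the generators of the
  previous step suffice.\<close>

lemma free_mod_submodule_finitely_generated:
 fixes R :: "'a ring" (structure)
 assumes R: "cring R" and noeth: "noetherian_ring R" and K: "submodule K R (free_mod R r)"
 shows "\<exists>g n. (\<forall>i<n. g i \<in> K) \<and> K = adjoin_seq R (free_mod R r) {\<zero>\<^bsub>free_mod R r\<^esub>} g n"
proof -
 interpret R: cring R by fact
 let ?F = "free_mod R r"
 note F = free_mod_is_module[OF R, of r] and S = self_module_is_module[OF R]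
 interpret F: module R ?F by (rule F)
 note K' = F.submoduleE[OF K]
 define Kj where "Kj j = {v \<in> K. \<forall>i. j \<le> i \<and> i < r --> v i = \<zero>}" for j
 have minus: "(\<ominus>\<^bsub>?F\<^esub> v) i = \<ominus> v i" if "v \<in> carrier ?F" "i < r" for v i
  using free_mod_minus[OF R that(1)] that(2) by simp
 have c: "v i \<in> carrier R" if "v \<in> K" "i < r" for v i using that K'(1) by (auto simp: free_mod_simps)
 have Kj: "submodule (Kj j) R ?F" for j
  by (rule F.submoduleI)
   (insert K' submodule_zero[OF F K] minus c, auto simp: Kj_def free_mod_simps(2-4) subset_iff)
 have "\<exists>g n. (\<forall>i<n. g i \<in> Kj j) \<and> Kj j = adjoin_seq R ?F {\<zero>\<^bsub>?F\<^esub>} g n" if "j \<le> r" for j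
  using that
 proof (induction j)
  case 0
  have "Kj 0 = {\<zero>\<^bsub>?F\<^esub>}"
  proof -
   have "v = \<zero>\<^bsub>?F\<^esub>" if "v \<in> Kj 0" for v
    using that K'(1) by (intro extensionalityI[of _ "{..<r}"]) (auto simp: Kj_def free_mod_simps PiE_iff subset_iff)
   then show ?thesis using submodule_zero[OF F Kj] by blast
  qed
  then show ?case by (intro exI[of _ "\<lambda>_. \<zero>\<^bsub>?F\<^esub>"] exI[of _ 0]) simp
 next
  case (Suc j)
  then obtain g n where g: "!!i. i < n ==> g i \<in> Kj j" "Kj j = adjoin_seq R ?F {\<zero>\<^bsub>?F\<^esub>} g n" by auto
  have j: "j < r" using Suc.prems by simp
  define \<aa> where "\<aa> = (\<lambda>v. v j) ` Kj (Suc j)"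
  note KS = F.submoduleE[OF Kj[of "Suc j"]]
  have "ideal \<aa> R"
  proof (rule idealI'[OF R]; unfold \<aa>_def)
   show "(\<lambda>v. v j) ` Kj (Suc j) \<subseteq> carrier R" using c j by (auto simp: Kj_def)
   show "\<zero> \<in> (\<lambda>v. v j) ` Kj (Suc j)"
    using imageI[OF submodule_zero[OF F Kj[of "Suc j"]], of "\<lambda>v. v j"] j by (simp add: free_mod_simps)
   show "a \<oplus> b \<in> (\<lambda>v. v j) ` Kj (Suc j)" if ab: "a \<in> (\<lambda>v. v j) ` Kj (Suc j)" "b \<in> (\<lambda>v. v j) ` Kj (Suc j)" for a b
   proof -
    obtain v w where "v \<in> Kj (Suc j)" "w \<in> Kj (Suc j)" "a = v j" "b = w j" using ab by blast
    then show ?thesis using KS(5)[of v w] j by (intro image_eqI[where x = "v \<oplus>\<^bsub>?F\<^esub> w"]) (auto simp: free_mod_simps)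
   qed
   show "a \<otimes> b \<in> (\<lambda>v. v j) ` Kj (Suc j)" if a: "a \<in> carrier R" and b: "b \<in> (\<lambda>v. v j) ` Kj (Suc j)" for a b
   proof -
    obtain v where "v \<in> Kj (Suc j)" "b = v j" using b by blast
    then show ?thesis using KS(4)[OF a, of v] j by (intro image_eqI[where x = "a \<odot>\<^bsub>?F\<^esub> v"]) (auto simp: free_mod_simps)
   qed
  qed
  then obtain cc s where cc: "!!i. i < s ==> cc i \<in> \<aa>" "\<aa> = adjoin_seq R (self_module R) {\<zero>} cc s"
   using noetherian_ideal_adjoin_seq[OF R noeth] by metis
  have "\<exists>v. i < s --> v \<in> Kj (Suc j) \<and> v j = cc i" for i using cc(1)[of i] unfolding \<aa>_def by (auto simp: image_iff) metis
  then obtain h where h: "!!i. i < s ==> h i \<in> Kj (Suc j)" "!!i. i < s ==> h i j = cc i" by metis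
  have sub: "Kj j \<subseteq> Kj (Suc j)" by (auto simp: Kj_def)
  have hF: "h i \<in> carrier ?F" if "i < s" for i using h[OF that] KS(1) by blast
  let ?V = "adjoin_seq R ?F (Kj j) h s"
  have V: "submodule ?V R ?F" "Kj j \<subseteq> ?V" using adjoin_seq_submodule[OF F Kj[of j], of s h] hF by auto
  have coord: "\<exists>w\<in>adjoin_seq R ?F (Kj j) h t. w j = a"
   if "a \<in> adjoin_seq R (self_module R) {\<zero>} cc t" "t \<le> s" for a t
   using that
  proof (induction t arbitrary: a)
   case 0
   then show ?case using submodule_zero[OF F Kj[of j]] j by (intro bexI[of _ "\<zero>\<^bsub>?F\<^esub>"]) (auto simp: free_mod_simps)
  next
   case (Suc t)
   then obtain b x where b: "b \<in> adjoin_seq R (self_module R) {\<zero>} cc t" "x \<in> carrier R" "a = b \<oplus> x \<otimes> cc t"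
    by (auto simp: adjoin_def)
   then obtain w where w: "w \<in> adjoin_seq R ?F (Kj j) h t" "w j = b" using Suc by auto
   then show ?case
    using b h[of t] Suc.prems j by (intro bexI[of _ "w \<oplus>\<^bsub>?F\<^esub> x \<odot>\<^bsub>?F\<^esub> h t"]) (auto simp: adjoin_def free_mod_simps)
  qed
  have "Kj (Suc j) \<subseteq> ?V"
  proof
   fix k assume k: "k \<in> Kj (Suc j)"
   then have "k j \<in> adjoin_seq R (self_module R) {\<zero>} cc s" unfolding cc(2)[symmetric] \<aa>_def by blast
   then obtain w where w: "w \<in> ?V" "w j = k j" using coord by blast
   have VS: "?V \<subseteq> Kj (Suc j)" by (rule adjoin_seq_least[OF F Kj Kj sub]) (use h in auto)
   have wk: "w \<in> carrier ?F" "k \<in> carrier ?F" using VS KS(1) w k by auto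
   have d: "k \<oplus>\<^bsub>?F\<^esub> \<ominus>\<^bsub>?F\<^esub> w \<in> Kj (Suc j)" using KS(3,5) k w VS by blast
   have "k \<oplus>\<^bsub>?F\<^esub> \<ominus>\<^bsub>?F\<^esub> w \<in> Kj j"
   proof -
    have "(k \<oplus>\<^bsub>?F\<^esub> \<ominus>\<^bsub>?F\<^esub> w) j = \<zero>"
     using w minus[OF wk(1) j] j wk by (auto simp: free_mod_simps(1,3) R.r_neg PiE_iff)
    then show ?thesis using d by (auto simp: Kj_def) (metis le_neq_implies_less Suc_leI)
   qed
   then have "k \<oplus>\<^bsub>?F\<^esub> \<ominus>\<^bsub>?F\<^esub> w \<in> ?V" using V(2) by blast
   then have "(k \<oplus>\<^bsub>?F\<^esub> \<ominus>\<^bsub>?F\<^esub> w) \<oplus>\<^bsub>?F\<^esub> w \<in> ?V" using F.submoduleE(5)[OF V(1)] w by blast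
   then show "k \<in> ?V" using wk by (simp add: F.M.a_assoc F.M.l_neg)
  qed
  moreover have "?V \<subseteq> Kj (Suc j)" by (rule adjoin_seq_least[OF F Kj Kj sub]) (use h in auto)
  ultimately have "Kj (Suc j) = adjoin_seq R ?F {\<zero>\<^bsub>?F\<^esub>} (\<lambda>i. if i < n then g i else h (i - n)) (n + s)"
   unfolding g(2) adjoin_seq_append by blast
  moreover have "\<forall>i<n + s. (if i < n then g i else h (i - n)) \<in> Kj (Suc j)" using g(1) h sub by auto
  ultimately show ?case by (intro exI conjI)
 qed
 moreover have "Kj r = K" by (auto simp: Kj_def)
 ultimately show ?thesis by fastforce
qed

definition local_maximal :: "'a ring => 'a set => bool" where
 "local_maximal R \<mm> \<longleftrightarrow> ideal \<mm> R \<and> \<mm> \<noteq> carrier R \<and> carrier R - \<mm> \<subseteq> Units R"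

lemma local_maximalD:
 fixes R (structure) assumes "local_maximal R \<mm>"
 shows "ideal \<mm> R" "\<one> \<notin> \<mm>" "!!x. x \<in> carrier R ==> x \<notin> \<mm> ==> x \<in> Units R"
proof -
 show i: "ideal \<mm> R" using assms by (simp add: local_maximal_def)
 show "\<one> \<notin> \<mm>" using assms ideal.one_imp_carrier[OF i] by (auto simp: local_maximal_def)
 show "x \<in> Units R" if "x \<in> carrier R" "x \<notin> \<mm>" for x using assms that by (auto simp: local_maximal_def)
qed

lemma ideal_subset_local_maximal:
 fixes R :: "'a ring" (structure)
 assumes "cring R" "local_maximal R \<mm>" "ideal \<aa> R" "\<aa> \<noteq> carrier R"
 shows "\<aa> \<subseteq> \<mm>"
proof
 interpret R: cring R by fact
 interpret a: ideal \<aa> R by fact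
 fix x assume x: "x \<in> \<aa>"
 show "x \<in> \<mm>"
 proof (rule ccontr)
  assume "x \<notin> \<mm>"
  then have u: "x \<in> Units R" using local_maximalD(3)[OF assms(2) a.Icarr[OF x]] by blast
  then have "inv x \<otimes> x \<in> \<aa>" using x a.I_l_closed R.Units_inv_closed by blast
  then show False using u a.one_imp_carrier assms(4) by simp
 qed
qed

lemma unit_relation_member:
 fixes R :: "'a ring" (structure) and M :: "('a, 'm) module"
 assumes M: "module R M" and V: "submodule V R M"
  and g: "!!i. i < n ==> g i \<in> carrier M" and v: "!!i. i < n ==> v i \<in> carrier R"
  and rel: "lin_comb M g v n = \<zero>\<^bsub>M\<^esub>" and j: "j < n" "v j \<in> Units R"
  and gV: "!!i. i < n ==> i \<noteq> j ==> g i \<in> V"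
 shows "g j \<in> V"
proof -
 interpret M: module R M by fact
 note V' = M.submoduleE[OF V]
 define w where "w = lin_comb M g (v(j := \<zero>)) n"
 have "w = lin_comb M (g(j := \<zero>\<^bsub>M\<^esub>)) (v(j := \<zero>)) n"
 proof -
  have "lin_comb M g (v(j := \<zero>)) m = lin_comb M (g(j := \<zero>\<^bsub>M\<^esub>)) (v(j := \<zero>)) m" if "m \<le> n" for m
   using that g by (induction m) auto
  then show ?thesis by (simp add: w_def)
 qed
 also have "\<dots> \<in> V"
  by (rule lin_comb_closed[OF M V]) (use gV v submodule_zero[OF M V] in auto)
 finally have w: "w \<in> V" .
 have vg: "v j \<odot>\<^bsub>M\<^esub> g j \<in> carrier M" using g v j by simp
 have "w \<oplus>\<^bsub>M\<^esub> v j \<odot>\<^bsub>M\<^esub> g j = \<zero>\<^bsub>M\<^esub>"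
  using lin_comb_split[OF M g v j(1)] rel by (simp add: w_def)
 then have "v j \<odot>\<^bsub>M\<^esub> g j = \<ominus>\<^bsub>M\<^esub> w"
  using M.M.minus_equality[of "v j \<odot>\<^bsub>M\<^esub> g j" w] w vg V'(1) by (auto simp: M.M.a_comm subset_iff)
 then have "v j \<odot>\<^bsub>M\<^esub> g j \<in> V" using V'(3)[OF w] by simp
 then have "inv (v j) \<odot>\<^bsub>M\<^esub> (v j \<odot>\<^bsub>M\<^esub> g j) \<in> V" using V'(4) j by simp
 moreover have "inv (v j) \<odot>\<^bsub>M\<^esub> (v j \<odot>\<^bsub>M\<^esub> g j) = g j"
  using M.smult_assoc1[of "inv (v j)" "v j" "g j"] g v j by simp
 ultimately show ?thesis by simp
qed

lemma minimal_generators: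
 fixes R :: "'a ring"
 assumes R: "cring R" and noeth: "noetherian_ring R" and loc: "local_maximal R \<mm>"
  and K: "submodule K R (free_mod R r)"
 obtains g n where "!!i. i < n ==> g i \<in> K"
  and "!!k. k \<in> K ==> \<exists>v \<in> carrier (free_mod R n). lin_comb (free_mod R r) g v n = k"
  and "!!v. v \<in> carrier (free_mod R n) ==> lin_comb (free_mod R r) g v n = \<zero>\<^bsub>free_mod R r\<^esub> ==> v \<in> {..<n} \<rightarrow>\<^sub>E \<mm>"
proof -
 let ?F = "free_mod R r"
 note F = free_mod_is_module[OF R, of r]
 interpret F: module R ?F by (rule F)
 note K' = F.submoduleE[OF K]
 note z = zero_submodule[OF F]
 define P where "P n = (\<exists>g. (\<forall>i<n. g i \<in> K) \<and> K \<subseteq> adjoin_seq R ?F {\<zero>\<^bsub>?F\<^esub>} g n)" for n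
 define n where "n = (LEAST n. P n)"
 have "\<exists>n. P n" using free_mod_submodule_finitely_generated[OF R noeth K] unfolding P_def by blast
 then have Pn: "P n" unfolding n_def by (rule LeastI_ex)
 have least: "\<not> P m" if "m < n" for m using that unfolding n_def by (rule not_less_Least)
 obtain g where g: "!!i. i < n ==> g i \<in> K" "K \<subseteq> adjoin_seq R ?F {\<zero>\<^bsub>?F\<^esub>} g n" using Pn unfolding P_def by blast
 have gF: "g i \<in> carrier ?F" if "i < n" for i using g(1)[OF that] K'(1) by blast
 have "v \<in> {..<n} \<rightarrow>\<^sub>E \<mm>" if v: "v \<in> carrier (free_mod R n)" "lin_comb ?F g v n = \<zero>\<^bsub>?F\<^esub>" for v
 proof (rule ccontr)
  assume "v \<notin> {..<n} \<rightarrow>\<^sub>E \<mm>"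
  then obtain j where j: "j < n" "v j \<notin> \<mm>" using v(1) by (auto simp: free_mod_simps PiE_iff)
  have vR: "v i \<in> carrier R" if "i < n" for i using v(1) that by (auto simp: free_mod_simps)
  have u: "v j \<in> Units R" using local_maximalD(3)[OF loc vR] j by blast
  \<comment> \<open>Generator j is dropped; the last one takes its place, so that the remaining ones
    are indexed by the numbers below n - 1.\<close>
  define g' where "g' = g(j := g (n - 1))"
  let ?V = "adjoin_seq R ?F {\<zero>\<^bsub>?F\<^esub>} g' (n - 1)"
  have g'K: "g' i \<in> K" if "i < n - 1" for i using that g(1) j by (auto simp: g'_def)
  then have g'F: "g' i \<in> carrier ?F" if "i < n - 1" for i using that K'(1) by blast
  have V: "submodule ?V R ?F" and gV: "!!i. i < n - 1 ==> g' i \<in> ?V"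
   using adjoin_seq_submodule[OF F z, of "n - 1" g'] g'F by auto
  have other: "g i \<in> ?V" if "i < n" "i \<noteq> j" for i
  proof (cases "i = n - 1")
   case True
   then have "j < n - 1" using j that by linarith
   then show ?thesis using gV[of j] True by (simp add: g'_def)
  next
   case False
   then show ?thesis using gV[of i] that by (simp add: g'_def)
  qed
  have "g j \<in> ?V" by (rule unit_relation_member[OF F V gF vR v(2) j(1) u other])
  then have all: "g i \<in> ?V" if "i < n" for i using other that by metis
  have "adjoin_seq R ?F {\<zero>\<^bsub>?F\<^esub>} g n \<subseteq> ?V"
   by (rule adjoin_seq_least[OF F z V]) (use all submodule_zero[OF F V] in auto)
  then have "P (n - 1)" unfolding P_def using g'K g(2) by blast
  then show False using least[of "n - 1"] j by simp
 qed
 moreover have "\<exists>v \<in> carrier (free_mod R n). lin_comb ?F g v n = k" if "k \<in> K" for k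
  by (rule adjoin_seq_lin_comb[OF F _ gF]) (use g(2) that in auto)
 ultimately show ?thesis using that g(1) by blast
qed

section \<open>Regular sequences, relation modules and the injectivity of a high cosyzygy\<close>

abbreviation seq_ideal :: "'a ring => 'a set => (nat => 'a) => nat => 'a set" where
 "seq_ideal R \<qq> x n \<equiv> adjoin_seq R (self_module R) \<qq> x n"

definition regular_seq_mod :: "'a ring => 'a set => (nat => 'a) => nat => bool" where
 "regular_seq_mod R \<qq> x n \<longleftrightarrow>
  (\<forall>i<n. \<forall>a\<in>carrier R. x i \<otimes>\<^bsub>R\<^esub> a \<in> seq_ideal R \<qq> x i --> a \<in> seq_ideal R \<qq> x i)"

text \<open>For a submodule K this is the product (x_0, ..., x_{n-1}) K.\<close>

primrec seq_times :: "('a, 'm) module => (nat => 'a) => 'm set => nat => 'm set" where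
 "seq_times M x K 0 = {\<zero>\<^bsub>M\<^esub>}"
| "seq_times M x K (Suc n) = {w \<oplus>\<^bsub>M\<^esub> x n \<odot>\<^bsub>M\<^esub> k | w k. w \<in> seq_times M x K n \<and> k \<in> K}"

lemma seq_ideal_ideal:
 fixes R :: "'a ring"
 assumes R: "cring R" and q: "ideal \<qq> R" and x: "!!i. i < n ==> x i \<in> carrier R"
 shows "ideal (seq_ideal R \<qq> x n) R" "\<qq> \<subseteq> seq_ideal R \<qq> x n" "!!i. i < n ==> x i \<in> seq_ideal R \<qq> x n"
 using adjoin_seq_submodule[OF self_module_is_module[OF R], of \<qq> n x] q x submodule_self_iff[OF R] by auto

text \<open>Expanding each k in a sum of terms x_i k by the generators puts the factors x_i into the
  coefficients.\<close>

lemma seq_times_lift: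
 fixes R :: "'a ring" (structure)
 assumes R: "cring R" and M: "module R M" and x: "!!i. i < d ==> x i \<in> carrier R"
  and g: "!!i. i < n ==> g i \<in> carrier M"
  and gen: "!!k. k \<in> K ==> \<exists>v \<in> carrier (free_mod R n). lin_comb M g v n = k"
  and i: "i \<le> d" and k: "k \<in> seq_times M x K i"
 shows "\<exists>z \<in> {..<n} \<rightarrow>\<^sub>E seq_ideal R {\<zero>} x i. lin_comb M g z n = k"
 using i k
proof (induction i arbitrary: k)
 case 0
 interpret R: cring R by fact
 interpret F: module R "free_mod R n" by (rule free_mod_is_module[OF R])
 have "lin_comb M g \<zero>\<^bsub>free_mod R n\<^esub> n = \<zero>\<^bsub>M\<^esub>"
  by (rule mod_hom_zero[OF free_mod_is_module[OF R] M lin_comb_hom[OF M g]])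
 moreover have "\<zero>\<^bsub>free_mod R n\<^esub> \<in> {..<n} \<rightarrow>\<^sub>E {\<zero>}" by (auto simp: free_mod_simps)
 moreover have "k = \<zero>\<^bsub>M\<^esub>" using 0 by simp
 ultimately show ?case unfolding adjoin_seq.simps(1) by blast
next
 case (Suc i)
 interpret R: cring R by fact
 interpret F: module R "free_mod R n" by (rule free_mod_is_module[OF R])
 from Suc.prems(2) obtain w l where w: "w \<in> seq_times M x K i" "l \<in> K" "k = w \<oplus>\<^bsub>M\<^esub> x i \<odot>\<^bsub>M\<^esub> l" by auto
 obtain z where z: "z \<in> {..<n} \<rightarrow>\<^sub>E seq_ideal R {\<zero>} x i" "lin_comb M g z n = w" using Suc w by auto
 obtain v where v: "v \<in> carrier (free_mod R n)" "lin_comb M g v n = l" using gen[OF w(2)] by blast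
 have xi: "x i \<in> carrier R" using x Suc.prems by simp
 have qi: "ideal (seq_ideal R {\<zero>} x i) R"
  by (rule seq_ideal_ideal(1)[OF R R.zeroideal]) (use x Suc.prems in auto)
 interpret qi: ideal "seq_ideal R {\<zero>} x i" R by (rule qi)
 have zF: "z \<in> carrier (free_mod R n)" using z(1) qi.Icarr by (auto simp: free_mod_simps PiE_iff)
 have h0: "(\<lambda>v. lin_comb M g v n) \<in> mod_hom R (free_mod R n) M" by (rule lin_comb_hom[OF M g])
 note h = mod_homD[OF h0]
 have "lin_comb M g (z \<oplus>\<^bsub>free_mod R n\<^esub> x i \<odot>\<^bsub>free_mod R n\<^esub> v) n = k"
  using h(2)[OF zF F.smult_closed[OF xi v(1)]] h(3)[OF xi v(1)] z(2) v(2) w(3) by simp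
 moreover have "z \<oplus>\<^bsub>free_mod R n\<^esub> x i \<odot>\<^bsub>free_mod R n\<^esub> v \<in> {..<n} \<rightarrow>\<^sub>E seq_ideal R {\<zero>} x (Suc i)"
 proof -
  have "z t \<oplus> x i \<otimes> v t \<in> seq_ideal R {\<zero>} x (Suc i)" if "t < n" for t
  proof -
   have "z t \<in> seq_ideal R {\<zero>} x i" "v t \<in> carrier R" using z(1) v(1) that by (auto simp: free_mod_simps)
   moreover have "x i \<otimes> v t = v t \<otimes> x i" using calculation xi by (simp add: R.m_comm)
   ultimately show ?thesis unfolding adjoin_seq.simps(2) adjoin_def by auto
  qed
  then show ?thesis by (auto simp: free_mod_simps)
 qed
 ultimately show ?case by blast
qed

text \<open>The inclusion for i says that Tor_1(F/K, R/(x_0, ..., x_{i-1})) vanishes, F the free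
  module. Passing to relations shifts Tor by one degree, and since x_i is regular modulo the earlier
  ones, Tor_2 for i + 1 is controlled by Tor_2 and Tor_1 for i. So the relations satisfy the
  inclusion for one more value of i than K does.\<close>

lemma relations_regular:
 fixes R :: "'a ring" (structure)
 assumes R: "cring R" and x: "!!i. i < d ==> x i \<in> carrier R" and reg: "regular_seq_mod R {\<zero>} x d"
  and K: "submodule K R (free_mod R r)" and g: "!!i. i < n ==> g i \<in> K"
  and gen: "!!k. k \<in> K ==> \<exists>v \<in> carrier (free_mod R n). lin_comb (free_mod R r) g v n = k"
  and Kreg: "!!i. i \<le> j ==> K \<inter> ({..<r} \<rightarrow>\<^sub>E seq_ideal R {\<zero>} x i) \<subseteq> seq_times (free_mod R r) x K i"
  and j: "Suc j \<le> d"
  and L: "L = {v \<in> carrier (free_mod R n). lin_comb (free_mod R r) g v n = \<zero>\<^bsub>free_mod R r\<^esub>}"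
  and i: "i \<le> Suc j"
 shows "L \<inter> ({..<n} \<rightarrow>\<^sub>E seq_ideal R {\<zero>} x i) \<subseteq> seq_times (free_mod R n) x L i"
 using i
proof (induction i)
 interpret R: cring R by fact
 case 0
 show ?case by (auto simp: free_mod_simps intro!: extensionalityI[of _ "{..<n}"])
next
 case (Suc i)
 interpret R: cring R by fact
 let ?F = "free_mod R r" and ?P = "free_mod R n"
 note F = free_mod_is_module[OF R, of r] and P = free_mod_is_module[OF R, of n]
 interpret F: module R ?F by (rule F)
 interpret P: module R ?P by (rule P)
 let ?q = "seq_ideal R {\<zero>} x i"
 have gF: "g t \<in> carrier ?F" if "t < n" for t using g[OF that] F.submoduleE(1)[OF K] by blast
 have xi: "x i \<in> carrier R" and id: "i < d" using x Suc.prems j by auto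
 have q: "ideal ?q R" by (rule seq_ideal_ideal(1)[OF R R.zeroideal]) (use x id in auto)
 interpret q: ideal ?q R by (rule q)
 note sub = free_mod_ideal_submodule[OF R q]
 have h: "(\<lambda>v. lin_comb ?F g v n) \<in> mod_hom R ?P ?F" by (rule lin_comb_hom[OF F gF])
 note h' = mod_homD[OF h]
 show ?case
 proof
  fix v assume "v \<in> L \<inter> ({..<n} \<rightarrow>\<^sub>E seq_ideal R {\<zero>} x (Suc i))"
  then have v: "v \<in> carrier ?P" "lin_comb ?F g v n = \<zero>\<^bsub>?F\<^esub>" "v \<in> {..<n} \<rightarrow>\<^sub>E seq_ideal R {\<zero>} x (Suc i)"
   by (auto simp: L)
  have "\<exists>p. p \<in> ?q \<times> carrier R \<and> v t = fst p \<oplus> x i \<otimes> snd p" if "t < n" for t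
  proof -
   have "v t \<in> adjoin_ideal R ?q (x i)" using v(3) that by auto
   then obtain w a where "w \<in> ?q" "a \<in> carrier R" "v t = w \<oplus> a \<otimes> x i" by (rule adjoin_idealE)
   then show ?thesis using xi by (intro exI[of _ "(w, a)"]) (simp add: R.m_comm)
  qed
  then obtain p where p: "!!t. t < n ==> p t \<in> ?q \<times> carrier R \<and> v t = fst (p t) \<oplus> x i \<otimes> snd (p t)" by metis
  \<comment> \<open>The relation is split as v = w + x_i a, the entries of w lying in the ideal of
    the earlier elements.\<close>
  define w where "w = (\<lambda>t\<in>{..<n}. fst (p t))"
  define a where "a = (\<lambda>t\<in>{..<n}. snd (p t))"
  have w: "w \<in> {..<n} \<rightarrow>\<^sub>E ?q" and a: "a \<in> carrier ?P" using p by (auto simp: w_def a_def free_mod_simps mem_Times_iff)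
  have wP: "w \<in> carrier ?P" using w q.Icarr by (auto simp: free_mod_simps PiE_iff)
  have xa: "x i \<odot>\<^bsub>?P\<^esub> a \<in> carrier ?P" using xi a by simp
  have v_eq: "v = w \<oplus>\<^bsub>?P\<^esub> x i \<odot>\<^bsub>?P\<^esub> a"
   by (rule extensionalityI[of _ "{..<n}"]) (insert v(1) p, auto simp: free_mod_simps w_def a_def PiE_iff)
  let ?la = "lin_comb ?F g a n" and ?lw = "lin_comb ?F g w n"
  have "a t \<in> carrier R" if "t < n" for t using a that by (auto simp: free_mod_simps)
  then have la: "?la \<in> carrier ?F" "?la \<in> K"
   using h'(1)[OF a] lin_comb_closed[OF F K, of n g a] g by auto
  have lw: "?lw \<in> {..<r} \<rightarrow>\<^sub>E ?q"
  proof -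
   have "lin_comb ?F g w m \<in> {..<r} \<rightarrow>\<^sub>E ?q" if "m \<le> n" for m
    using that
   proof (induction m)
    case 0 then show ?case using submodule_zero[OF F sub] by simp
   next
    case (Suc m)
    have "w m \<in> ?q" "g m \<in> {..<r} \<rightarrow>\<^sub>E carrier R"
     using w gF Suc.prems by (auto simp: free_mod_simps(1))
    then have "w m \<odot>\<^bsub>?F\<^esub> g m \<in> {..<r} \<rightarrow>\<^sub>E ?q"
     unfolding free_mod_simps(4) restrict_PiE_iff using q.I_r_closed by blast
    then show ?case using Suc F.submoduleE(5)[OF sub] by simp
   qed
   then show ?thesis by simp
  qed
  have sum0: "?lw \<oplus>\<^bsub>?F\<^esub> x i \<odot>\<^bsub>?F\<^esub> ?la = \<zero>\<^bsub>?F\<^esub>"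
   using v(2) h'(2)[OF wP xa] h'(3)[OF xi a] unfolding v_eq by simp
  \<comment> \<open>Modulo the ideal of the earlier elements the relation v says that x_i times the
    combination of a vanishes, and x_i is a nonzerodivisor there.\<close>
  have "?la c \<in> ?q" if c: "c < r" for c
  proof -
   have "?lw c \<oplus> x i \<otimes> ?la c = \<zero>"
    using fun_cong[OF sum0, of c] c by (simp add: free_mod_simps)
   moreover have c': "?lw c \<in> ?q" "?la c \<in> carrier R" using lw la c by (auto simp: free_mod_simps)
   ultimately have "\<ominus> ?lw c = x i \<otimes> ?la c"
    using R.minus_equality[of "x i \<otimes> ?la c" "?lw c"] q.Icarr xi by (simp add: R.a_comm)
   then have "x i \<otimes> ?la c \<in> ?q" using c'(1) by (metis q.a_inv_closed)
   then show ?thesis using reg id c'(2) unfolding regular_seq_mod_def by blast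
  qed
  then have "?la \<in> K \<inter> ({..<r} \<rightarrow>\<^sub>E ?q)" using la by (auto simp: free_mod_simps PiE_iff)
  then have "?la \<in> seq_times ?F x K i" using Kreg[of i] Suc.prems by auto
  \<comment> \<open>The inclusion for K puts the combination of a into the product of the ideal with
    K, so it is also the combination of some z with entries in the ideal. Then a - z is a relation,
    and x_i z can be absorbed into w.\<close>
  then have "\<exists>z \<in> {..<n} \<rightarrow>\<^sub>E ?q. lin_comb ?F g z n = ?la"
   by (intro seq_times_lift[OF R F x gF gen]) (use id in auto)
  then obtain z where z: "z \<in> {..<n} \<rightarrow>\<^sub>E ?q" "lin_comb ?F g z n = ?la" by blast
  have zP: "z \<in> carrier ?P" using z q.Icarr by (auto simp: free_mod_simps PiE_iff)
  define a' where "a' = a \<ominus>\<^bsub>?P\<^esub> z"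
  have a'P: "a' \<in> carrier ?P" using a zP by (simp add: a'_def)
  have "lin_comb ?F g a' n = \<zero>\<^bsub>?F\<^esub>"
   using mod_hom_diff[OF P F h a zP] z(2) la by (simp add: a'_def F.M.r_neg a_minus_def)
  then have a'L: "a' \<in> L" using a'P by (simp add: L)
  define w' where "w' = w \<oplus>\<^bsub>?P\<^esub> x i \<odot>\<^bsub>?P\<^esub> z"
  have xz: "x i \<odot>\<^bsub>?P\<^esub> z \<in> {..<n} \<rightarrow>\<^sub>E ?q" using P.submoduleE(4)[OF sub xi z(1)] .
  have w'q: "w' \<in> {..<n} \<rightarrow>\<^sub>E ?q" unfolding w'_def using P.submoduleE(5)[OF sub w xz] .
  have xz': "x i \<odot>\<^bsub>?P\<^esub> z \<in> carrier ?P" using xi zP by simp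
  have w'P: "w' \<in> carrier ?P" using wP xz' by (simp add: w'_def)
  have v': "v = w' \<oplus>\<^bsub>?P\<^esub> x i \<odot>\<^bsub>?P\<^esub> a'"
  proof -
   have "x i \<odot>\<^bsub>?P\<^esub> z \<oplus>\<^bsub>?P\<^esub> x i \<odot>\<^bsub>?P\<^esub> a' = x i \<odot>\<^bsub>?P\<^esub> (a' \<oplus>\<^bsub>?P\<^esub> z)"
    using xi zP a'P by (simp add: P.smult_r_distr P.M.a_comm)
   also have "a' \<oplus>\<^bsub>?P\<^esub> z = a" using a zP by (simp add: a'_def a_minus_def P.M.a_assoc P.M.l_neg)
   finally show ?thesis unfolding w'_def v_eq using wP xz' xi a'P by (simp add: P.M.a_assoc)
  qed
  have "lin_comb ?F g w' n = \<zero>\<^bsub>?F\<^esub>"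
  proof -
   have "lin_comb ?F g v n = lin_comb ?F g w' n \<oplus>\<^bsub>?F\<^esub> x i \<odot>\<^bsub>?F\<^esub> lin_comb ?F g a' n"
    using h'(2)[OF w'P P.smult_closed[OF xi a'P]] h'(3)[OF xi a'P] v' by simp
   moreover have "lin_comb ?F g a' n = \<zero>\<^bsub>?F\<^esub>" using a'L by (simp add: L)
   ultimately show ?thesis using v(2) h'(1)[OF w'P] xi by simp
  qed
  then have "w' \<in> L \<inter> ({..<n} \<rightarrow>\<^sub>E ?q)" using w'P w'q by (simp add: L)
  then have "w' \<in> seq_times ?P x L i" using Suc by auto
  then show "v \<in> seq_times ?P x L (Suc i)" using v' a'L by auto
 qed
qed

text \<open>For free N this is Ext^1(N/K, C) = Ext^2(N/K, D) = Ext^1(K, D) done by hand: one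
  cosyzygy of the target is traded for one syzygy of the source.\<close>

lemma short_exact_hom_lift:
 assumes R: "cring R" and D: "module R D" and E: "module R E" and C: "module R C"
  and ex: "short_exact R D E C \<iota> \<delta>" and baer: "baer R E"
  and N: "module R N" and K: "submodule K R N" and g: "!!i. i < n ==> g i \<in> K"
  and gen: "!!k. k \<in> K ==> \<exists>v \<in> carrier (free_mod R n). lin_comb N g v n = k"
  and L: "L = {v \<in> carrier (free_mod R n). lin_comb N g v n = \<zero>\<^bsub>N\<^esub>}"
  and IH: "!!f. f \<in> mod_hom R (sub_mod (free_mod R n) L) D ==>
   \<exists>h \<in> mod_hom R (free_mod R n) D. \<forall>v\<in>L. h v = f v"
  and f: "f \<in> mod_hom R (sub_mod N K) C"
 shows "\<exists>h \<in> mod_hom R N C. \<forall>k\<in>K. h k = f k"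
proof -
 let ?P = "free_mod R n"
 interpret D: module R D by fact
 interpret E: module R E by fact
 interpret C: module R C by fact
 interpret N: module R N by fact
 note P = free_mod_is_module[OF R, of n]
 interpret P: module R ?P by (rule P)
 note ex' = short_exactD[OF ex]
 note \<iota> = mod_homD[OF ex'(1)] and \<delta> = mod_homD[OF ex'(3)] and f' = mod_homD[OF f, simplified]
 have gN: "g i \<in> carrier N" if "i < n" for i using g[OF that] N.submoduleE(1)[OF K] by blast
 have h: "(\<lambda>v. lin_comb N g v n) \<in> mod_hom R ?P N" by (rule lin_comb_hom[OF N gN])
 note h' = mod_homD[OF h]
 have lK: "lin_comb N g v n \<in> K" if "v \<in> carrier ?P" for v
  by (rule lin_comb_closed[OF N K g]) (insert that, auto simp: free_mod_simps)
 have Lker: "L = mod_ker ?P N (\<lambda>v. lin_comb N g v n)" by (simp add: L mod_ker_def)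
 have Lsub: "submodule L R ?P" unfolding Lker by (rule mod_ker_submodule[OF P N h])
 have "\<exists>e. i < n --> e \<in> carrier E \<and> \<delta> e = f (g i)" for i
 proof (cases "i < n")
  case True
  then have "f (g i) \<in> \<delta> ` carrier E" using f'(1)[OF g] ex'(4) by simp
  then show ?thesis by auto
 qed simp
 then obtain e where "\<forall>i. i < n --> e i \<in> carrier E \<and> \<delta> (e i) = f (g i)" by metis
 then have e: "!!i. i < n ==> e i \<in> carrier E" "!!i. i < n ==> \<delta> (e i) = f (g i)" by auto
 \<comment> \<open>\<phi> lifts f to E on the free module over K and carries the relations L into D.
   The resulting map on L extends to the free module by \<open>IH\<close>; subtracting the extension
   gives \<chi>, which vanishes on L and hence descends to K, from where injectivity of E extends it
   to N.\<close>
 define \<phi> where "\<phi> v = lin_comb E e v n" for v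
 have \<phi>: "\<phi> \<in> mod_hom R ?P E" unfolding \<phi>_def[abs_def] by (rule lin_comb_hom[OF E e(1)])
 note \<phi>' = mod_homD[OF \<phi>]
 have \<delta>\<phi>: "\<delta> (\<phi> v) = f (lin_comb N g v n)" if v: "v \<in> carrier ?P" for v
 proof -
  have vR: "v i \<in> carrier R" if "i < n" for i using v that by (auto simp: free_mod_simps)
  have "\<delta> \<in> mod_hom R (sub_mod E (carrier E)) C" using ex'(3) by (simp add: mod_hom_def)
  from hom_lin_comb[OF E C E.carrier_is_submodule this e(1) vR]
  have "\<delta> (\<phi> v) = lin_comb C (\<lambda>i. \<delta> (e i)) v n" by (simp add: \<phi>_def)
  also have "\<dots> = lin_comb C (\<lambda>i. f (g i)) v n" by (rule lin_comb_cong) (simp_all add: e)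
  also have "\<dots> = f (lin_comb N g v n)" using hom_lin_comb[OF N C K f g vR] by simp
  finally show ?thesis .
 qed
 have f0: "f \<zero>\<^bsub>N\<^esub> = \<zero>\<^bsub>C\<^esub>" by (rule mod_hom_sub_zero[OF N K C f])
 define \<psi> where "\<psi> v = the_inv_into (carrier D) \<iota> (\<phi> v)" for v
 have LP: "v \<in> carrier ?P" if "v \<in> L" for v using that by (simp add: L)
 have "\<phi> v \<in> \<iota> ` carrier D" if v: "v \<in> L" for v
  unfolding ex'(5)[symmetric] using \<delta>\<phi>[OF LP[OF v]] \<phi>'(1)[OF LP[OF v]] v f0 by (simp add: mod_ker_def L)
 then have \<psi>: "\<psi> v \<in> carrier D" "\<iota> (\<psi> v) = \<phi> v" if "v \<in> L" for v
  using that by (simp_all add: \<psi>_def the_inv_into_into[OF ex'(2)] f_the_inv_into_f[OF ex'(2)])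
 have eqI: "p = q" if "\<iota> p = \<iota> q" "p \<in> carrier D" "q \<in> carrier D" for p q
  using ex'(2) that by (auto dest: inj_onD)
 note L' = P.submoduleE[OF Lsub]
 have "\<psi> \<in> mod_hom R (sub_mod ?P L) D"
 proof (rule mod_homI; simp)
  fix v assume v: "v \<in> L"
  show "\<psi> v \<in> carrier D" using \<psi> v by simp
  show "\<psi> (a \<odot>\<^bsub>?P\<^esub> v) = a \<odot>\<^bsub>D\<^esub> \<psi> v" if "a \<in> carrier R" for a
   by (rule eqI) (use \<psi> v L'(4)[OF that v] that \<iota> \<phi>' LP in simp_all)
  show "\<psi> (v \<oplus>\<^bsub>?P\<^esub> w) = \<psi> v \<oplus>\<^bsub>D\<^esub> \<psi> w" if w: "w \<in> L" for w
   by (rule eqI) (use \<psi> v L'(5)[OF v w] w \<iota> \<phi>' LP in simp_all)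
 qed
 then obtain \<psi>' where \<psi>': "\<psi>' \<in> mod_hom R ?P D" "!!v. v \<in> L ==> \<psi>' v = \<psi> v" using IH by blast
 note \<psi>'' = mod_homD[OF \<psi>'(1)]
 define \<chi> where "\<chi> v = \<phi> v \<ominus>\<^bsub>E\<^esub> \<iota> (\<psi>' v)" for v
 have \<chi>: "\<chi> \<in> mod_hom R ?P E"
  by (rule mod_homI)
   (simp_all add: \<chi>_def \<phi>' \<psi>'' \<iota> a_minus_def E.smult_r_distr E.smult_r_minus E.M.minus_add E.M.a_ac)
 note \<chi>' = mod_homD[OF \<chi>]
 have \<chi>L: "\<chi> v = \<zero>\<^bsub>E\<^esub>" if v: "v \<in> L" for v
  using \<psi>[OF v] \<psi>'(2)[OF v] \<phi>'(1)[OF LP[OF v]] by (simp add: \<chi>_def a_minus_def E.M.r_neg)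
 have \<delta>\<chi>: "\<delta> (\<chi> v) = f (lin_comb N g v n)" if v: "v \<in> carrier ?P" for v
 proof -
  have "\<iota> (\<psi>' v) \<in> mod_ker E C \<delta>" using ex'(5) \<psi>''(1)[OF v] by blast
  then have "\<iota> (\<psi>' v) \<in> carrier E" "\<delta> (\<iota> (\<psi>' v)) = \<zero>\<^bsub>C\<^esub>" by (auto simp: mod_ker_def)
  then show ?thesis
   using mod_hom_diff[OF E C ex'(3) \<phi>'(1)[OF v]] \<delta>\<phi>[OF v] f'(1)[OF lK[OF v]] by (simp add: \<chi>_def a_minus_def)
 qed
 have \<chi>_cong: "\<chi> v = \<chi> w" if v: "v \<in> carrier ?P" "w \<in> carrier ?P" "lin_comb N g v n = lin_comb N g w n" for v w
 proof -
  have "v \<ominus>\<^bsub>?P\<^esub> w \<in> L"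
   using mod_hom_diff[OF P N h v(1,2)] v h'(1)[OF v(2)] by (simp add: L a_minus_def N.M.r_neg)
  then have "\<chi> v \<ominus>\<^bsub>E\<^esub> \<chi> w = \<zero>\<^bsub>E\<^esub>" using mod_hom_diff[OF P E \<chi> v(1,2)] \<chi>L by simp
  then have "\<ominus>\<^bsub>E\<^esub> (\<ominus>\<^bsub>E\<^esub> \<chi> w) = \<chi> v" using v \<chi>'(1) by (intro E.M.minus_equality) (auto simp: a_minus_def)
  then show ?thesis using v \<chi>'(1) by simp
 qed
 define u where "u k = (SOME v. v \<in> carrier ?P \<and> lin_comb N g v n = k)" for k
 have u: "u k \<in> carrier ?P" "lin_comb N g (u k) n = k" if k: "k \<in> K" for k
  using someI_ex[of "\<lambda>v. v \<in> carrier ?P \<and> lin_comb N g v n = k"] gen[OF k] unfolding u_def by blast+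
 note K' = N.submoduleE[OF K]
 have fl: "(\<lambda>k. \<chi> (u k)) \<in> mod_hom R (sub_mod N K) E"
 proof (rule mod_homI; simp)
  fix k assume k: "k \<in> K"
  show "\<chi> (u k) \<in> carrier E" using u \<chi>' k by simp
  show "\<chi> (u (a \<odot>\<^bsub>N\<^esub> k)) = a \<odot>\<^bsub>E\<^esub> \<chi> (u k)" if a: "a \<in> carrier R" for a
   using \<chi>_cong[OF u(1)[OF K'(4)[OF a k]] P.smult_closed[OF a u(1)[OF k]]] u k K'(4)[OF a k] h'(3)[OF a u(1)[OF k]] \<chi>'(3)[OF a u(1)[OF k]]
   by simp
  show "\<chi> (u (k \<oplus>\<^bsub>N\<^esub> l)) = \<chi> (u k) \<oplus>\<^bsub>E\<^esub> \<chi> (u l)" if l: "l \<in> K" for l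
   using \<chi>_cong[OF u(1)[OF K'(5)[OF k l]] P.M.a_closed[OF u(1)[OF k] u(1)[OF l]]] u k l K'(5)[OF k l]
    h'(2)[OF u(1)[OF k] u(1)[OF l]] \<chi>'(2)[OF u(1)[OF k] u(1)[OF l]] by simp
 qed
 obtain H where H: "H \<in> mod_hom R N E" "!!w. w \<in> K ==> H w = \<chi> (u w)"
  by (rule baer_extension[OF N E K baer fl]) blast
 show ?thesis
 proof (intro bexI ballI)
  show "(\<lambda>x. \<delta> (H x)) \<in> mod_hom R N C" by (rule mod_hom_comp[OF H(1) ex'(3)])
  show "\<delta> (H k) = f k" if "k \<in> K" for k using H(2)[OF that] \<delta>\<chi> u that by simp
 qed
qed

text \<open>A proper ideal is a submodule K of the free module of rank one. Each trade lowers the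
  cosyzygy and replaces K by its minimal relations, which again lie in \<mm> times a free module and
  gain one inclusion from \<open>relations_regular\<close>. After d trades this gives K = \<mm> K,
  so K = 0 and nothing is left to extend.\<close>

lemma regular_baer_cosyzygy:
 fixes R :: "'a ring" (structure)
 assumes R: "cring R" and noeth: "noetherian_ring R" and loc: "local_maximal R (seq_ideal R {\<zero>} x d)"
  and x: "!!i. i < d ==> x i \<in> carrier R" and reg: "regular_seq_mod R {\<zero>} x d"
  and D: "!!i. i \<le> d ==> module R (D i)" and E: "!!i. i < d ==> module R (E i)"
  and baer: "!!i. i < d ==> baer R (E i)"
  and ex: "!!i. i < d ==> short_exact R (D i) (E i) (D (Suc i)) (\<iota> i) (\<delta> i)"
 shows "baer R (D d)"
proof -
 interpret R: cring R by fact
 define \<mm> where "\<mm> = seq_ideal R {\<zero>} x d"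
 note loc' = local_maximalD[OF loc[folded \<mm>_def]]
 interpret m: ideal \<mm> R by (rule loc'(1))
 \<comment> \<open>The index t counts the trades still to be made and j those already made.\<close>
 have main: "\<exists>h \<in> mod_hom R (free_mod R r) (D t). \<forall>k\<in>K. h k = f k"
  if "t + j = d" "submodule K R (free_mod R r)" "K \<subseteq> {..<r} \<rightarrow>\<^sub>E \<mm>"
   "!!i. i \<le> j ==> K \<inter> ({..<r} \<rightarrow>\<^sub>E seq_ideal R {\<zero>} x i) \<subseteq> seq_times (free_mod R r) x K i"
   "f \<in> mod_hom R (sub_mod (free_mod R r) K) (D t)" for t j r K f
  using that
 proof (induction t arbitrary: j r K f)
  case 0
  let ?F = "free_mod R r"
  note F = free_mod_is_module[OF R, of r]
  interpret F: module R ?F by (rule F)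
  interpret D0: module R "D 0" using D by simp
  obtain g n where g: "!!i. i < n ==> g i \<in> K"
   and gen: "!!k. k \<in> K ==> \<exists>v \<in> carrier (free_mod R n). lin_comb ?F g v n = k"
   and rel: "!!v. v \<in> carrier (free_mod R n) ==> lin_comb ?F g v n = \<zero>\<^bsub>?F\<^esub> ==> v \<in> {..<n} \<rightarrow>\<^sub>E \<mm>"
   by (rule minimal_generators[OF R noeth loc[folded \<mm>_def] 0(2)]) blast
  have gF: "g i \<in> carrier ?F" if "i < n" for i using g[OF that] F.submoduleE(1)[OF 0(2)] by blast
  \<comment> \<open>Nakayama for minimal generators: K lies in \<mm> K, so the first generator is a
    combination with coefficients in \<mm>, which is a relation whose first coefficient 1 - z_0 is
    not in \<mm>.\<close>
  have "n = 0"
  proof (rule ccontr)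
   assume "n \<noteq> 0"
   then have n: "0 < n" by simp
   have "g 0 \<in> K \<inter> ({..<r} \<rightarrow>\<^sub>E seq_ideal R {\<zero>} x d)" using g[OF n] 0(3) by (auto simp: \<mm>_def)
   then have "g 0 \<in> seq_times ?F x K d" using 0(4)[of d] 0(1) by auto
   then have "\<exists>z \<in> {..<n} \<rightarrow>\<^sub>E \<mm>. lin_comb ?F g z n = g 0"
    unfolding \<mm>_def by (intro seq_times_lift[OF R F x gF gen]) auto
   then obtain z where z: "z \<in> {..<n} \<rightarrow>\<^sub>E \<mm>" "lin_comb ?F g z n = g 0" by blast
   let ?P = "free_mod R n"
   note P = free_mod_is_module[OF R, of n]
   interpret P: module R ?P by (rule P)
   define e where "e = (\<lambda>i\<in>{..<n}. if i = 0 then \<one> else \<zero>)"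
   have e: "e \<in> carrier ?P" by (auto simp: e_def free_mod_simps)
   have zP: "z \<in> carrier ?P" using z(1) m.Icarr by (auto simp: free_mod_simps PiE_iff)
   have "lin_comb ?F g e m = g 0" if "0 < m" "m \<le> n" for m
    using that
   proof (induction m)
    case (Suc m)
    then show ?case using gF[of 0] gF[of m] by (cases "m = 0") (auto simp: e_def)
   qed simp
   then have "lin_comb ?F g (e \<ominus>\<^bsub>?P\<^esub> z) n = \<zero>\<^bsub>?F\<^esub>"
    using mod_hom_diff[OF P F lin_comb_hom[OF F gF] e zP] z(2) n gF[OF n] by (simp add: a_minus_def F.M.r_neg)
   then have "(e \<ominus>\<^bsub>?P\<^esub> z) 0 \<in> \<mm>" using rel[of "e \<ominus>\<^bsub>?P\<^esub> z"] e zP n by auto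
   moreover have "(e \<ominus>\<^bsub>?P\<^esub> z) 0 = \<one> \<oplus> \<ominus> z 0"
    using n free_mod_minus[OF R zP] by (simp add: a_minus_def free_mod_simps(3) e_def)
   moreover have "z 0 \<in> \<mm>" using z(1) n by auto
   ultimately have "(\<one> \<oplus> \<ominus> z 0) \<oplus> z 0 \<in> \<mm>" by simp
   then show False using loc'(2) m.Icarr[OF \<open>z 0 \<in> \<mm>\<close>] by (simp add: R.a_assoc R.l_neg)
  qed
  then have "K \<subseteq> {\<zero>\<^bsub>?F\<^esub>}" using gen by auto
  moreover have "f \<zero>\<^bsub>?F\<^esub> = \<zero>\<^bsub>D 0\<^esub>" using mod_hom_sub_zero[OF F 0(2) D0.module_axioms 0(5)] .
  moreover have "(\<lambda>_. \<zero>\<^bsub>D 0\<^esub>) \<in> mod_hom R ?F (D 0)" by (rule mod_homI) auto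
  ultimately show ?case by (intro bexI[of _ "\<lambda>_. \<zero>\<^bsub>D 0\<^esub>"]) auto
 next
  case (Suc t)
  let ?F = "free_mod R r"
  note F = free_mod_is_module[OF R, of r]
  obtain g n where g: "!!i. i < n ==> g i \<in> K"
   and gen: "!!k. k \<in> K ==> \<exists>v \<in> carrier (free_mod R n). lin_comb ?F g v n = k"
   and rel: "!!v. v \<in> carrier (free_mod R n) ==> lin_comb ?F g v n = \<zero>\<^bsub>?F\<^esub> ==> v \<in> {..<n} \<rightarrow>\<^sub>E \<mm>"
   by (rule minimal_generators[OF R noeth loc[folded \<mm>_def] Suc.prems(2)]) blast
  interpret F: module R ?F by (rule F)
  have gF: "g i \<in> carrier ?F" if "i < n" for i using g[OF that] F.submoduleE(1)[OF Suc.prems(2)] by blast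
  define L where "L = {v \<in> carrier (free_mod R n). lin_comb ?F g v n = \<zero>\<^bsub>?F\<^esub>}"
  have Lsub: "submodule L R (free_mod R n)"
   using mod_ker_submodule[OF free_mod_is_module[OF R] F lin_comb_hom[OF F gF]] by (simp add: L_def mod_ker_def)
  have Lm: "L \<subseteq> {..<n} \<rightarrow>\<^sub>E \<mm>" using rel by (auto simp: L_def)
  have td: "t < d" "t + Suc j = d" using Suc.prems(1) by auto
  have Lreg: "L \<inter> ({..<n} \<rightarrow>\<^sub>E seq_ideal R {\<zero>} x i) \<subseteq> seq_times (free_mod R n) x L i" if "i \<le> Suc j" for i
   by (rule relations_regular[OF R x reg Suc.prems(2) g gen Suc.prems(4) _ L_def that]) (use td in auto)
  show ?case
   by (rule short_exact_hom_lift[OF R D E D ex baer F Suc.prems(2) g gen L_def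
      Suc.IH[OF td(2) Lsub Lm Lreg] Suc.prems(5)]) (use td in auto)
 qed
 interpret Dd: module R "D d" using D by simp
 show ?thesis
  unfolding baer_def hom_extends_def
 proof (intro allI impI ballI)
  fix \<aa> f assume a: "ideal \<aa> R" and f: "f \<in> mod_hom R (ideal_mod R \<aa>) (D d)"
  interpret a: ideal \<aa> R by (rule a)
  note f' = mod_homD[OF f, simplified]
  show "\<exists>e\<in>carrier (D d). \<forall>a\<in>\<aa>. f a = a \<odot>\<^bsub>D d\<^esub> e"
  proof (cases "\<aa> = carrier R")
   case True
   have "f \<one> \<in> carrier (D d)" using f'(1) True by simp
   then show ?thesis using True mod_hom_carrier_eq[OF R Dd.module_axioms f[unfolded True]] by blast
  next
   case False
   note am = ideal_subset_local_maximal[OF R loc[folded \<mm>_def] a False]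
   let ?F = "free_mod R (Suc 0)"
   let ?K = "{..<Suc 0} \<rightarrow>\<^sub>E \<aa>"
   have K: "submodule ?K R ?F" by (rule free_mod_ideal_submodule[OF R a])
   have "(\<lambda>v. f (v 0)) \<in> mod_hom R (sub_mod ?F ?K) (D d)"
    by (rule mod_homI) (insert f', auto simp: free_mod_simps PiE_iff)
   moreover have "?K \<inter> ({..<Suc 0} \<rightarrow>\<^sub>E seq_ideal R {\<zero>} x i) \<subseteq> seq_times ?F x ?K i" if "i \<le> 0" for i
   proof -
    have "v = \<zero>\<^bsub>?F\<^esub>" if "v \<in> {..<Suc 0} \<rightarrow>\<^sub>E {\<zero>}" for v
     by (rule extensionalityI[of _ "{..<Suc 0}"]) (insert that, auto simp: free_mod_simps PiE_iff)
    then show ?thesis using that by auto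
   qed
   moreover have "?K \<subseteq> {..<Suc 0} \<rightarrow>\<^sub>E \<mm>" using am by (rule PiE_mono)
   ultimately obtain h where h: "h \<in> mod_hom R ?F (D d)" "!!k. k \<in> ?K ==> h k = f (k 0)"
    using main[of d 0 ?K "Suc 0" "\<lambda>v. f (v 0)"] K by auto
   define e where "e = (\<lambda>i\<in>{..<Suc 0}. \<one>)"
   have e: "e \<in> carrier ?F" by (auto simp: e_def free_mod_simps)
   show ?thesis
   proof (intro bexI ballI)
    show "h e \<in> carrier (D d)" using mod_homD(1)[OF h(1) e] .
    fix b assume b: "b \<in> \<aa>"
    have be: "(\<lambda>i\<in>{..<Suc 0}. b) = b \<odot>\<^bsub>?F\<^esub> e" using b a.Icarr by (auto simp: free_mod_simps e_def intro!: restrict_ext)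
    have "h (\<lambda>i\<in>{..<Suc 0}. b) = f b" using h(2)[of "\<lambda>i\<in>{..<Suc 0}. b"] b by simp
    then show "f b = b \<odot>\<^bsub>D d\<^esub> h e" using mod_homD(3)[OF h(1) a.Icarr[OF b] e] unfolding be by simp
   qed
  qed
 qed
qed

section \<open>Regular local rings\<close>

text \<open>For an ideal \<bb> and a prime P this is the contraction to R of \<bb> extended to the
  localization at P. Local statements are phrased through it, so that all ideals stay in R.\<close>

definition saturation :: "'a ring => 'a set => 'a set => 'a set" where
 "saturation R P \<bb> = {a \<in> carrier R. \<exists>s\<in>carrier R - P. s \<otimes>\<^bsub>R\<^esub> a \<in> \<bb>}"

text \<open>Modulo P these are the symbolic powers of Q, the contractions of its powers from the
  localization at Q. Keeping P inside each term avoids passing to the ring R/P.\<close>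

primrec symbolic_power :: "'a ring => 'a set => 'a set => nat => 'a set" where
 "symbolic_power R P Q 0 = carrier R"
| "symbolic_power R P Q (Suc n) =
  saturation R Q (P <+>\<^bsub>R\<^esub> ideal_prod R (symbolic_power R P Q n) Q)"

context
 fixes R :: "'a ring" (structure)
 assumes R: "cring R"
begin

interpretation R: cring R by (rule R)

lemma primeD:
 assumes "primeideal P R"
 shows "ideal P R" "P \<noteq> carrier R" "\<one> \<notin> P"
  and "!!a b. a \<in> carrier R ==> b \<in> carrier R ==> a \<otimes> b \<in> P ==> a \<in> P \<or> b \<in> P"
proof -
 interpret P: primeideal P R by fact
 show "ideal P R" by (rule P.ideal_axioms)
 show "P \<noteq> carrier R" using P.I_notcarr by blast
 show "\<one> \<notin> P" using P.I_notcarr P.one_imp_carrier by blast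
 show "!!a b. a \<in> carrier R ==> b \<in> carrier R ==> a \<otimes> b \<in> P ==> a \<in> P \<or> b \<in> P" by (rule P.I_prime)
qed

lemma saturation_ideal:
 assumes P: "primeideal P R" and b: "ideal \<bb> R"
 shows "ideal (saturation R P \<bb>) R" "\<bb> \<subseteq> saturation R P \<bb>"
proof -
 interpret b: ideal \<bb> R by fact
 note P' = primeD[OF P]
 show "ideal (saturation R P \<bb>) R"
 proof (rule idealI'[OF R])
  show "saturation R P \<bb> \<subseteq> carrier R" by (auto simp: saturation_def)
  show "\<zero> \<in> saturation R P \<bb>" using P' by (auto simp: saturation_def intro!: bexI[of _ "\<one>"])
  fix a assume "a \<in> saturation R P \<bb>"
  then obtain s where s: "a \<in> carrier R" "s \<in> carrier R" "s \<notin> P" "s \<otimes> a \<in> \<bb>" by (auto simp: saturation_def)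
  { fix b assume "b \<in> saturation R P \<bb>"
   then obtain t where t: "b \<in> carrier R" "t \<in> carrier R" "t \<notin> P" "t \<otimes> b \<in> \<bb>" by (auto simp: saturation_def)
   have "(s \<otimes> t) \<otimes> (a \<oplus> b) = t \<otimes> (s \<otimes> a) \<oplus> s \<otimes> (t \<otimes> b)"
    using s t by (simp add: R.r_distr R.m_ac)
   also have "\<dots> \<in> \<bb>" using s t b.I_l_closed by simp
   finally show "a \<oplus> b \<in> saturation R P \<bb>"
    using s t P'(4)[of s t] by (auto simp: saturation_def intro!: bexI[of _ "s \<otimes> t"]) }
  { fix r assume r: "r \<in> carrier R"
   have "s \<otimes> (r \<otimes> a) = r \<otimes> (s \<otimes> a)" using s r by (simp add: R.m_lcomm)
   then have "s \<otimes> (r \<otimes> a) \<in> \<bb>" using s r b.I_l_closed by simp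
   then show "r \<otimes> a \<in> saturation R P \<bb>" using s r by (auto simp: saturation_def) }
 qed
 show "\<bb> \<subseteq> saturation R P \<bb>" using P' b.Icarr by (auto simp: saturation_def intro!: bexI[of _ "\<one>"])
qed

lemma saturation_mono: "\<aa> \<subseteq> \<bb> ==> saturation R P \<aa> \<subseteq> saturation R P \<bb>"
 by (auto simp: saturation_def)

lemma saturation_idem:
 assumes P: "primeideal P R"
 shows "saturation R P (saturation R P \<bb>) \<subseteq> saturation R P \<bb>"
proof
 note P' = primeD[OF P]
 fix a assume "a \<in> saturation R P (saturation R P \<bb>)"
 then obtain s t where s: "a \<in> carrier R" "s \<in> carrier R - P" "t \<in> carrier R - P" "t \<otimes> (s \<otimes> a) \<in> \<bb>"
  by (auto simp: saturation_def)
 then have "(t \<otimes> s) \<otimes> a \<in> \<bb>" by (simp add: R.m_assoc)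
 moreover have "t \<otimes> s \<in> carrier R - P" using s P'(4)[of t s] by auto
 ultimately show "a \<in> saturation R P \<bb>" using s unfolding saturation_def by blast
qed

text \<open>An associated prime of R/\<aa>: a maximal member among the colon ideals of \<aa> by
  elements outside \<aa> is prime.\<close>

lemma prime_colon_exists:
 assumes noeth: "noetherian_ring R" and a: "ideal \<aa> R" "\<aa> \<noteq> carrier R"
 obtains s where "s \<in> carrier R" "s \<notin> \<aa>" "primeideal (colon R \<aa> s) R"
proof -
 interpret a: ideal \<aa> R by fact
 let ?T = "{colon R \<aa> s | s. s \<in> carrier R \<and> s \<notin> \<aa>}"
 have ne: "?T \<noteq> {}" using a a.a_subset by blast
 obtain M where M: "M \<in> ?T" "!!H. H \<in> ?T ==> M \<subseteq> H ==> H = M"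
  by (rule noetherian_maximal_ideal_in[OF noeth ne]) (use colon_ideal(1)[OF R a(1)] in auto)
 then obtain s where s: "s \<in> carrier R" "s \<notin> \<aa>" "M = colon R \<aa> s" by auto
 have "primeideal M R"
 proof (rule primeidealI)
  show "ideal M R" using s colon_ideal(1)[OF R a(1)] by simp
  show "cring R" by (rule R)
  show "carrier R \<noteq> M" using s by (auto simp: colon_def) (metis R.l_one R.one_closed mem_Collect_eq)
  fix x y assume xy: "x \<in> carrier R" "y \<in> carrier R" "x \<otimes> y \<in> M"
  show "x \<in> M \<or> y \<in> M"
  proof (rule disjCI)
   assume "y \<notin> M"
   then have y: "y \<otimes> s \<notin> \<aa>" using xy s by (simp add: colon_def)
   have "M \<subseteq> colon R \<aa> (y \<otimes> s)"
   proof
    fix r assume "r \<in> M"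
    then have r: "r \<in> carrier R" "r \<otimes> s \<in> \<aa>" by (auto simp: s(3) colon_def)
    then have "y \<otimes> (r \<otimes> s) \<in> \<aa>" using a.I_l_closed xy by blast
    then show "r \<in> colon R \<aa> (y \<otimes> s)" using r xy s(1) by (simp add: colon_def R.m_lcomm)
   qed
   moreover have "colon R \<aa> (y \<otimes> s) \<in> ?T" by (rule CollectI, rule exI[of _ "y \<otimes> s"]) (use y xy(2) s(1) in simp)
   ultimately have "colon R \<aa> (y \<otimes> s) = M" by (intro M(2))
   moreover have "x \<in> colon R \<aa> (y \<otimes> s)" using xy s by (simp add: colon_def R.m_assoc)
   ultimately show "x \<in> M" by simp
  qed
 qed
 then show ?thesis using that s by blast
qed

text \<open>Nakayama at the prime P, by elimination instead of determinants: in the last equation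
  the last generator gets the coefficient s - p_n outside P, and multiplying the others by it
  removes that generator and leaves a system of the same shape.\<close>

lemma local_nakayama:
 assumes P: "primeideal P R" and K: "ideal K R"
  and g: "!!i. i < n ==> g i \<in> carrier R"
  and H: "!!i. i < n ==> \<exists>s\<in>carrier R - P. \<exists>\<kappa>\<in>K. \<exists>p. (\<forall>j<n. p j \<in> P) \<and>
   s \<otimes> g i = \<kappa> \<oplus> lin_comb (self_module R) g p n"
 shows "\<forall>i<n. g i \<in> saturation R P K"
 using g H
proof (induction n)
 case (Suc n)
 note P' = primeD[OF P]
 interpret P: ideal P R by (rule P'(1))
 interpret K: ideal K R by (rule K)
 note S = self_module_is_module[OF R]
 interpret S: module R "self_module R" by (rule S)
 let ?l = "\<lambda>p. lin_comb (self_module R) g p n"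
 obtain s \<kappa> p where s: "s \<in> carrier R" "s \<notin> P" "\<kappa> \<in> K" "!!j. j < Suc n ==> p j \<in> P"
  "s \<otimes> g n = \<kappa> \<oplus> (?l p \<oplus> p n \<otimes> g n)" using Suc.prems(2)[of n] by auto
 have pc: "p j \<in> carrier R" if "j < Suc n" for j using s(4)[OF that] P.Icarr by simp
 have gc: "g j \<in> carrier R" if "j < Suc n" for j using Suc.prems(1) that by blast
 have lc: "?l q \<in> carrier R" if "!!j. j < n ==> q j \<in> carrier R" for q
  using lin_comb_carrier[OF S, of n g q] gc that by simp
 have lp: "?l p \<in> carrier R" using lc pc by simp
 define t where "t = s \<ominus> p n"
 have t: "t \<in> carrier R" using s pc by (simp add: t_def)
 have tP: "t \<notin> P"
 proof
  assume "t \<in> P"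
  then have "t \<oplus> p n \<in> P" using s(4)[of n] by simp
  then show False using s pc[of n] by (simp add: t_def a_minus_def R.a_assoc R.l_neg)
 qed
 have kc: "\<kappa> \<in> carrier R" using s K.Icarr by simp
 have tg: "t \<otimes> g n = \<kappa> \<oplus> ?l p"
 proof -
  have "t \<otimes> g n = s \<otimes> g n \<ominus> p n \<otimes> g n"
   using s pc[of n] gc[of n] by (simp add: t_def a_minus_def R.l_distr R.l_minus)
  also have "\<dots> = \<kappa> \<oplus> ?l p"
   unfolding s(5) using kc lp pc[of n] gc[of n] by (simp add: a_minus_def R.a_assoc R.r_neg)
  finally show ?thesis .
 qed
 have "\<forall>i<n. g i \<in> saturation R P K"
 proof (rule Suc.IH)
  fix i assume i: "i < n"
  then obtain s' \<kappa>' p' where s': "s' \<in> carrier R" "s' \<notin> P" "\<kappa>' \<in> K" "!!j. j < Suc n ==> p' j \<in> P"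
   "s' \<otimes> g i = \<kappa>' \<oplus> (?l p' \<oplus> p' n \<otimes> g n)" using Suc.prems(2)[of i] by auto
  have pc': "p' j \<in> carrier R" if "j < Suc n" for j using s'(4)[OF that] P.Icarr by simp
  have kc': "\<kappa>' \<in> carrier R" using s' K.Icarr by simp
  have lp': "?l p' \<in> carrier R" using lc pc' by simp
  have pn': "p' n \<in> carrier R" "g n \<in> carrier R" "g i \<in> carrier R" using pc' gc i by auto
  let ?q = "\<lambda>j. t \<otimes> p' j \<oplus> p' n \<otimes> p j"
  have lq: "?l ?q = t \<otimes> ?l p' \<oplus> p' n \<otimes> ?l p"
   using lin_comb_add[OF S, of n g "\<lambda>j. t \<otimes> p' j" "\<lambda>j. p' n \<otimes> p j"]
    lin_comb_smult[OF S, of n g p' t] lin_comb_smult[OF S, of n g p "p' n"] gc pc pc' t by simp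
  have "(t \<otimes> s') \<otimes> g i = t \<otimes> (s' \<otimes> g i)" using t s' pn' by (simp add: R.m_assoc)
  also have "\<dots> = t \<otimes> \<kappa>' \<oplus> (t \<otimes> ?l p' \<oplus> p' n \<otimes> (t \<otimes> g n))"
   unfolding s'(5) using t kc' lp' pn' by (simp add: R.r_distr R.m_lcomm)
  also have "\<dots> = (t \<otimes> \<kappa>' \<oplus> p' n \<otimes> \<kappa>) \<oplus> ?l ?q"
   unfolding tg lq using t kc' lp' pn' kc lp by (simp add: R.r_distr R.a_ac)
  finally have eq: "(t \<otimes> s') \<otimes> g i = (t \<otimes> \<kappa>' \<oplus> p' n \<otimes> \<kappa>) \<oplus> ?l ?q" .
  have 1: "t \<otimes> s' \<in> carrier R - P" using t tP s' P'(4)[of t s'] by auto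
  have 2: "t \<otimes> \<kappa>' \<oplus> p' n \<otimes> \<kappa> \<in> K" using s s' t pn' K.I_l_closed by simp
  have 3: "\<forall>j<n. ?q j \<in> P" using s'(4) t pc pn'(1) s(4) P.I_l_closed by simp
  show "\<exists>s\<in>carrier R - P. \<exists>\<kappa>\<in>K. \<exists>p. (\<forall>j<n. p j \<in> P) \<and> s \<otimes> g i = \<kappa> \<oplus> ?l p"
   by (rule bexI[OF _ 1], rule bexI[OF _ 2], rule exI[of _ ?q]) (use 3 eq in blast)
 qed (use gc in simp)
 moreover have "g n \<in> saturation R P K"
 proof -
  note sat = saturation_ideal[OF P K]
  interpret sat: ideal "saturation R P K" R by (rule sat(1))
  have "?l p \<in> saturation R P K"
   using lin_comb_closed[OF S _, of "saturation R P K" n g p] sat(1) submodule_self_iff[OF R] calculation pc by simp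
  then have "t \<otimes> g n \<in> saturation R P K" unfolding tg using s(3) sat(2) by auto
  then have "g n \<in> saturation R P (saturation R P K)" using t tP gc unfolding saturation_def[of R P "saturation R P K"] by auto
  then show ?thesis using saturation_idem[OF P] by blast
 qed
 ultimately show ?case by (auto simp: less_Suc_eq)
qed simp

text \<open>When P is minimal over \<pp>, the localization of R/\<pp> at P is Artinian. By
  noetherian induction on a lower bound \<aa> of the chain: the associated prime found by
  \<open>prime_colon_exists\<close> lies in P, hence equals P, so that adjoining its element s
  enlarges a term locally by at most one simple factor.\<close>

lemma saturated_descending_chain:
 assumes noeth: "noetherian_ring R" and P: "primeideal P R" and p: "ideal \<pp> R"
  and min: "!!Q. primeideal Q R ==> \<pp> \<subseteq> Q ==> Q \<subseteq> P ==> Q = P"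
  and b: "!!n. ideal (b n) R" "!!n. \<pp> \<subseteq> b n" "!!n. saturation R P (b n) \<subseteq> b n" "!!n. b (Suc n) \<subseteq> b n"
 shows "\<exists>N. \<forall>n\<ge>N. b n = b N"
proof (rule ccontr)
 define good where "good \<aa> \<longleftrightarrow> (\<forall>b. (\<forall>n. ideal (b n) R \<and> \<aa> \<subseteq> b n \<and> saturation R P (b n) \<subseteq> b n \<and> b (Suc n) \<subseteq> b n) -->
  (\<exists>N. \<forall>n\<ge>N. b n = b N))" for \<aa>
 let ?T = "{\<aa>. ideal \<aa> R \<and> \<pp> \<subseteq> \<aa> \<and> saturation R P \<aa> \<subseteq> \<aa> \<and> \<not> good \<aa>}"
 assume not: "\<not> ?thesis"
 have "saturation R P \<pp> \<in> ?T"
 proof -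
  have "saturation R P \<pp> \<subseteq> b n" for n using saturation_mono[OF b(2)] b(3) by blast
  then have "\<not> good (saturation R P \<pp>)" using not b unfolding good_def by blast
  then show ?thesis using saturation_ideal[OF P p] saturation_idem[OF P] by blast
 qed
 then have ne: "?T \<noteq> {}" by blast
 obtain \<aa> where a: "\<aa> \<in> ?T" and max: "!!H. H \<in> ?T ==> \<aa> \<subseteq> H ==> H = \<aa>"
  by (rule noetherian_maximal_ideal_in[OF noeth ne]) auto
 have ai: "ideal \<aa> R" and ap: "\<pp> \<subseteq> \<aa>" and asat: "saturation R P \<aa> \<subseteq> \<aa>" and bad: "\<not> good \<aa>" using a by auto
 from bad obtain c where c: "!!n. ideal (c n) R" "!!n. \<aa> \<subseteq> c n" "!!n. saturation R P (c n) \<subseteq> c n" "!!n. c (Suc n) \<subseteq> c n"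
  and cn: "\<not> (\<exists>N. \<forall>n\<ge>N. c n = c N)" unfolding good_def by meson
 have cmono: "c n \<subseteq> c m" if "m \<le> n" for m n using that c(4) by (rule lift_Suc_antimono_le[rotated])
 have "\<aa> \<noteq> carrier R"
 proof
  assume "\<aa> = carrier R"
  then have "c n = carrier R" for n using c(2)[of n] additive_subgroup.a_subset[OF ideal.axioms(1)[OF c(1)[of n]]] by blast
  then show False using cn by simp
 qed
 then obtain s where s: "s \<in> carrier R" "s \<notin> \<aa>" "primeideal (colon R \<aa> s) R"
  using prime_colon_exists[OF noeth ai] by blast
 have "colon R \<aa> s \<subseteq> P"
 proof
  fix r assume "r \<in> colon R \<aa> s"
  then show "r \<in> P" using s asat by (auto simp: colon_def saturation_def)
 qed
 then have cP: "colon R \<aa> s = P" using min[OF s(3)] ap colon_ideal(2)[OF R ai s(1)] by blast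
 define c' where "c' n = saturation R P (adjoin_ideal R (c n) s)" for n
 note ad = adjoin_ideal_ideal[OF R c(1) s(1)]
 note ada = adjoin_ideal_ideal[OF R ai s(1)]
 have admono: "adjoin_ideal R \<bb> s \<subseteq> adjoin_ideal R \<cc> s" if "\<bb> \<subseteq> \<cc>" for \<bb> \<cc>
  using that by (auto simp: adjoin_def)
 let ?a' = "saturation R P (adjoin_ideal R \<aa> s)"
 note sa = saturation_ideal[OF P ada(1)]
 have "?a' \<notin> ?T"
 proof
  assume "?a' \<in> ?T"
  then have "?a' = \<aa>" using max ada(2) sa(2) by blast
  then show False using ada(3) sa(2) s by blast
 qed
 then have "good ?a'" using sa ada(2) ap saturation_idem[OF P] by blast
 moreover have "ideal (c' n) R \<and> ?a' \<subseteq> c' n \<and> saturation R P (c' n) \<subseteq> c' n \<and> c' (Suc n) \<subseteq> c' n" for n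
  unfolding c'_def using saturation_ideal(1)[OF P ad(1)] saturation_mono[OF admono[OF c(2)]]
   saturation_idem[OF P] saturation_mono[OF admono[OF c(4)]] by blast
 ultimately obtain N1 where N1: "!!n. n \<ge> N1 ==> c' n = c' N1" unfolding good_def by blast
 have sub': "c n \<subseteq> c' n" for n unfolding c'_def using ad(2) saturation_ideal(2)[OF P ad(1)] by blast
 show False
 \<comment> \<open>Where c' is constant, c can still shrink only by losing s. Once s is lost, a
   multiple of x in c N by an element outside P differs from an element of c n by r s; here r must
   lie in P, and P s lies in \<aa>.\<close>
 proof (cases "\<forall>n. s \<in> c n")
  case True
  have "c' n \<subseteq> c n" for n
   unfolding c'_def using adjoin_ideal_least[OF R c(1), of "c n" n s] True saturation_mono c(3) by blast
  then have "c n = c' n" for n using sub' by blast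
  then show False using cn N1 by metis
 next
  case False
  then obtain N2 where N2: "s \<notin> c N2" by blast
  define N where "N = max N1 N2"
  have "c n = c N" if n: "n \<ge> N" for n
  proof
   show "c n \<subseteq> c N" using cmono n by blast
   show "c N \<subseteq> c n"
   proof
    fix x assume x: "x \<in> c N"
    have "c' N = c' n" using N1[of N] N1[of n] n by (simp add: N_def)
    then have "x \<in> c' n" using x sub' by blast
    then obtain t where t: "t \<in> carrier R" "t \<notin> P" "t \<otimes> x \<in> adjoin_ideal R (c n) s" and xR: "x \<in> carrier R"
     unfolding c'_def saturation_def by blast
    from t(3) obtain w r where w: "w \<in> c n" "r \<in> carrier R" "t \<otimes> x = w \<oplus> r \<otimes> s" by (rule adjoin_idealE)
    interpret cN: ideal "c N" R by (rule c(1))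
    interpret cn: ideal "c n" R by (rule c(1))
    have wc: "w \<in> carrier R" using w cn.Icarr by simp
    have "r \<otimes> s = \<ominus> w \<oplus> t \<otimes> x"
     using w s wc by (simp add: R.r_neg1 R.a_assoc[symmetric] R.l_neg)
    moreover have "w \<in> c N" using w cmono n by blast
    ultimately have rs: "r \<otimes> s \<in> c N" using x t cN.I_l_closed by simp
    have "r \<in> P"
    proof (rule ccontr)
     assume "r \<notin> P"
     then have "s \<in> saturation R P (c N)" using rs w s by (auto simp: saturation_def)
     then have "s \<in> c N" using c(3) by blast
     then have "s \<in> c N2" using cmono[of N2 N] by (auto simp: N_def)
     then show False using N2 by blast
    qed
    then have "r \<otimes> s \<in> \<aa>" using cP by (auto simp: colon_def)
    then have "r \<otimes> s \<in> c n" using c(2) by blast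
    then have "t \<otimes> x \<in> c n" using w by simp
    then have "x \<in> saturation R P (c n)" using t xR by (auto simp: saturation_def)
    then show "x \<in> c n" using c(3) by blast
   qed
  qed
  then show False using cn by blast
 qed
qed

lemma symbolic_power_props:
 assumes Q: "primeideal Q R" and P: "ideal P R" "P \<subseteq> Q"
 shows "ideal (symbolic_power R P Q n) R" "P \<subseteq> symbolic_power R P Q n"
  "saturation R Q (symbolic_power R P Q n) \<subseteq> symbolic_power R P Q n"
  "symbolic_power R P Q (Suc n) \<subseteq> symbolic_power R P Q n"
  "a \<in> symbolic_power R P Q n ==> b \<in> Q ==> a \<otimes> b \<in> symbolic_power R P Q (Suc n)"
proof -
 note Q' = primeD[OF Q]
 interpret Q: ideal Q R by (rule Q'(1))
 interpret P: ideal P R by (rule P)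
 let ?G = "\<lambda>n. P <+>\<^bsub>R\<^esub> ideal_prod R (symbolic_power R P Q n) Q"
 have sum: "ideal (?G n) R" "P \<subseteq> ?G n" "ideal_prod R (symbolic_power R P Q n) Q \<subseteq> ?G n"
  if i: "ideal (symbolic_power R P Q n) R" for n
 proof -
  note p = R.ideal_prod_is_ideal[OF i Q'(1)]
  interpret p: ideal "ideal_prod R (symbolic_power R P Q n) Q" R by (rule p)
  show "ideal (?G n) R" by (rule R.add_ideals[OF P(1) p])
  have mem: "x \<oplus> y \<in> ?G n" if "x \<in> P" "y \<in> ideal_prod R (symbolic_power R P Q n) Q" for x y
   unfolding set_add_def' using that by blast
  show "P \<subseteq> ?G n" using mem[OF _ p.zero_closed] P.Icarr by auto
  show "ideal_prod R (symbolic_power R P Q n) Q \<subseteq> ?G n" using mem[OF P.zero_closed] p.Icarr by auto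
 qed
 have A: "ideal (symbolic_power R P Q n) R \<and> P \<subseteq> symbolic_power R P Q n \<and>
   saturation R Q (symbolic_power R P Q n) \<subseteq> symbolic_power R P Q n" for n
 proof (induction n)
  case 0
  show ?case using R.oneideal P.a_subset by (auto simp: saturation_def)
 next
  case (Suc n)
  then have i: "ideal (symbolic_power R P Q n) R" by simp
  show ?case using saturation_ideal[OF Q sum(1)[OF i]] sum(2)[OF i] saturation_idem[OF Q] by auto
 qed
 then show i: "ideal (symbolic_power R P Q n) R" "P \<subseteq> symbolic_power R P Q n"
  "saturation R Q (symbolic_power R P Q n) \<subseteq> symbolic_power R P Q n" for n by auto
 show "symbolic_power R P Q (Suc n) \<subseteq> symbolic_power R P Q n"
 proof -
  interpret s: ideal "symbolic_power R P Q n" R by (rule i(1))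
  have "?G n \<subseteq> symbolic_power R P Q n"
   using i(2)[of n] R.ideal_prod_inter[OF i(1)[of n] Q'(1)] by (auto simp: set_add_def set_mult_def)
  from saturation_mono[OF this, of Q] show ?thesis using i(3)[of n] by (simp only: symbolic_power.simps)
 qed
 show "a \<otimes> b \<in> symbolic_power R P Q (Suc n)" if "a \<in> symbolic_power R P Q n" "b \<in> Q"
  unfolding symbolic_power.simps
  by (rule subsetD[OF saturation_ideal(2)[OF Q sum(1)[OF i(1)]] subsetD[OF sum(3)[OF i(1)]]])
   (rule ideal_prod.prod[OF that])
qed

lemma ideal_generators:
 assumes noeth: "noetherian_ring R" and N: "ideal N R"
 obtains g n where "!!i. i < n ==> g i \<in> N"
  and "!!a. a \<in> N ==> \<exists>v. (\<forall>i<n. v i \<in> carrier R) \<and> lin_comb (self_module R) g v n = a"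
proof -
 obtain g n where g: "!!i. i < n ==> g i \<in> N" "N = adjoin_seq R (self_module R) {\<zero>} g n"
  using noetherian_ideal_adjoin_seq[OF R noeth N] by metis
 have gc: "g i \<in> carrier (self_module R)" if "i < n" for i using ideal.Icarr[OF N g(1)[OF that]] by simp
 have "\<exists>v. (\<forall>i<n. v i \<in> carrier R) \<and> lin_comb (self_module R) g v n = a" if a: "a \<in> N" for a
 proof -
  have "\<exists>v \<in> carrier (free_mod R n). lin_comb (self_module R) g v n = a"
   by (rule adjoin_seq_lin_comb[OF self_module_is_module[OF R] _ gc]) (use a g(2) in simp_all)
  then show ?thesis by (auto simp: free_mod_simps PiE_iff)
 qed
 then show ?thesis using that g(1) by blast
qed

text \<open>
 A form of Krull's principal ideal theorem.  The symbolic powers of the middle prime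
 stabilize modulo \<open>x\<close>, hence by Nakayama stabilize, hence vanish modulo \<open>P\<close>.
\<close>

lemma prime_between:
 assumes noeth: "noetherian_ring R" and P: "primeideal P R" and Q: "primeideal Q R" and M: "primeideal M R"
  and PQ: "P \<subset> Q" and QM: "Q \<subset> M" and x: "x \<in> M"
 obtains L where "primeideal L R" "P \<subset> L" "L \<subset> M" "x \<in> L"
proof (rule ccontr)
 assume not: "\<not> thesis"
 note P' = primeD[OF P] and Q' = primeD[OF Q] and M' = primeD[OF M]
 interpret Q: ideal Q R by (rule Q'(1))
 interpret M: ideal M R by (rule M'(1))
 \<comment> \<open>If x were in Q, then Q itself would serve as L.\<close>
 have xQ: "x \<notin> Q" using that Q PQ QM not by blast
 have xR: "x \<in> carrier R" using x M.Icarr by simp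
 let ?p = "adjoin_ideal R P x"
 note p = adjoin_ideal_ideal[OF R P'(1) xR]
 have min: "L = M" if "primeideal L R" "?p \<subseteq> L" "L \<subseteq> M" for L
  using not \<open>!!L. primeideal L R ==> P \<subset> L ==> L \<subset> M ==> x \<in> L ==> thesis\<close> that p(2,3) xQ PQ by blast
 let ?C = "symbolic_power R P Q"
 have PsQ: "P \<subseteq> Q" using PQ by blast
 note C = symbolic_power_props[OF Q P'(1) PsQ]
 \<comment> \<open>By \<open>min\<close>, M is minimal over the ideal generated by P and x, so the
   symbolic powers enlarged by x and saturated at M become stationary.\<close>
 define b where "b n = saturation R M (adjoin_ideal R (?C n) x)" for n
 note ad = adjoin_ideal_ideal[OF R C(1) xR]
 have admono: "adjoin_ideal R \<bb> x \<subseteq> adjoin_ideal R \<cc> x" if "\<bb> \<subseteq> \<cc>" for \<bb> \<cc>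
  using that by (auto simp: adjoin_def)
 have "\<exists>N. \<forall>n\<ge>N. b n = b N"
 proof (rule saturated_descending_chain[OF noeth M p(1) min])
  show "ideal (b n) R" "saturation R M (b n) \<subseteq> b n" "b (Suc n) \<subseteq> b n" for n
   unfolding b_def using saturation_ideal(1)[OF M ad(1)] saturation_idem[OF M] saturation_mono[OF admono[OF C(4)]] by auto
  show "?p \<subseteq> b n" for n
   unfolding b_def using admono[OF C(2)] saturation_ideal(2)[OF M ad(1)] by blast
 qed
 then obtain n where "\<forall>m\<ge>n. b m = b n" by blast
 then have bn: "b n = b (Suc n)" using le_SucI[OF order_refl, of n] by metis
 interpret Cn: ideal "?C n" R by (rule C(1))
 interpret CS: ideal "?C (Suc n)" R by (rule C(1))
 obtain g r where g: "!!i. i < r ==> g i \<in> ?C n"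
  and gen: "!!a. a \<in> ?C n ==> \<exists>v. (\<forall>i<r. v i \<in> carrier R) \<and> lin_comb (self_module R) g v r = a"
  using ideal_generators[OF noeth C(1)[of n]] by metis
 have gR: "g i \<in> carrier R" if "i < r" for i using Cn.Icarr[OF g[OF that]] .
 note S = self_module_is_module[OF R]
 have gS: "g i \<in> carrier (self_module R)" if "i < r" for i using gR[OF that] by simp
 have "\<forall>i<r. g i \<in> saturation R M (?C (Suc n))"
 proof (rule local_nakayama[OF M C(1) gR])
  fix i assume i: "i < r"
  have "g i \<in> b n"
   unfolding b_def using ad(2)[of n] saturation_ideal(2)[OF M ad(1)[of n]] g[OF i] by blast
  then have "g i \<in> b (Suc n)" using bn by simp
  then obtain s where s: "s \<in> carrier R" "s \<notin> M" "s \<otimes> g i \<in> adjoin_ideal R (?C (Suc n)) x"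
   unfolding b_def saturation_def by blast
  from s(3) obtain c t where c: "c \<in> ?C (Suc n)" "t \<in> carrier R" "s \<otimes> g i = c \<oplus> t \<otimes> x"
   by (rule adjoin_idealE)
  have cR: "c \<in> carrier R" using CS.Icarr[OF c(1)] .
  have "t \<otimes> x = \<ominus> c \<oplus> s \<otimes> g i"
   unfolding c(3) using c cR xR by (simp add: R.a_assoc[symmetric] R.l_neg)
  moreover have "c \<in> ?C n" using c(1) C(4) by blast
  ultimately have "t \<otimes> x \<in> ?C n" using s(1) Cn.I_l_closed[OF g[OF i]] by simp
  then have "x \<otimes> t \<in> ?C n" using R.m_comm[OF c(2) xR] by (simp only:)
  \<comment> \<open>x lies outside Q and the symbolic power is saturated at Q, so the coefficient t
    of x lies in it as well. This puts t x into M times the symbolic power, as Nakayama at M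
    requires.\<close>
  then have "t \<in> saturation R Q (?C n)" using c(2) xR xQ unfolding saturation_def by blast
  then have "t \<in> ?C n" using C(3) by blast
  then obtain v where v: "\<forall>i<r. v i \<in> carrier R" "lin_comb (self_module R) g v r = t" using gen by blast
  have "lin_comb (self_module R) g (\<lambda>j. x \<otimes> v j) r = x \<otimes> t"
   using lin_comb_smult[OF S, of r g v x] gS v xR by simp
  then have "s \<otimes> g i = c \<oplus> lin_comb (self_module R) g (\<lambda>j. x \<otimes> v j) r"
   using c(2,3) xR by (simp add: R.m_comm)
  moreover have "\<forall>j<r. x \<otimes> v j \<in> M" using v(1) x M.I_r_closed by simp
  ultimately show "\<exists>s\<in>carrier R - M. \<exists>\<kappa>\<in>?C (Suc n). \<exists>p. (\<forall>j<r. p j \<in> M) \<and>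
    s \<otimes> g i = \<kappa> \<oplus> lin_comb (self_module R) g p r"
   by (intro bexI[of _ s] bexI[of _ c] exI[of _ "\<lambda>j. x \<otimes> v j"] conjI) (insert s(1,2) c(1), simp_all only: Diff_iff simp_thms)
 qed
 moreover have "saturation R M (?C (Suc n)) \<subseteq> ?C (Suc n)"
 proof -
  have "saturation R M (?C (Suc n)) \<subseteq> saturation R Q (?C (Suc n))" using QM unfolding saturation_def by blast
  then show ?thesis using C(3)[of "Suc n"] by blast
 qed
 ultimately have gS: "g i \<in> ?C (Suc n)" if "i < r" for i using that by blast
 \<comment> \<open>Now the symbolic power equals its successor, which up to saturation at Q is P
   plus Q times the symbolic power; Nakayama at Q leaves only P.\<close>
 have "\<forall>i<r. g i \<in> saturation R Q P"
 proof (rule local_nakayama[OF Q P'(1) gR])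
  fix i assume i: "i < r"
  obtain s where s: "s \<in> carrier R" "s \<notin> Q" "s \<otimes> g i \<in> P <+>\<^bsub>R\<^esub> ideal_prod R (?C n) Q"
   using gS[OF i] unfolding symbolic_power.simps saturation_def by blast
  then obtain \<kappa> z where \<kappa>: "\<kappa> \<in> P" and z: "z \<in> ideal_prod R (?C n) Q" and eq: "s \<otimes> g i = \<kappa> \<oplus> z"
   by (auto simp: set_add_def set_mult_def)
  from z have "\<exists>p. (\<forall>j<r. p j \<in> Q) \<and> lin_comb (self_module R) g p r = z"
  proof induction
   case (prod a b)
   then obtain v where v: "\<forall>i<r. v i \<in> carrier R" "lin_comb (self_module R) g v r = a" using gen by blast
   have "lin_comb (self_module R) g (\<lambda>j. b \<otimes> v j) r = a \<otimes> b"
    using lin_comb_smult[OF S, of r g v b] gR v prod Q.Icarr Cn.Icarr by (simp add: R.m_comm)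
   then show ?case using v(1) prod(2) Q.I_r_closed by (intro exI[of _ "\<lambda>j. b \<otimes> v j"]) simp
  next
   case (sum z z')
   then obtain p p' where p: "\<forall>j<r. p j \<in> Q" "lin_comb (self_module R) g p r = z"
    "\<forall>j<r. p' j \<in> Q" "lin_comb (self_module R) g p' r = z'" by blast
   then show ?case
    using lin_comb_add[OF S, of r g p p'] gR Q.Icarr by (intro exI[of _ "\<lambda>j. p j \<oplus> p' j"]) simp
  qed
  then have "\<exists>p. (\<forall>j<r. p j \<in> Q) \<and> s \<otimes> g i = \<kappa> \<oplus> lin_comb (self_module R) g p r" unfolding eq by metis
  then show "\<exists>s\<in>carrier R - Q. \<exists>\<kappa>\<in>P. \<exists>p. (\<forall>j<r. p j \<in> Q) \<and>
    s \<otimes> g i = \<kappa> \<oplus> lin_comb (self_module R) g p r" using s(1,2) \<kappa> by (intro bexI[of _ s] bexI[of _ \<kappa>]) auto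
 qed
 moreover have "saturation R Q P \<subseteq> P"
 proof
  fix a assume "a \<in> saturation R Q P"
  then obtain s where "a \<in> carrier R" "s \<in> carrier R" "s \<notin> Q" "s \<otimes> a \<in> P" unfolding saturation_def by blast
  then show "a \<in> P" using P'(4)[of s a] PQ by blast
 qed
 ultimately have "g i \<in> P" if "i < r" for i using that by blast
 then have CP: "?C n \<subseteq> P"
  using gen lin_comb_closed[OF S, of P r g] P'(1) submodule_self_iff[OF R] by blast
 obtain y where y: "y \<in> Q" "y \<notin> P" using PQ by blast
 have yR: "y \<in> carrier R" using y Q.Icarr by simp
 \<comment> \<open>The contradiction: the n-th power of an element of Q outside P lies in the n-th
   symbolic power, which is contained in the prime P.\<close>
 have "y [^] m \<in> ?C m" for m :: nat
 proof (induction m)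
  case (Suc m) then show ?case using C(5)[OF Suc y(1)] by simp
 qed simp
 then have "y [^] n \<in> P" using CP by blast
 moreover have "y [^] m \<notin> P" for m :: nat
 proof (induction m)
  case (Suc m) then show ?case using P'(4)[of "y [^] m" y] y yR by auto
 qed (use P' in simp)
 ultimately show False by blast
qed

end

section \<open>Chains of primes and regular systems of parameters\<close>

definition prime_chain :: "'a ring => (nat => 'a set) => nat => bool" where
 "prime_chain R p n \<longleftrightarrow> (\<forall>i\<le>n. primeideal (p i) R) \<and> (\<forall>i<n. p i \<subset> p (Suc i))"

text \<open>\<open>prime_between\<close> pushes x down the chain one prime at a time without moving
  the two ends. Hence dividing by x shortens the longest chains by at most one.\<close>

lemma prime_chain_through:
 assumes R: "cring R" and noeth: "noetherian_ring R" and p: "prime_chain R p n" "0 < n" "x \<in> p n"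
 shows "\<exists>p'. prime_chain R p' n \<and> p' 0 = p 0 \<and> p' n = p n \<and> x \<in> p' 1"
 using p
proof (induction n arbitrary: p)
 case (Suc n)
 show ?case
 proof (cases n)
  case 0
  then show ?thesis using Suc.prems by auto
 next
  case (Suc n')
  note pr = Suc.prems(1)[unfolded prime_chain_def]
  have pc: "primeideal (p n') R" "primeideal (p n) R" "primeideal (p (Suc n)) R"
   "p n' \<subset> p n" "p n \<subset> p (Suc n)" using pr Suc by auto
  obtain L where L: "primeideal L R" "p n' \<subset> L" "L \<subset> p (Suc n)" "x \<in> L"
  proof (cases "x \<in> p n")
   case True then show ?thesis using that pc by blast
  next
   case False then show ?thesis using prime_between[OF R noeth pc Suc.prems(3)] that by blast
  qed
  have "prime_chain R (p(n := L)) n" unfolding prime_chain_def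
  proof (intro conjI allI impI)
   show "primeideal ((p(n := L)) i) R" if "i \<le> n" for i using that pr L by auto
   show "(p(n := L)) i \<subset> (p(n := L)) (Suc i)" if "i < n" for i
    using that pr L Suc by (cases "i = n'") auto
  qed
  from Suc.IH[OF this] obtain p' where p': "prime_chain R p' n" "p' 0 = p 0" "p' n = L" "x \<in> p' 1"
   using L(4) Suc by (metis fun_upd_apply zero_less_Suc nat.distinct(1))
  let ?p = "p'(Suc n := p (Suc n))"
  have "prime_chain R ?p (Suc n)" unfolding prime_chain_def
  proof (intro conjI allI impI)
   show "primeideal (?p i) R" if "i \<le> Suc n" for i using that p'(1) pc by (auto simp: prime_chain_def)
   show "?p i \<subset> ?p (Suc i)" if "i < Suc n" for i
    using that p'(1,3) L by (cases "i = n") (auto simp: prime_chain_def)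
  qed
  moreover have "?p 0 = p 0" "?p (Suc n) = p (Suc n)" "x \<in> ?p 1" using p' Suc by simp_all
  ultimately show ?thesis by blast
 qed
qed simp

text \<open>\<open>adjoin_seq\<close> grows at its end, whereas the induction on the number of
  parameters divides out x_0 first.\<close>

lemma seq_ideal_shift:
 "seq_ideal R (adjoin_ideal R \<qq> (x 0)) (\<lambda>i. x (Suc i)) n = seq_ideal R \<qq> x (Suc n)"
 by (induction n) auto

lemma local_maximal_prime:
 fixes R (structure) assumes R: "cring R" and loc: "local_maximal R \<mm>"
 shows "primeideal \<mm> R"
proof -
 interpret R: cring R by (rule R)
 note l = local_maximalD[OF loc]
 interpret m: ideal \<mm> R by (rule l(1))
 show ?thesis
 proof (rule primeidealI[OF l(1) R])
  show "carrier R \<noteq> \<mm>" using l(2) R.one_closed by blast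
  fix a b assume ab: "a \<in> carrier R" "b \<in> carrier R" "a \<otimes> b \<in> \<mm>"
  show "a \<in> \<mm> \<or> b \<in> \<mm>"
  proof (rule disjCI)
   assume "b \<notin> \<mm>"
   then have b: "b \<in> Units R" using l(3) ab by blast
   then have "(a \<otimes> b) \<otimes> inv b \<in> \<mm>" using m.I_r_closed[OF ab(3)] R.Units_inv_closed by blast
   then show "a \<in> \<mm>" using ab b by (simp add: R.m_assoc)
  qed
 qed
qed

lemma saturation_local_maximal:
 fixes R (structure) assumes R: "cring R" and loc: "local_maximal R \<mm>" and K: "ideal K R"
 shows "saturation R \<mm> K \<subseteq> K"
proof
 interpret R: cring R by (rule R)
 interpret K: ideal K R by (rule K)
 fix a assume "a \<in> saturation R \<mm> K"
 then obtain s where s: "a \<in> carrier R" "s \<in> carrier R" "s \<notin> \<mm>" "s \<otimes> a \<in> K" unfolding saturation_def by blast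
 then have u: "s \<in> Units R" using local_maximalD(3)[OF loc] by blast
 then have "inv s \<otimes> (s \<otimes> a) \<in> K" using K.I_l_closed[OF s(4)] R.Units_inv_closed by blast
 then show "a \<in> K" using s u by (simp add: R.m_assoc[symmetric])
qed

text \<open>Induction on d by dividing out x_0. A chain of full length forces the ideal of \<qq> and
  x_0 to be the prime just above the bottom prime P; elements of P are then of the form w + b x_0
  with w in \<qq> and b again in P, so P = \<qq> by Nakayama. Thus \<qq> is prime and x_0 is regular
  modulo it.\<close>

lemma maximal_chain_regular_seq:
 fixes R (structure) assumes R: "cring R" and noeth: "noetherian_ring R"
 shows "ideal \<qq> R ==> (!!i. i < d ==> x i \<in> carrier R) ==> local_maximal R (seq_ideal R \<qq> x d) ==>
  prime_chain R p n ==> \<qq> \<subseteq> p 0 ==>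
  n \<le> d \<and> (n = d --> \<qq> = p 0 \<and> regular_seq_mod R \<qq> x d)"
proof (induction d arbitrary: \<qq> x p n)
 case 0
 interpret R: cring R by (rule R)
 have sub: "p i \<subseteq> \<qq>" if "i \<le> n" for i
  using ideal_subset_local_maximal[OF R 0(3)] primeD[OF R, of "p i"] 0(4) that by (simp add: prime_chain_def)
 have "n = 0"
 proof (rule ccontr)
  assume "n \<noteq> 0"
  then have "p 0 \<subset> p 1" "p 1 \<subseteq> \<qq>" using 0(4) sub[of 1] by (auto simp: prime_chain_def)
  then show False using 0(5) by blast
 qed
 then show ?case using sub[of 0] 0(5) by (auto simp: regular_seq_mod_def)
next
 case (Suc d)
 interpret R: cring R by (rule R)
 interpret q: ideal \<qq> R by (rule Suc.prems(1))
 define \<mm> where "\<mm> = seq_ideal R \<qq> x (Suc d)"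
 have loc: "local_maximal R \<mm>" using Suc.prems(3) by (simp add: \<mm>_def)
 note mp = local_maximal_prime[OF R loc]
 have x0: "x 0 \<in> carrier R" using Suc.prems(2) by simp
 have xm: "x 0 \<in> \<mm>" unfolding \<mm>_def by (rule seq_ideal_ideal(3)[OF R Suc.prems(1,2)]) auto
 let ?q = "adjoin_ideal R \<qq> (x 0)"
 note q' = adjoin_ideal_ideal[OF R Suc.prems(1) x0]
 show ?case
 proof (cases n)
  case 0
  then show ?thesis by simp
 next
  case (Suc n')
  note pr = Suc.prems(4)[unfolded prime_chain_def]
  have pm: "p n \<subseteq> \<mm>" using ideal_subset_local_maximal[OF R loc] primeD[OF R, of "p n"] pr by simp
  \<comment> \<open>Replacing the top prime by \<mm> ensures that x_0 lies in the last member of the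
    chain.\<close>
  have c1: "prime_chain R (p(n := \<mm>)) n" unfolding prime_chain_def
  proof (intro conjI allI impI)
   show "primeideal ((p(n := \<mm>)) i) R" if "i \<le> n" for i using that pr mp by auto
   show "(p(n := \<mm>)) i \<subset> (p(n := \<mm>)) (Suc i)" if "i < n" for i
   proof (cases "Suc i = n")
    case True
    then have "p i \<subset> p n" using pr that by blast
    then show ?thesis using True pm by auto
   qed (use that pr in auto)
  qed
  obtain p' where p': "prime_chain R p' n" "p' 0 = p 0" "x 0 \<in> p' 1"
   using prime_chain_through[OF R noeth c1, of "x 0"] xm Suc by auto
  note pr' = p'(1)[unfolded prime_chain_def]
  have id1: "ideal (p' 1) R" using pr' Suc primeD(1)[OF R, of "p' 1"] by simp
  have "p' 0 \<subset> p' 1" using pr' Suc by simp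
  then have "?q \<subseteq> p' 1" using adjoin_ideal_least[OF R id1] p' Suc.prems(5) by blast
  moreover have "prime_chain R (\<lambda>i. p' (Suc i)) n'" using pr' Suc by (simp add: prime_chain_def)
  ultimately have IH: "n' \<le> d \<and> (n' = d --> ?q = p' 1 \<and> regular_seq_mod R ?q (\<lambda>i. x (Suc i)) d)"
   using Suc.IH[OF q'(1), of "\<lambda>i. x (Suc i)" "\<lambda>i. p' (Suc i)" n'] Suc.prems(2) loc
   unfolding \<mm>_def seq_ideal_shift by fastforce
  have "\<qq> = p 0 \<and> regular_seq_mod R \<qq> x (Suc d)" if nd: "n = Suc d"
  proof -
   have Q: "?q = p' 1" and reg: "regular_seq_mod R ?q (\<lambda>i. x (Suc i)) d" using IH nd Suc by auto
   define P where "P = p' 0"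
   have qP: "\<qq> \<subseteq> P" using p'(2) Suc.prems(5) by (simp add: P_def)
   have P: "primeideal P R" using pr' by (simp add: P_def)
   note P' = primeD[OF R P]
   interpret P: ideal P R by (rule P'(1))
   have Pq: "P \<subset> ?q" unfolding P_def Q using pr' Suc by simp
   have xP: "x 0 \<notin> P" using adjoin_ideal_least[OF R P'(1) qP, of "x 0"] Pq by blast
   obtain g r where g: "!!i. i < r ==> g i \<in> P"
    and gen: "!!a. a \<in> P ==> \<exists>v. (\<forall>i<r. v i \<in> carrier R) \<and> lin_comb (self_module R) g v r = a"
    using ideal_generators[OF R noeth P'(1)] by metis
   have gR: "g i \<in> carrier R" if "i < r" for i using P.Icarr[OF g[OF that]] .
   interpret m: ideal \<mm> R by (rule local_maximalD(1)[OF loc])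
   have "\<forall>i<r. g i \<in> saturation R \<mm> \<qq>"
   proof (rule local_nakayama[OF R mp Suc.prems(1) gR])
    fix i assume i: "i < r"
    obtain w b where w: "w \<in> \<qq>" "b \<in> carrier R" "g i = w \<oplus> b \<otimes> x 0"
     using adjoin_idealE[of "g i" R \<qq> "x 0"] g[OF i] Pq by blast
    have wR: "w \<in> carrier R" using w q.Icarr by simp
    have "b \<otimes> x 0 = \<ominus> w \<oplus> g i"
     unfolding w(3) using w(2) wR x0 by (simp add: R.a_assoc[symmetric] R.l_neg)
    then have "b \<otimes> x 0 \<in> P" using w(1) qP g[OF i] by auto
    then have "b \<in> P" using P'(4)[OF w(2) x0] xP by blast
    then obtain v where v: "\<forall>i<r. v i \<in> carrier R" "lin_comb (self_module R) g v r = b" using gen by blast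
    have "lin_comb (self_module R) g (\<lambda>j. x 0 \<otimes> v j) r = x 0 \<otimes> b"
     using lin_comb_smult[OF self_module_is_module[OF R], of r g v "x 0"] gR v x0 by simp
    then have eq: "\<one> \<otimes> g i = w \<oplus> lin_comb (self_module R) g (\<lambda>j. x 0 \<otimes> v j) r"
     using w x0 gR[OF i] by (simp add: R.m_comm)
    have one: "\<one> \<in> carrier R - \<mm>" using local_maximalD(2)[OF loc] by simp
    have xv: "\<forall>j<r. x 0 \<otimes> v j \<in> \<mm>" using v(1) xm m.I_r_closed by simp
    show "\<exists>s\<in>carrier R - \<mm>. \<exists>\<kappa>\<in>\<qq>. \<exists>p. (\<forall>j<r. p j \<in> \<mm>) \<and>
      s \<otimes> g i = \<kappa> \<oplus> lin_comb (self_module R) g p r"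
     by (rule bexI[OF _ one], rule bexI[OF _ w(1)], rule exI) (rule conjI[OF xv eq])
   qed
   then have "g i \<in> \<qq>" if "i < r" for i
    using saturation_local_maximal[OF R loc Suc.prems(1)] that by blast
   then have "P \<subseteq> \<qq>"
    using gen lin_comb_closed[OF self_module_is_module[OF R], of \<qq> r g] Suc.prems(1) submodule_self_iff[OF R]
    by blast
   then have qP: "\<qq> = P" using qP by blast
   have "a \<in> seq_ideal R \<qq> x i" if "i < Suc d" "a \<in> carrier R" "x i \<otimes> a \<in> seq_ideal R \<qq> x i" for i a
   proof (cases i)
    case 0
    then show ?thesis using that P'(4)[OF x0 that(2)] xP qP by simp
   next
    case (Suc j)
    then show ?thesis
     using that reg unfolding regular_seq_mod_def seq_ideal_shift by simp
   qed
   then show ?thesis using qP p'(2) by (simp add: regular_seq_mod_def P_def)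
  qed
  then show ?thesis using IH unfolding Suc Suc_le_mono nat.inject by blast
 qed
qed

lemma noetherian_local_maximal:
 fixes R (structure) assumes loc: "noetherian_local_ring R" and M: "maximalideal M R"
 shows "local_maximal R M"
proof -
 have R: "cring R" and noeth: "noetherian_ring R" and uniq: "!!N. maximalideal N R ==> N = M"
  using loc M by (auto simp: noetherian_local_ring_def)
 interpret R: cring R by (rule R)
 interpret M: maximalideal M R by (rule M)
 have "a \<in> Units R" if a: "a \<in> carrier R" "a \<notin> M" for a
 proof (rule ccontr)
  assume nu: "a \<notin> Units R"
  let ?T = "{\<aa>. ideal \<aa> R \<and> \<aa> \<noteq> carrier R \<and> a \<in> \<aa>}"
  note ga = R.cgenideal_ideal[OF a(1)]
  have "PIdl a \<noteq> carrier R"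
  proof
   assume "PIdl a = carrier R"
   then have "\<one> \<in> PIdl a" by simp
   then obtain b where "b \<in> carrier R" "\<one> = b \<otimes> a" by (auto simp: cgenideal_def)
   then show False using nu a by (auto simp: Units_def R.m_comm)
  qed
  then have "?T \<noteq> {}" using ga R.cgenideal_self[OF a(1)] by blast
  then obtain N where N: "N \<in> ?T" "!!H. H \<in> ?T ==> N \<subseteq> H ==> H = N"
   by (rule noetherian_maximal_ideal_in[OF noeth]) auto
  have "maximalideal N R"
  proof (rule maximalidealI)
   show "ideal N R" "carrier R \<noteq> N" using N(1) by auto
   show "J = N \<or> J = carrier R" if "ideal J R" "N \<subseteq> J" "J \<subseteq> carrier R" for J using N that by blast
  qed
  then show False using uniq N(1) a by blast
 qed
 then show ?thesis using M.ideal_axioms M.I_notcarr by (auto simp: local_maximal_def)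
qed

lemma regular_local_ring_regular_seq:
 fixes R (structure) assumes reg: "regular_local_ring R"
 obtains x d where "!!i. i < d ==> x i \<in> carrier R" "local_maximal R (seq_ideal R {\<zero>} x d)"
  "regular_seq_mod R {\<zero>} x d"
proof -
 obtain S where loc: "noetherian_local_ring R" and S: "S \<subseteq> carrier R" "finite S"
  "maximalideal (genideal R S) R" "enat (card S) = krull_dim R"
  using reg by (auto simp: regular_local_ring_def)
 have R: "cring R" and noeth: "noetherian_ring R" using loc by (auto simp: noetherian_local_ring_def)
 interpret R: cring R by (rule R)
 define d where "d = card S"
 obtain x where "bij_betw x {0..<d} S" using ex_bij_betw_nat_finite[OF S(2)] d_def by blast
 then have xS: "S = x ` {..<d}" by (simp add: bij_betw_def lessThan_atLeast0)
 have xc: "x i \<in> carrier R" if "i < d" for i using that xS S(1) by auto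
 note si = seq_ideal_ideal[OF R R.zeroideal xc]
 have "genideal R S = seq_ideal R {\<zero>} x d"
 proof
  show "genideal R S \<subseteq> seq_ideal R {\<zero>} x d" by (rule R.genideal_minimal[OF si(1)]) (use si(3) xS in auto)
  have g: "ideal (genideal R S) R" "S \<subseteq> genideal R S" using R.genideal_ideal R.genideal_self S(1) by auto
  interpret g: ideal "genideal R S" R by (rule g(1))
  show "seq_ideal R {\<zero>} x d \<subseteq> genideal R S"
   by (rule adjoin_seq_least[OF self_module_is_module[OF R]]) (use g xc submodule_self_iff[OF R] xS R.zeroideal g.zero_closed in auto)
 qed
 then have max: "maximalideal (seq_ideal R {\<zero>} x d) R" using S(3) by simp
 note lm = noetherian_local_maximal[OF loc this]
 \<comment> \<open>\<open>krull_dim\<close> is a supremum: as it exceeds d - 1, some chain has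
   length at least d, and its initial part is taken.\<close>
 obtain p where p: "prime_chain R p d"
 proof (cases d)
  case 0
  then show ?thesis
   using that[of "\<lambda>_. seq_ideal R {\<zero>} x d"] local_maximal_prime[OF R lm] by (simp add: prime_chain_def)
 next
  case (Suc e)
  then have "enat e < krull_dim R" using S(4)[folded d_def, symmetric] by simp
  then obtain p n where p: "e < n" "prime_chain R p n"
   unfolding krull_dim_def less_Sup_iff prime_chain_def by auto
  then show ?thesis using that[of p] Suc by (simp add: prime_chain_def)
 qed
 have "{\<zero>} \<subseteq> p 0" using p primeD(1)[OF R, of "p 0"] additive_subgroup.zero_closed[OF ideal.axioms(1)]
  by (auto simp: prime_chain_def)
 then have "regular_seq_mod R {\<zero>} x d"
  using maximal_chain_regular_seq[OF R noeth R.zeroideal xc lm p] by blast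
 then show ?thesis using that[OF xc lm] by blast
qed

section \<open>From a vanishing Ext^1 to finite injective dimension, and extension by dual
  elements\<close>

lemma short_exact_hom_extends:
 assumes C: "module R C" and E: "module R E"
  and ex: "short_exact R C E D \<iota> \<delta>" and I: "ideal I R" and IC: "hom_extends R I C"
 shows "hom_extends R I (sub_mod E (mod_ker E D \<delta>))"
 unfolding hom_extends_def
proof
 interpret C: module R C by fact
 interpret I: ideal I R by fact
 note ex' = short_exactD[OF ex]
 note \<iota> = mod_homD[OF ex'(1)]
 fix f assume f: "f \<in> mod_hom R (ideal_mod R I) (sub_mod E (mod_ker E D \<delta>))"
 note f' = mod_homD[OF f]
 have "\<exists>c\<in>carrier C. \<iota> c = f x" if "x \<in> I" for x using f'(1)[of x] that ex'(5) by auto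
 then obtain g where g: "!!x. x \<in> I ==> g x \<in> carrier C" "!!x. x \<in> I ==> \<iota> (g x) = f x" by metis
 have inj: "c = c'" if "c \<in> carrier C" "c' \<in> carrier C" "\<iota> c = \<iota> c'" for c c'
  using inj_onD[OF ex'(2)] that by blast
 have "g \<in> mod_hom R (ideal_mod R I) C"
 proof (rule mod_homI)
  show "g x \<in> carrier C" if "x \<in> carrier (ideal_mod R I)" for x using g that by simp
  show "g (x \<oplus>\<^bsub>ideal_mod R I\<^esub> y) = g x \<oplus>\<^bsub>C\<^esub> g y"
   if "x \<in> carrier (ideal_mod R I)" "y \<in> carrier (ideal_mod R I)" for x y
   by (rule inj) (insert that g \<iota> f'(2)[OF that], simp_all)
  show "g (a \<odot>\<^bsub>ideal_mod R I\<^esub> x) = a \<odot>\<^bsub>C\<^esub> g x" if "a \<in> carrier R" "x \<in> carrier (ideal_mod R I)" for a x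
   by (rule inj) (insert that g \<iota> f'(3)[OF that] I.I_l_closed, simp_all)
 qed
 then obtain e where e: "e \<in> carrier C" "\<forall>a\<in>I. g a = a \<odot>\<^bsub>C\<^esub> e" using hom_extendsD[OF IC] by blast
 have "f a = a \<odot>\<^bsub>E\<^esub> \<iota> e" if "a \<in> I" for a using g(2)[OF that] e that \<iota>(3)[of a e] I.Icarr by simp
 then show "\<exists>e\<in>carrier (sub_mod E (mod_ker E D \<delta>)). \<forall>a\<in>I. f a = a \<odot>\<^bsub>sub_mod E (mod_ker E D \<delta>)\<^esub> e"
  using e(1) ex'(5) by auto
qed

text \<open>At the step where the chain first leaves \<cc> an element s is adjoined with I s in the
  previous ideal, hence in \<cc>. This supplies the condition \<open>nil\<close> of
  \<open>baer_of_hom_extends\<close>.\<close>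

lemma quotient_chain_quasi_nilpotent:
 assumes "quotient_chain R I \<aa> \<bb>" and R: "cring R" and c: "ideal \<cc> R" and "\<aa> \<subseteq> \<cc>" "\<not> \<bb> \<subseteq> \<cc>"
 shows "\<exists>s\<in>carrier R - \<cc>. \<forall>c\<in>I. c \<otimes>\<^bsub>R\<^esub> s \<in> \<cc>"
 using assms(1,5)
proof induction
 case refl
 then show ?case using assms(4) by blast
next
 case (step \<bb> s)
 show ?case
 proof (cases "\<bb> \<subseteq> \<cc>")
  case True
  then have "s \<notin> \<cc>" using step adjoin_ideal_least[OF R c True] by blast
  then show ?thesis using step(2,3) True by (auto simp: colon_def)
 qed (use step in blast)
qed

theorem finite_self_injective_dimension_descent:
 fixes R :: "'a ring" (structure) and A :: "'b ring" and k :: "'k ring"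
 assumes hom: "surjective_ring_hom R A \<phi>" and I: "I = surjective_ring_hom.K R A \<phi>"
  and noeth: "noetherian_ring R" and reg: "regular_local_ring A"
  and k: "field k" and \<kappa>: "\<kappa> \<in> ring_hom k R"
  and chain: "quotient_chain R I {\<zero>} I" "quotient_chain R I I (carrier R)"
  and ext: "hom_extends R I (self_module R)"
 shows "finite_self_injective_dimension R"
proof -
 interpret surjective_ring_hom R A \<phi> by (rule hom)
 have R: "cring R" ..
 have A: "cring A" ..
 note Ii = K_ideal[folded I]
 let ?C = "cosyzygy k \<kappa> R" and ?E = "envelope k \<kappa> R"
 note C = cosyzygy_is_module[OF R k \<kappa>] and E = cosyzygy_envelope(1,2)[OF R k \<kappa>]
  and ex = cosyzygy_envelope(3)[OF R k \<kappa>]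
 \<comment> \<open>The vanishing of Ext^1(A, -) passes from R up to every cosyzygy; this keeps the
   torsion sequences exact and lets the last step reduce to ideals containing I.\<close>
 have IC: "hom_extends R I (?C i)" for i
 proof (induction i)
  case 0
  show ?case
   using baer_transport[OF self_module_is_module[OF R] _ ext, of "\<lambda>a. {[a]}"] by (simp add: inj_on_def)
 next
  case (Suc i)
  show ?case
   by (rule hom_extends_cokernel[OF chain(1) R Ii E(1) C short_exactD(3,4)[OF ex]])
    (insert E(2) Ii short_exact_hom_extends[OF C E(1) ex Ii Suc], auto simp: baer_def)
 qed
 obtain d x where x: "!!i. i < d ==> x i \<in> carrier A" "local_maximal A (seq_ideal A {\<zero>\<^bsub>A\<^esub>} x d)"
  "regular_seq_mod A {\<zero>\<^bsub>A\<^esub>} x d"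
  by (rule regular_local_ring_regular_seq[OF reg], rule that)
 have nA: "noetherian_ring A" using reg by (simp add: regular_local_ring_def noetherian_local_ring_def)
 have bA: "baer A (descend \<phi> R A (?C d))"
 proof (rule regular_baer_cosyzygy[OF A nA x(2) _ x(3)])
  show "Module.module A (descend \<phi> R A (?C i))" "Module.module A (descend \<phi> R A (?E i))"
   "baer A (descend \<phi> R A (?E i))" for i
   by (rule descend_mod[OF C] descend_mod[OF E(1)] descend_baer[OF E])+
  show "short_exact A (descend \<phi> R A (?C i)) (descend \<phi> R A (?E i)) (descend \<phi> R A (?C (Suc i)))
    (envelope_in k \<kappa> R i) (envelope_out k \<kappa> R i)" for i
   by (rule descend_short_exact[OF C E(1) C ex IC[unfolded I]])
 qed (rule x(1))
 have "baer R (?C d)"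
 proof (rule baer_of_hom_extends[OF R noeth C Ii IC])
  show "\<exists>e\<in>carrier (?C d). \<forall>b\<in>\<bb>. f b = b \<odot>\<^bsub>?C d\<^esub> e"
   if "ideal \<bb> R" "I \<subseteq> \<bb>" "f \<in> mod_hom R (ideal_mod R \<bb>) (?C d)" "!!c. c \<in> I ==> f c = \<zero>\<^bsub>?C d\<^esub>" for \<bb> f
   using hom_of_descend_baer[OF C bA] that I by blast
  show "\<exists>s\<in>carrier R - \<aa>. \<forall>c\<in>I. c \<otimes> s \<in> \<aa>" if a: "ideal \<aa> R" "\<aa> \<noteq> carrier R" for \<aa>
  proof (rule quotient_chain_quasi_nilpotent[OF quotient_chain_trans[OF chain(2,1)] R a(1)])
   interpret a: ideal \<aa> R by (rule a(1))
   show "{\<zero>} \<subseteq> \<aa>" by simp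
   show "\<not> carrier R \<subseteq> \<aa>" using a(2) a.a_subset by blast
  qed
 qed
 then show ?thesis by (rule finite_self_injective_dimensionI[OF R k \<kappa>])
qed

text \<open>A multiplication by e that is right on \<aa> fails at s by an error that the colon ideal
  annihilates. By \<open>soc\<close> the error is c t s, and since t kills \<aa>, the element e + c
  t repairs the value at s without spoiling \<aa>.\<close>

lemma hom_extends_adjoin_dual:
 fixes R :: "'a ring" (structure)
 assumes R: "cring R" and a: "ideal \<aa> R" and ext: "hom_extends R \<aa> (self_module R)" and s: "s \<in> carrier R"
  and t: "t \<in> carrier R" "!!a. a \<in> \<aa> ==> t \<otimes> a = \<zero>"
  and soc: "!!a. a \<in> carrier R ==> (!!c. c \<in> colon R \<aa> s ==> c \<otimes> a = \<zero>) ==> \<exists>c\<in>carrier R. a = c \<otimes> (t \<otimes> s)"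
 shows "hom_extends R (adjoin_ideal R \<aa> s) (self_module R)"
 unfolding hom_extends_def
proof
 interpret R: cring R by (rule R)
 interpret a: ideal \<aa> R by (rule a)
 note ad = adjoin_ideal_ideal[OF R a s]
 fix f assume f: "f \<in> mod_hom R (ideal_mod R (adjoin_ideal R \<aa> s)) (self_module R)"
 note f' = mod_homD[OF f, simplified]
 have "f \<in> mod_hom R (ideal_mod R \<aa>) (self_module R)"
  by (rule mod_homI) (insert f' ad(2), simp_all add: subset_iff)
 then obtain e where e: "e \<in> carrier R" "!!a. a \<in> \<aa> ==> f a = a \<otimes> e"
  using hom_extendsD[OF ext] unfolding self_module_simps by blast
 have fs: "f s \<in> carrier R" using f'(1) ad(3) by blast
 obtain c where c: "c \<in> carrier R" "f s \<ominus> s \<otimes> e = c \<otimes> (t \<otimes> s)"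
 proof (rule bexE[OF soc])
  show "f s \<ominus> s \<otimes> e \<in> carrier R" using fs s e by simp
  fix b assume b: "b \<in> colon R \<aa> s"
  then have b': "b \<in> carrier R" "b \<otimes> s \<in> \<aa>" by (auto simp: colon_def)
  have "b \<otimes> f s = f (b \<otimes> s)" using f'(3)[of b s] b' ad(3) by simp
  also have "\<dots> = b \<otimes> (s \<otimes> e)" using e b' s by (simp add: R.m_assoc)
  finally show "b \<otimes> (f s \<ominus> s \<otimes> e) = \<zero>"
   using b' fs s e by (simp add: a_minus_def R.r_distr R.r_minus R.r_neg)
 qed blast
 define e' where "e' = e \<oplus> c \<otimes> t"
 have e': "e' \<in> carrier R" using e c t by (simp add: e'_def)
 have fs': "f s = s \<otimes> e'"
 proof -
  have "f s = (f s \<ominus> s \<otimes> e) \<oplus> s \<otimes> e" using fs s e by (simp add: a_minus_def R.a_assoc R.l_neg)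
  then show ?thesis unfolding c(2) e'_def using c(1) t(1) s e by (simp add: R.r_distr R.m_ac R.a_ac)
 qed
 have fa: "f a = a \<otimes> e'" if "a \<in> \<aa>" for a
 proof -
  have "a \<otimes> (c \<otimes> t) = c \<otimes> (t \<otimes> a)" using a.Icarr[OF that] c t by (simp add: R.m_ac)
  then show ?thesis using e that t c a.Icarr[OF that] by (simp add: e'_def R.r_distr)
 qed
 show "\<exists>e\<in>carrier (self_module R). \<forall>a\<in>adjoin_ideal R \<aa> s. f a = a \<odot>\<^bsub>self_module R\<^esub> e"
 proof (intro bexI ballI)
  show "e' \<in> carrier (self_module R)" using e' by simp
  fix b assume "b \<in> adjoin_ideal R \<aa> s"
  then obtain w r where w: "w \<in> \<aa>" "r \<in> carrier R" "b = w \<oplus> r \<otimes> s" by (rule adjoin_idealE)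
  have "r \<otimes> s \<in> adjoin_ideal R \<aa> s" using ideal.I_l_closed[OF ad(1) ad(3) w(2)] .
  then have "f b = f w \<oplus> r \<otimes> f s" unfolding w(3) using f'(2,3) w ad by (simp add: subset_iff)
  then show "f b = b \<odot>\<^bsub>self_module R\<^esub> e'"
   using fa[OF w(1)] fs' w s e' a.Icarr by (simp add: R.l_distr R.m_assoc)
 qed
qed

text \<open>Of a basis of V/W over R/I only its effect on the partial sums is recorded, in the form
  that \<open>quotient_chain\<close> takes: each new element contributes one copy of R/I.\<close>

definition quotient_basis :: "'a ring => 'a set => 'a set => 'a set => (nat => 'a) => nat => bool" where
 "quotient_basis R I W V g n \<longleftrightarrow> (\<forall>j<n. g j \<in> carrier R) \<and>
  (\<forall>j<n. colon R (seq_ideal R W g j) (g j) = I) \<and> seq_ideal R W g n = V"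

lemma quotient_basisD:
 assumes "quotient_basis R I W V g n"
 shows "j < n ==> g j \<in> carrier R" "j < n ==> colon R (seq_ideal R W g j) (g j) = I" "seq_ideal R W g n = V"
 using assms by (auto simp: quotient_basis_def)

lemma quotient_basis_chain:
 assumes "quotient_basis R I W V g n" "i \<le> n"
 shows "quotient_chain R I (seq_ideal R W g i) V"
proof -
 have "quotient_chain R I (seq_ideal R W g i) (seq_ideal R W g j)" if "i \<le> j" "j \<le> n" for j
  using that by (induction j rule: dec_induct)
   (auto intro!: quotient_chain.intros quotient_basisD(1,2)[OF assms(1)])
 then show ?thesis using assms(2) quotient_basisD(3)[OF assms(1)] by blast
qed

section \<open>Stalks of ringed spaces\<close>

text \<open>That stalks are commutative rings is an assumption, because the conditions on local
  rings provide it in the application; what has to be shown is that germs respect the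
  operations.\<close>

locale ringed =
 fixes S :: "('p, 'r) ringed_space"
 assumes rs: "is_ringed_space S"
  and stalk_cring: "!!x. x \<in> topspace (space_of S) ==> cring (stalk S x)"
begin

abbreviation opn where "opn \<equiv> openin (space_of S)"
abbreviation sec where "sec U \<equiv> carrier (sect S U)"
abbreviation "B \<equiv> stalk S"
abbreviation stalk_mult ("_ \<otimes>\<^sub>_ _" [70, 1000, 71] 70) where "s \<otimes>\<^sub>x t \<equiv> s \<otimes>\<^bsub>B x\<^esub> t"
abbreviation stalk_add ("_ \<oplus>\<^sub>_ _" [65, 1000, 66] 65) where "s \<oplus>\<^sub>x t \<equiv> s \<oplus>\<^bsub>B x\<^esub> t"
abbreviation stalk_zero ("\<zero>\<^sub>_") where "\<zero>\<^sub>x \<equiv> \<zero>\<^bsub>B x\<^esub>"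
abbreviation stalk_one ("\<one>\<^sub>_") where "\<one>\<^sub>x \<equiv> \<one>\<^bsub>B x\<^esub>"

lemma sect_cring: "opn U ==> cring (sect S U)"
 using rs by (simp add: is_ringed_space_def)

lemma restr_hom: "opn U ==> opn V ==> V \<subseteq> U ==> restr S U V \<in> ring_hom (sect S U) (sect S V)"
 using rs by (simp add: is_ringed_space_def opens_in_def)

lemma restr_simps [simp]:
 assumes "opn U" "opn V" "V \<subseteq> U"
 shows "s \<in> sec U ==> restr S U V s \<in> sec V"
  "s \<in> sec U ==> t \<in> sec U ==> restr S U V (s \<oplus>\<^bsub>sect S U\<^esub> t) = restr S U V s \<oplus>\<^bsub>sect S V\<^esub> restr S U V t"
  "s \<in> sec U ==> t \<in> sec U ==> restr S U V (s \<otimes>\<^bsub>sect S U\<^esub> t) = restr S U V s \<otimes>\<^bsub>sect S V\<^esub> restr S U V t"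
  "restr S U V \<one>\<^bsub>sect S U\<^esub> = \<one>\<^bsub>sect S V\<^esub>" "restr S U V \<zero>\<^bsub>sect S U\<^esub> = \<zero>\<^bsub>sect S V\<^esub>"
 using restr_hom[OF assms] ring_hom_zero[OF restr_hom[OF assms]] assms cring.axioms(1)[OF sect_cring]
 by (simp_all add: ring_hom_closed ring_hom_add ring_hom_mult ring_hom_one)

lemma restr_trans [simp]:
 "opn U ==> opn V ==> V \<subseteq> U ==> s \<in> sec U ==> W \<subseteq> V ==> opn W ==> restr S V W (restr S U V s) = restr S U W s"
 using rs by (simp add: is_ringed_space_def opens_in_def)

lemma restr_id [simp]: "opn U ==> s \<in> sec U ==> restr S U U s = s"
 using rs by (simp add: is_ringed_space_def)

lemma restr_eq_mono:
 assumes "restr S U W s = restr S V W t" "opn U" "opn V" "opn W" "W \<subseteq> U" "W \<subseteq> V" "s \<in> sec U" "t \<in> sec V"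
  "opn W'" "W' \<subseteq> W"
 shows "restr S U W' s = restr S V W' t"
 using restr_trans[of U W s W'] restr_trans[of V W t W'] assms by simp

lemma germ_eq_iff:
 assumes "opn U" "opn V" "x \<in> U" "x \<in> V" "s \<in> sec U" "t \<in> sec V"
 shows "germ S x U s = germ S x V t \<longleftrightarrow>
  (\<exists>W. opn W \<and> x \<in> W \<and> W \<subseteq> U \<and> W \<subseteq> V \<and> restr S U W s = restr S V W t)" (is "_ \<longleftrightarrow> ?R")
proof
 assume "germ S x U s = germ S x V t"
 moreover have "(V, t) \<in> germ S x V t" using assms by (auto simp: germ_def nhds_in_def)
 ultimately have "(V, t) \<in> germ S x U s" by simp
 then show ?R by (auto simp: germ_def nhds_in_def)
next
 have *: "germ S x U s \<subseteq> germ S x V t" if "opn U" "opn V" "s \<in> sec U" "t \<in> sec V"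
  "opn W" "x \<in> W" "W \<subseteq> U" "W \<subseteq> V" "restr S U W s = restr S V W t" for U V s t W
 proof clarify
  fix V' t' assume "(V', t') \<in> germ S x U s"
  then obtain W' where W': "opn V'" "x \<in> V'" "t' \<in> sec V'" "opn W'" "x \<in> W'" "W' \<subseteq> U" "W' \<subseteq> V'"
   "restr S U W' s = restr S V' W' t'" by (auto simp: germ_def nhds_in_def)
  let ?W = "W \<inter> W'"
  have o: "opn ?W" using that W' by blast
  have "restr S V ?W t = restr S V' ?W t'"
   using restr_eq_mono[OF that(9), of ?W] restr_eq_mono[OF W'(8), of ?W] that W' o by auto
  then show "(V', t') \<in> germ S x V t"
   using W' that o unfolding germ_def nhds_in_def by (auto intro!: exI[of _ ?W])
 qed
 assume ?R
 then obtain W where "opn W" "x \<in> W" "W \<subseteq> U" "W \<subseteq> V" "restr S U W s = restr S V W t" by blast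
 then show "germ S x U s = germ S x V t" using *[of U V s t W] *[of V U t s W] assms by auto
qed

lemma germ_restr [simp]:
 "opn U ==> opn V ==> V \<subseteq> U ==> x \<in> V ==> s \<in> sec U ==> germ S x V (restr S U V s) = germ S x U s"
 by (subst germ_eq_iff) auto

lemma germ_closed [simp]: "opn U ==> x \<in> U ==> s \<in> sec U ==> germ S x U s \<in> carrier (B x)"
 by (auto simp: stalk_def)

lemma stalkE:
 assumes "b \<in> carrier (B x)" "opn N" "x \<in> N"
 obtains U s where "opn U" "x \<in> U" "U \<subseteq> N" "s \<in> sec U" "b = germ S x U s"
proof -
 obtain U s where U: "opn U" "x \<in> U" "s \<in> sec U" "b = germ S x U s" using assms by (auto simp: stalk_def)
 show ?thesis
  by (rule that[of "U \<inter> N" "restr S U (U \<inter> N) s"]) (use U assms openin_Int[OF U(1) assms(2)] in auto)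
qed

text \<open>The stalk operations are described over all representatives. Uniqueness is proved once,
  for any operation that commutes with restriction, by shrinking to a neighbourhood where two
  choices of representatives agree.\<close>

lemma germ_op:
 assumes U: "opn U" "x \<in> U" "s \<in> sec U" "t \<in> sec U"
  and f: "!!U s t. opn U ==> s \<in> sec U ==> t \<in> sec U ==> f U s t \<in> sec U"
  and fr: "!!U V s t. opn U ==> opn V ==> V \<subseteq> U ==> s \<in> sec U ==> t \<in> sec U ==>
   restr S U V (f U s t) = f V (restr S U V s) (restr S U V t)"
 shows "(THE C. \<exists>V s' t'. opn V \<and> x \<in> V \<and> s' \<in> sec V \<and> t' \<in> sec V \<and>
  germ S x U s = germ S x V s' \<and> germ S x U t = germ S x V t' \<and> C = germ S x V (f V s' t')) = germ S x U (f U s t)"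
proof (rule the_equality)
 show "\<exists>V s' t'. opn V \<and> x \<in> V \<and> s' \<in> sec V \<and> t' \<in> sec V \<and>
  germ S x U s = germ S x V s' \<and> germ S x U t = germ S x V t' \<and> germ S x U (f U s t) = germ S x V (f V s' t')"
  using U by blast
 fix C assume "\<exists>V s' t'. opn V \<and> x \<in> V \<and> s' \<in> sec V \<and> t' \<in> sec V \<and>
  germ S x U s = germ S x V s' \<and> germ S x U t = germ S x V t' \<and> C = germ S x V (f V s' t')"
 then obtain V s' t' where V: "opn V" "x \<in> V" "s' \<in> sec V" "t' \<in> sec V"
  "germ S x U s = germ S x V s'" "germ S x U t = germ S x V t'" "C = germ S x V (f V s' t')" by blast
 obtain W where W: "opn W" "x \<in> W" "W \<subseteq> U" "W \<subseteq> V" "restr S U W s = restr S V W s'"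
  using V U germ_eq_iff[of U V x s s'] by auto
 obtain W' where W': "opn W'" "x \<in> W'" "W' \<subseteq> U" "W' \<subseteq> V" "restr S U W' t = restr S V W' t'"
  using V U germ_eq_iff[of U V x t t'] by auto
 let ?W = "W \<inter> W'"
 have o: "opn ?W" using W W' by blast
 have 1: "restr S U ?W s = restr S V ?W s'" by (rule restr_eq_mono[OF W(5)]) (use U V W o in auto)
 have 2: "restr S U ?W t = restr S V ?W t'" by (rule restr_eq_mono[OF W'(5)]) (use U V W' o in auto)
 have "restr S V ?W (f V s' t') = f ?W (restr S V ?W s') (restr S V ?W t')" by (rule fr) (use V W W' o in auto)
 also have "\<dots> = restr S U ?W (f U s t)" unfolding 1[symmetric] 2[symmetric] by (rule fr[symmetric]) (use U W W' o in auto)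
 finally show "C = germ S x U (f U s t)"
  unfolding V(7) by (subst germ_eq_iff) (insert U V W W' o f, auto intro!: exI[of _ ?W])
qed

lemma germ_simps:
 assumes U: "opn U" "x \<in> U" "s \<in> sec U" "t \<in> sec U"
 shows germ_add: "germ S x U (s \<oplus>\<^bsub>sect S U\<^esub> t) = germ S x U s \<oplus>\<^sub>x germ S x U t"
  and germ_mult: "germ S x U (s \<otimes>\<^bsub>sect S U\<^esub> t) = germ S x U s \<otimes>\<^sub>x germ S x U t"
 using germ_op[OF U, of "\<lambda>U s t. s \<oplus>\<^bsub>sect S U\<^esub> t"] germ_op[OF U, of "\<lambda>U s t. s \<otimes>\<^bsub>sect S U\<^esub> t"]
  cring.cring_simprules(1,5)[OF sect_cring]
 by (simp_all add: stalk_def)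

lemma germ_consts:
 assumes U: "opn U" "x \<in> U"
 shows germ_one: "germ S x U \<one>\<^bsub>sect S U\<^esub> = \<one>\<^sub>x"
  and germ_zero: "germ S x U \<zero>\<^bsub>sect S U\<^esub> = \<zero>\<^sub>x"
proof -
 let ?T = "topspace (space_of S)"
 interpret cring "sect S U" by (rule sect_cring[OF U(1)])
 interpret T: cring "sect S ?T" by (rule sect_cring) simp
 have "germ S x U \<one>\<^bsub>sect S U\<^esub> = germ S x ?T \<one>\<^bsub>sect S ?T\<^esub>" "germ S x U \<zero>\<^bsub>sect S U\<^esub> = germ S x ?T \<zero>\<^bsub>sect S ?T\<^esub>"
  using U openin_subset[OF U(1)] by (subst germ_eq_iff; force intro!: exI[of _ U])+
 then show "germ S x U \<one>\<^bsub>sect S U\<^esub> = \<one>\<^sub>x" "germ S x U \<zero>\<^bsub>sect S U\<^esub> = \<zero>\<^sub>x"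
  by (simp_all add: stalk_def)
qed

lemma germ_hom: "opn U ==> x \<in> U ==> germ S x U \<in> ring_hom (sect S U) (B x)"
 by (rule ring_hom_memI) (simp_all add: germ_simps germ_consts)

lemma opn_topspace: "opn U ==> x \<in> U ==> x \<in> topspace (space_of S)"
 using openin_subset by blast

lemma section_eqI:
 assumes U: "opn U" "s \<in> sec U" "t \<in> sec U" and eq: "!!x. x \<in> U ==> germ S x U s = germ S x U t"
 shows "s = t"
proof -
 have "\<exists>W. opn W \<and> x \<in> W \<and> W \<subseteq> U \<and> restr S U W s = restr S U W t" if "x \<in> U" for x
  using eq[OF that] germ_eq_iff[of U U x s t] U that by auto
 then obtain W where W: "!!x. x \<in> U ==> opn (W x) \<and> x \<in> W x \<and> W x \<subseteq> U \<and> restr S U (W x) s = restr S U (W x) t"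
  by metis
 have un: "\<Union>(W ` U) = U" using W by blast
 have "\<forall>\<U>. (\<forall>V\<in>\<U>. opn V) --> (\<forall>s\<in>sec (\<Union>\<U>). \<forall>t\<in>sec (\<Union>\<U>).
     (\<forall>V\<in>\<U>. restr S (\<Union>\<U>) V s = restr S (\<Union>\<U>) V t) --> s = t)"
  using rs unfolding is_ringed_space_def by blast
 from this[rule_format, of "W ` U"] show ?thesis unfolding un using W U by blast
qed

lemma germ_zeroE:
 assumes "opn U" "x \<in> U" "s \<in> sec U" "germ S x U s = \<zero>\<^sub>x"
 obtains W where "opn W" "x \<in> W" "W \<subseteq> U" "restr S U W s = \<zero>\<^bsub>sect S W\<^esub>"
proof -
 interpret cring "sect S U" by (rule sect_cring) fact
 have "germ S x U s = germ S x U \<zero>\<^bsub>sect S U\<^esub>" using assms germ_zero by simp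
 then show ?thesis using that assms germ_eq_iff[of U U x s "\<zero>\<^bsub>sect S U\<^esub>"] by auto
qed

end

lemma coset_facts:
 fixes R (structure) assumes R: "cring R" and G: "ideal G R" and a: "a \<in> carrier R"
 shows coset_mem_iff: "t \<in> G +> a \<longleftrightarrow> t \<in> carrier R \<and> t \<ominus> a \<in> G"
  and coset_eq: "t \<in> G +> a ==> G +> t = G +> a"
  and coset_self: "a \<in> G +> a"
proof -
 interpret cring R by (rule R)
 interpret G: ideal G R by (rule G)
 have mem: "t \<in> G +> a \<longleftrightarrow> t \<in> carrier R \<and> t \<ominus> a \<in> G" for t
 proof
  assume "t \<in> G +> a"
  then obtain g where "g \<in> G" "t = g \<oplus> a" by (auto simp: a_r_coset_def r_coset_def)
  then show "t \<in> carrier R \<and> t \<ominus> a \<in> G" using a G.Icarr by (simp add: a_minus_def a_assoc r_neg)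
 next
  assume t: "t \<in> carrier R \<and> t \<ominus> a \<in> G"
  then have "t = (t \<ominus> a) \<oplus> a" using a by (simp add: a_minus_def a_assoc l_neg)
  then show "t \<in> G +> a" using t unfolding a_r_coset_def r_coset_def by auto
 qed
 show "t \<in> G +> a \<longleftrightarrow> t \<in> carrier R \<and> t \<ominus> a \<in> G" by (rule mem)
 show "G +> t = G +> a" if "t \<in> G +> a"
  using G.a_repr_independence'[OF that a] by simp
 show "a \<in> G +> a" unfolding mem using a r_neg[OF a] by (simp add: a_minus_def)
qed

lemma coset_zero: "cring R ==> ideal G R ==> G +>\<^bsub>R\<^esub> \<zero>\<^bsub>R\<^esub> = G"
 by (simp add: abelian_group.a_coset_add_zero ring.is_abelian_group cring.axioms(1) additive_subgroup.a_subset ideal.axioms(1))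

section \<open>Ideal sheaves and their stalks\<close>

context ringed
begin

text \<open>The last clause makes membership local; it is what allows membership to be tested on
  germs in \<open>ideal_sheaf_memI\<close>.\<close>

definition ideal_sheaf where
 "ideal_sheaf F \<longleftrightarrow> (\<forall>U. opn U --> ideal (F U) (sect S U)) \<and>
  (\<forall>U V s. opn U \<and> opn V \<and> V \<subseteq> U \<and> s \<in> F U --> restr S U V s \<in> F V) \<and>
  (\<forall>U s. opn U \<and> s \<in> sec U \<and> (\<forall>x\<in>U. \<exists>V. opn V \<and> x \<in> V \<and> V \<subseteq> U \<and> restr S U V s \<in> F V) --> s \<in> F U)"

abbreviation st where
 "st F x \<equiv> ideal_stalk S F x"

lemma germ_in_st: "opn U ==> x \<in> U ==> s \<in> F U ==> germ S x U s \<in> st F x"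
 by (auto simp: ideal_stalk_def)

context
 fixes F :: "'p set => 'r set"
 assumes F: "ideal_sheaf F"
begin

lemma ideal_sheafD:
 "opn U ==> ideal (F U) (sect S U)" "opn U ==> s \<in> F U ==> s \<in> sec U"
 "opn U ==> opn V ==> V \<subseteq> U ==> s \<in> F U ==> restr S U V s \<in> F V"
 "opn U ==> s \<in> sec U ==> (!!x. x \<in> U ==> \<exists>V. opn V \<and> x \<in> V \<and> V \<subseteq> U \<and> restr S U V s \<in> F V) ==> s \<in> F U"
proof -
 show i: "opn U ==> ideal (F U) (sect S U)" using F by (simp add: ideal_sheaf_def)
 show "opn U ==> s \<in> F U ==> s \<in> sec U" by (rule ideal.Icarr[OF i])
 show "opn U ==> opn V ==> V \<subseteq> U ==> s \<in> F U ==> restr S U V s \<in> F V"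
  by (rule F[unfolded ideal_sheaf_def, THEN conjunct2, THEN conjunct1, rule_format]) (intro conjI)
 show "opn U ==> s \<in> sec U ==> (!!x. x \<in> U ==> \<exists>V. opn V \<and> x \<in> V \<and> V \<subseteq> U \<and> restr S U V s \<in> F V) ==> s \<in> F U"
  by (rule F[unfolded ideal_sheaf_def, THEN conjunct2, THEN conjunct2, rule_format]) (intro conjI ballI)
qed

lemma ideal_stalkE:
 assumes "b \<in> st F x" "opn N" "x \<in> N"
 obtains U s where "opn U" "x \<in> U" "U \<subseteq> N" "s \<in> F U" "s \<in> sec U" "b = germ S x U s"
proof -
 obtain U s where U: "opn U" "x \<in> U" "s \<in> F U" "b = germ S x U s" using assms by (auto simp: ideal_stalk_def)
 have o: "opn (U \<inter> N)" using U assms by blast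
 show ?thesis
  by (rule that[of "U \<inter> N" "restr S U (U \<inter> N) s"]) (use U assms o ideal_sheafD in auto)
qed

lemma germ_in_stD:
 assumes "germ S x U s \<in> st F x" "opn U" "x \<in> U" "s \<in> sec U"
 obtains V where "opn V" "x \<in> V" "V \<subseteq> U" "restr S U V s \<in> F V"
proof -
 obtain V t where V: "opn V" "x \<in> V" "V \<subseteq> U" "t \<in> F V" "t \<in> sec V" "germ S x U s = germ S x V t"
  by (rule ideal_stalkE[OF assms(1-3)])
 then obtain W where W: "opn W" "x \<in> W" "W \<subseteq> U" "W \<subseteq> V" "restr S U W s = restr S V W t"
  using germ_eq_iff[of U V x s t] assms by auto
 then show ?thesis using that[of W] V ideal_sheafD(3)[of V W t] by simp
qed

lemma ideal_sheaf_memI: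
 assumes "opn U" "s \<in> sec U" "!!x. x \<in> U ==> germ S x U s \<in> st F x"
 shows "s \<in> F U"
proof (rule ideal_sheafD(4)[OF assms(1,2)])
 fix x assume x: "x \<in> U"
 show "\<exists>V. opn V \<and> x \<in> V \<and> V \<subseteq> U \<and> restr S U V s \<in> F V"
  by (rule germ_in_stD[OF assms(3)[OF x] assms(1) x assms(2)]) blast
qed

lemma st_ideal:
 assumes x: "x \<in> topspace (space_of S)" shows "ideal (st F x) (B x)"
proof -
 let ?T = "topspace (space_of S)"
 have T: "opn ?T" by simp
 note R = stalk_cring[OF x]
 have car: "st F x \<subseteq> carrier (B x)"
 proof
  fix b assume "b \<in> st F x"
  then show "b \<in> carrier (B x)" by (rule ideal_stalkE[OF _ T x]) simp
 qed
 have smult: "a \<otimes>\<^sub>x b \<in> st F x" if a: "a \<in> carrier (B x)" and b: "b \<in> st F x" for a b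
 proof -
  obtain U s where U: "opn U" "x \<in> U" "s \<in> F U" "s \<in> sec U" "b = germ S x U s" by (rule ideal_stalkE[OF b T x])
  obtain V t where V: "opn V" "x \<in> V" "V \<subseteq> U" "t \<in> sec V" "a = germ S x V t" by (rule stalkE[OF a U(1,2)])
  let ?s = "restr S U V s"
  have s: "?s \<in> F V" "?s \<in> sec V" "germ S x V ?s = b" using U V ideal_sheafD(3) by auto
  have "t \<otimes>\<^bsub>sect S V\<^esub> ?s \<in> F V" using ideal.I_l_closed[OF ideal_sheafD(1)[OF V(1)]] s V by blast
  then show ?thesis using germ_in_st[OF V(1,2)] germ_mult[OF V(1,2) V(4) s(2)] s V(5) by metis
 qed
 have add: "a \<oplus>\<^sub>x b \<in> st F x" if a: "a \<in> st F x" and b: "b \<in> st F x" for a b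
 proof -
  obtain U s where U: "opn U" "x \<in> U" "s \<in> F U" "s \<in> sec U" "b = germ S x U s" by (rule ideal_stalkE[OF b T x])
  obtain V t where V: "opn V" "x \<in> V" "V \<subseteq> U" "t \<in> F V" "t \<in> sec V" "a = germ S x V t" by (rule ideal_stalkE[OF a U(1,2)])
  let ?s = "restr S U V s"
  have s: "?s \<in> F V" "?s \<in> sec V" "germ S x V ?s = b" using U V ideal_sheafD(3) by auto
  have "t \<oplus>\<^bsub>sect S V\<^esub> ?s \<in> F V"
   using additive_subgroup.a_closed[OF ideal.axioms(1)[OF ideal_sheafD(1)[OF V(1)]]] s V by blast
  then show ?thesis using germ_in_st[OF V(1,2)] germ_add[OF V(1,2) V(5) s(2)] s V(6) by metis
 qed
 have zero: "\<zero>\<^sub>x \<in> st F x"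
  using germ_in_st[OF T x, of "\<zero>\<^bsub>sect S ?T\<^esub>" F] germ_zero[OF T x]
   additive_subgroup.zero_closed[OF ideal.axioms(1)[OF ideal_sheafD(1)[OF T]]] by simp
 show ?thesis by (rule idealI'[OF R car zero add smult])
qed

end

end

section \<open>The surjection of structure sheaves and its kernel on stalks\<close>

locale ringed_surjection = Y: ringed Y + Z: ringed Z
 for Y :: "('p, 'r) ringed_space" and Z :: "('p, 's) ringed_space" +
 fixes \<pi> :: "'p set => 'r => 's"
 assumes space_eq: "space_of Z = space_of Y" and \<pi>_hom: "sheaf_of_rings_hom Y Z \<pi>"
  and \<pi>_surj: "!!U s x. openin (space_of Y) U ==> s \<in> carrier (sect Z U) ==> x \<in> U ==>
   \<exists>V\<in>nhds_in Y U x. restr Z U V s \<in> \<pi> V ` carrier (sect Y V)"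
begin
abbreviation "opn \<equiv> Y.opn"
abbreviation "st \<equiv> Y.st"
abbreviation "T \<equiv> topspace (space_of Y)"
abbreviation "I \<equiv> kernel_sheaf Y Z \<pi>"
abbreviation "B \<equiv> stalk Y"
abbreviation Y_mult ("_ \<otimes>\<^sub>_ _" [70, 1000, 71] 70) where "s \<otimes>\<^sub>x t \<equiv> s \<otimes>\<^bsub>B x\<^esub> t"
abbreviation Y_add ("_ \<oplus>\<^sub>_ _" [65, 1000, 66] 65) where "s \<oplus>\<^sub>x t \<equiv> s \<oplus>\<^bsub>B x\<^esub> t"
abbreviation Y_minus ("_ \<ominus>\<^sub>_ _" [65, 1000, 66] 65) where "s \<ominus>\<^sub>x t \<equiv> s \<ominus>\<^bsub>B x\<^esub> t"
abbreviation Y_coset ("_ +>\<^sub>_ _" [60, 1000, 61] 60) where "A +>\<^sub>x t \<equiv> A +>\<^bsub>B x\<^esub> t"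
abbreviation Y_zero ("\<zero>\<^sub>_") where "\<zero>\<^sub>x \<equiv> \<zero>\<^bsub>B x\<^esub>"
abbreviation Y_one ("\<one>\<^sub>_") where "\<one>\<^sub>x \<equiv> \<one>\<^bsub>B x\<^esub>"

lemma Z_opn [simp]: "Z.opn = opn"
 by (simp add: space_eq)

lemma \<pi>_simps [simp]:
 assumes "opn U"
 shows "s \<in> Y.sec U ==> \<pi> U s \<in> Z.sec U"
  "s \<in> Y.sec U ==> t \<in> Y.sec U ==> \<pi> U (s \<oplus>\<^bsub>sect Y U\<^esub> t) = \<pi> U s \<oplus>\<^bsub>sect Z U\<^esub> \<pi> U t"
  "s \<in> Y.sec U ==> t \<in> Y.sec U ==> \<pi> U (s \<otimes>\<^bsub>sect Y U\<^esub> t) = \<pi> U s \<otimes>\<^bsub>sect Z U\<^esub> \<pi> U t"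
  "\<pi> U \<one>\<^bsub>sect Y U\<^esub> = \<one>\<^bsub>sect Z U\<^esub>"
  "opn V ==> V \<subseteq> U ==> s \<in> Y.sec U ==> \<pi> V (restr Y U V s) = restr Z U V (\<pi> U s)"
 using \<pi>_hom assms
 by (auto simp: sheaf_of_rings_hom_def opens_in_def ring_hom_closed ring_hom_add ring_hom_mult ring_hom_one)

lemma kernel_iff: "opn U ==> s \<in> I U \<longleftrightarrow> s \<in> Y.sec U \<and> \<pi> U s = \<zero>\<^bsub>sect Z U\<^esub>"
 by (auto simp: kernel_sheaf_def a_kernel_def kernel_def)

lemma kernel_ideal_sheaf: "Y.ideal_sheaf (I)"
 unfolding Y.ideal_sheaf_def
proof (intro conjI allI impI; (elim conjE)?)
 fix U assume U: "opn U"
 have "ring_hom_ring (sect Y U) (sect Z U) (\<pi> U)"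
  using cring.axioms(1)[OF Y.sect_cring[OF U]] cring.axioms(1)[OF Z.sect_cring] U
  by (intro ring_hom_ring.intro ring_hom_ring_axioms.intro) (insert \<pi>_hom, auto simp: sheaf_of_rings_hom_def)
 then show "ideal (I U) (sect Y U)"
  unfolding kernel_sheaf_def by (rule ring_hom_ring.kernel_is_ideal)
next
 fix U V s assume "opn U" "opn V" "V \<subseteq> U" "s \<in> I U"
 then show "restr Y U V s \<in> I V" by (simp add: kernel_iff)
next
 fix U s assume U: "opn U" "s \<in> Y.sec U"
  and loc: "\<forall>x\<in>U. \<exists>V. opn V \<and> x \<in> V \<and> V \<subseteq> U \<and> restr Y U V s \<in> I V"
 interpret zu: cring "sect Z U" by (rule Z.sect_cring) (simp add: U)
 have "\<pi> U s = \<zero>\<^bsub>sect Z U\<^esub>"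
 proof (rule Z.section_eqI)
  fix x assume x: "x \<in> U"
  then obtain V where V: "opn V" "x \<in> V" "V \<subseteq> U" "restr Y U V s \<in> I V" using loc by blast
  then show "germ Z x U (\<pi> U s) = germ Z x U \<zero>\<^bsub>sect Z U\<^esub>"
   using U x by (subst Z.germ_eq_iff) (auto simp: kernel_iff)
 qed (use U in auto)
 then show "s \<in> I U" using U by (simp add: kernel_iff)
qed

definition stalk_map where
 "stalk_map x b = (SOME a. \<exists>U s. opn U \<and> x \<in> U \<and> s \<in> Y.sec U \<and> b = germ Y x U s \<and> a = germ Z x U (\<pi> U s))"

lemma stalk_map_germ:
 assumes U: "opn U" "x \<in> U" "s \<in> Y.sec U"
 shows "stalk_map x (germ Y x U s) = germ Z x U (\<pi> U s)"
proof -
 have "\<exists>V t. opn V \<and> x \<in> V \<and> t \<in> Y.sec V \<and> germ Y x U s = germ Y x V t \<and>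
   stalk_map x (germ Y x U s) = germ Z x V (\<pi> V t)"
  unfolding stalk_map_def
  by (rule someI[of "\<lambda>a. \<exists>V t. opn V \<and> x \<in> V \<and> t \<in> Y.sec V \<and> germ Y x U s = germ Y x V t \<and> a = germ Z x V (\<pi> V t)"])
   (use U in blast)
 then obtain V t where V: "opn V" "x \<in> V" "t \<in> Y.sec V" "germ Y x U s = germ Y x V t"
  "stalk_map x (germ Y x U s) = germ Z x V (\<pi> V t)" by blast
 then obtain W where W: "opn W" "x \<in> W" "W \<subseteq> U" "W \<subseteq> V" "restr Y U W s = restr Y V W t"
  using Y.germ_eq_iff[of U V x s t] U by auto
 then have "restr Z U W (\<pi> U s) = restr Z V W (\<pi> V t)" using U V by (simp flip: \<pi>_simps(5))
 then have "germ Z x U (\<pi> U s) = germ Z x V (\<pi> V t)" using U V W by (subst Z.germ_eq_iff) auto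
 then show ?thesis using V by simp
qed

lemma stalk_map_surjective:
 assumes x: "x \<in> T"
 shows "surjective_ring_hom (B x) (stalk Z x) (stalk_map x)"
proof -
 let ?T = "T"
 have T: "opn ?T" by simp
 have xz: "x \<in> topspace (space_of Z)" using x space_eq by simp
 interpret B: cring "B x" by (rule Y.stalk_cring[OF x])
 interpret A: cring "stalk Z x" by (rule Z.stalk_cring[OF xz])
 have two: "\<exists>U s t. opn U \<and> x \<in> U \<and> s \<in> Y.sec U \<and> t \<in> Y.sec U \<and> a = germ Y x U s \<and> b = germ Y x U t"
  if a: "a \<in> carrier (B x)" and b: "b \<in> carrier (B x)" for a b
 proof -
  obtain U s where U: "opn U" "x \<in> U" "s \<in> Y.sec U" "b = germ Y x U s" by (rule Y.stalkE[OF b T x])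
  obtain V t where V: "opn V" "x \<in> V" "V \<subseteq> U" "t \<in> Y.sec V" "a = germ Y x V t" by (rule Y.stalkE[OF a U(1,2)])
  show ?thesis by (rule exI[of _ V], rule exI[of _ t], rule exI[of _ "restr Y U V s"]) (use U V in simp)
 qed
 show ?thesis
 proof (intro surjective_ring_hom.intro surjective_ring_hom_axioms.intro B.cring_axioms A.cring_axioms ring_hom_memI)
  fix a b assume "a \<in> carrier (B x)" "b \<in> carrier (B x)"
  from two[OF this] obtain U s t where U: "opn U" "x \<in> U" "s \<in> Y.sec U" "t \<in> Y.sec U"
   "a = germ Y x U s" "b = germ Y x U t" by (elim exE conjE)
  interpret u: cring "sect Y U" by (rule Y.sect_cring[OF U(1)])
  show "stalk_map x (a \<otimes>\<^sub>x b) = stalk_map x a \<otimes>\<^bsub>stalk Z x\<^esub> stalk_map x b"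
   "stalk_map x (a \<oplus>\<^sub>x b) = stalk_map x a \<oplus>\<^bsub>stalk Z x\<^esub> stalk_map x b"
   using U by (simp_all add: stalk_map_germ Z.germ_simps flip: Y.germ_simps)
  show "stalk_map x a \<in> carrier (stalk Z x)" using U by (simp add: stalk_map_germ)
 next
  interpret u: cring "sect Y ?T" by (rule Y.sect_cring[OF T])
  show "stalk_map x \<one>\<^sub>x = \<one>\<^bsub>stalk Z x\<^esub>"
   using x by (simp add: stalk_map_germ Z.germ_one flip: Y.germ_one[OF T x])
  show "stalk_map x ` carrier (B x) = carrier (stalk Z x)"
  proof
   show "stalk_map x ` carrier (B x) \<subseteq> carrier (stalk Z x)"
   proof clarify
    fix a assume "a \<in> carrier (B x)"
    then show "stalk_map x a \<in> carrier (stalk Z x)" by (rule Y.stalkE[OF _ T x]) (simp add: stalk_map_germ)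
   qed
   show "carrier (stalk Z x) \<subseteq> stalk_map x ` carrier (B x)"
   proof
    fix c assume c: "c \<in> carrier (stalk Z x)"
    obtain U s where U: "opn U" "x \<in> U" "s \<in> Z.sec U" "c = germ Z x U s"
     by (rule Z.stalkE[OF c, of ?T]) (use T x in auto)
    obtain V b where V: "opn V" "x \<in> V" "V \<subseteq> U" "b \<in> Y.sec V" "restr Z U V s = \<pi> V b"
     using \<pi>_surj[OF U(1,3,2)] by (auto simp: nhds_in_def)
    have "germ Z x V (restr Z U V s) = germ Z x U s" using U V by (intro Z.germ_restr) auto
    then have "c = stalk_map x (germ Y x V b)" using U V by (simp add: stalk_map_germ)
    then show "c \<in> stalk_map x ` carrier (B x)" using Y.germ_closed[OF V(1,2,4)] by (rule image_eqI)
   qed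
  qed
 qed
qed

lemma stalk_map_kernel:
 assumes x: "x \<in> T"
 shows "surjective_ring_hom.K (B x) (stalk Z x) (stalk_map x) = st (I) x"
proof -
 interpret surjective_ring_hom "B x" "stalk Z x" "stalk_map x" by (rule stalk_map_surjective[OF x])
 have T: "opn (T)" by simp
 show ?thesis
 proof (intro equalityI subsetI)
  fix b assume b: "b \<in> K"
  then have "b \<in> carrier (B x)" by (simp add: K_def)
  then obtain U s where U: "opn U" "x \<in> U" "s \<in> Y.sec U" "b = germ Y x U s" by (rule Y.stalkE[OF _ T x])
  then have "germ Z x U (\<pi> U s) = \<zero>\<^bsub>stalk Z x\<^esub>" using b by (simp add: K_def stalk_map_germ)
  then obtain W where W: "opn W" "x \<in> W" "W \<subseteq> U" "restr Z U W (\<pi> U s) = \<zero>\<^bsub>sect Z W\<^esub>"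
   using Z.germ_zeroE[of U x "\<pi> U s"] U by auto
  then have "restr Y U W s \<in> I W" using U by (simp add: kernel_iff)
  then show "b \<in> st (I) x" using Y.germ_in_st[OF W(1,2)] U W by fastforce
 next
  fix b assume "b \<in> st (I) x"
  then obtain U s where U: "opn U" "x \<in> U" "s \<in> I U" "b = germ Y x U s" by (auto simp: ideal_stalk_def)
  then show "b \<in> K" by (simp add: K_def stalk_map_germ kernel_iff Z.germ_zero)
 qed
qed

end

section \<open>Quotient sheaves\<close>

text \<open>\<open>IFG\<close> says that the kernel of \<pi> maps F into G on stalks; this makes the
  action of Z on F/G independent of the lift to Y.\<close>

locale quotient_sheaf = ringed_surjection Y Z \<pi>
 for Y :: "('p, 'r) ringed_space" and Z :: "('p, 's) ringed_space" and \<pi> +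
 fixes F G :: "'p set => 'r set"
 assumes F: "Y.ideal_sheaf F" and G: "Y.ideal_sheaf G"
  and GF: "!!x. x \<in> topspace (space_of Y) ==> Y.st G x \<subseteq> Y.st F x"
  and IFG: "!!x c b. x \<in> topspace (space_of Y) ==> c \<in> Y.st (kernel_sheaf Y Z \<pi>) x ==> b \<in> Y.st F x ==>
   c \<otimes>\<^bsub>stalk Y x\<^esub> b \<in> Y.st G x"
begin

abbreviation Q where "Q \<equiv> quot_sheaf Z Y \<pi> F G"
abbreviation Qsec where "Qsec U \<equiv> carrier (msect Q U)"

definition sclass where
 "sclass V s = (\<lambda>y\<in>V. st G y +>\<^sub>y germ Y y V s)"

lemma Qsec_iff: "\<mu> \<in> Qsec U \<longleftrightarrow> \<mu> \<in> extensional U \<and> (\<forall>x\<in>U. \<exists>V. opn V \<and> x \<in> V \<and> V \<subseteq> U \<and>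
  (\<exists>s\<in>F V. \<forall>y\<in>V. \<mu> y = st G y +>\<^sub>y germ Y y V s))"
 unfolding quot_sheaf_def nhds_in_def by auto

lemma Q_simps:
 "\<zero>\<^bsub>msect Q U\<^esub> = (\<lambda>x\<in>U. st G x)"
 "\<mu> \<oplus>\<^bsub>msect Q U\<^esub> \<nu> = (\<lambda>x\<in>U. set_add (B x) (\<mu> x) (\<nu> x))"
 "a \<odot>\<^bsub>msect Q U\<^esub> \<mu> = (\<lambda>x\<in>U. set_add (B x)
    {germ Y x V b \<otimes>\<^sub>x t | V b t. V \<in> nhds_in Y U x \<and> b \<in> carrier (sect Y V) \<and>
      \<pi> V b = restr Z U V a \<and> t \<in> \<mu> x} (st G x))"
 "mrestr Q U V \<mu> = restrict \<mu> V"
 by (simp_all add: quot_sheaf_def)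

context
 fixes x assumes x: "x \<in> T"
begin

lemma st_facts: "cring (B x)" "ideal (st F x) (B x)" "ideal (st G x) (B x)"
 using Y.stalk_cring Y.st_ideal F G x by auto

text \<open>A may be a proper part of its coset: \<open>quot_sheaf\<close> defines the action of
  scalars by a set of products that need not fill a coset, and adding a full coset completes
  it.\<close>

lemma set_add_coset:
 assumes a: "a \<in> carrier (B x)" "b \<in> carrier (B x)"
  and A: "A \<subseteq> st G x +>\<^sub>x a" "a \<in> A" and C: "C = st G x +>\<^sub>x b"
 shows "set_add (B x) A C = st G x +>\<^sub>x (a \<oplus>\<^sub>x b)"
proof -
 interpret B: cring "B x" by (rule st_facts)
 interpret G: ideal "st G x" "B x" by (rule st_facts)
 note mem = coset_mem_iff[OF st_facts(1,3)]
 show ?thesis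
 proof (intro equalityI subsetI)
  fix t assume "t \<in> set_add (B x) A C"
  then obtain a' b' where "a' \<in> A" "b' \<in> C" "t = a' \<oplus>\<^sub>x b'"
   by (auto simp: set_add_def set_mult_def)
  then have *: "a' \<in> carrier (B x)" "b' \<in> carrier (B x)" "a' \<ominus>\<^sub>x a \<in> st G x"
   "b' \<ominus>\<^sub>x b \<in> st G x" "t = a' \<oplus>\<^sub>x b'" using A mem a C by auto
  have "t \<ominus>\<^sub>x (a \<oplus>\<^sub>x b) = (a' \<ominus>\<^sub>x a) \<oplus>\<^sub>x (b' \<ominus>\<^sub>x b)"
   using * a by (simp add: a_minus_def B.minus_add B.a_ac)
  then show "t \<in> st G x +>\<^sub>x (a \<oplus>\<^sub>x b)" using * a mem by simp
 next
  fix t assume "t \<in> st G x +>\<^sub>x (a \<oplus>\<^sub>x b)"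
  then have t: "t \<in> carrier (B x)" "t \<ominus>\<^sub>x (a \<oplus>\<^sub>x b) \<in> st G x" using mem a by auto
  have "(t \<ominus>\<^sub>x a) \<ominus>\<^sub>x b \<in> st G x" using t a by (simp add: a_minus_def B.minus_add B.a_ac)
  then have "t \<ominus>\<^sub>x a \<in> C" using t a mem C by simp
  moreover have "t = a \<oplus>\<^sub>x (t \<ominus>\<^sub>x a)" using t a by (simp add: a_minus_def B.a_comm[of a] B.a_assoc B.l_neg)
  ultimately show "t \<in> set_add (B x) A C" using A by (auto simp: set_add_def set_mult_def)
 qed
qed

end

lemma sclass_in:
 assumes "opn V" "s \<in> F V"
 shows "sclass V s \<in> Qsec V"
 unfolding Qsec_iff sclass_def using assms by auto

lemma sclass_mem:
 assumes "opn V" "s \<in> F V" "y \<in> V"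
 shows "germ Y y V s \<in> sclass V s y"
 using coset_self[OF st_facts(1,3)[OF Y.opn_topspace[OF assms(1,3)]], of "germ Y y V s"]
  Y.ideal_sheafD(2)[OF F assms(1,2)] assms by (simp add: sclass_def)

lemma Qsec_repE:
 assumes "\<mu> \<in> Qsec U" "x \<in> U"
 obtains V s where "opn V" "x \<in> V" "V \<subseteq> U" "s \<in> F V" "\<forall>y\<in>V. \<mu> y = st G y +>\<^sub>y germ Y y V s"
 using assms(1)[unfolded Qsec_iff, THEN conjunct2, THEN bspec, OF assms(2)] that by (elim exE conjE bexE)

lemma sectionE:
 assumes \<mu>: "\<mu> \<in> Qsec U" and U: "opn U" "x \<in> U" and t: "t \<in> \<mu> x"
 obtains V s where "opn V" "x \<in> V" "V \<subseteq> U" "s \<in> F V" "germ Y x V s = t" "!!y. y \<in> V ==> germ Y y V s \<in> \<mu> y"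
  "!!y. y \<in> V ==> \<mu> y = st G y +>\<^sub>y germ Y y V s"
proof -
 have xT: "y \<in> T" if "y \<in> U" for y using Y.opn_topspace U that by blast
 interpret B: cring "B x" by (rule st_facts[OF xT[OF U(2)]])
 obtain V s where V: "opn V" "x \<in> V" "V \<subseteq> U" "s \<in> F V"
  and "\<forall>y\<in>V. \<mu> y = st G y +>\<^sub>y germ Y y V s"
  by (rule Qsec_repE[OF \<mu> U(2)])
 then have V: "opn V" "x \<in> V" "V \<subseteq> U" "s \<in> F V"
  "!!y. y \<in> V ==> \<mu> y = st G y +>\<^sub>y germ Y y V s" by auto
 note sV = Y.ideal_sheafD(2)[OF F V(1,4)]
 have t': "t \<in> carrier (B x)" "t \<ominus>\<^sub>x germ Y x V s \<in> st G x"
  using t V(2,5) coset_mem_iff[OF st_facts(1,3)[OF xT[OF U(2)]], of "germ Y x V s" t] sV V(1) by auto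
 obtain W g where W: "opn W" "x \<in> W" "W \<subseteq> V" "g \<in> G W" "g \<in> Y.sec W" "t \<ominus>\<^sub>x germ Y x V s = germ Y x W g"
  by (rule Y.ideal_stalkE[OF G t'(2) V(1,2)])
 let ?s = "restr Y V W s"
 have s: "?s \<in> F W" "?s \<in> Y.sec W" "!!y. y \<in> W ==> germ Y y W ?s = germ Y y V s"
  using V W Y.ideal_sheafD(3)[OF F] sV by auto
 interpret FW: ideal "F W" "sect Y W" by (rule Y.ideal_sheafD(1)[OF F W(1)])
 have gF: "g \<in> F W"
 proof (rule Y.ideal_sheaf_memI[OF F W(1,5)])
  fix y assume y: "y \<in> W"
  have "germ Y y W g \<in> st G y" by (rule Y.germ_in_st[where F = G, OF W(1) y W(4)])
  then show "germ Y y W g \<in> st F y" using GF[of y] xT W V y by blast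
 qed
 let ?r = "?s \<oplus>\<^bsub>sect Y W\<^esub> g"
 have r: "germ Y y W ?r = germ Y y V s \<oplus>\<^sub>y germ Y y W g" if "y \<in> W" for y
  using Y.germ_add[OF W(1) that s(2) W(5)] s(3)[OF that] by simp
 have mem: "germ Y y W ?r \<in> \<mu> y" if y: "y \<in> W" for y
 proof -
  have yT: "y \<in> T" "y \<in> V" using y W V xT by auto
  interpret By: cring "B y" by (rule st_facts[OF yT(1)])
  have c: "germ Y y V s \<in> carrier (B y)" "germ Y y W g \<in> carrier (B y)"
   using V W yT y sV by auto
  have "germ Y y W ?r \<ominus>\<^sub>y germ Y y V s = germ Y y W g"
   unfolding r[OF y] using c by (simp add: a_minus_def By.a_comm[of "germ Y y V s"] By.a_assoc By.r_neg)
  then show ?thesis unfolding V(5)[OF yT(2)] coset_mem_iff[OF st_facts(1,3)[OF yT(1)] c(1)]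
   using Y.germ_in_st[where F=G and s = g, OF W(1) y W(4)] c unfolding r[OF y] by simp
 qed
 show ?thesis
 proof (rule that[of W ?r])
  show "germ Y x W ?r = t"
  proof -
   have c: "germ Y x V s \<in> carrier (B x)" using V sV by simp
   show ?thesis unfolding r[OF W(2)] W(6)[symmetric]
    using t'(1) c by (simp add: a_minus_def B.a_lcomm B.r_neg)
  qed
  show "\<mu> y = st G y +>\<^sub>y germ Y y W ?r" if "y \<in> W" for y
  proof -
   have yT: "y \<in> T" "y \<in> V" using that W V xT by auto
   then show ?thesis using coset_eq[OF st_facts(1,3)[OF yT(1)], of "germ Y y V s"] mem[OF that] V(1,5) sV by simp
  qed
 qed (use W V s gF mem in auto)
qed

lemma section_ne:
 assumes "\<mu> \<in> Qsec U" "opn U" "x \<in> U"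
 obtains t where "t \<in> \<mu> x"
proof -
 obtain V s where V: "opn V" "x \<in> V" "V \<subseteq> U" "s \<in> F V" "\<forall>y\<in>V. \<mu> y = st G y +>\<^sub>y germ Y y V s"
  by (rule Qsec_repE[OF assms(1,3)])
 then have "germ Y x V s \<in> \<mu> x" using sclass_mem[of V s x] by (simp add: sclass_def)
 then show ?thesis by (rule that)
qed

lemma section_val:
 assumes "\<mu> \<in> Qsec U" "opn U" "x \<in> U" "t \<in> \<mu> x"
 shows "t \<in> st F x" "t \<in> carrier (B x)" "\<mu> x = st G x +>\<^sub>x t"
  "t' \<in> \<mu> x \<longleftrightarrow> t' \<in> carrier (B x) \<and> t' \<ominus>\<^sub>x t \<in> st G x"
proof -
 obtain V s where V: "opn V" "x \<in> V" "V \<subseteq> U" "s \<in> F V" "germ Y x V s = t"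
  "!!y. y \<in> V ==> germ Y y V s \<in> \<mu> y" "!!y. y \<in> V ==> \<mu> y = st G y +>\<^sub>y germ Y y V s"
  by (rule sectionE[OF assms], rule that)
 show "t \<in> st F x" using Y.germ_in_st[where F = F, OF V(1,2,4)] V(5) by simp
 show t: "t \<in> carrier (B x)" using V Y.ideal_sheafD(2)[OF F] by auto
 show e: "\<mu> x = st G x +>\<^sub>x t" using V(7)[OF V(2)] V(5) by simp
 show "t' \<in> \<mu> x \<longleftrightarrow> t' \<in> carrier (B x) \<and> t' \<ominus>\<^sub>x t \<in> st G x"
  unfolding e by (rule coset_mem_iff[OF st_facts(1,3)[OF Y.opn_topspace[OF assms(2,3)]] t])
qed

text \<open>Cosets with a common element coincide. Identities between sections of quotient sheaves
  are thereby reduced to a computation with one representative at each point.\<close>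

lemma section_eqI:
 assumes "\<mu> \<in> Qsec U" "\<nu> \<in> Qsec U" "opn U" and eq: "!!x. x \<in> U ==> \<exists>t. t \<in> \<mu> x \<and> t \<in> \<nu> x"
 shows "\<mu> = \<nu>"
proof (rule extensionalityI)
 show "\<mu> \<in> extensional U" "\<nu> \<in> extensional U" using assms by (auto simp: Qsec_iff)
 show "\<mu> x = \<nu> x" if "x \<in> U" for x
  using eq[OF that] section_val(3)[OF assms(1,3) that] section_val(3)[OF assms(2,3) that] by auto
qed

lemma restrict_in: "\<mu> \<in> Qsec U ==> opn U ==> opn V ==> V \<subseteq> U ==> restrict \<mu> V \<in> Qsec V"
proof -
 assume \<mu>: "\<mu> \<in> Qsec U" and U: "opn U" and V: "opn V" "V \<subseteq> U"
 have "\<exists>W. opn W \<and> x \<in> W \<and> W \<subseteq> V \<and> (\<exists>s\<in>F W. \<forall>y\<in>W. restrict \<mu> V y = st G y +>\<^sub>y germ Y y W s)"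
  if x: "x \<in> V" for x
 proof -
  have "x \<in> U" using x V by blast
  then obtain W s where W: "opn W" "x \<in> W" "W \<subseteq> U" "s \<in> F W"
   "\<forall>y\<in>W. \<mu> y = st G y +>\<^sub>y germ Y y W s" by (rule Qsec_repE[OF \<mu>])
  have o: "opn (W \<inter> V)" using W V by blast
  have "restr Y W (W \<inter> V) s \<in> F (W \<inter> V)" using Y.ideal_sheafD(3)[OF F W(1) o _ W(4)] by simp
  moreover have "restrict \<mu> V y = st G y +>\<^sub>y germ Y y (W \<inter> V) (restr Y W (W \<inter> V) s)" if "y \<in> W \<inter> V" for y
   using that W o Y.ideal_sheafD(2)[OF F W(1,4)] by simp
  ultimately show ?thesis using o x W(2) by blast
 qed
 then show ?thesis unfolding Qsec_iff by auto
qed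

lemma section_locally_eq:
 assumes "\<mu> \<in> Qsec U" "\<nu> \<in> Qsec V" "opn U" "opn V" "x \<in> U" "x \<in> V" "t \<in> \<mu> x" "t \<in> \<nu> x"
 obtains W where "opn W" "x \<in> W" "W \<subseteq> U" "W \<subseteq> V" "restrict \<mu> W = restrict \<nu> W"
proof -
 obtain U' s where U': "opn U'" "x \<in> U'" "U' \<subseteq> U" "s \<in> F U'" "germ Y x U' s = t" "!!y. y \<in> U' ==> germ Y y U' s \<in> \<mu> y"
  by (rule sectionE[OF assms(1,3,5,7)]) blast
 obtain V' r where V': "opn V'" "x \<in> V'" "V' \<subseteq> V" "r \<in> F V'" "germ Y x V' r = t" "!!y. y \<in> V' ==> germ Y y V' r \<in> \<nu> y"
  by (rule sectionE[OF assms(2,4,6,8)]) blast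
 have c: "s \<in> Y.sec U'" "r \<in> Y.sec V'" using U' V' Y.ideal_sheafD(2)[OF F] by auto
 then obtain W where W: "opn W" "x \<in> W" "W \<subseteq> U'" "W \<subseteq> V'" "restr Y U' W s = restr Y V' W r"
  using Y.germ_eq_iff[of U' V' x s r] U' V' by auto
 have W': "W \<subseteq> U" "W \<subseteq> V" using W U' V' by auto
 have "restrict \<mu> W = restrict \<nu> W"
 proof (rule section_eqI[OF restrict_in[OF assms(1,3) W(1) W'(1)] restrict_in[OF assms(2,4) W(1) W'(2)] W(1)])
  fix y assume y: "y \<in> W"
  have "germ Y y U' s = germ Y y V' r"
   using Y.germ_restr[OF U'(1) W(1,3) y c(1)] Y.germ_restr[OF V'(1) W(1,4) y c(2)] W(5) by simp
  then show "\<exists>t. t \<in> restrict \<mu> W y \<and> t \<in> restrict \<nu> W y"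
   using U'(6)[of y] V'(6)[of y] W y by (intro exI[of _ "germ Y y U' s"]) auto
 qed
 then show ?thesis using that W W' by blast
qed

lemma zero_mem: "opn U ==> x \<in> U ==> \<zero>\<^sub>x \<in> \<zero>\<^bsub>msect Q U\<^esub> x"
 using additive_subgroup.zero_closed[OF ideal.axioms(1)[OF st_facts(3)[OF Y.opn_topspace]], of U x] by (simp add: Q_simps)

lemma zero_in: "opn U ==> \<zero>\<^bsub>msect Q U\<^esub> \<in> Qsec U"
proof -
 assume U: "opn U"
 interpret u: ideal "F U" "sect Y U" by (rule Y.ideal_sheafD(1)[OF F U])
 have "\<zero>\<^bsub>msect Q U\<^esub> = sclass U \<zero>\<^bsub>sect Y U\<^esub>"
  unfolding Q_simps sclass_def
  by (rule restrict_ext) (use coset_zero[OF st_facts(1,3)[OF Y.opn_topspace[OF U]]] Y.germ_zero[OF U] in simp)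
 then show ?thesis using sclass_in[OF U] u.zero_closed by simp
qed

lemma add_val:
 assumes "\<mu> \<in> Qsec U" "\<nu> \<in> Qsec U" "opn U" "x \<in> U" "s \<in> \<mu> x" "t \<in> \<nu> x"
 shows "(\<mu> \<oplus>\<^bsub>msect Q U\<^esub> \<nu>) x = st G x +>\<^sub>x (s \<oplus>\<^sub>x t)"
 unfolding Q_simps using assms set_add_coset[OF Y.opn_topspace[OF assms(3,4)], of s t "\<mu> x" "\<nu> x"]
  section_val(2,3)[OF assms(1,3,4,5)] section_val(2,3)[OF assms(2,3,4,6)] by simp

lemma coset_self':
 "opn U ==> x \<in> U ==> a \<in> carrier (B x) ==> a \<in> st G x +>\<^sub>x a"
 using coset_self[OF st_facts(1,3)[OF Y.opn_topspace]] by blast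

lemma add_mem:
 assumes "\<mu> \<in> Qsec U" "\<nu> \<in> Qsec U" "opn U" "x \<in> U" "s \<in> \<mu> x" "t \<in> \<nu> x"
 shows "s \<oplus>\<^sub>x t \<in> (\<mu> \<oplus>\<^bsub>msect Q U\<^esub> \<nu>) x"
 unfolding add_val[OF assms] using section_val(2)[OF assms(1,3,4,5)] section_val(2)[OF assms(2,3,4,6)]
  cring.cring_simprules(1)[OF st_facts(1)[OF Y.opn_topspace[OF assms(3,4)]]]
 by (intro coset_self'[OF assms(3,4)]) simp

lemma QsecI:
 assumes "\<mu> \<in> extensional U" "opn U"
  and "!!x. x \<in> U ==> \<exists>V s. opn V \<and> x \<in> V \<and> V \<subseteq> U \<and> s \<in> F V \<and> (\<forall>y\<in>V. \<mu> y = st G y +>\<^sub>y germ Y y V s)"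
 shows "\<mu> \<in> Qsec U"
 unfolding Qsec_iff
proof (intro conjI ballI assms(1))
 fix x assume "x \<in> U"
 from assms(3)[OF this] show "\<exists>V. opn V \<and> x \<in> V \<and> V \<subseteq> U \<and> (\<exists>s\<in>F V. \<forall>y\<in>V. \<mu> y = st G y +>\<^sub>y germ Y y V s)"
  by (elim exE conjE) (intro exI conjI bexI)
qed

lemma add_in:
 assumes "\<mu> \<in> Qsec U" "\<nu> \<in> Qsec U" "opn U"
 shows "\<mu> \<oplus>\<^bsub>msect Q U\<^esub> \<nu> \<in> Qsec U"
proof (rule QsecI[OF _ assms(3)])
 show "\<mu> \<oplus>\<^bsub>msect Q U\<^esub> \<nu> \<in> extensional U" by (simp add: Q_simps)
 fix x assume x: "x \<in> U"
 obtain t where t: "t \<in> \<mu> x" by (rule section_ne[OF assms(1,3) x])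
 obtain t' where t': "t' \<in> \<nu> x" by (rule section_ne[OF assms(2,3) x])
 obtain V s where V: "opn V" "x \<in> V" "V \<subseteq> U" "s \<in> F V" "!!y. y \<in> V ==> germ Y y V s \<in> \<mu> y"
  by (rule sectionE[OF assms(1,3) x t]) blast
 obtain W r where W: "opn W" "x \<in> W" "W \<subseteq> U" "r \<in> F W" "!!y. y \<in> W ==> germ Y y W r \<in> \<nu> y"
  by (rule sectionE[OF assms(2,3) x t']) blast
 let ?W = "V \<inter> W"
 have o: "opn ?W" using V W by blast
 let ?s = "restr Y V ?W s" and ?r = "restr Y W ?W r"
 have c: "s \<in> Y.sec V" "r \<in> Y.sec W" using V W Y.ideal_sheafD(2)[OF F] by auto
 have f: "?s \<in> F ?W" "?r \<in> F ?W" "?s \<in> Y.sec ?W" "?r \<in> Y.sec ?W"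
  using Y.ideal_sheafD(3)[OF F _ o] V W c o by auto
 have "(\<mu> \<oplus>\<^bsub>msect Q U\<^esub> \<nu>) y = st G y +>\<^sub>y germ Y y ?W (?s \<oplus>\<^bsub>sect Y ?W\<^esub> ?r)" if y: "y \<in> ?W" for y
 proof -
  have y': "y \<in> U" "y \<in> V" "y \<in> W" using y V by auto
  have "germ Y y ?W (?s \<oplus>\<^bsub>sect Y ?W\<^esub> ?r) = germ Y y V s \<oplus>\<^sub>y germ Y y W r"
   unfolding Y.germ_add[OF o y f(3,4)] using V W o y c by simp
  then show ?thesis using add_val[OF assms y'(1) V(5)[OF y'(2)] W(5)[OF y'(3)]] by simp
 qed
 moreover have "?s \<oplus>\<^bsub>sect Y ?W\<^esub> ?r \<in> F ?W"
  using additive_subgroup.a_closed[OF ideal.axioms(1)[OF Y.ideal_sheafD(1)[OF F o]]] f by blast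
 ultimately show "\<exists>V s. opn V \<and> x \<in> V \<and> V \<subseteq> U \<and> s \<in> F V \<and>
   (\<forall>y\<in>V. (\<mu> \<oplus>\<^bsub>msect Q U\<^esub> \<nu>) y = st G y +>\<^sub>y germ Y y V s)"
  using o V W by blast
qed

text \<open>Any lift b and any representative t may be used: another lift differs by an element of
  the stalk of the kernel, which \<open>IFG\<close> absorbs, and another representative by an
  element of the stalk of G.\<close>

lemma smult_val:
 assumes \<mu>: "\<mu> \<in> Qsec U" and U: "opn U" "x \<in> U" and t: "t \<in> \<mu> x" and a: "a \<in> Z.sec U"
  and b: "b \<in> carrier (B x)" "stalk_map x b = germ Z x U a"
 shows "(a \<odot>\<^bsub>msect Q U\<^esub> \<mu>) x = st G x +>\<^sub>x (b \<otimes>\<^sub>x t)"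
proof -
 note xT = Y.opn_topspace[OF U]
 interpret s: surjective_ring_hom "B x" "stalk Z x" "stalk_map x" by (rule stalk_map_surjective[OF xT])
 interpret G: ideal "st G x" "B x" by (rule st_facts(3)[OF xT])
 have K: "s.K = st (I) x" by (rule stalk_map_kernel[OF xT])
 note tv = section_val[OF \<mu> U t]
 let ?A = "{germ Y x V b \<otimes>\<^sub>x t | V b t. V \<in> nhds_in Y U x \<and> b \<in> carrier (sect Y V) \<and>
      \<pi> V b = restr Z U V a \<and> t \<in> \<mu> x}"
 have in1: "b \<otimes>\<^sub>x t \<in> ?A"
 proof -
  obtain V b' where V: "opn V" "x \<in> V" "V \<subseteq> U" "b' \<in> Y.sec V" "b = germ Y x V b'" by (rule Y.stalkE[OF b(1) U])
  have "germ Z x V (\<pi> V b') = germ Z x U a" using b V by (simp add: stalk_map_germ)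
  then obtain W where W: "opn W" "x \<in> W" "W \<subseteq> V" "restr Z V W (\<pi> V b') = restr Z U W a"
   using Z.germ_eq_iff[of V U x "\<pi> V b'" a] U V a by auto
  have "b = germ Y x W (restr Y V W b')" "\<pi> W (restr Y V W b') = restr Z U W a" "restr Y V W b' \<in> Y.sec W"
   using V W by auto
  moreover have "W \<in> nhds_in Y U x" using V W by (auto simp: nhds_in_def)
  ultimately show ?thesis using t by blast
 qed
 have sub: "?A \<subseteq> st G x +>\<^sub>x (b \<otimes>\<^sub>x t)"
 proof
  fix z assume "z \<in> ?A"
  then obtain V b' t' where V: "opn V" "x \<in> V" "V \<subseteq> U" "b' \<in> Y.sec V" "\<pi> V b' = restr Z U V a" "t' \<in> \<mu> x"
   "z = germ Y x V b' \<otimes>\<^sub>x t'" by (auto simp: nhds_in_def)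
  let ?b = "germ Y x V b'"
  have bc: "?b \<in> carrier (B x)" using V by simp
  have t': "t' \<in> carrier (B x)" "t' \<ominus>\<^sub>x t \<in> st G x" using V(6) tv(4) by auto
  have "stalk_map x ?b = stalk_map x b" using V U a b(2) by (simp add: stalk_map_germ)
  then have "?b \<ominus>\<^sub>x b \<in> st (I) x" using s.eq_imp_diff_in_K[OF bc b(1)] K by simp
  then have "(?b \<ominus>\<^sub>x b) \<otimes>\<^sub>x t \<in> st G x" by (rule IFG[OF xT _ tv(1)])
  moreover have "?b \<otimes>\<^sub>x (t' \<ominus>\<^sub>x t) \<in> st G x" using G.I_l_closed t'(2) bc by blast
  moreover have "z \<ominus>\<^sub>x b \<otimes>\<^sub>x t =
   ?b \<otimes>\<^sub>x (t' \<ominus>\<^sub>x t) \<oplus>\<^sub>x (?b \<ominus>\<^sub>x b) \<otimes>\<^sub>x t"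
   using V(7) bc t' tv(2) b(1) by (simp add: a_minus_def s.R.r_distr s.R.l_distr s.R.r_minus s.R.l_minus s.R.a_assoc s.R.r_neg1)
  ultimately show "z \<in> st G x +>\<^sub>x (b \<otimes>\<^sub>x t)"
   unfolding coset_mem_iff[OF st_facts(1,3)[OF xT] s.R.m_closed[OF b(1) tv(2)]] using V(7) bc t' by simp
 qed
 show ?thesis
  unfolding Q_simps restrict_apply'[OF U(2)]
  using set_add_coset[OF xT _ s.R.zero_closed sub in1 coset_zero[OF st_facts(1,3)[OF xT], symmetric]] b tv by simp
qed

lemma smult_mem:
 assumes "\<mu> \<in> Qsec U" "opn U" "x \<in> U" "t \<in> \<mu> x" "a \<in> Z.sec U" "b \<in> carrier (B x)" "stalk_map x b = germ Z x U a"
 shows "b \<otimes>\<^sub>x t \<in> (a \<odot>\<^bsub>msect Q U\<^esub> \<mu>) x"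
 unfolding smult_val[OF assms] using section_val(2)[OF assms(1-4)] assms(6)
  cring.cring_simprules(5)[OF st_facts(1)[OF Y.opn_topspace[OF assms(2,3)]]]
 by (intro coset_self'[OF assms(2,3)]) simp

lemma liftE:
 assumes "opn U" "x \<in> U" "a \<in> Z.sec U"
 obtains V b where "opn V" "x \<in> V" "V \<subseteq> U" "b \<in> Y.sec V" "\<pi> V b = restr Z U V a"
  "!!y. y \<in> V ==> stalk_map y (germ Y y V b) = germ Z y U a"
proof -
 obtain V b where V: "opn V" "x \<in> V" "V \<subseteq> U" "b \<in> Y.sec V" "restr Z U V a = \<pi> V b"
  using \<pi>_surj[OF assms(1,3,2)] by (auto simp: nhds_in_def)
 have "stalk_map y (germ Y y V b) = germ Z y U a" if "y \<in> V" for y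
 proof -
  have "germ Z y V (restr Z U V a) = germ Z y U a" using V assms that by (intro Z.germ_restr) auto
  then show ?thesis using V that by (simp add: stalk_map_germ)
 qed
 then show ?thesis using that V by metis
qed

lemma lift_at:
 assumes "opn V" "y \<in> V" "a \<in> Z.sec V"
 obtains b where "b \<in> carrier (B y)" "stalk_map y b = germ Z y V a"
proof -
 obtain W b where "opn W" "y \<in> W" "b \<in> Y.sec W" "!!y. y \<in> W ==> stalk_map y (germ Y y W b) = germ Z y V a"
  by (rule liftE[OF assms]) blast
 then show ?thesis using that[of "germ Y y W b"] by simp
qed

lemma smult_in:
 assumes "\<mu> \<in> Qsec U" "opn U" "a \<in> Z.sec U"
 shows "a \<odot>\<^bsub>msect Q U\<^esub> \<mu> \<in> Qsec U"
proof (rule QsecI[OF _ assms(2)])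
 show "a \<odot>\<^bsub>msect Q U\<^esub> \<mu> \<in> extensional U" by (simp add: Q_simps)
 fix x assume x: "x \<in> U"
 obtain t where t: "t \<in> \<mu> x" by (rule section_ne[OF assms(1,2) x])
 obtain V s where V: "opn V" "x \<in> V" "V \<subseteq> U" "s \<in> F V" "!!y. y \<in> V ==> germ Y y V s \<in> \<mu> y"
  by (rule sectionE[OF assms(1,2) x t]) blast
 obtain W b where W: "opn W" "x \<in> W" "W \<subseteq> U" "b \<in> Y.sec W" "!!y. y \<in> W ==> stalk_map y (germ Y y W b) = germ Z y U a"
  by (rule liftE[OF assms(2) x assms(3)]) blast
 let ?W = "V \<inter> W"
 have o: "opn ?W" using V W by blast
 let ?s = "restr Y V ?W s" and ?b = "restr Y W ?W b"
 have c: "s \<in> Y.sec V" using V Y.ideal_sheafD(2)[OF F] by auto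
 have f: "?s \<in> F ?W" "?s \<in> Y.sec ?W" "?b \<in> Y.sec ?W"
  using Y.ideal_sheafD(3)[OF F _ o] V W c o by auto
 have "(a \<odot>\<^bsub>msect Q U\<^esub> \<mu>) y = st G y +>\<^sub>y germ Y y ?W (?b \<otimes>\<^bsub>sect Y ?W\<^esub> ?s)" if y: "y \<in> ?W" for y
 proof -
  have y': "y \<in> U" "y \<in> V" "y \<in> W" using y V by auto
  have "germ Y y ?W (?b \<otimes>\<^bsub>sect Y ?W\<^esub> ?s) = germ Y y W b \<otimes>\<^sub>y germ Y y V s"
   unfolding Y.germ_mult[OF o y f(3,2)] using V W o y c by simp
  then show ?thesis using smult_val[OF assms(1,2) y'(1) V(5)[OF y'(2)] assms(3) _ W(5)[OF y'(3)]] W(1,4) y'(3) by simp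
 qed
 moreover have "?b \<otimes>\<^bsub>sect Y ?W\<^esub> ?s \<in> F ?W"
  using ideal.I_l_closed[OF Y.ideal_sheafD(1)[OF F o]] f by blast
 ultimately show "\<exists>V s. opn V \<and> x \<in> V \<and> V \<subseteq> U \<and> s \<in> F V \<and>
   (\<forall>y\<in>V. (a \<odot>\<^bsub>msect Q U\<^esub> \<mu>) y = st G y +>\<^sub>y germ Y y V s)"
  using o V W by blast
qed

lemma smult_distrib:
 assumes \<nu>: "\<nu> \<in> Qsec U" and U: "opn U" and a: "a \<in> Z.sec U" and b: "b \<in> Z.sec U"
 shows "(a \<oplus>\<^bsub>sect Z U\<^esub> b) \<odot>\<^bsub>msect Q U\<^esub> \<nu> = a \<odot>\<^bsub>msect Q U\<^esub> \<nu> \<oplus>\<^bsub>msect Q U\<^esub> b \<odot>\<^bsub>msect Q U\<^esub> \<nu>" (is "?l = ?r")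
  and "(a \<otimes>\<^bsub>sect Z U\<^esub> b) \<odot>\<^bsub>msect Q U\<^esub> \<nu> = a \<odot>\<^bsub>msect Q U\<^esub> (b \<odot>\<^bsub>msect Q U\<^esub> \<nu>)" (is "?l' = ?r'")
proof -
 interpret z: cring "sect Z U" using Z.sect_cring U by simp
 note sm = smult_in[OF \<nu> U]
 have "(\<exists>z. z \<in> ?l x \<and> z \<in> ?r x) \<and> (\<exists>z. z \<in> ?l' x \<and> z \<in> ?r' x)" if x: "x \<in> U" for x
 proof -
  interpret s: surjective_ring_hom "B x" "stalk Z x" "stalk_map x" by (rule stalk_map_surjective[OF Y.opn_topspace[OF U x]])
  obtain t where t: "t \<in> \<nu> x" by (rule section_ne[OF \<nu> U x])
  obtain c where c: "c \<in> carrier (B x)" "stalk_map x c = germ Z x U a" by (rule lift_at[OF U x a])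
  obtain d where d: "d \<in> carrier (B x)" "stalk_map x d = germ Z x U b" by (rule lift_at[OF U x b])
  note mem = smult_mem[OF \<nu> U x t]
  have "(c \<oplus>\<^sub>x d) \<otimes>\<^sub>x t \<in> ?l x" "(c \<otimes>\<^sub>x d) \<otimes>\<^sub>x t \<in> ?l' x"
   using mem[of "a \<oplus>\<^bsub>sect Z U\<^esub> b" "c \<oplus>\<^sub>x d"] mem[of "a \<otimes>\<^bsub>sect Z U\<^esub> b" "c \<otimes>\<^sub>x d"] a b c d U x
   by (simp_all add: Z.germ_add Z.germ_mult)
  then show ?thesis
   using add_mem[OF sm[OF a] sm[OF b] U x mem[OF a c] mem[OF b d]] smult_mem[OF sm[OF b] U x mem[OF b d] a c]
   unfolding s.R.l_distr[OF c(1) d(1) section_val(2)[OF \<nu> U x t]] s.R.m_assoc[OF c(1) d(1) section_val(2)[OF \<nu> U x t]] by blast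
 qed
 then show "?l = ?r" "?l' = ?r'" using a b U
  by (auto intro!: section_eqI[of _ U] add_in smult_in \<nu>)
qed

lemma restrict_smult:
 assumes \<nu>: "\<nu> \<in> Qsec U" and U: "opn U" and a: "a \<in> Z.sec U" and V: "opn V" "V \<subseteq> U"
 shows "restrict (a \<odot>\<^bsub>msect Q U\<^esub> \<nu>) V = restr Z U V a \<odot>\<^bsub>msect Q V\<^esub> restrict \<nu> V"
proof -
 note r = restrict_in[OF \<nu> U V]
 show ?thesis
 proof (rule section_eqI[OF restrict_in[OF smult_in[OF \<nu> U a] U V] smult_in[OF r V(1)] V(1)])
  show "restr Z U V a \<in> Z.sec V" using a U V by simp
  fix x assume x: "x \<in> V"
  then have xU: "x \<in> U" using V by blast
  obtain t where t: "t \<in> \<nu> x" by (rule section_ne[OF \<nu> U xU])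
  obtain c where c: "c \<in> carrier (B x)" "stalk_map x c = germ Z x U a" by (rule lift_at[OF U xU a])
  show "\<exists>z. z \<in> restrict (a \<odot>\<^bsub>msect Q U\<^esub> \<nu>) V x \<and> z \<in> (restr Z U V a \<odot>\<^bsub>msect Q V\<^esub> restrict \<nu> V) x"
   using smult_mem[OF \<nu> U xU t a c] smult_mem[OF r V(1) x _ _ c(1), of t "restr Z U V a"] c a U V x t by auto
 qed
qed

end

section \<open>Annihilator sheaves\<close>

context ringed
begin

text \<open>Annihilators are also formed of the powers of I, of which only stability under
  restriction is established; this is enough to describe the annihilator on germs.\<close>

definition res_closed where
 "res_closed F \<longleftrightarrow> (\<forall>U V s. opn U --> opn V --> V \<subseteq> U --> s \<in> F U --> s \<in> sec U \<and> restr S U V s \<in> F V)"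

lemma res_closedD:
 assumes "res_closed F" "opn U" "s \<in> F U" shows "s \<in> sec U" "opn V ==> V \<subseteq> U ==> restr S U V s \<in> F V"
 using assms unfolding res_closed_def by blast+

lemma ideal_sheaf_res_closed: "ideal_sheaf F ==> res_closed F"
 unfolding res_closed_def using ideal_sheafD(2,3) by blast

lemma res_closed_stE:
 assumes F: "res_closed F" and b: "b \<in> st F x" and N: "opn N" "x \<in> N"
 obtains U s where "opn U" "x \<in> U" "U \<subseteq> N" "s \<in> F U" "s \<in> sec U" "b = germ S x U s"
proof -
 obtain U s where U: "opn U" "x \<in> U" "s \<in> F U" "b = germ S x U s" using b by (auto simp: ideal_stalk_def)
 have o: "opn (U \<inter> N)" using U N by blast
 show ?thesis
  by (rule that[of "U \<inter> N" "restr S U (U \<inter> N) s"]) (use U N o res_closedD[OF F U(1,3)] in auto)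
qed

text \<open>The condition over all smaller open sets becomes one on stalks: a family stable under
  restriction represents its germs on arbitrarily small sets, and sections are determined by their
  germs.\<close>

lemma ann_sheaf_iff:
 assumes F: "res_closed F" and U: "opn U"
 shows "s \<in> ann_sheaf S F U \<longleftrightarrow>
  s \<in> sec U \<and> (\<forall>y\<in>U. \<forall>t\<in>st F y. germ S y U s \<otimes>\<^sub>y t = \<zero>\<^sub>y)"
proof (intro iffI conjI ballI)
 assume s: "s \<in> ann_sheaf S F U"
 show sU: "s \<in> sec U" using s by (simp add: ann_sheaf_def)
 fix y t assume y: "y \<in> U" and t: "t \<in> st F y"
 obtain V t' where V: "opn V" "y \<in> V" "V \<subseteq> U" "t' \<in> F V" "t' \<in> sec V" "t = germ S y V t'"
  by (rule res_closed_stE[OF F t U y])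
 have "restr S U V s \<otimes>\<^bsub>sect S V\<^esub> t' = \<zero>\<^bsub>sect S V\<^esub>" using s V by (auto simp: ann_sheaf_def opens_in_def)
 then have "germ S y V (restr S U V s) \<otimes>\<^sub>y t = \<zero>\<^sub>y"
  using V U sU germ_mult[OF V(1,2) _ V(5), of "restr S U V s"] germ_zero[OF V(1,2)] by simp
 then show "germ S y U s \<otimes>\<^sub>y t = \<zero>\<^sub>y" using U V sU by simp
next
 assume s: "s \<in> sec U \<and> (\<forall>y\<in>U. \<forall>t\<in>st F y. germ S y U s \<otimes>\<^sub>y t = \<zero>\<^sub>y)"
 have "restr S U V s \<otimes>\<^bsub>sect S V\<^esub> t = \<zero>\<^bsub>sect S V\<^esub>" if V: "opn V" "V \<subseteq> U" "t \<in> F V" for V t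
 proof -
  have t: "t \<in> sec V" using res_closedD[OF F V(1,3)] by simp
  interpret V: cring "sect S V" by (rule sect_cring[OF V(1)])
  have r: "restr S U V s \<in> sec V" using s V U by simp
  show ?thesis
  proof (rule section_eqI[OF V(1)])
   fix y assume y: "y \<in> V"
   have "germ S y V t \<in> st F y" by (rule germ_in_st[where F = F, OF V(1) y V(3)])
   moreover have "y \<in> U" using y V by blast
   ultimately have "germ S y U s \<otimes>\<^sub>y germ S y V t = \<zero>\<^sub>y" using s by blast
   then show "germ S y V (restr S U V s \<otimes>\<^bsub>sect S V\<^esub> t) = germ S y V \<zero>\<^bsub>sect S V\<^esub>"
    unfolding germ_mult[OF V(1) y r t] germ_zero[OF V(1) y] using s U V y by simp
  qed (use r t in auto)
 qed
 then show "s \<in> ann_sheaf S F U" using s by (auto simp: ann_sheaf_def opens_in_def)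
qed

lemma ann_ideal_sheaf:
 assumes F: "res_closed F"
 shows "ideal_sheaf (ann_sheaf S F)"
 unfolding ideal_sheaf_def
proof (intro conjI allI impI; (elim conjE)?)
 have tc: "t \<in> carrier (B y)" if "t \<in> st F y" "opn U" "y \<in> U" for t y U
  by (rule res_closed_stE[OF F that]) simp
 fix U assume U: "opn U"
 interpret U: cring "sect S U" by (rule sect_cring[OF U])
 note R = sect_cring[OF U]
 note iff = ann_sheaf_iff[OF F U]
 have stc: "cring (B y)" if "y \<in> U" for y by (rule stalk_cring[OF opn_topspace[OF U that]])
 show "ideal (ann_sheaf S F U) (sect S U)"
 proof (rule idealI'[OF R])
  show "ann_sheaf S F U \<subseteq> sec U" by (auto simp: ann_sheaf_def)
  show "\<zero>\<^bsub>sect S U\<^esub> \<in> ann_sheaf S F U"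
   unfolding iff using germ_zero[OF U] cring.cring_simprules(26)[OF stc] tc[OF _ U] by simp
 next
  fix s r assume s: "s \<in> ann_sheaf S F U" and r: "r \<in> ann_sheaf S F U"
  have "germ S y U (s \<oplus>\<^bsub>sect S U\<^esub> r) \<otimes>\<^sub>y t = \<zero>\<^sub>y" if y: "y \<in> U" "t \<in> st F y" for y t
  proof -
   interpret y: cring "B y" by (rule stc[OF y(1)])
   show ?thesis using s[unfolded iff] r[unfolded iff] germ_add[OF U y(1)] tc[OF y(2) U y(1)] y U by (simp add: y.l_distr)
  qed
  then show "s \<oplus>\<^bsub>sect S U\<^esub> r \<in> ann_sheaf S F U" using s r unfolding iff by simp
 next
  fix a s assume a: "a \<in> sec U" and s: "s \<in> ann_sheaf S F U"
  have "germ S y U (a \<otimes>\<^bsub>sect S U\<^esub> s) \<otimes>\<^sub>y t = \<zero>\<^sub>y" if y: "y \<in> U" "t \<in> st F y" for y t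
  proof -
   interpret y: cring "B y" by (rule stc[OF y(1)])
   show ?thesis using s[unfolded iff] a germ_mult[OF U y(1)] tc[OF y(2) U y(1)] y U by (simp add: y.m_assoc)
  qed
  then show "a \<otimes>\<^bsub>sect S U\<^esub> s \<in> ann_sheaf S F U" using s a unfolding iff by simp
 qed
next
 fix U V s assume "opn U" "opn V" "V \<subseteq> U" "s \<in> ann_sheaf S F U"
 then show "restr S U V s \<in> ann_sheaf S F V" by (auto simp: ann_sheaf_iff[OF F])
next
 fix U s assume U: "opn U" "s \<in> sec U" and loc: "\<forall>x\<in>U. \<exists>V. opn V \<and> x \<in> V \<and> V \<subseteq> U \<and> restr S U V s \<in> ann_sheaf S F V"
 have "germ S y U s \<otimes>\<^sub>y t = \<zero>\<^sub>y" if y: "y \<in> U" "t \<in> st F y" for y t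
 proof -
  obtain V where V: "opn V" "y \<in> V" "V \<subseteq> U" "restr S U V s \<in> ann_sheaf S F V" using loc y(1) by blast
  then have "germ S y V (restr S U V s) \<otimes>\<^sub>y t = \<zero>\<^sub>y" using y(2) by (simp only: ann_sheaf_iff[OF F])
  then show ?thesis using U V by simp
 qed
 then show "s \<in> ann_sheaf S F U" using U by (simp add: ann_sheaf_iff[OF F])
qed

lemma ann_stalk_kills:
 assumes F: "res_closed F" and b: "b \<in> st (ann_sheaf S F) x" and t: "t \<in> st F x" and x: "x \<in> topspace (space_of S)"
 shows "b \<otimes>\<^sub>x t = \<zero>\<^sub>x"
proof (rule ideal_stalkE[OF ann_ideal_sheaf[OF F] b _ x])
 fix U s assume "opn U" "x \<in> U" "s \<in> ann_sheaf S F U" "b = germ S x U s"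
 then show ?thesis using t by (simp add: ann_sheaf_iff[OF F])
qed simp

text \<open>A substitute for finite generation near x. In general a germ that annihilates the stalk
  of F at x need not do so at nearby points; finitely many test sections that decide annihilation
  throughout a neighbourhood exclude this.\<close>

definition finitely_detected where
 "finitely_detected F x \<longleftrightarrow> (\<exists>V T. opn V \<and> x \<in> V \<and> finite T \<and> T \<subseteq> F V \<and>
  (\<forall>y\<in>V. \<forall>b\<in>carrier (B y). (\<forall>t\<in>T. b \<otimes>\<^sub>y germ S y V t = \<zero>\<^sub>y) -->
   (\<forall>t\<in>st F y. b \<otimes>\<^sub>y t = \<zero>\<^sub>y)))"

text \<open>The product with each test section vanishes on some neighbourhood of x; as there are
  finitely many, all vanish on their intersection, where the section then annihilates F.\<close>

lemma ann_stalkI: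
 assumes F: "res_closed F" and fd: "finitely_detected F x" and b: "b \<in> carrier (B x)"
  and kill: "!!t. t \<in> st F x ==> b \<otimes>\<^sub>x t = \<zero>\<^sub>x"
 shows "b \<in> st (ann_sheaf S F) x"
proof -
 obtain V T where V: "opn V" "x \<in> V" "finite T" "T \<subseteq> F V"
  "!!y b. y \<in> V ==> b \<in> carrier (B y) ==> (\<forall>t\<in>T. b \<otimes>\<^sub>y germ S y V t = \<zero>\<^sub>y) ==>
   (\<forall>t\<in>st F y. b \<otimes>\<^sub>y t = \<zero>\<^sub>y)"
  using fd unfolding finitely_detected_def by (elim exE conjE) metis
 obtain U s where U: "opn U" "x \<in> U" "U \<subseteq> V" "s \<in> sec U" "b = germ S x U s" by (rule stalkE[OF b V(1,2)])
 have ex: "\<exists>W. opn W \<and> x \<in> W \<and> W \<subseteq> U \<and> (\<forall>y\<in>W. germ S y U s \<otimes>\<^sub>y germ S y V t = \<zero>\<^sub>y)"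
  if t: "t \<in> T" for t
 proof -
  have tF: "t \<in> F V" "t \<in> sec V" using t V res_closedD[OF F V(1)] by auto
  let ?t = "restr S V U t"
  interpret U: cring "sect S U" by (rule sect_cring[OF U(1)])
  have t': "?t \<in> sec U" using tF U V by simp
  have p: "germ S y U (s \<otimes>\<^bsub>sect S U\<^esub> ?t) = germ S y U s \<otimes>\<^sub>y germ S y V t" if "y \<in> U" for y
   using germ_mult[OF U(1) that U(4) t'] tF U V that by simp
  have "germ S x U (s \<otimes>\<^bsub>sect S U\<^esub> ?t) = \<zero>\<^sub>x"
   unfolding p[OF U(2)] using kill[OF germ_in_st[where F = F, OF V(1,2) tF(1)]] U(5) by simp
  then obtain W where W: "opn W" "x \<in> W" "W \<subseteq> U" "restr S U W (s \<otimes>\<^bsub>sect S U\<^esub> ?t) = \<zero>\<^bsub>sect S W\<^esub>"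
   by (rule germ_zeroE[OF U(1,2) U.m_closed[OF U(4) t']])
  have "germ S y U s \<otimes>\<^sub>y germ S y V t = \<zero>\<^sub>y" if y: "y \<in> W" for y
  proof -
   have "germ S y U (s \<otimes>\<^bsub>sect S U\<^esub> ?t) = germ S y W \<zero>\<^bsub>sect S W\<^esub>"
    using germ_restr[OF U(1) W(1,3) y U.m_closed[OF U(4) t']] W(4) by simp
   then show ?thesis using p[of y] W y germ_zero[OF W(1) y] by auto
  qed
  then show ?thesis using W by blast
 qed
 then obtain W where W: "!!t. t \<in> T ==> opn (W t) \<and> x \<in> W t \<and> W t \<subseteq> U \<and>
   (\<forall>y\<in>W t. germ S y U s \<otimes>\<^sub>y germ S y V t = \<zero>\<^sub>y)" by metis
 define N where "N = \<Inter>(insert U (W ` T))"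
 have "opn N" unfolding N_def by (rule openin_Inter) (use W U V(3) in auto)
 then have N: "opn N" "x \<in> N" "N \<subseteq> U" using W U by (auto simp: N_def)
 have NW: "N \<subseteq> W t" if "t \<in> T" for t using that by (auto simp: N_def)
 have "restr S U N s \<in> ann_sheaf S F N"
  unfolding ann_sheaf_iff[OF F N(1)]
 proof (intro conjI ballI)
  show "restr S U N s \<in> sec N" using N U by simp
  fix y t assume y: "y \<in> N" "t \<in> st F y"
  have "\<forall>t\<in>T. germ S y U s \<otimes>\<^sub>y germ S y V t = \<zero>\<^sub>y" using W NW y(1) by blast
  moreover have "y \<in> V" "y \<in> U" using y N U by auto
  ultimately have "germ S y U s \<otimes>\<^sub>y t = \<zero>\<^sub>y" using V(5)[of y "germ S y U s"] U(1,4) y(2) by simp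
  then show "germ S y N (restr S U N s) \<otimes>\<^sub>y t = \<zero>\<^sub>y" using U N y by simp
 qed
 moreover have "b = germ S x N (restr S U N s)" using U N by simp
 ultimately show ?thesis using germ_in_st[where F = "ann_sheaf S F", OF N(1,2)] by simp
qed

section \<open>Powers of an ideal sheaf\<close>

context
 fixes I assumes I: "ideal_sheaf I"
begin

abbreviation "P \<equiv> ideal_sheaf_pow S I"

lemma ideal_pow_facts:
 assumes U: "opn U"
 shows "ideal (ideal_pow (sect S U) (I U) n) (sect S U)"
  "ideal_pow (sect S U) (I U) (Suc n) \<subseteq> ideal_pow (sect S U) (I U) n"
  "ideal_pow (sect S U) (I U) (Suc 0) = I U"
proof -
 interpret cring "sect S U" by (rule sect_cring[OF U])
 note IU = ideal_sheafD(1)[OF I U]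
 have i: "ideal (ideal_pow (sect S U) (I U) n) (sect S U)" for n
  by (induction n) (use oneideal ideal_prod_is_ideal IU in auto)
 show "ideal (ideal_pow (sect S U) (I U) n) (sect S U)" by (rule i)
 show "ideal_pow (sect S U) (I U) (Suc n) \<subseteq> ideal_pow (sect S U) (I U) n"
  using ideal_prod_inter[OF i IU] by auto
 show "ideal_pow (sect S U) (I U) (Suc 0) = I U"
  using ideal_prod_one[OF IU] ideal_prod_commute[OF IU oneideal] by simp
qed

lemma ideal_pow_restr:
 assumes "opn U" "opn V" "V \<subseteq> U" "s \<in> ideal_pow (sect S U) (I U) n"
 shows "restr S U V s \<in> ideal_pow (sect S V) (I V) n"
 using assms(4)
proof (induction n arbitrary: s)
 case (Suc n)
 then have "s \<in> ideal_prod (sect S U) (ideal_pow (sect S U) (I U) n) (I U)" by simp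
 then show ?case
 proof induction
  case (prod i j)
  have c: "i \<in> sec U" "j \<in> sec U" using prod ideal.Icarr[OF ideal_pow_facts(1)[OF assms(1)]] ideal_sheafD(2)[OF I assms(1)] by auto
  then show ?case using prod Suc.IH ideal_sheafD(3)[OF I assms(1-3)] assms by (auto intro: ideal_prod.prod)
 next
  case (sum s1 s2)
  have "s1 \<in> sec U" "s2 \<in> sec U" using sum ideal.Icarr[OF ideal_pow_facts(1)[OF assms(1), of "Suc n"]] by auto
  then show ?case using sum assms by (auto intro: ideal_prod.sum)
 qed
qed (use assms in simp)

lemma ideal_sheaf_pow_iff:
 "s \<in> P n U \<longleftrightarrow> s \<in> sec U \<and>
  (\<forall>x\<in>U. \<exists>V. opn V \<and> x \<in> V \<and> V \<subseteq> U \<and> restr S U V s \<in> ideal_pow (sect S V) (I V) n)"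
 unfolding ideal_sheaf_pow_def nhds_in_def by auto

lemma ideal_sheaf_pow_res_closed: "res_closed (P n)"
 unfolding res_closed_def
proof (intro allI impI conjI)
 fix U V s assume U: "opn U" "opn V" "V \<subseteq> U" and s: "s \<in> P n U"
 show sU: "s \<in> sec U" using s by (simp add: ideal_sheaf_pow_def)
 show "restr S U V s \<in> P n V"
  unfolding ideal_sheaf_pow_iff
 proof (intro conjI ballI)
  show "restr S U V s \<in> sec V" using U sU by simp
  fix x assume x: "x \<in> V"
  then obtain W where W: "opn W" "x \<in> W" "W \<subseteq> U" "restr S U W s \<in> ideal_pow (sect S W) (I W) n"
   using s U unfolding ideal_sheaf_pow_iff by blast
  have o: "opn (W \<inter> V)" using W U by blast
  have "restr S W (W \<inter> V) (restr S U W s) \<in> ideal_pow (sect S (W \<inter> V)) (I (W \<inter> V)) n"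
   by (rule ideal_pow_restr[OF W(1) o _ W(4)]) simp
  moreover have "restr S W (W \<inter> V) (restr S U W s) = restr S V (W \<inter> V) (restr S U V s)" using U W o sU by simp
  ultimately have "restr S V (W \<inter> V) (restr S U V s) \<in> ideal_pow (sect S (W \<inter> V)) (I (W \<inter> V)) n" by simp
  then show "\<exists>W. opn W \<and> x \<in> W \<and> W \<subseteq> V \<and> restr S V W (restr S U V s) \<in> ideal_pow (sect S W) (I W) n"
   using o x W(2) by (intro exI[of _ "W \<inter> V"] conjI) auto
 qed
qed

lemma ideal_pow_in_sheaf:
 assumes U: "opn U" and s: "s \<in> ideal_pow (sect S U) (I U) n" shows "s \<in> P n U"
proof -
 have "s \<in> sec U" using ideal.Icarr[OF ideal_pow_facts(1)[OF U]] s by blast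
 then show ?thesis unfolding ideal_sheaf_pow_iff using U s by (auto intro!: exI[of _ U])
qed

lemma st_pow_facts:
 shows "x \<in> topspace (space_of S) ==> st (P 0) x = carrier (B x)"
  and st_pow_Suc_subset: "st (P (Suc n)) x \<subseteq> st (P n) x"
  and st_pow_one: "st (P (Suc 0)) x = st I x"
  and st_pow_mult: "a \<in> st I x ==> p \<in> st (P n) x ==> p \<otimes>\<^sub>x a \<in> st (P (Suc n)) x"
proof -
 have loc: "\<exists>U s. opn U \<and> x \<in> U \<and> s \<in> sec U \<and> s \<in> ideal_pow (sect S U) (I U) n \<and> b = germ S x U s"
  if b: "b \<in> st (P n) x" for b n x
 proof -
  obtain U s where U: "opn U" "x \<in> U" "s \<in> P n U" "b = germ S x U s"
   using b by (auto simp: ideal_stalk_def)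
  then obtain V where "opn V" "x \<in> V" "V \<subseteq> U" "restr S U V s \<in> ideal_pow (sect S V) (I V) n" "s \<in> sec U"
   unfolding ideal_sheaf_pow_iff by blast
  then show ?thesis using U by (intro exI[of _ V] exI[of _ "restr S U V s"]) auto
 qed
 have mk: "germ S x U s \<in> st (P n) x" if "opn U" "x \<in> U" "s \<in> ideal_pow (sect S U) (I U) n" for U s x n
  by (rule germ_in_st[where F = "P n", OF that(1,2) ideal_pow_in_sheaf[OF that(1,3)]])
 show "st (P (Suc n)) x \<subseteq> st (P n) x"
 proof
  fix b assume "b \<in> st (P (Suc n)) x"
  from loc[OF this] obtain U s where U: "opn U" "x \<in> U" "s \<in> ideal_pow (sect S U) (I U) (Suc n)" "b = germ S x U s"
   by (elim exE conjE)
  then show "b \<in> st (P n) x" using mk[OF U(1,2), of s n] ideal_pow_facts(2)[OF U(1)] by blast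
 qed
 show "st (P (Suc 0)) x = st I x"
 proof (intro equalityI subsetI)
  fix b assume "b \<in> st (P (Suc 0)) x"
  from loc[OF this] obtain U s where U: "opn U" "x \<in> U" "s \<in> ideal_pow (sect S U) (I U) (Suc 0)" "b = germ S x U s"
   by (elim exE conjE)
  then show "b \<in> st I x" using germ_in_st[where F = I, OF U(1,2)] ideal_pow_facts(3)[OF U(1)] by simp
 next
  fix b assume "b \<in> st I x"
  then obtain U s where U: "opn U" "x \<in> U" "s \<in> I U" "b = germ S x U s" by (auto simp: ideal_stalk_def)
  then show "b \<in> st (P (Suc 0)) x" using mk[OF U(1,2), of s "Suc 0"] ideal_pow_facts(3)[OF U(1)] by simp
 qed
 show "p \<otimes>\<^sub>x a \<in> st (P (Suc n)) x"
  if a: "a \<in> st I x" and p: "p \<in> st (P n) x"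
 proof -
  from loc[OF p] obtain U s where U: "opn U" "x \<in> U" "s \<in> sec U" "s \<in> ideal_pow (sect S U) (I U) n" "p = germ S x U s"
   by (elim exE conjE)
  obtain V t where V: "opn V" "x \<in> V" "V \<subseteq> U" "t \<in> I V" "t \<in> sec V" "a = germ S x V t"
   by (rule ideal_stalkE[OF I a U(1,2)])
  have "restr S U V s \<otimes>\<^bsub>sect S V\<^esub> t \<in> ideal_pow (sect S V) (I V) (Suc n)"
   using ideal_prod.prod[OF ideal_pow_restr[OF U(1) V(1,3) U(4)] V(4)] by simp
  from mk[OF V(1,2) this] show ?thesis using germ_mult[OF V(1,2) _ V(5), of "restr S U V s"] U V by simp
 qed
 show "st (P 0) x = carrier (B x)" if x: "x \<in> topspace (space_of S)"
 proof (intro equalityI subsetI)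
  fix b assume "b \<in> st (P 0) x"
  from loc[OF this] show "b \<in> carrier (B x)" by auto
 next
  fix b assume b: "b \<in> carrier (B x)"
  obtain U s where "opn U" "x \<in> U" "s \<in> sec U" "b = germ S x U s" by (rule stalkE[OF b _ x]) auto
  then show "b \<in> st (P 0) x" using mk[of U x s 0] by simp
 qed
qed

end

end

section \<open>Bases of stalks from local trivializations of a quotient sheaf\<close>

locale local_trivialization = quotient_sheaf Y Z \<pi> F G
 for Y :: "('p, 'r) ringed_space" and Z :: "('p, 's) ringed_space" and \<pi> F G +
 fixes U :: "'p set" and n :: nat and \<theta> :: "'p set => (nat => 's) => 'p => ('p set \<times> 'r) set set"
 assumes U: "openin (space_of Y) U"
  and iso: "mod_sheaf_iso (open_subspace Z U) (free_mod_sheaf Z n) (quot_sheaf Z Y \<pi> F G) \<theta>"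
begin

abbreviation vec where "vec V \<equiv> {..<n} \<rightarrow>\<^sub>E Z.sec V"
abbreviation vrestr where
 "vrestr V W v \<equiv> \<lambda>i\<in>{..<n}. restr Z V W (v i)"

definition unit_vec where
 "unit_vec V j = (\<lambda>i\<in>{..<n}. if i = j then \<one>\<^bsub>sect Z V\<^esub> else \<zero>\<^bsub>sect Z V\<^esub>)"

lemma free_simps:
 "carrier (msect (free_mod_sheaf Z n) V) = vec V"
 "v \<oplus>\<^bsub>msect (free_mod_sheaf Z n) V\<^esub> w = (\<lambda>i\<in>{..<n}. v i \<oplus>\<^bsub>sect Z V\<^esub> w i)"
 "a \<odot>\<^bsub>msect (free_mod_sheaf Z n) V\<^esub> v = (\<lambda>i\<in>{..<n}. a \<otimes>\<^bsub>sect Z V\<^esub> v i)"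
 "mrestr (free_mod_sheaf Z n) V W v = vrestr V W v"
 by (simp_all add: free_mod_sheaf_def)

lemma \<theta>_facts:
 assumes V: "opn V" "V \<subseteq> U"
 shows "v \<in> vec V ==> \<theta> V v \<in> Qsec V"
  "v \<in> vec V ==> w \<in> vec V ==> \<theta> V (\<lambda>i\<in>{..<n}. v i \<oplus>\<^bsub>sect Z V\<^esub> w i) = \<theta> V v \<oplus>\<^bsub>msect Q V\<^esub> \<theta> V w"
  "a \<in> Z.sec V ==> v \<in> vec V ==> \<theta> V (\<lambda>i\<in>{..<n}. a \<otimes>\<^bsub>sect Z V\<^esub> v i) = a \<odot>\<^bsub>msect Q V\<^esub> \<theta> V v"
  "bij_betw (\<theta> V) (vec V) (Qsec V)"
  "opn W ==> W \<subseteq> V ==> v \<in> vec V ==> \<theta> W (vrestr V W v) = restrict (\<theta> V v) W"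
proof -
 have s: "sect (open_subspace Z U) V = sect Z V" by (simp add: open_subspace_def)
 have o: "openin (space_of (open_subspace Z U)) V" if "opn V" "V \<subseteq> U" for V using that U by (simp add: open_subspace_def space_eq openin_open_subtopology)
 have i: "\<theta> V \<in> mod_hom (sect Z V) (msect (free_mod_sheaf Z n) V) (msect Q V) \<and>
    bij_betw (\<theta> V) (vec V) (Qsec V) \<and>
    (\<forall>W\<in>opens_in (open_subspace Z U) V. \<forall>v\<in>vec V. \<theta> W (vrestr V W v) = restrict (\<theta> V v) W)"
  using iso[unfolded mod_sheaf_iso_def free_simps Q_simps, THEN spec, THEN mp, OF o[OF V]] unfolding s .
 note h = mod_homD[OF i[THEN conjunct1], unfolded free_simps]
 show "v \<in> vec V ==> \<theta> V v \<in> Qsec V" by (rule h(1))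
 show "v \<in> vec V ==> w \<in> vec V ==> \<theta> V (\<lambda>i\<in>{..<n}. v i \<oplus>\<^bsub>sect Z V\<^esub> w i) = \<theta> V v \<oplus>\<^bsub>msect Q V\<^esub> \<theta> V w" by (rule h(2))
 show "a \<in> Z.sec V ==> v \<in> vec V ==> \<theta> V (\<lambda>i\<in>{..<n}. a \<otimes>\<^bsub>sect Z V\<^esub> v i) = a \<odot>\<^bsub>msect Q V\<^esub> \<theta> V v" by (rule h(3))
 show "bij_betw (\<theta> V) (vec V) (Qsec V)" using i by blast
 show "opn W ==> W \<subseteq> V ==> v \<in> vec V ==> \<theta> W (vrestr V W v) = restrict (\<theta> V v) W"
  using i o[of W] V by (auto simp: opens_in_def)
qed

lemma zcring: "opn V ==> cring (sect Z V)"
 by (rule Z.sect_cring) simp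

lemma unit_vec_in: "opn V ==> unit_vec V j \<in> vec V"
 using cring.cring_simprules(2,6)[OF zcring] by (auto simp: unit_vec_def)

lemma unit_vec_restr: "opn V ==> opn W ==> W \<subseteq> V ==> vrestr V W (unit_vec V j) = unit_vec W j"
 by (auto simp: unit_vec_def fun_eq_iff)

lemma vrestr_in: "opn V ==> opn W ==> W \<subseteq> V ==> v \<in> vec V ==> vrestr V W v \<in> vec W"
 by (auto intro!: Z.restr_simps)

lemma zero_vec_mem:
 assumes V: "opn V" "V \<subseteq> U" "y \<in> V" and z: "!!i. i < n ==> v i = \<zero>\<^bsub>sect Z V\<^esub>" "v \<in> vec V"
 shows "t \<in> \<theta> V v y \<longleftrightarrow> t \<in> st G y"
proof -
 note yT = Y.opn_topspace[OF V(1,3)]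
 interpret zv: cring "sect Z V" by (rule zcring[OF V(1)])
 interpret B: cring "B y" by (rule st_facts(1)[OF yT])
 interpret G: ideal "st G y" "B y" by (rule st_facts(3)[OF yT])
 have v: "\<theta> V v \<in> Qsec V" using \<theta>_facts(1) V z by blast
 have eq: "(\<lambda>i\<in>{..<n}. v i \<oplus>\<^bsub>sect Z V\<^esub> v i) = v"
  using z by (auto simp: fun_eq_iff PiE_iff extensional_def)
 obtain t0 where t0: "t0 \<in> \<theta> V v y" by (rule section_ne[OF v V(1,3)])
 note tv = section_val[OF v V(1,3) t0]
 \<comment> \<open>The zero vector satisfies v + v = v, so t0 + t0 and t0 lie in one coset of the
   stalk of G; hence t0 lies in that stalk.\<close>
 have "t0 \<oplus>\<^sub>y t0 \<in> \<theta> V v y"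
  using add_mem[OF v v V(1,3) t0 t0] \<theta>_facts(2)[OF V(1,2) z(2,2)] unfolding eq by simp
 then have "t0 \<in> st G y" using tv(2) by (simp add: tv(4) a_minus_def B.a_assoc B.r_neg)
 then have "\<theta> V v y = st G y" using tv(3) G.a_rcos_const by simp
 then show ?thesis by simp
qed

lemma basis_sections:
 assumes x: "x \<in> U" and j: "j \<le> n"
 shows "\<exists>V s. opn V \<and> x \<in> V \<and> V \<subseteq> U \<and>
  (\<forall>i<j. s i \<in> F V \<and> (\<forall>y\<in>V. germ Y y V (s i) \<in> \<theta> U (unit_vec U i) y))"
 using j
proof (induction j)
 case 0
 then show ?case using U x by auto
next
 case (Suc j)
 then obtain V s where V: "opn V" "x \<in> V" "V \<subseteq> U"
  "!!i. i < j ==> s i \<in> F V \<and> (\<forall>y\<in>V. germ Y y V (s i) \<in> \<theta> U (unit_vec U i) y)" by auto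
 have e: "\<theta> U (unit_vec U j) \<in> Qsec U" by (rule \<theta>_facts(1)[OF U order_refl unit_vec_in[OF U]])
 obtain t where "t \<in> \<theta> U (unit_vec U j) x" by (rule section_ne[OF e U x])
 then obtain W r where W: "opn W" "x \<in> W" "W \<subseteq> U" "r \<in> F W" "!!y. y \<in> W ==> germ Y y W r \<in> \<theta> U (unit_vec U j) y"
  by (rule sectionE[OF e U x]) blast
 let ?W = "V \<inter> W" and ?s = "\<lambda>i. if i = j then restr Y W (V \<inter> W) r else restr Y V (V \<inter> W) (s i)"
 have o: "opn ?W" using V W by blast
 have "?s i \<in> F ?W \<and> (\<forall>y\<in>?W. germ Y y ?W (?s i) \<in> \<theta> U (unit_vec U i) y)" if i: "i < Suc j" for i
 proof (cases "i = j")
  case True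
  then show ?thesis using Y.ideal_sheafD(2,3)[OF F] W V o by auto
 next
  case False
  then have "s i \<in> F V" "\<forall>y\<in>V. germ Y y V (s i) \<in> \<theta> U (unit_vec U i) y" using V(4)[of i] i by auto
  then show ?thesis using False Y.ideal_sheafD(2,3)[OF F] W V o by auto
 qed
 then show ?case using o V W by (intro exI[of _ ?W] exI[of _ ?s]) auto
qed

context
 fixes V s
 assumes V: "opn V" "V \<subseteq> U"
  and s: "!!i. i < n ==> s i \<in> F V" "!!i y. i < n ==> y \<in> V ==> germ Y y V (s i) \<in> \<theta> U (unit_vec U i) y"
begin

text \<open>The partial sums that are to give copies of the stalk of Z. \<open>vec_in_stage\<close>
  and \<open>stage_vec\<close> match stage j with the vectors supported on the first j
  coordinates.\<close>

abbreviation "stage y j \<equiv> seq_ideal (B y) (st G y) (\<lambda>i. germ Y y V (s i)) j"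

lemma germ_s: "i < n ==> y \<in> V ==> germ Y y V (s i) \<in> carrier (B y)"
 using s(1) Y.ideal_sheafD(2)[OF F V(1)] V(1) by simp

lemma stage_ideal: "y \<in> V ==> j \<le> n ==> ideal (stage y j) (B y) \<and> st G y \<subseteq> stage y j"
 using seq_ideal_ideal(1,2)[OF st_facts(1,3)[OF Y.opn_topspace[OF V(1)]], of y j "\<lambda>i. germ Y y V (s i)"] germ_s by auto

text \<open>On representatives, changing the j-th coordinate from 0 to a adds a lift of a times the
  j-th basis germ.\<close>

lemma add_multiple_mem:
 assumes W: "opn W" "W \<subseteq> V" "y \<in> W" and v: "v \<in> vec W" and j: "j < n" and a: "a \<in> Z.sec W"
  and t: "t \<in> \<theta> W v y" and b: "b \<in> carrier (B y)" "stalk_map y b = germ Z y W a" and vj: "v j = \<zero>\<^bsub>sect Z W\<^esub>"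
 shows "v(j := a) \<in> vec W" "t \<oplus>\<^sub>y b \<otimes>\<^sub>y germ Y y V (s j) \<in> \<theta> W (v(j := a)) y"
proof -
 interpret zw: cring "sect Z W" by (rule zcring[OF W(1)])
 have WU: "W \<subseteq> U" using W V by blast
 have vi: "v i \<in> Z.sec W" if "i < n" for i using v that by auto
 show va: "v(j := a) \<in> vec W" using v a j by (auto simp: PiE_iff extensional_def)
 let ?e = "unit_vec W j" and ?w = "\<lambda>i\<in>{..<n}. a \<otimes>\<^bsub>sect Z W\<^esub> unit_vec W j i"
 have w: "?w \<in> vec W" using a by (auto simp: unit_vec_def)
 have eq: "(\<lambda>i\<in>{..<n}. v i \<oplus>\<^bsub>sect Z W\<^esub> ?w i) = v(j := a)"
  using v a j vj vi by (auto simp: fun_eq_iff unit_vec_def PiE_iff extensional_def)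
 have yV: "y \<in> V" using W by blast
 have "\<theta> W ?e = restrict (\<theta> U (unit_vec U j)) W"
  using \<theta>_facts(5)[OF U order_refl W(1) WU unit_vec_in[OF U]] unit_vec_restr[OF U W(1) WU] by simp
 then have "germ Y y V (s j) \<in> \<theta> W ?e y" using s(2)[OF j yV] W(3) by simp
 from smult_mem[OF \<theta>_facts(1)[OF W(1) WU unit_vec_in[OF W(1)]] W(1,3) this a b]
 have "b \<otimes>\<^sub>y germ Y y V (s j) \<in> \<theta> W ?w y"
  using \<theta>_facts(3)[OF W(1) WU a unit_vec_in[OF W(1)]] by simp
 from add_mem[OF \<theta>_facts(1)[OF W(1) WU v] \<theta>_facts(1)[OF W(1) WU w] W(1,3) t this]
 show "t \<oplus>\<^sub>y b \<otimes>\<^sub>y germ Y y V (s j) \<in> \<theta> W (v(j := a)) y"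
  using \<theta>_facts(2)[OF W(1) WU v w] unfolding eq by (simp only:)
qed

lemma vec_in_stage:
 assumes W: "opn W" "W \<subseteq> V" "y \<in> W"
 shows "j \<le> n ==> v \<in> vec W ==> (!!i. j \<le> i ==> i < n ==> v i = \<zero>\<^bsub>sect Z W\<^esub>) ==> t \<in> \<theta> W v y ==> t \<in> stage y j"
proof (induction j arbitrary: v t)
 case 0
 have "W \<subseteq> U" using W V by blast
 then show ?case using zero_vec_mem[OF W(1) _ W(3) _ "0.prems"(2)] "0.prems"(3,4) by simp
next
 case (Suc j)
 have WU: "W \<subseteq> U" and yV: "y \<in> V" using W V by auto
 interpret zw: cring "sect Z W" by (rule zcring[OF W(1)])
 interpret B: cring "B y" by (rule st_facts(1)[OF Y.opn_topspace[OF W(1,3)]])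
 have jn: "j < n" using Suc.prems by simp
 interpret J: ideal "stage y j" "B y" using stage_ideal[OF yV, of j] jn by simp
 let ?v = "v(j := \<zero>\<^bsub>sect Z W\<^esub>)"
 have v': "?v \<in> vec W" using Suc.prems(2) jn by (auto simp: PiE_iff extensional_def)
 have a: "v j \<in> Z.sec W" using Suc.prems(2) jn by auto
 obtain t' where t': "t' \<in> \<theta> W ?v y" by (rule section_ne[OF \<theta>_facts(1)[OF W(1) WU v'] W(1,3)])
 have t'J: "t' \<in> stage y j" by (rule Suc.IH[OF _ v' _ t']) (use Suc.prems jn in auto)
 obtain b where b: "b \<in> carrier (B y)" "stalk_map y b = germ Z y W (v j)" by (rule lift_at[OF W(1,3) a])
 let ?r = "b \<otimes>\<^sub>y germ Y y V (s j)"
 have gc: "germ Y y V (s j) \<in> carrier (B y)" "?r \<in> carrier (B y)" using germ_s[OF jn yV] b by auto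
 have "t' \<oplus>\<^sub>y ?r \<in> \<theta> W (?v(j := v j)) y"
  by (rule add_multiple_mem(2)[OF W v' jn a t' b]) simp
 then have m: "t' \<oplus>\<^sub>y ?r \<in> \<theta> W v y" by simp
 have c: "t' \<in> carrier (B y)" using t'J by (rule J.Icarr)
 have t: "t \<in> carrier (B y)" "t \<ominus>\<^sub>y (t' \<oplus>\<^sub>y ?r) \<in> st G y"
  using section_val(4)[OF \<theta>_facts(1)[OF W(1) WU Suc.prems(2)] W(1,3) m] Suc.prems(4) by auto
 define w where "w = (t \<ominus>\<^sub>y (t' \<oplus>\<^sub>y ?r)) \<oplus>\<^sub>y t'"
 have "w \<in> stage y j" unfolding w_def using t(2) t'J stage_ideal[OF yV, of j] jn by auto
 moreover have "t = w \<oplus>\<^sub>y ?r"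
  unfolding w_def using t(1) c gc by (simp add: a_minus_def B.minus_add B.a_assoc B.l_neg)
   (simp add: B.a_comm B.a_lcomm B.r_neg B.a_assoc B.r_neg1)
 ultimately show ?case using b(1) by (auto simp: adjoin_def)
qed

lemma stage_vec:
 assumes y: "y \<in> V"
 shows "j \<le> n ==> k \<in> stage y j ==> \<exists>W v. opn W \<and> y \<in> W \<and> W \<subseteq> V \<and> v \<in> vec W \<and>
  (\<forall>i. j \<le> i --> i < n --> v i = \<zero>\<^bsub>sect Z W\<^esub>) \<and> k \<in> \<theta> W v y"
proof (induction j arbitrary: k)
 case 0
 interpret zv: cring "sect Z V" by (rule zcring[OF V(1)])
 define v where "v = (\<lambda>i\<in>{..<n}. \<zero>\<^bsub>sect Z V\<^esub>)"
 have v: "v \<in> vec V" "!!i. i < n ==> v i = \<zero>\<^bsub>sect Z V\<^esub>" by (auto simp: v_def)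
 have "k \<in> \<theta> V v y" using zero_vec_mem[OF V y v(2,1)] 0 by simp
 then show ?case using V(1) y v by blast
next
 case (Suc j)
 from Suc.prems(2) obtain w r where w: "w \<in> stage y j" "r \<in> carrier (B y)"
  "k = w \<oplus>\<^sub>y r \<otimes>\<^sub>y germ Y y V (s j)" by (auto simp: adjoin_def)
 obtain W v where W: "opn W" "y \<in> W" "W \<subseteq> V" "v \<in> vec W"
  "!!i. j \<le> i ==> i < n ==> v i = \<zero>\<^bsub>sect Z W\<^esub>" "w \<in> \<theta> W v y"
  using Suc.IH[OF _ w(1)] Suc.prems(1) by auto
 obtain W' r' where W': "opn W'" "y \<in> W'" "W' \<subseteq> W" "r' \<in> Y.sec W'" "r = germ Y y W' r'"
  by (rule Y.stalkE[OF w(2) W(1,2)])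
 have sub: "W' \<subseteq> V" "W' \<subseteq> U" "W \<subseteq> U" using W W' V by auto
 let ?v = "vrestr W W' v" and ?a = "\<pi> W' r'"
 have v': "?v \<in> vec W'" by (rule vrestr_in[OF W(1) W'(1,3) W(4)])
 have wv: "w \<in> \<theta> W' ?v y" using \<theta>_facts(5)[OF W(1) sub(3) W'(1,3) W(4)] W(6) W'(2) by simp
 have jn: "j < n" using Suc.prems by simp
 have a: "?a \<in> Z.sec W'" using W' by simp
 have z: "?v i = \<zero>\<^bsub>sect Z W'\<^esub>" if "j \<le> i" "i < n" for i using W(1,5) W' that by simp
 have "k \<in> \<theta> W' (?v(j := ?a)) y"
  unfolding w(3) by (rule add_multiple_mem(2)[OF W'(1) sub(1) W'(2) v' jn a wv w(2) _ z])
   (insert W' jn, simp_all add: stalk_map_germ)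
 moreover have "?v(j := ?a) \<in> vec W'"
  by (rule add_multiple_mem(1)[OF W'(1) sub(1) W'(2) v' jn a wv w(2) _ z])
   (insert W' jn, simp_all add: stalk_map_germ)
 moreover have "\<forall>i. Suc j \<le> i --> i < n --> (?v(j := ?a)) i = \<zero>\<^bsub>sect Z W'\<^esub>" using z by auto
 ultimately show ?case using W' sub by (intro exI[of _ W'] exI[of _ "?v(j := ?a)"] conjI)
qed

lemma stage_n: "y \<in> V ==> stage y n = st F y"
proof (intro equalityI subsetI)
 fix k assume y: "y \<in> V" and k: "k \<in> stage y n"
 obtain W v where W: "opn W" "y \<in> W" "W \<subseteq> V" "v \<in> vec W" "k \<in> \<theta> W v y" using stage_vec[OF y order_refl k] by blast
 then show "k \<in> st F y" using section_val(1)[OF \<theta>_facts(1) W(1,2,5)] V by blast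
next
 fix b assume y: "y \<in> V" and b: "b \<in> st F y"
 obtain W t where W: "opn W" "y \<in> W" "W \<subseteq> V" "t \<in> F W" "b = germ Y y W t" by (rule Y.ideal_stalkE[OF F b V(1) y])
 have WU: "W \<subseteq> U" using W V by blast
 obtain v where v: "v \<in> vec W" "sclass W t = \<theta> W v"
  using sclass_in[OF W(1,4)] \<theta>_facts(4)[OF W(1) WU] by (auto simp: bij_betw_def)
 show "b \<in> stage y n"
  by (rule vec_in_stage[OF W(1,3,2) order_refl v(1)]) (use sclass_mem[OF W(1,4,2)] v W in auto)
qed

text \<open>If r times the j-th germ lies in stage j, it is represented both by a vector with j-th
  entry 0 and by the vector whose only entry is the image of r at j. The two sections agree near y,
  and injectivity of \<theta> there makes the image of r zero.\<close>

lemma stage_colon: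
 assumes y: "y \<in> V" and j: "j < n"
 shows "colon (B y) (stage y j) (germ Y y V (s j)) = st (I) y"
proof (intro equalityI subsetI)
 note yT = Y.opn_topspace[OF V(1) y]
 fix r assume "r \<in> colon (B y) (stage y j) (germ Y y V (s j))"
 then have r: "r \<in> carrier (B y)" "r \<otimes>\<^sub>y germ Y y V (s j) \<in> stage y j" by (auto simp: colon_def)
 interpret B: cring "B y" by (rule st_facts(1)[OF yT])
 let ?k = "r \<otimes>\<^sub>y germ Y y V (s j)"
 obtain W v where W: "opn W" "y \<in> W" "W \<subseteq> V" "v \<in> vec W"
  "!!i. j \<le> i ==> i < n ==> v i = \<zero>\<^bsub>sect Z W\<^esub>" "?k \<in> \<theta> W v y"
  using stage_vec[OF y _ r(2)] j by auto
 obtain W' r' where W': "opn W'" "y \<in> W'" "W' \<subseteq> W" "r' \<in> Y.sec W'" "r = germ Y y W' r'"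
  by (rule Y.stalkE[OF r(1) W(1,2)])
 have sub: "W' \<subseteq> V" "W' \<subseteq> U" "W \<subseteq> U" using W W' V by auto
 interpret zw: cring "sect Z W'" by (rule zcring[OF W'(1)])
 let ?z = "\<lambda>i\<in>{..<n}. \<zero>\<^bsub>sect Z W'\<^esub>" and ?a = "\<pi> W' r'"
 have z: "?z \<in> vec W'" by auto
 have z0: "\<zero>\<^sub>y \<in> \<theta> W' ?z y"
  using zero_vec_mem[OF W'(1) sub(2) W'(2) _ z] additive_subgroup.zero_closed[OF ideal.axioms(1)[OF st_facts(3)[OF yT]]] by simp
 have a: "?a \<in> Z.sec W'" "stalk_map y r = germ Z y W' ?a" using W' by (auto simp: stalk_map_germ)
 note za = add_multiple_mem[OF W'(1) sub(1) W'(2) z j a(1) z0 r(1) a(2)]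
 have m: "?k \<in> \<theta> W' (?z(j := ?a)) y" using za(2) r(1) germ_s[OF j y] j by simp
 have za': "?z(j := ?a) \<in> vec W'" using za(1) j by simp
 obtain N where N: "opn N" "y \<in> N" "N \<subseteq> W" "N \<subseteq> W'" "restrict (\<theta> W v) N = restrict (\<theta> W' (?z(j := ?a))) N"
  by (rule section_locally_eq[OF \<theta>_facts(1)[OF W(1) sub(3) W(4)] \<theta>_facts(1)[OF W'(1) sub(2) za'] W(1) W'(1) W(2) W'(2) W(6) m])
 have NU: "N \<subseteq> U" using N sub by blast
 have "\<theta> N (vrestr W N v) = \<theta> N (vrestr W' N (?z(j := ?a)))"
  using N \<theta>_facts(5)[OF W(1) sub(3) N(1,3) W(4)] \<theta>_facts(5)[OF W'(1) sub(2) N(1,4) za'] by simp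
 then have "vrestr W N v = vrestr W' N (?z(j := ?a))"
  using inj_onD[OF bij_betw_imp_inj_on[OF \<theta>_facts(4)[OF N(1) NU]] _ vrestr_in[OF W(1) N(1,3) W(4)] vrestr_in[OF W'(1) N(1,4) za']]
  by (simp only:)
 from fun_cong[OF this, of j] have "restr Z W' N ?a = \<zero>\<^bsub>sect Z N\<^esub>" using j W N by simp
 then have "restr Y W' N r' \<in> I N" using N W' by (simp add: kernel_iff)
 from Y.germ_in_st[where F = "I", OF N(1,2) this]
 show "r \<in> st (I) y" using W' N by simp
next
 note yT = Y.opn_topspace[OF V(1) y]
 fix c assume c: "c \<in> st (I) y"
 have "c \<in> carrier (B y)" using ideal.Icarr[OF Y.st_ideal[OF kernel_ideal_sheaf yT] c] .
 moreover have "c \<otimes>\<^sub>y germ Y y V (s j) \<in> st G y"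
  by (rule IFG[OF yT c Y.germ_in_st[where F = F, OF V(1) y s(1)[OF j]]])
 ultimately show "c \<in> colon (B y) (stage y j) (germ Y y V (s j))"
  using stage_ideal[OF y, of j] j by (auto simp: colon_def)
qed

lemma stage_basis:
 "y \<in> V ==> quotient_basis (B y) (st (I) y) (st G y) (st F y) (\<lambda>i. germ Y y V (s i)) n"
 by (simp add: quotient_basis_def germ_s stage_n stage_colon)

end

end

section \<open>Multiple structures of free type\<close>

lemma adjoin_seq_killed:
 fixes R (structure) assumes R: "cring R" and W: "ideal W R" and g: "!!i. i < n ==> g i \<in> carrier R" and b: "b \<in> carrier R"
  and kW: "!!w. w \<in> W ==> b \<otimes> w = \<zero>" and kg: "!!i. i < n ==> b \<otimes> g i = \<zero>"
  and w: "w \<in> seq_ideal R W g n"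
 shows "b \<otimes> w = \<zero>"
proof -
 interpret R: cring R by (rule R)
 interpret W: ideal W R by (rule W)
 have "seq_ideal R W g n \<subseteq> colon R {\<zero>} b"
  by (rule adjoin_seq_least[OF self_module_is_module[OF R]])
   (insert W colon_ideal(1)[OF R R.zeroideal b] submodule_self_iff[OF R] kW kg g b, auto simp: colon_def R.m_comm)
 then show ?thesis using w b by (auto simp: colon_def R.m_comm)
qed

context ringed
begin

lemma ann_sheaf_cong:
 assumes "res_closed F" "res_closed F'" "opn U" "!!y. y \<in> U ==> st F y = st F' y"
 shows "ann_sheaf S F U = ann_sheaf S F' U"
proof -
 have "s \<in> ann_sheaf S F U \<longleftrightarrow> s \<in> ann_sheaf S F' U" for s using assms by (simp add: ann_sheaf_iff)
 then show ?thesis by blast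
qed

lemma ann_stalk_sectionI:
 assumes "res_closed F" "opn U" "x \<in> U" "s \<in> sec U"
  and "!!y t. y \<in> U ==> t \<in> st F y ==> germ S y U s \<otimes>\<^sub>y t = \<zero>\<^sub>y"
 shows "germ S x U s \<in> st (ann_sheaf S F) x"
 by (rule germ_in_st[where F = "ann_sheaf S F", OF assms(2,3)]) (insert assms, simp add: ann_sheaf_iff)

end

locale free_multiple_structure = ringed_surjection Y Z \<pi>
 for Y :: "('p, 'r) ringed_space" and Z :: "('p, 's) ringed_space" and \<pi> +
 fixes m :: nat
 assumes conn: "connected_space (space_of Y)"
  and Y_local: "!!x. x \<in> topspace (space_of Y) ==> noetherian_local_ring (stalk Y x)"
  and Z_regular: "!!x. x \<in> topspace (space_of Y) ==> regular_local_ring (stalk Z x)"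
  and pow_nonzero: "\<not> zero_ideal_sheaf Y (ideal_sheaf_pow Y (kernel_sheaf Y Z \<pi>) m)"
  and pow_zero: "zero_ideal_sheaf Y (ideal_sheaf_pow Y (kernel_sheaf Y Z \<pi>) (Suc m))"
  and free: "!!l. l \<le> m ==> locally_free Z (M_piece Z Y \<pi> m l)"
begin

abbreviation "P \<equiv> ideal_sheaf_pow Y I"
abbreviation "F \<equiv> I_filt Y I m"
abbreviation "J \<equiv> J_filt Y I m"
abbreviation "basis l x \<equiv> quotient_basis (B x) (st I x) (st (F (Suc l)) x) (st (F l) x)"

lemma T_opn: "opn T"
 by simp

lemma B_facts: assumes "x \<in> T" shows "cring (B x)" "noetherian_ring (B x)" "ideal (st I x) (B x)"
 using Y_local[OF assms] Y.st_ideal[OF kernel_ideal_sheaf assms] by (auto simp: noetherian_local_ring_def)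

lemma P_res_closed: "Y.res_closed (P n)"
 by (rule Y.ideal_sheaf_pow_res_closed[OF kernel_ideal_sheaf])

lemma F_ideal_sheaf: "Y.ideal_sheaf (F l)"
 unfolding I_filt_def by (rule Y.ann_ideal_sheaf[OF P_res_closed])

lemma J_ideal_sheaf: "Y.ideal_sheaf (J l)"
 unfolding J_filt_def by (rule Y.ann_ideal_sheaf[OF Y.ideal_sheaf_res_closed[OF F_ideal_sheaf]])

lemma F_res_closed: "Y.res_closed (F l)"
 by (rule Y.ideal_sheaf_res_closed[OF F_ideal_sheaf])

lemma F_ideal: "x \<in> T ==> ideal (st (F l) x) (B x)"
 by (rule Y.st_ideal[OF F_ideal_sheaf])

lemma J_ideal: "x \<in> T ==> ideal (st (J l) x) (B x)"
 by (rule Y.st_ideal[OF J_ideal_sheaf])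

lemma F_car: "x \<in> T ==> b \<in> st (F l) x ==> b \<in> carrier (B x)"
 by (rule ideal.Icarr[OF F_ideal])

lemma J_car: "x \<in> T ==> b \<in> st (J l) x ==> b \<in> carrier (B x)"
 by (rule ideal.Icarr[OF J_ideal])

lemma I_car: "x \<in> T ==> b \<in> st I x ==> b \<in> carrier (B x)"
 by (rule ideal.Icarr[OF B_facts(3)])

lemma P_car: "x \<in> T ==> p \<in> st (P n) x ==> p \<in> carrier (B x)"
 by (rule Y.res_closed_stE[OF P_res_closed _ T_opn]) auto

lemma F_kills: "x \<in> T ==> b \<in> st (F l) x ==> p \<in> st (P (m + 1 - l)) x ==> b \<otimes>\<^sub>x p = \<zero>\<^sub>x"
 unfolding I_filt_def by (rule Y.ann_stalk_kills[OF P_res_closed])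

lemma J_kills: "x \<in> T ==> b \<in> st (J l) x ==> p \<in> st (F (m + 1 - l)) x ==> b \<otimes>\<^sub>x p = \<zero>\<^sub>x"
 unfolding J_filt_def by (rule Y.ann_stalk_kills[OF F_res_closed])

lemma F_sectionI:
 assumes "opn U" "x \<in> U" "s \<in> Y.sec U"
  and "!!y p. y \<in> U ==> p \<in> st (P (m + 1 - l)) y ==> germ Y y U s \<otimes>\<^sub>y p = \<zero>\<^sub>y"
 shows "germ Y x U s \<in> st (F l) x"
 unfolding I_filt_def by (rule Y.ann_stalk_sectionI[OF P_res_closed assms])

lemma F_Suc_subset: "x \<in> T ==> st (F (Suc l)) x \<subseteq> st (F l) x"
proof
 fix b assume x: "x \<in> T" and b: "b \<in> st (F (Suc l)) x"
 obtain U s where U: "opn U" "x \<in> U" "s \<in> F (Suc l) U" "s \<in> Y.sec U" "b = germ Y x U s"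
  by (rule Y.ideal_stalkE[OF F_ideal_sheaf b T_opn x]) blast
 show "b \<in> st (F l) x"
  unfolding U(5)
 proof (rule F_sectionI[OF U(1,2,4)])
  fix y p assume y: "y \<in> U" and p: "p \<in> st (P (m + 1 - l)) y"
  \<comment> \<open>For l > m both exponents are 0 by truncated subtraction.\<close>
  have "p \<in> st (P (m + 1 - Suc l)) y"
   using p Y.st_pow_Suc_subset[OF kernel_ideal_sheaf, of "m - l" y] by (cases "l \<le> m") (auto simp: Suc_diff_le)
  then show "germ Y y U s \<otimes>\<^sub>y p = \<zero>\<^sub>y"
   using F_kills[OF Y.opn_topspace[OF U(1) y] Y.germ_in_st[where F = "F (Suc l)", OF U(1) y U(3)]] by blast
 qed
qed

text \<open>The power I^(m-l) times c lies in I^(m+1-l), which b annihilates. Sections are used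
  instead of germs because membership in the stalk of an annihilator needs the vanishing at all
  nearby points.\<close>

lemma I_F_subset:
 assumes x: "x \<in> T" and l: "l \<le> m" and c: "c \<in> st I x" and b: "b \<in> st (F l) x"
 shows "c \<otimes>\<^sub>x b \<in> st (F (Suc l)) x"
proof -
 obtain U s where U: "opn U" "x \<in> U" "s \<in> F l U" "s \<in> Y.sec U" "b = germ Y x U s"
  by (rule Y.ideal_stalkE[OF F_ideal_sheaf b T_opn x]) blast
 obtain V t where V: "opn V" "x \<in> V" "V \<subseteq> U" "t \<in> I V" "t \<in> Y.sec V" "c = germ Y x V t"
  by (rule Y.ideal_stalkE[OF kernel_ideal_sheaf c U(1,2)])
 let ?s = "restr Y U V s"
 interpret V: cring "sect Y V" by (rule Y.sect_cring[OF V(1)])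
 have s: "?s \<in> F l V" "?s \<in> Y.sec V" "germ Y x V ?s = b"
  using U V Y.ideal_sheafD(3)[OF F_ideal_sheaf U(1) V(1,3) U(3)] by auto
 have "germ Y x V (t \<otimes>\<^bsub>sect Y V\<^esub> ?s) \<in> st (F (Suc l)) x"
 proof (rule F_sectionI[OF V(1,2)])
  show "t \<otimes>\<^bsub>sect Y V\<^esub> ?s \<in> Y.sec V" using V s by simp
  fix y p assume y: "y \<in> V" and p: "p \<in> st (P (m + 1 - Suc l)) y"
  have yT: "y \<in> T" by (rule Y.opn_topspace[OF V(1) y])
  interpret B: cring "B y" by (rule B_facts[OF yT])
  have pc: "p \<in> carrier (B y)" by (rule P_car[OF yT p])
  have tI: "germ Y y V t \<in> st I y" by (rule Y.germ_in_st[where F = I, OF V(1) y V(4)])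
  have "p \<otimes>\<^sub>y germ Y y V t \<in> st (P (m + 1 - l)) y"
   using Y.st_pow_mult[OF kernel_ideal_sheaf tI p] l by (simp add: Suc_diff_le)
  then have "germ Y y V ?s \<otimes>\<^sub>y (p \<otimes>\<^sub>y germ Y y V t) = \<zero>\<^sub>y"
   by (rule F_kills[OF yT Y.germ_in_st[where F = "F l", OF V(1) y s(1)]])
  then show "germ Y y V (t \<otimes>\<^bsub>sect Y V\<^esub> ?s) \<otimes>\<^sub>y p = \<zero>\<^sub>y"
   unfolding Y.germ_mult[OF V(1) y V(5) s(2)]
   using pc Y.germ_closed[OF V(1) y V(5)] Y.germ_closed[OF V(1) y s(2)] by (simp add: B.m_ac)
 qed
 then show ?thesis unfolding Y.germ_mult[OF V(1,2) V(5) s(2)] using s V by simp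
qed

lemma F_0: "x \<in> T ==> st (F 0) x = carrier (B x)"
proof (intro equalityI subsetI)
 fix b assume x: "x \<in> T" and b: "b \<in> carrier (B x)"
 obtain U s where U: "opn U" "x \<in> U" "s \<in> Y.sec U" "b = germ Y x U s" by (rule Y.stalkE[OF b T_opn x])
 show "b \<in> st (F 0) x"
  unfolding U(4)
 proof (rule F_sectionI[OF U(1-3)])
  fix y p assume y: "y \<in> U" and p: "p \<in> st (P (m + 1 - 0)) y"
  interpret B: cring "B y" by (rule B_facts[OF Y.opn_topspace[OF U(1) y]])
  have "p = \<zero>\<^sub>y"
   using p pow_zero Y.germ_zero unfolding ideal_stalk_def zero_ideal_sheaf_def by auto
  then show "germ Y y U s \<otimes>\<^sub>y p = \<zero>\<^sub>y" using U y by simp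
 qed
qed (rule F_car)

lemma F_top: "x \<in> T ==> st (F (Suc m)) x = {\<zero>\<^sub>x}"
proof -
 assume x: "x \<in> T"
 interpret B: cring "B x" by (rule B_facts[OF x])
 have "b = \<zero>\<^sub>x" if b: "b \<in> st (F (Suc m)) x" for b
 proof -
  have "\<one>\<^sub>x \<in> st (P (m + 1 - Suc m)) x" using Y.st_pow_facts(1)[OF kernel_ideal_sheaf x] by simp
  then have "b \<otimes>\<^sub>x \<one>\<^sub>x = \<zero>\<^sub>x" by (rule F_kills[OF x b])
  then show ?thesis using F_car[OF x b] by simp
 qed
 then show ?thesis using additive_subgroup.zero_closed[OF ideal.axioms(1)[OF F_ideal[OF x, of "Suc m"]]] by blast
qed

lemma quotient_F: "l \<le> m ==> quotient_sheaf Y Z \<pi> (F l) (F (Suc l))"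
 by (intro quotient_sheaf.intro quotient_sheaf_axioms.intro ringed_surjection_axioms F_ideal_sheaf)
  (use F_Suc_subset I_F_subset in blast)+

lemma trivialization_at:
 assumes l: "l \<le> m" and x: "x \<in> T"
 obtains U n \<theta> where "local_trivialization Y Z \<pi> (F l) (F (Suc l)) U n \<theta>" "x \<in> U"
  "mod_sheaf_iso (open_subspace Z U) (free_mod_sheaf Z n) (M_piece Z Y \<pi> m l) \<theta>"
proof -
 have "x \<in> topspace (space_of Z)" using x by (simp add: space_eq)
 then obtain U n \<theta> where U: "Z.opn U" "x \<in> U" "mod_sheaf_iso (open_subspace Z U) (free_mod_sheaf Z n) (M_piece Z Y \<pi> m l) \<theta>"
  using free[OF l] unfolding locally_free_def by blast
 have "local_trivialization Y Z \<pi> (F l) (F (Suc l)) U n \<theta>"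
  by (intro local_trivialization.intro local_trivialization_axioms.intro quotient_F l)
   (insert U, simp_all add: M_piece_def Let_def)
 then show ?thesis using that U by blast
qed

lemma basis_at:
 assumes l: "l \<le> m" and x: "x \<in> T"
 obtains V n s where "opn V" "x \<in> V" "!!i. i < n ==> s i \<in> F l V" "!!i. i < n ==> s i \<in> Y.sec V"
  "!!y. y \<in> V ==> basis l y (\<lambda>i. germ Y y V (s i)) n"
proof -
 obtain U n \<theta> where U: "local_trivialization Y Z \<pi> (F l) (F (Suc l)) U n \<theta>" "x \<in> U" by (rule trivialization_at[OF l x])
 interpret t: local_trivialization Y Z \<pi> "F l" "F (Suc l)" U n \<theta> by (rule U)
 obtain V s where V: "opn V" "x \<in> V" "V \<subseteq> U"
  "!!i. i < n ==> s i \<in> F l V" "!!i y. i < n ==> y \<in> V ==> germ Y y V (s i) \<in> \<theta> U (t.unit_vec U i) y"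
  using t.basis_sections[OF U(2) order_refl] by blast
 show ?thesis
  by (rule that[OF V(1,2,4) Y.ideal_sheafD(2)[OF F_ideal_sheaf V(1) V(4)] t.stage_basis[OF V(1,3-5)]])
qed

lemma one_notin_I: "x \<in> T ==> \<one>\<^sub>x \<notin> st I x"
proof
 assume x: "x \<in> T" and "\<one>\<^sub>x \<in> st I x"
 interpret s: surjective_ring_hom "B x" "stalk Z x" "stalk_map x" by (rule stalk_map_surjective[OF x])
 have one: "\<one>\<^bsub>stalk Z x\<^esub> = \<zero>\<^bsub>stalk Z x\<^esub>"
  using \<open>\<one>\<^sub>x \<in> st I x\<close> unfolding stalk_map_kernel[OF x, symmetric] s.K_def by simp
 obtain M where "maximalideal M (stalk Z x)"
  using Z_regular[OF x] by (auto simp: regular_local_ring_def)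
 then interpret M: maximalideal M "stalk Z x" .
 have "carrier (stalk Z x) = {\<zero>\<^bsub>stalk Z x\<^esub>}" using s.A.one_zeroD[OF one] by simp
 then show False using M.I_notcarr M.zero_closed M.a_subset by auto
qed

text \<open>Where the piece M_0 has positive rank, F 1 kills a basis element of it and so lies in
  its colon ideal, which is I. The rank is locally constant, so the set D where it is 0 and F 1 is
  the whole stalk is open and closed. Were D the whole space, I^m would vanish; by connectedness D
  is empty.\<close>

lemma F_1: "x \<in> T ==> st (F 1) x = st I x"
proof -
 define D where "D = {x \<in> T. \<one>\<^sub>x \<in> st (F 1) x}"
 have I_sub: "st I y \<subseteq> st (F 1) y" if y: "y \<in> T" for y
 proof
  fix c assume c: "c \<in> st I y"
  interpret B: cring "B y" by (rule B_facts[OF y])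
  have "c \<otimes>\<^sub>y \<one>\<^sub>y \<in> st (F (Suc 0)) y" by (rule I_F_subset[OF y _ c]) (use F_0[OF y] in auto)
  then show "c \<in> st (F 1) y" using I_car[OF y c] by simp
 qed
 have key: "\<exists>V. opn V \<and> x \<in> V \<and> (\<forall>y\<in>V. y \<notin> D \<and> st (F 1) y = st I y)" if x: "x \<in> T" "x \<notin> D" for x
 proof -
  obtain V n s where V: "opn V" "x \<in> V" "!!i. i < n ==> s i \<in> F 0 V" "!!i. i < n ==> s i \<in> Y.sec V"
   "!!y. y \<in> V ==> basis 0 y (\<lambda>i. germ Y y V (s i)) n"
   by (rule basis_at[OF le0 x(1)], rule that)
  interpret Bx: cring "B x" by (rule B_facts[OF x(1)])
  have "n \<noteq> 0"
  proof
   assume "n = 0"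
   then have "st (F 1) x = carrier (B x)" using quotient_basisD(3)[OF V(5)[OF V(2)]] F_0[OF x(1)] by simp
   then show False using x by (simp add: D_def)
  qed
  have "y \<notin> D \<and> st (F 1) y = st I y" if y: "y \<in> V" for y
  proof -
   have yT: "y \<in> T" by (rule Y.opn_topspace[OF V(1) y])
   interpret B: cring "B y" by (rule B_facts[OF yT])
   interpret F1: ideal "st (F 1) y" "B y" by (rule F_ideal[OF yT])
   have "colon (B y) (st (F 1) y) (germ Y y V (s 0)) = st I y" using quotient_basisD(2)[OF V(5)[OF y], of 0] \<open>n \<noteq> 0\<close> by simp
   moreover have "st (F 1) y \<subseteq> colon (B y) (st (F 1) y) (germ Y y V (s 0))"
    using F1.Icarr F1.I_r_closed V(4)[of 0] \<open>n \<noteq> 0\<close> V(1) y by (auto simp: colon_def)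
   ultimately have "st (F 1) y = st I y" using I_sub[OF yT] by blast
   then show ?thesis using one_notin_I[OF yT] by (simp add: D_def)
  qed
  then show ?thesis using V by blast
 qed
 have o1: "opn D"
 proof (subst openin_subopen, intro ballI)
  fix x assume "x \<in> D"
  then have x: "x \<in> T" "\<one>\<^sub>x \<in> st (F 1) x" by (auto simp: D_def)
  interpret T: cring "sect Y T" by (rule Y.sect_cring[OF T_opn])
  have "germ Y x T \<one>\<^bsub>sect Y T\<^esub> \<in> st (F 1) x" using x Y.germ_one[OF T_opn x(1)] by simp
  then obtain V where V: "opn V" "x \<in> V" "V \<subseteq> T" "restr Y T V \<one>\<^bsub>sect Y T\<^esub> \<in> F 1 V"
   by (rule Y.germ_in_stD[OF F_ideal_sheaf _ T_opn x(1) T.one_closed])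
  have "\<one>\<^sub>y \<in> st (F 1) y" if y: "y \<in> V" for y
   using Y.germ_in_st[where F = "F 1", OF V(1) y V(4)] V T_opn Y.germ_one[OF V(1) y] by simp
  then show "\<exists>V. opn V \<and> x \<in> V \<and> V \<subseteq> D" using V by (auto simp: D_def)
 qed
 have o2: "opn (T - D)"
 proof (subst openin_subopen, intro ballI)
  fix x assume "x \<in> T - D"
  then obtain V where "opn V" "x \<in> V" "\<forall>y\<in>V. y \<notin> D" using key[of x] by auto
  then show "\<exists>V. opn V \<and> x \<in> V \<and> V \<subseteq> T - D" using Y.opn_topspace by blast
 qed
 have ne: "T - D \<noteq> {}"
 proof
  assume TD: "T - D = {}"
  have "P m U = {\<zero>\<^bsub>sect Y U\<^esub>}" if U: "opn U" for U
  proof -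
   interpret U: cring "sect Y U" by (rule Y.sect_cring[OF U])
   have "s = \<zero>\<^bsub>sect Y U\<^esub>" if s: "s \<in> P m U" for s
   proof (rule Y.section_eqI[OF U])
    show "s \<in> Y.sec U" using Y.res_closedD(1)[OF P_res_closed U s] .
    fix y assume y: "y \<in> U"
    have yT: "y \<in> T" by (rule Y.opn_topspace[OF U y])
    interpret B: cring "B y" by (rule B_facts[OF yT])
    have "\<one>\<^sub>y \<otimes>\<^sub>y germ Y y U s = \<zero>\<^sub>y"
    proof (rule F_kills[OF yT])
     show "\<one>\<^sub>y \<in> st (F 1) y" using TD yT by (auto simp: D_def)
     show "germ Y y U s \<in> st (P (m + 1 - 1)) y" using Y.germ_in_st[where F = "P m", OF U y s] by simp
    qed
    then show "germ Y y U s = germ Y y U \<zero>\<^bsub>sect Y U\<^esub>"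
     using Y.germ_zero[OF U y] Y.germ_closed[OF U y \<open>s \<in> Y.sec U\<close>] by simp
   qed simp
   moreover have "\<zero>\<^bsub>sect Y U\<^esub> \<in> P m U"
    by (rule Y.ideal_pow_in_sheaf[OF kernel_ideal_sheaf U])
     (rule additive_subgroup.zero_closed[OF ideal.axioms(1)[OF Y.ideal_pow_facts(1)[OF kernel_ideal_sheaf U]]])
   ultimately show ?thesis by blast
  qed
  then show False using pow_nonzero by (simp add: zero_ideal_sheaf_def)
 qed
 have "D = {}"
 proof (rule ccontr)
  assume "D \<noteq> {}"
  then show False using conn o1 o2 ne unfolding connected_space_def by blast
 qed
 then show "x \<in> T ==> st (F 1) x = st I x" using key by blast
qed

text \<open>Descending induction: F (m + 1) is zero, and test sections for F (l + 1) together with a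
  local basis of F l modulo F (l + 1) are test sections for F l.\<close>

lemma F_finitely_detected: "l \<le> Suc m ==> x \<in> T ==> Y.finitely_detected (F l) x"
proof (induction l rule: inc_induct)
 case base
 have "b \<otimes>\<^sub>y t = \<zero>\<^sub>y" if "y \<in> T" "b \<in> carrier (B y)" "t \<in> st (F (Suc m)) y" for y b t
  using that F_top[OF that(1)] cring.cring_simprules(27)[OF B_facts(1)[OF that(1)]] by simp
 then show ?case unfolding Y.finitely_detected_def using base T_opn
  by (intro exI[of _ T] exI[of _ "{}"]) auto
next
 case (step l)
 have l: "l \<le> m" using step by simp
 obtain V n s where V: "opn V" "x \<in> V" "!!i. i < n ==> s i \<in> F l V" "!!i. i < n ==> s i \<in> Y.sec V"
   "!!y. y \<in> V ==> basis l y (\<lambda>i. germ Y y V (s i)) n"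
  by (rule basis_at[OF l step.prems], rule that)
 obtain W K where W: "opn W" "x \<in> W" "finite K" "K \<subseteq> F (Suc l) W"
  "\<forall>y\<in>W. \<forall>b\<in>carrier (B y). (\<forall>t\<in>K. b \<otimes>\<^sub>y germ Y y W t = \<zero>\<^sub>y) -->
   (\<forall>t\<in>st (F (Suc l)) y. b \<otimes>\<^sub>y t = \<zero>\<^sub>y)"
  using step.IH[OF step.prems] unfolding Y.finitely_detected_def by blast
 let ?N = "V \<inter> W"
 have o: "opn ?N" using V W by blast
 define K' where "K' = restr Y W ?N ` K \<union> (\<lambda>i. restr Y V ?N (s i)) ` {..<n}"
 have Kc: "k \<in> Y.sec W" "restr Y W ?N k \<in> F (Suc l) ?N" if "k \<in> K" for k
  using Y.ideal_sheafD(2,3)[OF F_ideal_sheaf W(1)] W(4) that o by auto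
 show ?case
  unfolding Y.finitely_detected_def
 proof (intro exI[of _ ?N] exI[of _ K'] conjI ballI impI)
  show "opn ?N" "x \<in> ?N" "finite K'" using o V W by (auto simp: K'_def)
  have "restr Y W ?N k \<in> F l ?N" if "k \<in> K" for k
  proof (rule Y.ideal_sheaf_memI[OF F_ideal_sheaf o])
   show "restr Y W ?N k \<in> Y.sec ?N" using Kc[OF that] Y.ideal_sheafD(2)[OF F_ideal_sheaf o] by blast
   show "germ Y y ?N (restr Y W ?N k) \<in> st (F l) y" if "y \<in> ?N" for y
    using Y.germ_in_st[where F = "F (Suc l)", OF o that Kc(2)[OF \<open>k \<in> K\<close>]] F_Suc_subset[OF Y.opn_topspace[OF o that]] by blast
  qed
  then show "K' \<subseteq> F l ?N" using Y.ideal_sheafD(3)[OF F_ideal_sheaf V(1) o _ V(3)] by (auto simp: K'_def)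
  fix y b t assume y: "y \<in> ?N" and b: "b \<in> carrier (B y)" and t: "t \<in> st (F l) y"
   and kill: "\<forall>k\<in>K'. b \<otimes>\<^sub>y germ Y y ?N k = \<zero>\<^sub>y"
  have yT: "y \<in> T" by (rule Y.opn_topspace[OF o y])
  have yV: "y \<in> V" "y \<in> W" using y by auto
  show "b \<otimes>\<^sub>y t = \<zero>\<^sub>y"
  proof (rule adjoin_seq_killed[OF B_facts(1)[OF yT] F_ideal[OF yT] _ b])
   show "t \<in> seq_ideal (B y) (st (F (Suc l)) y) (\<lambda>i. germ Y y V (s i)) n" using quotient_basisD(3)[OF V(5)[OF yV(1)]] t by simp
   show "germ Y y V (s i) \<in> carrier (B y)" if "i < n" for i using V(1,4) yV that by simp
   show "b \<otimes>\<^sub>y germ Y y V (s i) = \<zero>\<^sub>y" if "i < n" for i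
   proof -
    have "restr Y V ?N (s i) \<in> K'" using that by (simp add: K'_def)
    then have "b \<otimes>\<^sub>y germ Y y ?N (restr Y V ?N (s i)) = \<zero>\<^sub>y" using kill by blast
    then show ?thesis using V(1,4) o y that by simp
   qed
   have "\<forall>k\<in>K. b \<otimes>\<^sub>y germ Y y W k = \<zero>\<^sub>y"
   proof
    fix k assume k: "k \<in> K"
    then have "restr Y W ?N k \<in> K'" by (simp add: K'_def)
    then have "b \<otimes>\<^sub>y germ Y y ?N (restr Y W ?N k) = \<zero>\<^sub>y" using kill by blast
    then show "b \<otimes>\<^sub>y germ Y y W k = \<zero>\<^sub>y" using W(1) Kc(1)[OF k] o y by simp
   qed
   then show "!!w. w \<in> st (F (Suc l)) y ==> b \<otimes>\<^sub>y w = \<zero>\<^sub>y" using W(5) yV b by blast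
  qed
 qed
qed

lemma J_memI:
 assumes "x \<in> T" "b \<in> carrier (B x)" "!!t. t \<in> st (F (m + 1 - l)) x ==> b \<otimes>\<^sub>x t = \<zero>\<^sub>x"
 shows "b \<in> st (J l) x"
 unfolding J_filt_def by (rule Y.ann_stalkI[OF F_res_closed F_finitely_detected[OF _ assms(1)] assms(2,3)]) auto

text \<open>Both are the annihilator of I: F m by its definition, as m + 1 - m = 1, and J m because
  F 1 has the stalks of I.\<close>

lemma F_m_eq_J_m: "opn U ==> F m U = J m U"
 unfolding I_filt_def[of _ _ _ m] J_filt_def
 by (rule Y.ann_sheaf_cong[OF P_res_closed F_res_closed])
  (use F_1[OF Y.opn_topspace] Y.st_pow_one[OF kernel_ideal_sheaf] in auto)

lemma F_top_eq_J_top: "opn U ==> F (Suc m) U = J (Suc m) U"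
 unfolding I_filt_def[of _ _ _ "Suc m"] J_filt_def
 by (rule Y.ann_sheaf_cong[OF P_res_closed F_res_closed])
  (use F_0[OF Y.opn_topspace] Y.st_pow_facts(1)[OF kernel_ideal_sheaf Y.opn_topspace] in auto)

text \<open>So the stalk of F m is the full annihilator of the stalk of I. F m is defined through a
  power of I, for which no test sections have been provided, so the route is through J m, which is
  defined through F 1.\<close>

lemma F_m_memI:
 assumes "x \<in> T" "b \<in> carrier (B x)" "!!c. c \<in> st I x ==> c \<otimes>\<^sub>x b = \<zero>\<^sub>x"
 shows "b \<in> st (F m) x"
proof -
 interpret B: cring "B x" by (rule B_facts[OF assms(1)])
 have "b \<in> st (J m) x"
  by (rule J_memI[OF assms(1,2)]) (insert F_1[OF assms(1)] assms I_car, auto simp: B.m_comm)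
 then show ?thesis using F_m_eq_J_m by (auto simp: ideal_stalk_def)
qed

lemma F_m_killed: "x \<in> T ==> c \<in> st I x ==> b \<in> st (F m) x ==> c \<otimes>\<^sub>x b = \<zero>\<^sub>x"
 using I_F_subset[of x m c b] F_top by auto

text \<open>F l is mapped by I into F (l + 1). If I killed only 0, descending induction would make
  every F l zero, down to F 0, which is the whole stalk.\<close>

lemma F_m_nonzero: "x \<in> T ==> st (F m) x \<noteq> {\<zero>\<^sub>x}"
proof
 assume x: "x \<in> T" and z: "st (F m) x = {\<zero>\<^sub>x}"
 interpret B: cring "B x" by (rule B_facts[OF x])
 have "st (F l) x \<subseteq> {\<zero>\<^sub>x}" if "l \<le> Suc m" for l
  using that
 proof (induction l rule: inc_induct)
  case base
  then show ?case using F_top[OF x] by simp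
 next
  case (step l)
  show ?case
  proof
   fix b assume b: "b \<in> st (F l) x"
   have "b \<in> st (F m) x"
    by (rule F_m_memI[OF x F_car[OF x b]]) (use I_F_subset[OF x _ _ b] step in auto)
   then show "b \<in> {\<zero>\<^sub>x}" using z by simp
  qed
 qed
 from this[of 0] have "\<one>\<^sub>x = \<zero>\<^sub>x" using F_0[OF x] B.one_closed by auto
 then have "\<one>\<^sub>x \<in> st I x" using additive_subgroup.zero_closed[OF ideal.axioms(1)[OF B_facts(3)[OF x]]] by simp
 then show False using one_notin_I[OF x] by simp
qed

lemma quotient_J:
 assumes l: "l \<le> m" shows "quotient_sheaf Y Z \<pi> (J l) (J (Suc l))"
proof (intro quotient_sheaf.intro quotient_sheaf_axioms.intro ringed_surjection_axioms J_ideal_sheaf)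
 have e: "m + 1 - l = Suc (m - l)" "m + 1 - Suc l = m - l" using l by auto
 fix x assume x: "x \<in> T"
 show "st (J (Suc l)) x \<subseteq> st (J l) x"
 proof
  fix b assume b: "b \<in> st (J (Suc l)) x"
  show "b \<in> st (J l) x"
   by (rule J_memI[OF x J_car[OF x b]]) (insert J_kills[OF x b] F_Suc_subset[OF x, of "m - l"], simp add: e Suc_diff_le[OF l] subset_iff)
 qed
 fix c b assume c: "c \<in> st I x" and b: "b \<in> st (J l) x"
 interpret B: cring "B x" by (rule B_facts[OF x])
 note cb = I_car[OF x c] J_car[OF x b]
 show "c \<otimes>\<^sub>x b \<in> st (J (Suc l)) x"
 proof (rule J_memI[OF x])
  show "c \<otimes>\<^sub>x b \<in> carrier (B x)" using cb by simp
  fix t assume t: "t \<in> st (F (m + 1 - Suc l)) x"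
  then have "c \<otimes>\<^sub>x t \<in> st (F (m + 1 - l)) x" using I_F_subset[OF x _ c, of "m - l" t] by (simp add: e Suc_diff_le[OF l])
  then have "b \<otimes>\<^sub>x (c \<otimes>\<^sub>x t) = \<zero>\<^sub>x" by (rule J_kills[OF x b])
  then show "c \<otimes>\<^sub>x b \<otimes>\<^sub>x t = \<zero>\<^sub>x" using cb F_car[OF x t] by (simp add: B.m_ac)
 qed
qed

end

text \<open>The homomorphism sending s to 0 and s' to s would be multiplication by some e. Then s e
  = 0 puts e into I, which kills s', so s = 0 and its annihilator I contains 1.\<close>

lemma socle_not_two_generated:
 fixes R :: "'a ring" (structure)
 assumes R: "cring R" and s: "s \<in> carrier R" "s' \<in> carrier R" and I: "\<one> \<notin> I"
  and c: "colon R {\<zero>} s = I" "colon R (adjoin_ideal R {\<zero>} s) s' = I" and I's: "!!c. c \<in> I ==> c \<otimes> s' = \<zero>"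
  and ext: "hom_extends R (adjoin_ideal R (adjoin_ideal R {\<zero>} s) s') (self_module R)"
 shows False
proof -
 interpret R: cring R by (rule R)
 note S = self_module_is_module[OF R]
 let ?a = "adjoin_ideal R {\<zero>} s"
 note a = adjoin_ideal_ideal[OF R R.zeroideal s(1)]
 have z: "(\<lambda>_. \<zero>) \<in> mod_hom R (ideal_mod R ?a) (self_module R)" by (rule mod_homI) auto
 have cs: "r \<otimes> s = \<zero>" if "r \<in> I" for r using that c(1) by (auto simp: colon_def)
 obtain f where f: "f \<in> mod_hom R (ideal_mod R (adjoin_ideal R ?a s')) (self_module R)"
  "!!w. w \<in> ?a ==> f w = \<zero>" "f s' = s"
  by (rule extend_ideal_hom_one_step[OF R S a(1) z s(2), of s]) (use s c(2) cs in auto)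
 obtain e where e: "e \<in> carrier R" "!!b. b \<in> adjoin_ideal R ?a s' ==> f b = b \<otimes> e"
  using hom_extendsD[OF ext f(1)] unfolding self_module_simps by blast
 note b = adjoin_ideal_ideal[OF R a(1) s(2)]
 have "s \<otimes> e = \<zero>" using e(2)[of s] f(2)[OF a(3)] a(3) b(2) by auto
 then have "e \<in> I" using c(1) e(1) s(1) by (auto simp: colon_def R.m_comm)
 then have "s = \<zero>" using e(2)[OF b(3)] f(3) I's[of e] e(1) s(2) by (simp add: R.m_comm)
 then have "\<one> \<in> I" using c(1) by (auto simp: colon_def)
 then show False using I by blast
qed

section \<open>Both implications on a single stalk\<close>

context free_multiple_structure
begin

lemma basis_chain:
 assumes l: "l \<le> m" and x: "x \<in> T"
 obtains n g where "basis l x g n"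
 by (rule basis_at[OF l x]) blast

lemma F_chain: "l \<le> l' ==> l' \<le> Suc m ==> x \<in> T ==> quotient_chain (B x) (st I x) (st (F l') x) (st (F l) x)"
proof (induction l rule: inc_induct)
 case (step l)
 obtain n g where "basis l x g n"
  by (rule basis_chain[of l x]) (use step in auto)
 from quotient_chain_trans[OF quotient_basis_chain[OF this le0, unfolded adjoin_seq.simps(1)] step.IH[OF step.prems]]
 show ?case .
qed (rule quotient_chain.refl)

lemma hom_extends_F:
 assumes x: "x \<in> T" and fin: "finite_self_injective_dimension (B x)"
 shows "ideal \<aa> (B x) ==> quotient_chain (B x) (st I x) \<aa> (st (F m) x) ==> hom_extends (B x) \<aa> (self_module (B x))"
  and hom_extends_F': "l \<le> Suc m ==> hom_extends (B x) (st (F l) x) (self_module (B x))"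
proof -
 note R = B_facts(1)[OF x] and S = self_module_is_module[OF B_facts(1)[OF x]]
 obtain n g where g: "basis m x g n"
  by (rule basis_chain[OF order_refl x])
 note g = g[unfolded F_top[OF x]]
 have n: "0 < n" using F_m_nonzero[OF x] quotient_basisD(3)[OF g] by (cases n) auto
 \<comment> \<open>The first basis element of F m generates the copy of B/I inside B that
   \<open>injective_resolution_hom_extends\<close> asks for.\<close>
 have "quotient_chain (B x) (st I x) (adjoin_ideal (B x) {\<zero>\<^sub>x} (g 0)) (st (F m) x)"
  using quotient_basis_chain[OF g, of 1] n by simp
 then have chain: "quotient_chain (B x) (st I x) (adjoin_ideal (B x) {\<zero>\<^sub>x} (g 0)) (carrier (B x))"
  using quotient_chain_trans[OF F_chain[OF le0 _ x, of m]] F_0[OF x] by simp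
 obtain E :: "nat => (('p set \<times> 'r) set, ('p set \<times> 'r) set list set) module" and e d N
  where E: "injective_resolution (B x) (self_module (B x)) E e d" "!!i. i > N ==> carrier (E i) = {\<zero>\<^bsub>E i\<^esub>}"
  using fin unfolding finite_self_injective_dimension_def by blast
 have ext: "hom_extends (B x) (st I x) (self_module (B x))"
  by (rule injective_resolution_hom_extends[OF R E B_facts(3)[OF x] quotient_basisD(1)[OF g n] _ chain],
   assumption, rule quotient_basisD(2)[OF g n, unfolded adjoin_seq.simps(1)])
 show a: "hom_extends (B x) \<aa> (self_module (B x))"
  if "ideal \<aa> (B x)" "quotient_chain (B x) (st I x) \<aa> (st (F m) x)" for \<aa>
  by (rule quotient_chain_hom_extends[OF _ R S ext that(1)])
   (use quotient_chain_trans[OF F_chain[OF le0 _ x, of m] that(2)] F_0[OF x] in simp)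
 show "hom_extends (B x) (st (F l) x) (self_module (B x))" if "l \<le> Suc m"
  by (rule quotient_chain_hom_extends[OF _ R S ext F_ideal[OF x]])
   (use F_chain[OF le0 that x] F_0[OF x] in simp)
qed

text \<open>Rank 0 is excluded by \<open>F_m_nonzero\<close>. With rank at least 2 all homomorphisms
  from the ideal of the first two basis elements would be multiplications, against
  \<open>socle_not_two_generated\<close>.\<close>

lemma rank_one:
 assumes t: "local_trivialization Y Z \<pi> (F m) (F (Suc m)) U n \<theta>" and x: "x \<in> U"
  and fin: "finite_self_injective_dimension (B x)"
 shows "n = 1"
proof -
 interpret t: local_trivialization Y Z \<pi> "F m" "F (Suc m)" U n \<theta> by (rule t)
 have xT: "x \<in> T" by (rule Y.opn_topspace[OF t.U x])
 note R = B_facts(1)[OF xT]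
 interpret R: cring "B x" by (rule R)
 obtain V s where V: "opn V" "x \<in> V" "V \<subseteq> U"
  "!!i. i < n ==> s i \<in> F m V" "!!i y. i < n ==> y \<in> V ==> germ Y y V (s i) \<in> \<theta> U (t.unit_vec U i) y"
  using t.basis_sections[OF x order_refl] by blast
 let ?g = "\<lambda>i. germ Y x V (s i)"
 have g: "quotient_basis (B x) (st I x) {\<zero>\<^sub>x} (st (F m) x) ?g n"
  using t.stage_basis[OF V(1,3-5,2)] unfolding F_top[OF xT] .
 have "n \<noteq> 0" using F_m_nonzero[OF xT] quotient_basisD(3)[OF g] by (metis adjoin_seq.simps(1))
 moreover have "\<not> 2 \<le> n"
 proof
  assume n: "2 \<le> n"
  have "hom_extends (B x) (seq_ideal (B x) {\<zero>\<^sub>x} ?g 2) (self_module (B x))"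
  proof (rule hom_extends_F[OF xT fin])
   show "ideal (seq_ideal (B x) {\<zero>\<^sub>x} ?g 2) (B x)"
    by (rule seq_ideal_ideal(1)[OF R R.zeroideal]) (use quotient_basisD(1)[OF g] n in auto)
   show "quotient_chain (B x) (st I x) (seq_ideal (B x) {\<zero>\<^sub>x} ?g 2) (st (F m) x)"
    by (rule quotient_basis_chain[OF g n])
  qed
  moreover have "?g 1 \<in> st (F m) x"
   using Y.germ_in_st[where F = "F m", OF V(1,2) V(4)[of 1]] n by simp
  then have "!!c. c \<in> st I x ==> c \<otimes>\<^sub>x ?g 1 = \<zero>\<^sub>x" using F_m_killed[OF xT] by blast
  ultimately show False
   using socle_not_two_generated[OF R quotient_basisD(1)[OF g, of 0] quotient_basisD(1)[OF g, of 1] one_notin_I[OF xT]]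
    quotient_basisD(2)[OF g, of 0] quotient_basisD(2)[OF g, of 1] n
   by (simp add: numeral_2_eq_2)
 qed
 ultimately show ?thesis by simp
qed

text \<open>The basis of F l is adjoined to F (l + 1) one element at a time, so duality enters in
  triangular form: the multiplier for g j kills everything adjoined before and sends g j to the
  generator u of F m.\<close>

lemma hom_extends_of_dual:
 assumes x: "x \<in> T" and u: "st (F m) x = adjoin_ideal (B x) {\<zero>\<^sub>x} u"
  and dual: "!!l. l \<le> m ==> \<exists>n g. basis l x g n \<and>
   (\<forall>j<n. \<exists>t\<in>carrier (B x). (\<forall>b\<in>st (F (Suc l)) x. t \<otimes>\<^sub>x b = \<zero>\<^sub>x) \<and>
    (\<forall>i<j. t \<otimes>\<^sub>x g i = \<zero>\<^sub>x) \<and> t \<otimes>\<^sub>x g j = u)"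
 shows "l \<le> Suc m ==> hom_extends (B x) (st (F l) x) (self_module (B x))"
proof (induction l rule: inc_induct)
 note R = B_facts(1)[OF x]
 interpret R: cring "B x" by (rule R)
 {
  case base
  have "\<exists>e\<in>carrier (B x). \<forall>a\<in>{\<zero>\<^sub>x}. f a = a \<otimes>\<^sub>x e"
   if "f \<in> mod_hom (B x) (ideal_mod (B x) {\<zero>\<^sub>x}) (self_module (B x))" for f
   using mod_hom_sub_zero[OF self_module_is_module[OF R] _ self_module_is_module[OF R] that]
    submodule_self_iff[OF R] R.zeroideal by auto
  then show ?case unfolding hom_extends_def F_top[OF x] self_module_simps by blast
 next
  case (step l)
  have "l \<le> m" using step by simp
  from dual[OF this] obtain n g where gb: "basis l x g n"
   and g': "\<forall>j<n. \<exists>t\<in>carrier (B x). (\<forall>b\<in>st (F (Suc l)) x. t \<otimes>\<^sub>x b = \<zero>\<^sub>x) \<and>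
    (\<forall>i<j. t \<otimes>\<^sub>x g i = \<zero>\<^sub>x) \<and> t \<otimes>\<^sub>x g j = u" by (elim exE conjE)
  note g = quotient_basisD[OF gb]
  have "j \<le> n ==> hom_extends (B x) (seq_ideal (B x) (st (F (Suc l)) x) g j) (self_module (B x))" for j
  proof (induction j)
   case 0
   then show ?case using step.IH by simp
  next
   case (Suc j)
   then have j: "j < n" by simp
   obtain t where t: "t \<in> carrier (B x)" "\<forall>b\<in>st (F (Suc l)) x. t \<otimes>\<^sub>x b = \<zero>\<^sub>x"
    "\<forall>i<j. t \<otimes>\<^sub>x g i = \<zero>\<^sub>x" "t \<otimes>\<^sub>x g j = u" using g'[rule_format, OF j] by blast
   let ?K = "seq_ideal (B x) (st (F (Suc l)) x) g j"
   have "hom_extends (B x) (adjoin_ideal (B x) ?K (g j)) (self_module (B x))"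
   proof (rule hom_extends_adjoin_dual[OF R _ Suc.IH g(1)[OF j] t(1)])
    show "ideal ?K (B x)" by (rule seq_ideal_ideal(1)[OF R F_ideal[OF x]]) (use g(1) j in auto)
    show "t \<otimes>\<^sub>x a = \<zero>\<^sub>x" if "a \<in> ?K" for a
     by (rule adjoin_seq_killed[OF R F_ideal[OF x] _ t(1) _ _ that]) (use g(1) j t in auto)
    fix a assume a: "a \<in> carrier (B x)" "!!c. c \<in> colon (B x) ?K (g j) ==> c \<otimes>\<^sub>x a = \<zero>\<^sub>x"
    \<comment> \<open>The colon ideal is I, so I kills a; hence a is a multiple of u, which is t
      times g j.\<close>
    have "a \<in> st (F m) x" by (rule F_m_memI[OF x a(1)]) (use a(2) g(2)[OF j] in blast)
    then obtain w c where "w \<in> {\<zero>\<^sub>x}" "c \<in> carrier (B x)" "a = w \<oplus>\<^sub>x c \<otimes>\<^sub>x u"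
     unfolding u by (rule adjoin_idealE)
    moreover have "u \<in> carrier (B x)" using t g(1)[OF j] by auto
    ultimately have "a = c \<otimes>\<^sub>x (t \<otimes>\<^sub>x g j)" using t(4) by simp
    then show "\<exists>c\<in>carrier (B x). a = c \<otimes>\<^sub>x (t \<otimes>\<^sub>x g j)" using \<open>c \<in> carrier (B x)\<close> by blast
   qed (use j in simp)
   then show ?case by simp
  qed
  from this[OF order_refl] show ?case unfolding g(3) .
 }
qed

lemma finite_self_injective_dimension_stalk:
 fixes k :: "'k ring"
 assumes x: "x \<in> T" and k: "field k" and \<kappa>: "\<kappa> \<in> ring_hom k (B x)"
  and ext: "hom_extends (B x) (st I x) (self_module (B x))"
 shows "finite_self_injective_dimension (B x)"
proof (rule finite_self_injective_dimension_descent[OF stalk_map_surjective[OF x] stalk_map_kernel[OF x, symmetric]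
   B_facts(2)[OF x] Z_regular[OF x] k \<kappa> _ _ ext])
 show "quotient_chain (B x) (st I x) {\<zero>\<^sub>x} (st I x)"
  using F_chain[of 1 "Suc m" x] F_1[OF x] F_top[OF x] x by simp
 show "quotient_chain (B x) (st I x) (st I x) (carrier (B x))"
  using F_chain[of 0 1 x] F_1[OF x] F_0[OF x] x by simp
qed

end

section \<open>The multiplication maps\<close>

context free_multiple_structure
begin

lemma M_piece_eq: "M_piece Z Y \<pi> m l = quot_sheaf Z Y \<pi> (F l) (F (Suc l))"
 by (simp add: M_piece_def Let_def)

lemma A_piece_eq: "A_piece Z Y \<pi> m l = quot_sheaf Z Y \<pi> (J l) (J (Suc l))"
 by (simp add: A_piece_def Let_def)

lemma opens_in_Z: "opens_in Z U = opens_in Y U"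
 by (simp add: opens_in_def space_eq)

context
 fixes l assumes l: "l \<le> m"
begin

text \<open>In this part q stands for M in degree m - l, t for M in the top degree m, and a for A in
  degree l.\<close>

interpretation q: quotient_sheaf Y Z \<pi> "F (m - l)" "F (Suc (m - l))"
 by (rule quotient_F) simp
interpretation t: quotient_sheaf Y Z \<pi> "F m" "F (Suc m)"
 by (rule quotient_F) simp
interpretation a: quotient_sheaf Y Z \<pi> "J l" "J (Suc l)"
 by (rule quotient_J[OF l])

abbreviation "H \<equiv> hom_sheaf Z (M_piece Z Y \<pi> m (m - l)) (M_piece Z Y \<pi> m m)"
abbreviation "mu \<equiv> mult_map Z Y \<pi> m l"

lemma H_iff: "\<phi> \<in> carrier (msect H U) \<longleftrightarrow> \<phi> \<in> extensional (opens_in Y U) \<and>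
  (\<forall>V\<in>opens_in Y U. \<phi> V \<in> mod_hom (sect Z V) (msect q.Q V) (msect t.Q V) \<inter> extensional (q.Qsec V) \<and>
   (\<forall>W\<in>opens_in Y V. \<forall>s\<in>q.Qsec V. \<phi> W (restrict s W) = restrict (\<phi> V s) W))"
 by (simp add: hom_sheaf_def opens_in_Z M_piece_eq q.Q_simps t.Q_simps)

lemma H_simps:
 "\<phi> \<oplus>\<^bsub>msect H U\<^esub> \<psi> = (\<lambda>V\<in>opens_in Y U. \<lambda>s\<in>q.Qsec V. \<phi> V s \<oplus>\<^bsub>msect t.Q V\<^esub> \<psi> V s)"
 "c \<odot>\<^bsub>msect H U\<^esub> \<phi> = (\<lambda>V\<in>opens_in Y U. \<lambda>s\<in>q.Qsec V. restr Z U V c \<odot>\<^bsub>msect t.Q V\<^esub> \<phi> V s)"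
 "mrestr H U V \<phi> = restrict \<phi> (opens_in Y V)"
 by (simp_all add: hom_sheaf_def opens_in_Z M_piece_eq)

lemma HD:
 assumes "\<phi> \<in> carrier (msect H U)" "opn V" "V \<subseteq> U"
 shows "\<mu> \<in> q.Qsec V ==> \<phi> V \<mu> \<in> t.Qsec V"
  "\<mu> \<in> q.Qsec V ==> \<nu> \<in> q.Qsec V ==> \<phi> V (\<mu> \<oplus>\<^bsub>msect q.Q V\<^esub> \<nu>) = \<phi> V \<mu> \<oplus>\<^bsub>msect t.Q V\<^esub> \<phi> V \<nu>"
  "c \<in> Z.sec V ==> \<mu> \<in> q.Qsec V ==> \<phi> V (c \<odot>\<^bsub>msect q.Q V\<^esub> \<mu>) = c \<odot>\<^bsub>msect t.Q V\<^esub> \<phi> V \<mu>"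
  "opn W ==> W \<subseteq> V ==> \<mu> \<in> q.Qsec V ==> \<phi> W (restrict \<mu> W) = restrict (\<phi> V \<mu>) W"
  "\<phi> V \<in> extensional (q.Qsec V)"
 using assms(1)[unfolded H_iff, THEN conjunct2, THEN bspec, of V] assms(2,3)
 by (auto simp: opens_in_def mod_hom_def)

text \<open>F (m + 1) is zero on stalks, so in the top degree a coset is a single element, and
  values can be compared as elements of the stalk.\<close>

lemma t_val: "\<nu> \<in> t.Qsec V ==> opn V ==> x \<in> V ==> c \<in> \<nu> x ==> c' \<in> \<nu> x ==> c' = c"
proof -
 assume h: "\<nu> \<in> t.Qsec V" "opn V" "x \<in> V" "c \<in> \<nu> x" "c' \<in> \<nu> x"
 have x: "x \<in> T" by (rule Y.opn_topspace[OF h(2,3)])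
 interpret B: cring "B x" by (rule B_facts[OF x])
 have "c \<in> carrier (B x)" "c' \<in> carrier (B x)" "c' \<ominus>\<^sub>x c = \<zero>\<^sub>x"
  using t.section_val(2)[OF h(1-4)] t.section_val(4)[OF h(1-4)] h(5) F_top[OF x] by auto
 then show "c' = c" by (simp add: B.r_right_minus_eq)
qed

text \<open>I moves r into F (m - l + 1), which s kills; so I kills s r, and F m contains everything
  that I kills.\<close>

lemma J_F_mult:
 assumes x: "x \<in> T" and s: "s \<in> st (J l) x" and r: "r \<in> st (F (m - l)) x"
 shows "s \<otimes>\<^sub>x r \<in> st (F m) x"
proof -
 interpret B: cring "B x" by (rule B_facts[OF x])
 note c = J_car[OF x s] F_car[OF x r]
 show ?thesis
 proof (rule F_m_memI[OF x])
  show "s \<otimes>\<^sub>x r \<in> carrier (B x)" using c by simp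
  fix d assume d: "d \<in> st I x"
  have "d \<otimes>\<^sub>x r \<in> st (F (m + 1 - l)) x" using I_F_subset[OF x _ d r] l by (simp add: Suc_diff_le)
  then have "s \<otimes>\<^sub>x (d \<otimes>\<^sub>x r) = \<zero>\<^sub>x" by (rule J_kills[OF x s])
  then show "d \<otimes>\<^sub>x (s \<otimes>\<^sub>x r) = \<zero>\<^sub>x" using c I_car[OF x d] by (simp add: B.m_lcomm)
 qed
qed

text \<open>The set of products in \<open>mult_map\<close> is already a single element: changing s
  by J (l + 1) has no effect on F (m - l), and changing r by F (m - l + 1) none under J l.\<close>

lemma mult_val:
 assumes U: "opn U" "\<alpha> \<in> a.Qsec U" and V: "opn V" "V \<subseteq> U" "\<mu> \<in> q.Qsec V" and x: "x \<in> V"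
  and s: "s \<in> \<alpha> x" and r: "r \<in> \<mu> x"
 shows "mu U \<alpha> V \<mu> x = st (F (Suc m)) x +>\<^sub>x (s \<otimes>\<^sub>x r)"
proof -
 have xT: "x \<in> T" and xU: "x \<in> U" using Y.opn_topspace[OF V(1) x] x V by auto
 interpret B: cring "B x" by (rule B_facts[OF xT])
 note sv = a.section_val[OF U(2,1) xU s] and rv = q.section_val[OF V(3,1) x r]
 have e: "m + 1 - l = Suc (m - l)" "m + 1 - Suc l = m - l" using l by auto
 have one: "s' \<otimes>\<^sub>x r' = s \<otimes>\<^sub>x r" if s': "s' \<in> \<alpha> x" and r': "r' \<in> \<mu> x" for s' r'
 proof -
  note sc = s'[unfolded sv(4)] and rc = r'[unfolded rv(4)]
  have "(s' \<ominus>\<^sub>x s) \<otimes>\<^sub>x r' = \<zero>\<^sub>x"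
   using J_kills[OF xT conjunct2[OF sc]] q.section_val(1)[OF V(3,1) x r'] by (simp add: e)
  moreover have "s \<otimes>\<^sub>x (r' \<ominus>\<^sub>x r) = \<zero>\<^sub>x"
   using J_kills[OF xT sv(1)] conjunct2[OF rc] by (simp add: Suc_diff_le[OF l])
  ultimately have "s' \<otimes>\<^sub>x r' = s \<otimes>\<^sub>x r'" "s \<otimes>\<^sub>x r' = s \<otimes>\<^sub>x r"
   using sc rc sv(2) rv(2) B.r_right_minus_eq[of "s' \<otimes>\<^sub>x r'" "s \<otimes>\<^sub>x r'"] B.r_right_minus_eq[of "s \<otimes>\<^sub>x r'" "s \<otimes>\<^sub>x r"]
   by (simp_all add: a_minus_def B.l_distr B.r_distr B.l_minus B.r_minus)
  then show ?thesis by simp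
 qed
 have "mu U \<alpha> V \<mu> x = set_add (B x) {s' \<otimes>\<^sub>x r' | s' r'. s' \<in> \<alpha> x \<and> r' \<in> \<mu> x} (st (F (Suc m)) x)"
  using V x by (simp add: mult_map_def opens_in_Z opens_in_def M_piece_eq)
 also have "{s' \<otimes>\<^sub>x r' | s' r'. s' \<in> \<alpha> x \<and> r' \<in> \<mu> x} = {s \<otimes>\<^sub>x r}"
 proof (intro equalityI subsetI)
  fix z assume "z \<in> {s' \<otimes>\<^sub>x r' | s' r'. s' \<in> \<alpha> x \<and> r' \<in> \<mu> x}"
  then obtain s' r' where "s' \<in> \<alpha> x" "r' \<in> \<mu> x" "z = s' \<otimes>\<^sub>x r'" by blast
  then show "z \<in> {s \<otimes>\<^sub>x r}" using one by simp
 qed (use s r in blast)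
 also have "set_add (B x) {s \<otimes>\<^sub>x r} (st (F (Suc m)) x) = st (F (Suc m)) x +>\<^sub>x (s \<otimes>\<^sub>x r \<oplus>\<^sub>x \<zero>\<^sub>x)"
  by (rule t.set_add_coset[OF xT]) (use sv(2) rv(2) coset_self[OF t.st_facts(1,3)[OF xT]] coset_zero[OF t.st_facts(1,3)[OF xT]] in auto)
 finally show ?thesis using sv(2) rv(2) by simp
qed

lemma mult_mem:
 assumes "opn U" "\<alpha> \<in> a.Qsec U" "opn V" "V \<subseteq> U" "\<mu> \<in> q.Qsec V" "x \<in> V" "s \<in> \<alpha> x" "r \<in> \<mu> x"
 shows "s \<otimes>\<^sub>x r \<in> mu U \<alpha> V \<mu> x"
 unfolding mult_val[OF assms]
 by (rule t.coset_self'[OF assms(3,6)])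
  (use a.section_val(2)[OF assms(2,1) _ assms(7)] q.section_val(2)[OF assms(5,3,6,8)] assms
   cring.cring_simprules(5)[OF B_facts(1)[OF Y.opn_topspace[OF assms(3,6)]]] in blast)

lemma mult_in:
 assumes U: "opn U" "\<alpha> \<in> a.Qsec U" and V: "opn V" "V \<subseteq> U" "\<mu> \<in> q.Qsec V"
 shows "mu U \<alpha> V \<mu> \<in> t.Qsec V"
proof (rule t.QsecI[OF _ V(1)])
 show "mu U \<alpha> V \<mu> \<in> extensional V" using V by (simp add: mult_map_def opens_in_Z opens_in_def M_piece_eq)
 fix x assume x: "x \<in> V"
 have xU: "x \<in> U" using x V by blast
 obtain s where s: "s \<in> \<alpha> x" by (rule a.section_ne[OF U(2,1) xU])
 obtain r where r: "r \<in> \<mu> x" by (rule q.section_ne[OF V(3,1) x])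
 obtain W s' where W: "opn W" "x \<in> W" "W \<subseteq> U" "s' \<in> J l W" "!!y. y \<in> W ==> germ Y y W s' \<in> \<alpha> y"
  by (rule a.sectionE[OF U(2,1) xU s]) blast
 obtain W' r' where W': "opn W'" "x \<in> W'" "W' \<subseteq> V" "r' \<in> F (m - l) W'" "!!y. y \<in> W' ==> germ Y y W' r' \<in> \<mu> y"
  by (rule q.sectionE[OF V(3,1) x r]) blast
 let ?N = "W \<inter> W'"
 have o: "opn ?N" using W W' by blast
 let ?s = "restr Y W ?N s'" and ?r = "restr Y W' ?N r'"
 have c: "s' \<in> Y.sec W" "r' \<in> Y.sec W'"
  using Y.ideal_sheafD(2)[OF J_ideal_sheaf W(1,4)] Y.ideal_sheafD(2)[OF F_ideal_sheaf W'(1,4)] .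
 have c': "?s \<in> Y.sec ?N" "?r \<in> Y.sec ?N" using c W(1) W'(1) o by auto
 interpret N: cring "sect Y ?N" by (rule Y.sect_cring[OF o])
 have g: "germ Y y ?N (?s \<otimes>\<^bsub>sect Y ?N\<^esub> ?r) = germ Y y W s' \<otimes>\<^sub>y germ Y y W' r'" if y: "y \<in> ?N" for y
  unfolding Y.germ_mult[OF o y c'] using c W(1) W'(1) o y by simp
 have "?s \<otimes>\<^bsub>sect Y ?N\<^esub> ?r \<in> F m ?N"
 proof (rule Y.ideal_sheaf_memI[OF F_ideal_sheaf o N.m_closed[OF c']])
  fix y assume y: "y \<in> ?N"
  show "germ Y y ?N (?s \<otimes>\<^bsub>sect Y ?N\<^esub> ?r) \<in> st (F m) y"
   unfolding g[OF y]
   by (rule J_F_mult[OF Y.opn_topspace[OF o y]])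
    (use Y.germ_in_st[where F = "J l", OF W(1) _ W(4)] Y.germ_in_st[where F = "F (m - l)", OF W'(1) _ W'(4)] y in auto)
 qed
 moreover have "mu U \<alpha> V \<mu> y = st (F (Suc m)) y +>\<^sub>y germ Y y ?N (?s \<otimes>\<^bsub>sect Y ?N\<^esub> ?r)" if y: "y \<in> ?N" for y
  unfolding g[OF y] by (rule mult_val[OF U V]) (use W W' y in auto)
 ultimately show "\<exists>N s. opn N \<and> x \<in> N \<and> N \<subseteq> V \<and> s \<in> F m N \<and>
   (\<forall>y\<in>N. mu U \<alpha> V \<mu> y = st (F (Suc m)) y +>\<^sub>y germ Y y N s)"
  using o W(2) W'(2,3) by blast
qed

lemma mult_in_H:
 assumes U: "opn U" "\<alpha> \<in> a.Qsec U"
 shows "mu U \<alpha> \<in> carrier (msect H U)"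
 unfolding H_iff
proof (intro conjI ballI IntI)
 show "mu U \<alpha> \<in> extensional (opens_in Y U)" by (simp add: mult_map_def opens_in_Z)
 fix V assume "V \<in> opens_in Y U"
 then have V: "opn V" "V \<subseteq> U" by (auto simp: opens_in_def)
 have aV: "\<exists>s. s \<in> \<alpha> x" if "x \<in> V" for x using a.section_ne[OF U(2,1), of x] V that by blast
 show "mu U \<alpha> V \<in> extensional (q.Qsec V)"
  using V by (simp add: mult_map_def opens_in_Z opens_in_def M_piece_eq)
 show "mu U \<alpha> V \<in> mod_hom (sect Z V) (msect q.Q V) (msect t.Q V)"
 proof (rule mod_homI)
  fix \<mu> assume \<mu>: "\<mu> \<in> q.Qsec V"
  note m\<mu> = mult_in[OF U V \<mu>]
  show "mu U \<alpha> V \<mu> \<in> t.Qsec V" by (rule m\<mu>)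
  fix \<nu> assume \<nu>: "\<nu> \<in> q.Qsec V"
  show "mu U \<alpha> V (\<mu> \<oplus>\<^bsub>msect q.Q V\<^esub> \<nu>) = mu U \<alpha> V \<mu> \<oplus>\<^bsub>msect t.Q V\<^esub> mu U \<alpha> V \<nu>"
  proof (rule t.section_eqI[OF mult_in[OF U V q.add_in[OF \<mu> \<nu> V(1)]] t.add_in[OF m\<mu> mult_in[OF U V \<nu>] V(1)] V(1)])
   fix x assume x: "x \<in> V"
   interpret B: cring "B x" by (rule B_facts[OF Y.opn_topspace[OF V(1) x]])
   obtain s where s: "s \<in> \<alpha> x" using aV[OF x] by blast
   obtain r where r: "r \<in> \<mu> x" by (rule q.section_ne[OF \<mu> V(1) x])
   obtain r' where r': "r' \<in> \<nu> x" by (rule q.section_ne[OF \<nu> V(1) x])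
   have "s \<in> carrier (B x)" "r \<in> carrier (B x)" "r' \<in> carrier (B x)"
    using a.section_val(2)[OF U(2,1) _ s] q.section_val(2)[OF \<mu> V(1) x r] q.section_val(2)[OF \<nu> V(1) x r'] x V by auto
   then have "s \<otimes>\<^sub>x (r \<oplus>\<^sub>x r') = s \<otimes>\<^sub>x r \<oplus>\<^sub>x s \<otimes>\<^sub>x r'" by (simp add: B.r_distr)
   then show "\<exists>z. z \<in> mu U \<alpha> V (\<mu> \<oplus>\<^bsub>msect q.Q V\<^esub> \<nu>) x \<and> z \<in> (mu U \<alpha> V \<mu> \<oplus>\<^bsub>msect t.Q V\<^esub> mu U \<alpha> V \<nu>) x"
    using mult_mem[OF U V q.add_in[OF \<mu> \<nu> V(1)] x s q.add_mem[OF \<mu> \<nu> V(1) x r r']]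
     t.add_mem[OF m\<mu> mult_in[OF U V \<nu>] V(1) x mult_mem[OF U V \<mu> x s r] mult_mem[OF U V \<nu> x s r']]
    by (intro exI[of _ "s \<otimes>\<^sub>x (r \<oplus>\<^sub>x r')"] conjI) simp_all
  qed
 next
  fix c \<mu> assume c: "c \<in> Z.sec V" and \<mu>: "\<mu> \<in> q.Qsec V"
  show "mu U \<alpha> V (c \<odot>\<^bsub>msect q.Q V\<^esub> \<mu>) = c \<odot>\<^bsub>msect t.Q V\<^esub> mu U \<alpha> V \<mu>"
  proof (rule t.section_eqI[OF mult_in[OF U V q.smult_in[OF \<mu> V(1) c]] t.smult_in[OF mult_in[OF U V \<mu>] V(1) c] V(1)])
   fix x assume x: "x \<in> V"
   interpret B: cring "B x" by (rule B_facts[OF Y.opn_topspace[OF V(1) x]])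
   obtain s where s: "s \<in> \<alpha> x" using aV[OF x] by blast
   obtain r where r: "r \<in> \<mu> x" by (rule q.section_ne[OF \<mu> V(1) x])
   obtain b where b: "b \<in> carrier (B x)" "stalk_map x b = germ Z x V c" by (rule q.lift_at[OF V(1) x c])
   have "s \<in> carrier (B x)" "r \<in> carrier (B x)"
    using a.section_val(2)[OF U(2,1) _ s] q.section_val(2)[OF \<mu> V(1) x r] x V by auto
   then have "s \<otimes>\<^sub>x (b \<otimes>\<^sub>x r) = b \<otimes>\<^sub>x (s \<otimes>\<^sub>x r)" using b(1) by (simp add: B.m_lcomm)
   then show "\<exists>z. z \<in> mu U \<alpha> V (c \<odot>\<^bsub>msect q.Q V\<^esub> \<mu>) x \<and> z \<in> (c \<odot>\<^bsub>msect t.Q V\<^esub> mu U \<alpha> V \<mu>) x"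
    using mult_mem[OF U V q.smult_in[OF \<mu> V(1) c] x s q.smult_mem[OF \<mu> V(1) x r c b]]
     t.smult_mem[OF mult_in[OF U V \<mu>] V(1) x mult_mem[OF U V \<mu> x s r] c b]
    by (intro exI[of _ "s \<otimes>\<^sub>x (b \<otimes>\<^sub>x r)"] conjI) simp_all
  qed
 qed
 fix W \<mu> assume "W \<in> opens_in Y V" and \<mu>: "\<mu> \<in> q.Qsec V"
 then have W: "opn W" "W \<subseteq> V" "W \<subseteq> U" using V by (auto simp: opens_in_def)
 note r\<mu> = q.restrict_in[OF \<mu> V(1) W(1,2)]
 show "mu U \<alpha> W (restrict \<mu> W) = restrict (mu U \<alpha> V \<mu>) W"
 proof (rule t.section_eqI[OF mult_in[OF U W(1,3) r\<mu>] t.restrict_in[OF mult_in[OF U V \<mu>] V(1) W(1,2)] W(1)])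
  fix x assume x: "x \<in> W"
  then have xV: "x \<in> V" using W by blast
  obtain s where s: "s \<in> \<alpha> x" using aV[OF xV] by blast
  obtain r where r: "r \<in> \<mu> x" by (rule q.section_ne[OF \<mu> V(1) xV])
  show "\<exists>z. z \<in> mu U \<alpha> W (restrict \<mu> W) x \<and> z \<in> restrict (mu U \<alpha> V \<mu>) W x"
   using mult_mem[OF U W(1,3) r\<mu> x s] mult_mem[OF U V \<mu> xV s r] r x by (intro exI[of _ "s \<otimes>\<^sub>x r"]) simp
 qed
qed

lemma H_eqI:
 assumes "\<phi> \<in> carrier (msect H U)" "\<psi> \<in> carrier (msect H U)"
  and "!!V \<mu>. opn V ==> V \<subseteq> U ==> \<mu> \<in> q.Qsec V ==> \<phi> V \<mu> = \<psi> V \<mu>"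
 shows "\<phi> = \<psi>"
proof (rule extensionalityI)
 show "\<phi> \<in> extensional (opens_in Y U)" "\<psi> \<in> extensional (opens_in Y U)" using assms(1,2) by (auto simp: H_iff)
 fix V assume "V \<in> opens_in Y U"
 then have V: "opn V" "V \<subseteq> U" by (auto simp: opens_in_def)
 show "\<phi> V = \<psi> V" by (rule extensionalityI[OF HD(5)[OF assms(1) V] HD(5)[OF assms(2) V]]) (rule assms(3)[OF V])
qed

text \<open>The effect of a morphism M_(m-l) -> M_m on the stalk at x, as a map from F (m - l) to
  the local ring; the choices of a representing section and of an element of the coset are
  immaterial by \<open>stalk_value_eqI\<close>.\<close>

definition stalk_value where
 "stalk_value \<phi> U x b = (SOME c. \<exists>V s. opn V \<and> x \<in> V \<and> V \<subseteq> U \<and> s \<in> F (m - l) V \<and> b = germ Y x V s \<and> c \<in> \<phi> V (q.sclass V s) x)"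

lemma stalk_value_eqI:
 assumes \<phi>: "\<phi> \<in> carrier (msect H U)" and U: "opn U" and V: "opn V" "V \<subseteq> U" "\<mu> \<in> q.Qsec V" "x \<in> V" "b \<in> \<mu> x" "c \<in> \<phi> V \<mu> x"
 shows "stalk_value \<phi> U x b = c"
proof -
 have *: "c = c'" if h: "opn V" "V \<subseteq> U" "\<mu> \<in> q.Qsec V" "x \<in> V" "b \<in> \<mu> x" "c \<in> \<phi> V \<mu> x"
  "opn V'" "V' \<subseteq> U" "\<mu>' \<in> q.Qsec V'" "x \<in> V'" "b \<in> \<mu>' x" "c' \<in> \<phi> V' \<mu>' x" for V \<mu> c V' \<mu>' c'
 proof -
  obtain W where W: "opn W" "x \<in> W" "W \<subseteq> V" "W \<subseteq> V'" "restrict \<mu> W = restrict \<mu>' W"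
   by (rule q.section_locally_eq[OF h(3,9,1,7,4,10,5,11)])
  have "restrict (\<phi> V \<mu>) W = restrict (\<phi> V' \<mu>') W"
   using HD(4)[OF \<phi> h(1,2) W(1,3) h(3)] HD(4)[OF \<phi> h(7,8) W(1,4) h(9)] W(5) by simp
  from fun_cong[OF this, of x] have "\<phi> V \<mu> x = \<phi> V' \<mu>' x" using W by simp
  then have "c' \<in> \<phi> V \<mu> x" using h(12) by simp
  from t_val[OF HD(1)[OF \<phi> h(1-3)] h(1,4) this h(6)] show ?thesis .
 qed
 obtain W s where W: "opn W" "x \<in> W" "W \<subseteq> V" "s \<in> F (m - l) W" "germ Y x W s = b"
  by (rule q.sectionE[OF V(3,1,4,5)]) blast
 have sc: "q.sclass W s \<in> q.Qsec W" by (rule q.sclass_in[OF W(1,4)])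
 have WU: "W \<subseteq> U" using W V by blast
 obtain d where d: "d \<in> \<phi> W (q.sclass W s) x" by (rule t.section_ne[OF HD(1)[OF \<phi> W(1) WU sc] W(1,2)])
 have "\<exists>V s. opn V \<and> x \<in> V \<and> V \<subseteq> U \<and> s \<in> F (m - l) V \<and> b = germ Y x V s \<and> stalk_value \<phi> U x b \<in> \<phi> V (q.sclass V s) x"
  unfolding stalk_value_def
  by (rule someI[of "\<lambda>c. \<exists>V s. opn V \<and> x \<in> V \<and> V \<subseteq> U \<and> s \<in> F (m - l) V \<and> b = germ Y x V s \<and> c \<in> \<phi> V (q.sclass V s) x" d])
   (use W WU d in blast)
 then obtain N r where N: "opn N" "x \<in> N" "N \<subseteq> U" "r \<in> F (m - l) N" "b = germ Y x N r"
  "stalk_value \<phi> U x b \<in> \<phi> N (q.sclass N r) x" by (elim exE conjE)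
 show ?thesis
  by (rule *[OF N(1,3) q.sclass_in[OF N(1,4)] N(2) _ N(6) V]) (use q.sclass_mem[OF N(1,4,2)] N(5) in simp)
qed

text \<open>On the stalk \<phi> is a homomorphism from the ideal F (m - l) to the ring, hence
  multiplication by some e. It vanishes on F (m - l + 1), whose elements represent zero, so e lies
  in J l.\<close>

lemma multiplier_exists:
 assumes \<phi>: "\<phi> \<in> carrier (msect H U)" and U: "opn U" and x: "x \<in> U"
  and ext: "hom_extends (B x) (st (F (m - l)) x) (self_module (B x))"
 shows "\<exists>e. e \<in> st (J l) x \<and> (\<forall>V \<mu> b. opn V --> V \<subseteq> U --> x \<in> V --> \<mu> \<in> q.Qsec V --> b \<in> \<mu> x -->
  e \<otimes>\<^sub>x b \<in> \<phi> V \<mu> x)"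
proof -
 have xT: "x \<in> T" by (rule Y.opn_topspace[OF U x])
 interpret B: cring "B x" by (rule B_facts[OF xT])
 let ?f = "stalk_value \<phi> U x"
 have rep: "\<exists>V \<mu>. opn V \<and> V \<subseteq> N \<and> \<mu> \<in> q.Qsec V \<and> x \<in> V \<and> b \<in> \<mu> x" if b: "b \<in> st (F (m - l)) x" and N: "opn N" "x \<in> N" for b N
 proof -
  obtain V s where V: "opn V" "x \<in> V" "V \<subseteq> N" "s \<in> F (m - l) V" "b = germ Y x V s"
   by (rule Y.ideal_stalkE[OF F_ideal_sheaf b N]) blast
  then show ?thesis using q.sclass_in[OF V(1,4)] q.sclass_mem[OF V(1,4,2)] by blast
 qed
 have val: "?f b \<in> \<phi> V \<mu> x" if V: "opn V" "V \<subseteq> U" "\<mu> \<in> q.Qsec V" "x \<in> V" "b \<in> \<mu> x" for V \<mu> b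
 proof -
  obtain d where d: "d \<in> \<phi> V \<mu> x" by (rule t.section_ne[OF HD(1)[OF \<phi> V(1-3)] V(1,4)])
  then show ?thesis using stalk_value_eqI[OF \<phi> U V d] by simp
 qed
 have "?f \<in> mod_hom (B x) (ideal_mod (B x) (st (F (m - l)) x)) (self_module (B x))"
 proof (rule mod_homI; simp)
  fix b assume b: "b \<in> st (F (m - l)) x"
  obtain V \<mu> where V: "opn V" "V \<subseteq> U" "\<mu> \<in> q.Qsec V" "x \<in> V" "b \<in> \<mu> x" using rep[OF b U x] by blast
  show "?f b \<in> carrier (B x)" by (rule t.section_val(2)[OF HD(1)[OF \<phi> V(1-3)] V(1,4) val[OF V]])
  { fix b' assume b': "b' \<in> st (F (m - l)) x"
   obtain W \<nu> where W: "opn W" "W \<subseteq> V" "\<nu> \<in> q.Qsec W" "x \<in> W" "b' \<in> \<nu> x" using rep[OF b' V(1,4)] by blast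
   have WU: "W \<subseteq> U" using W V by blast
   note r = q.restrict_in[OF V(3,1) W(1,2)]
   have bW: "b \<in> restrict \<mu> W x" using V W by simp
   show "?f (b \<oplus>\<^sub>x b') = ?f b \<oplus>\<^sub>x ?f b'"
    by (rule stalk_value_eqI[OF \<phi> U W(1) WU q.add_in[OF r W(3,1)] W(4) q.add_mem[OF r W(3,1,4) bW W(5)]],
      subst HD(2)[OF \<phi> W(1) WU r W(3)])
     (rule t.add_mem[OF HD(1)[OF \<phi> W(1) WU r] HD(1)[OF \<phi> W(1) WU W(3)] W(1,4) val[OF W(1) WU r W(4) bW] val[OF W(1) WU W(3-5)]]) }
  fix c assume c: "c \<in> carrier (B x)"
  obtain W r where W: "opn W" "x \<in> W" "W \<subseteq> V" "r \<in> Y.sec W" "c = germ Y x W r" by (rule Y.stalkE[OF c V(1,4)])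
  have WU: "W \<subseteq> U" using W V by blast
  note rs = q.restrict_in[OF V(3,1) W(1,3)]
  have bW: "b \<in> restrict \<mu> W x" using V W by simp
  have pr: "\<pi> W r \<in> Z.sec W" "stalk_map x c = germ Z x W (\<pi> W r)" using W by (auto simp: stalk_map_germ)
  show "?f (c \<otimes>\<^sub>x b) = c \<otimes>\<^sub>x ?f b"
   by (rule stalk_value_eqI[OF \<phi> U W(1) WU q.smult_in[OF rs W(1) pr(1)] W(2) q.smult_mem[OF rs W(1,2) bW pr(1) c pr(2)]],
     subst HD(3)[OF \<phi> W(1) WU pr(1) rs])
    (rule t.smult_mem[OF HD(1)[OF \<phi> W(1) WU rs] W(1,2) val[OF W(1) WU rs W(2) bW] pr(1) c pr(2)])
 qed
 from hom_extendsD[OF ext this] obtain e where e: "e \<in> carrier (B x)" "!!b. b \<in> st (F (m - l)) x ==> ?f b = b \<otimes>\<^sub>x e"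
  unfolding self_module_simps by blast
 have "e \<in> st (J l) x"
 proof (rule J_memI[OF xT e(1)])
  fix b assume "b \<in> st (F (m + 1 - l)) x"
  then have b: "b \<in> st (F (Suc (m - l))) x" by (simp add: Suc_diff_le[OF l])
  then have b': "b \<in> st (F (m - l)) x" using F_Suc_subset[OF xT] by blast
  have z: "\<zero>\<^bsub>msect q.Q U\<^esub> \<in> q.Qsec U" "b \<in> \<zero>\<^bsub>msect q.Q U\<^esub> x" "\<zero>\<^sub>x \<in> \<zero>\<^bsub>msect q.Q U\<^esub> x"
   using q.zero_in[OF U] q.zero_mem[OF U x] b x by (simp_all add: q.Q_simps)
  have "?f b = ?f \<zero>\<^sub>x"
   by (rule t_val[OF HD(1)[OF \<phi> U order_refl z(1)] U x val[OF U order_refl z(1) x z(3)] val[OF U order_refl z(1) x z(2)]])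
  also have "\<dots> = \<zero>\<^sub>x"
   using e additive_subgroup.zero_closed[OF ideal.axioms(1)[OF F_ideal[OF xT]]] by simp
  finally show "e \<otimes>\<^sub>x b = \<zero>\<^sub>x" using e b' F_car[OF xT b'] by (simp add: B.m_comm)
 qed
 moreover have "e \<otimes>\<^sub>x b \<in> \<phi> V \<mu> x" if "opn V" "V \<subseteq> U" "x \<in> V" "\<mu> \<in> q.Qsec V" "b \<in> \<mu> x" for V \<mu> b
 proof -
  have b: "b \<in> st (F (m - l)) x" by (rule q.section_val(1)[OF that(4,1,3,5)])
  show ?thesis using val[OF that(1,2,4,3,5)] e(2)[OF b] B.m_comm[OF e(1) F_car[OF xT b]] by simp
 qed
 ultimately show ?thesis by blast
qed

lemma H_eqI':
 assumes "\<phi> \<in> extensional (opens_in Y U)"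
  and "!!V. opn V ==> V \<subseteq> U ==> \<phi> V \<in> extensional (q.Qsec V)"
  and "!!V \<mu>. opn V ==> V \<subseteq> U ==> \<mu> \<in> q.Qsec V ==> \<phi> V \<mu> = g V \<mu>"
 shows "\<phi> = (\<lambda>V\<in>opens_in Y U. \<lambda>s\<in>q.Qsec V. g V s)"
proof (rule extensionalityI[OF assms(1) restrict_extensional])
 fix V assume V': "V \<in> opens_in Y U"
 then have V: "opn V" "V \<subseteq> U" by (auto simp: opens_in_def)
 have "\<phi> V = (\<lambda>s\<in>q.Qsec V. g V s)"
  by (rule extensionalityI[OF assms(2)[OF V] restrict_extensional]) (use assms(3)[OF V] in simp)
 then show "\<phi> V = (\<lambda>V\<in>opens_in Y U. \<lambda>s\<in>q.Qsec V. g V s) V" using V' by simp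
qed

lemma mult_extensional:
 assumes "opn U" "\<alpha> \<in> a.Qsec U"
 shows "mu U \<alpha> \<in> extensional (opens_in Y U)" "!!V. opn V ==> V \<subseteq> U ==> mu U \<alpha> V \<in> extensional (q.Qsec V)"
 using mult_in_H[OF assms] HD(5)[OF mult_in_H[OF assms]] by (auto simp: H_iff)

lemma mult_hom:
 assumes U: "opn U"
 shows "mu U \<in> mod_hom (sect Z U) (msect a.Q U) (msect H U)"
proof (rule mod_homI)
 fix \<alpha> assume \<alpha>: "\<alpha> \<in> a.Qsec U"
 show "mu U \<alpha> \<in> carrier (msect H U)" by (rule mult_in_H[OF U \<alpha>])
 fix \<beta> assume \<beta>: "\<beta> \<in> a.Qsec U"
 note ab = a.add_in[OF \<alpha> \<beta> U]
 show "mu U (\<alpha> \<oplus>\<^bsub>msect a.Q U\<^esub> \<beta>) = mu U \<alpha> \<oplus>\<^bsub>msect H U\<^esub> mu U \<beta>"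
  unfolding H_simps
 proof (rule H_eqI'[OF mult_extensional[OF U ab]])
  fix V \<mu> assume V: "opn V" "V \<subseteq> U" "\<mu> \<in> q.Qsec V"
  note m = mult_in[OF U \<alpha> V] mult_in[OF U \<beta> V]
  show "mu U (\<alpha> \<oplus>\<^bsub>msect a.Q U\<^esub> \<beta>) V \<mu> = mu U \<alpha> V \<mu> \<oplus>\<^bsub>msect t.Q V\<^esub> mu U \<beta> V \<mu>"
  proof (rule t.section_eqI[OF mult_in[OF U ab V] t.add_in[OF m V(1)] V(1)])
   fix x assume x: "x \<in> V"
   then have xU: "x \<in> U" using V by blast
   interpret B: cring "B x" by (rule B_facts[OF Y.opn_topspace[OF U xU]])
   obtain s where s: "s \<in> \<alpha> x" by (rule a.section_ne[OF \<alpha> U xU])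
   obtain s' where s': "s' \<in> \<beta> x" by (rule a.section_ne[OF \<beta> U xU])
   obtain r where r: "r \<in> \<mu> x" by (rule q.section_ne[OF V(3,1) x])
   have "(s \<oplus>\<^sub>x s') \<otimes>\<^sub>x r = s \<otimes>\<^sub>x r \<oplus>\<^sub>x s' \<otimes>\<^sub>x r"
    using a.section_val(2)[OF \<alpha> U xU s] a.section_val(2)[OF \<beta> U xU s'] q.section_val(2)[OF V(3,1) x r] by (rule B.l_distr)
   then show "\<exists>z. z \<in> mu U (\<alpha> \<oplus>\<^bsub>msect a.Q U\<^esub> \<beta>) V \<mu> x \<and> z \<in> (mu U \<alpha> V \<mu> \<oplus>\<^bsub>msect t.Q V\<^esub> mu U \<beta> V \<mu>) x"
    using mult_mem[OF U ab V x a.add_mem[OF \<alpha> \<beta> U xU s s'] r]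
     t.add_mem[OF m V(1) x mult_mem[OF U \<alpha> V x s r] mult_mem[OF U \<beta> V x s' r]] by auto
  qed
 qed
next
 fix c \<alpha> assume c: "c \<in> Z.sec U" and \<alpha>: "\<alpha> \<in> a.Qsec U"
 note ca = a.smult_in[OF \<alpha> U c]
 show "mu U (c \<odot>\<^bsub>msect a.Q U\<^esub> \<alpha>) = c \<odot>\<^bsub>msect H U\<^esub> mu U \<alpha>"
  unfolding H_simps
 proof (rule H_eqI'[OF mult_extensional[OF U ca]])
  fix V \<mu> assume V: "opn V" "V \<subseteq> U" "\<mu> \<in> q.Qsec V"
  note m = mult_in[OF U \<alpha> V]
  have c': "restr Z U V c \<in> Z.sec V" using U V c by simp
  show "mu U (c \<odot>\<^bsub>msect a.Q U\<^esub> \<alpha>) V \<mu> = restr Z U V c \<odot>\<^bsub>msect t.Q V\<^esub> mu U \<alpha> V \<mu>"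
  proof (rule t.section_eqI[OF mult_in[OF U ca V] t.smult_in[OF m V(1) c'] V(1)])
   fix x assume x: "x \<in> V"
   then have xU: "x \<in> U" using V by blast
   interpret B: cring "B x" by (rule B_facts[OF Y.opn_topspace[OF U xU]])
   obtain s where s: "s \<in> \<alpha> x" by (rule a.section_ne[OF \<alpha> U xU])
   obtain r where r: "r \<in> \<mu> x" by (rule q.section_ne[OF V(3,1) x])
   obtain b where b: "b \<in> carrier (B x)" "stalk_map x b = germ Z x U c" by (rule q.lift_at[OF U xU c])
   have b': "stalk_map x b = germ Z x V (restr Z U V c)" using b(2) U V c x by simp
   have "(b \<otimes>\<^sub>x s) \<otimes>\<^sub>x r = b \<otimes>\<^sub>x (s \<otimes>\<^sub>x r)"
    using b(1) a.section_val(2)[OF \<alpha> U xU s] q.section_val(2)[OF V(3,1) x r] by (rule B.m_assoc)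
   then show "\<exists>z. z \<in> mu U (c \<odot>\<^bsub>msect a.Q U\<^esub> \<alpha>) V \<mu> x \<and> z \<in> (restr Z U V c \<odot>\<^bsub>msect t.Q V\<^esub> mu U \<alpha> V \<mu>) x"
    using mult_mem[OF U ca V x a.smult_mem[OF \<alpha> U xU s c b] r]
     t.smult_mem[OF m V(1) x mult_mem[OF U \<alpha> V x s r] c' b(1) b'] by auto
  qed
 qed
qed

lemma mult_restr:
 assumes U: "opn U" "\<alpha> \<in> a.Qsec U" and V: "opn V" "V \<subseteq> U"
 shows "mu V (restrict \<alpha> V) = restrict (mu U \<alpha>) (opens_in Y V)"
proof (rule extensionalityI[OF mult_extensional(1)[OF V(1) a.restrict_in[OF U(2,1) V]] restrict_extensional])
 note r = a.restrict_in[OF U(2,1) V]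
 fix W assume W': "W \<in> opens_in Y V"
 then have W: "opn W" "W \<subseteq> V" "W \<subseteq> U" using V by (auto simp: opens_in_def)
 have "mu V (restrict \<alpha> V) W = mu U \<alpha> W"
 proof (rule extensionalityI[OF mult_extensional(2)[OF V(1) r W(1,2)] mult_extensional(2)[OF U W(1,3)]])
  fix \<mu> assume \<mu>: "\<mu> \<in> q.Qsec W"
  show "mu V (restrict \<alpha> V) W \<mu> = mu U \<alpha> W \<mu>"
  proof (rule t.section_eqI[OF mult_in[OF V(1) r W(1,2) \<mu>] mult_in[OF U W(1,3) \<mu>] W(1)])
   fix x assume x: "x \<in> W"
   then have xU: "x \<in> U" "x \<in> V" using W V by auto
   obtain s where s: "s \<in> \<alpha> x" by (rule a.section_ne[OF U(2,1) xU(1)])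
   obtain b where b: "b \<in> \<mu> x" by (rule q.section_ne[OF \<mu> W(1) x])
   show "\<exists>z. z \<in> mu V (restrict \<alpha> V) W \<mu> x \<and> z \<in> mu U \<alpha> W \<mu> x"
    using mult_mem[OF V(1) r W(1,2) \<mu> x _ b, of s] mult_mem[OF U W(1,3) \<mu> x s b] s xU by auto
  qed
 qed
 then show "mu V (restrict \<alpha> V) W = restrict (mu U \<alpha>) (opens_in Y V) W" using W' by simp
qed

lemma J_Suc_memI:
 assumes x: "x \<in> T" and s: "s \<in> carrier (B x)" "s' \<in> carrier (B x)"
  and eq: "!!b. b \<in> st (F (m - l)) x ==> s \<otimes>\<^sub>x b = s' \<otimes>\<^sub>x b"
 shows "s \<ominus>\<^sub>x s' \<in> st (J (Suc l)) x"
proof -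
 interpret B: cring "B x" by (rule B_facts[OF x])
 show ?thesis
 proof (rule J_memI[OF x])
  fix b assume "b \<in> st (F (m + 1 - Suc l)) x"
  then have b: "b \<in> st (F (m - l)) x" by simp
  show "(s \<ominus>\<^sub>x s') \<otimes>\<^sub>x b = \<zero>\<^sub>x"
   using eq[OF b] s F_car[OF x b] by (simp add: a_minus_def B.l_distr B.l_minus B.r_neg)
 qed (use s in simp)
qed

text \<open>Representatives that act alike on F (m - l) differ by an element of its annihilator,
  which is J (l + 1).\<close>

lemma mult_inj:
 assumes U: "opn U"
 shows "inj_on (mu U) (a.Qsec U)"
proof (rule inj_onI)
 fix \<alpha> \<beta> assume \<alpha>: "\<alpha> \<in> a.Qsec U" and \<beta>: "\<beta> \<in> a.Qsec U" and eq: "mu U \<alpha> = mu U \<beta>"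
 show "\<alpha> = \<beta>"
 proof (rule a.section_eqI[OF \<alpha> \<beta> U])
  fix x assume x: "x \<in> U"
  have xT: "x \<in> T" by (rule Y.opn_topspace[OF U x])
  obtain s where s: "s \<in> \<alpha> x" by (rule a.section_ne[OF \<alpha> U x])
  obtain s' where s': "s' \<in> \<beta> x" by (rule a.section_ne[OF \<beta> U x])
  have c: "s \<in> carrier (B x)" "s' \<in> carrier (B x)"
   using a.section_val(2)[OF \<alpha> U x s] a.section_val(2)[OF \<beta> U x s'] by auto
  have "s \<ominus>\<^sub>x s' \<in> st (J (Suc l)) x"
  proof (rule J_Suc_memI[OF xT c])
   fix b assume b: "b \<in> st (F (m - l)) x"
   obtain V r where V: "opn V" "x \<in> V" "V \<subseteq> U" "r \<in> F (m - l) V" "b = germ Y x V r"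
    by (rule Y.ideal_stalkE[OF F_ideal_sheaf b U x]) blast
   note \<mu> = q.sclass_in[OF V(1,4)] and b' = q.sclass_mem[OF V(1,4,2), folded V(5)]
   show "s \<otimes>\<^sub>x b = s' \<otimes>\<^sub>x b"
    by (rule t_val[OF mult_in[OF U \<beta> V(1,3) \<mu>] V(1,2) mult_mem[OF U \<beta> V(1,3) \<mu> V(2) s' b']])
     (use mult_mem[OF U \<alpha> V(1,3) \<mu> V(2) s b'] eq in simp)
  qed
  then have "s \<in> \<beta> x" using a.section_val(4)[OF \<beta> U x s'] c by simp
  then show "\<exists>t. t \<in> \<alpha> x \<and> t \<in> \<beta> x" using s by blast
 qed
qed

text \<open>Multipliers e x are chosen point by point. That their cosets form a section of A_l is
  shown near each x by comparison with a section e' through e x: agreement with \<phi> on the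
  finitely many basis sections of M_(m-l) spreads to a neighbourhood, and there e y and e' differ by
  an element killing F (m - l).\<close>

lemma mult_surj:
 assumes U: "opn U" and \<phi>: "\<phi> \<in> carrier (msect H U)"
  and ext: "!!x. x \<in> T ==> hom_extends (B x) (st (F (m - l)) x) (self_module (B x))"
 shows "\<exists>\<alpha>\<in>a.Qsec U. mu U \<alpha> = \<phi>"
proof -
 have "\<forall>x\<in>U. \<exists>e. e \<in> st (J l) x \<and> (\<forall>V \<mu> b. opn V --> V \<subseteq> U --> x \<in> V --> \<mu> \<in> q.Qsec V --> b \<in> \<mu> x -->
   e \<otimes>\<^sub>x b \<in> \<phi> V \<mu> x)"
  using multiplier_exists[OF \<phi> U _ ext[OF Y.opn_topspace[OF U]]] by blast
 from bchoice[OF this] obtain e where e0: "\<forall>x\<in>U. e x \<in> st (J l) x \<and> (\<forall>V \<mu> b. opn V --> V \<subseteq> U --> x \<in> V -->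
   \<mu> \<in> q.Qsec V --> b \<in> \<mu> x --> e x \<otimes>\<^sub>x b \<in> \<phi> V \<mu> x)" ..
 have e: "!!x. x \<in> U ==> e x \<in> st (J l) x" and em: "!!x V \<mu> b. x \<in> U ==> opn V ==> V \<subseteq> U ==> x \<in> V ==>
   \<mu> \<in> q.Qsec V ==> b \<in> \<mu> x ==> e x \<otimes>\<^sub>x b \<in> \<phi> V \<mu> x"
  using e0 by simp_all
 define \<alpha> where "\<alpha> = (\<lambda>x\<in>U. st (J (Suc l)) x +>\<^sub>x e x)"
 have ec: "e x \<in> carrier (B x)" if "x \<in> U" for x using J_car[OF Y.opn_topspace[OF U that] e[OF that]] .
 have "\<alpha> \<in> a.Qsec U"
 proof (rule a.QsecI[OF _ U])
  show "\<alpha> \<in> extensional U" by (simp add: \<alpha>_def)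
  fix x assume x: "x \<in> U"
  have xT: "x \<in> T" by (rule Y.opn_topspace[OF U x])
  obtain W e' where W: "opn W" "x \<in> W" "W \<subseteq> U" "e' \<in> J l W" "e' \<in> Y.sec W" "e x = germ Y x W e'"
   by (rule Y.ideal_stalkE[OF J_ideal_sheaf e[OF x] U x])
  obtain V' n s where V': "opn V'" "x \<in> V'" "!!i. i < n ==> s i \<in> F (m - l) V'" "!!i. i < n ==> s i \<in> Y.sec V'"
   "!!y. y \<in> V' ==> basis (m - l) y (\<lambda>i. germ Y y V' (s i)) n"
   by (rule basis_at[OF _ xT, of "m - l"]) auto
  let ?V = "W \<inter> V'" and ?a = "a.sclass W e'"
  have V: "opn ?V" "?V \<subseteq> U" "?V \<subseteq> W" "x \<in> ?V" using W V' by auto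
  let ?m = "\<lambda>i. restrict (q.sclass V' (s i)) ?V"
  have m: "?m i \<in> q.Qsec ?V" "!!y. y \<in> ?V ==> germ Y y V' (s i) \<in> ?m i y" if "i < n" for i
   using q.restrict_in[OF q.sclass_in[OF V'(1,3)] V'(1) V(1)] q.sclass_mem[OF V'(1,3)] that by auto
  note aW = a.sclass_in[OF W(1,4)]
  have mm: "germ Y y W e' \<otimes>\<^sub>y germ Y y V' (s i) \<in> mu W ?a ?V (?m i) y" if "i < n" "y \<in> ?V" for i y
   by (rule mult_mem[OF W(1) aW V(1,3) m(1)[OF that(1)] that(2) a.sclass_mem[OF W(1,4)] m(2)[OF that]]) (use that in simp)
  have ex: "\<exists>N. opn N \<and> x \<in> N \<and> N \<subseteq> ?V \<and> restrict (\<phi> ?V (?m i)) N = restrict (mu W ?a ?V (?m i)) N" if i: "i < n" for i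
   by (rule t.section_locally_eq[OF HD(1)[OF \<phi> V(1,2) m(1)[OF i]] mult_in[OF W(1) aW V(1,3) m(1)[OF i]] V(1,1,4,4)
      em[OF x V(1,2,4) m(1)[OF i] m(2)[OF i V(4)]], unfolded W(6), OF mm[OF i V(4)]]) blast
  then obtain N where N: "!!i. i < n ==> opn (N i) \<and> x \<in> N i \<and> N i \<subseteq> ?V \<and>
    restrict (\<phi> ?V (?m i)) (N i) = restrict (mu W ?a ?V (?m i)) (N i)" by metis
  \<comment> \<open>One neighbourhood of x on which e' acts on every basis section as \<phi>
    does.\<close>
  define M where "M = \<Inter>(insert ?V (N ` {..<n}))"
  have "opn M" unfolding M_def by (rule openin_Inter) (use N V in auto)
  then have M: "opn M" "x \<in> M" "M \<subseteq> ?V" "!!i. i < n ==> M \<subseteq> N i" using N V by (auto simp: M_def)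
  have MW: "M \<subseteq> W" "M \<subseteq> U" using M V by auto
  have val: "\<alpha> y = st (J (Suc l)) y +>\<^sub>y germ Y y W e'" if y: "y \<in> M" for y
  proof -
   have yT: "y \<in> T" by (rule Y.opn_topspace[OF M(1) y])
   have y': "y \<in> U" "y \<in> W" "y \<in> V'" "y \<in> ?V" using y M V by auto
   interpret B: cring "B y" by (rule B_facts[OF yT])
   have ge: "germ Y y W e' \<in> st (J l) y" "germ Y y W e' \<in> carrier (B y)"
    using Y.germ_in_st[where F = "J l", OF W(1) y'(2) W(4)] W y' by auto
   let ?d = "e y \<ominus>\<^sub>y germ Y y W e'"
   note qb = V'(5)[OF y'(3)]
   have "?d \<otimes>\<^sub>y b = \<zero>\<^sub>y" if b: "b \<in> st (F (m - l)) y" for b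
   proof (rule adjoin_seq_killed[OF B_facts(1)[OF yT] F_ideal[OF yT] quotient_basisD(1)[OF qb]])
    show "?d \<in> carrier (B y)" using ec[OF y'(1)] ge by simp
    show "b \<in> seq_ideal (B y) (st (F (Suc (m - l))) y) (\<lambda>i. germ Y y V' (s i)) n" using b quotient_basisD(3)[OF qb] by simp
    show "?d \<otimes>\<^sub>y w = \<zero>\<^sub>y" if "w \<in> st (F (Suc (m - l))) y" for w
     using J_kills[OF yT e[OF y'(1)], of w] J_kills[OF yT ge(1), of w] that ec[OF y'(1)] ge(2) F_car[OF yT that]
     by (simp add: Suc_diff_le[OF l] a_minus_def B.l_distr B.l_minus)
    fix i assume i: "i < n"
    have g: "germ Y y V' (s i) \<in> carrier (B y)" by (rule quotient_basisD(1)[OF qb i])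
    have eq: "\<phi> ?V (?m i) y = mu W ?a ?V (?m i) y" using fun_cong[OF N[OF i, THEN conjunct2, THEN conjunct2, THEN conjunct2], of y] M(4)[OF i] y by auto
    have "e y \<otimes>\<^sub>y germ Y y V' (s i) \<in> mu W ?a ?V (?m i) y"
     unfolding eq[symmetric] by (rule em[OF y'(1) V(1,2) y'(4) m(1)[OF i] m(2)[OF i y'(4)]])
    from t_val[OF mult_in[OF W(1) aW V(1,3) m(1)[OF i]] V(1) y'(4) mm[OF i y'(4)] this]
    show "?d \<otimes>\<^sub>y germ Y y V' (s i) = \<zero>\<^sub>y"
     using ec[OF y'(1)] ge(2) g by (simp add: a_minus_def B.l_distr B.l_minus B.r_neg)
   qed
   then have "?d \<in> st (J (Suc l)) y"
    by (intro J_memI[OF yT]) (use ec[OF y'(1)] ge in auto)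
   then have "e y \<in> st (J (Suc l)) y +>\<^sub>y germ Y y W e'"
    using coset_mem_iff[OF B_facts(1)[OF yT] J_ideal[OF yT] ge(2)] ec[OF y'(1)] by blast
   from coset_eq[OF B_facts(1)[OF yT] J_ideal[OF yT] ge(2) this] show ?thesis using y' by (simp add: \<alpha>_def)
  qed
  have "\<alpha> y = st (J (Suc l)) y +>\<^sub>y germ Y y M (restr Y W M e')" if y: "y \<in> M" for y
   unfolding val[OF y] Y.germ_restr[OF W(1) M(1) MW(1) y W(5)] ..
  then show "\<exists>V s. opn V \<and> x \<in> V \<and> V \<subseteq> U \<and> s \<in> J l V \<and> (\<forall>y\<in>V. \<alpha> y = st (J (Suc l)) y +>\<^sub>y germ Y y V s)"
   using M(1,2) MW Y.ideal_sheafD(3)[OF J_ideal_sheaf W(1) M(1) MW(1) W(4)] by blast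
 qed
 moreover have "mu U \<alpha> = \<phi>"
 proof (rule H_eqI[OF mult_in_H[OF U calculation] \<phi>])
  fix V \<mu> assume V: "opn V" "V \<subseteq> U" "\<mu> \<in> q.Qsec V"
  show "mu U \<alpha> V \<mu> = \<phi> V \<mu>"
  proof (rule t.section_eqI[OF mult_in[OF U \<open>\<alpha> \<in> a.Qsec U\<close> V] HD(1)[OF \<phi> V] V(1)])
   fix x assume x: "x \<in> V"
   then have xU: "x \<in> U" using V by blast
   obtain b where b: "b \<in> \<mu> x" by (rule q.section_ne[OF V(3,1) x])
   have "e x \<in> \<alpha> x" using a.coset_self'[OF U xU ec[OF xU]] xU by (simp add: \<alpha>_def)
   from mult_mem[OF U \<open>\<alpha> \<in> a.Qsec U\<close> V x this b] show "\<exists>t. t \<in> mu U \<alpha> V \<mu> x \<and> t \<in> \<phi> V \<mu> x"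
    using em[OF xU V(1,2) x V(3) b] by blast
  qed
 qed
 ultimately show ?thesis by blast
qed

lemma mult_map_iso:
 assumes ext: "!!x. x \<in> T ==> hom_extends (B x) (st (F (m - l)) x) (self_module (B x))"
 shows "mod_sheaf_iso Z (A_piece Z Y \<pi> m l) H mu"
 unfolding mod_sheaf_iso_def A_piece_eq opens_in_Z
proof (intro allI impI conjI ballI)
 fix U assume "Z.opn U"
 then have U: "opn U" by simp
 show "mu U \<in> mod_hom (sect Z U) (msect a.Q U) (msect H U)" by (rule mult_hom[OF U])
 show "bij_betw (mu U) (a.Qsec U) (carrier (msect H U))"
  unfolding bij_betw_def using mult_inj[OF U] mult_in_H[OF U] mult_surj[OF U _ ext] by blast
 show "mu V (mrestr a.Q U V \<alpha>) = mrestr H U V (mu U \<alpha>)" if "V \<in> opens_in Y U" "\<alpha> \<in> a.Qsec U" for V \<alpha>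
  using mult_restr[OF U that(2)] that(1) by (simp add: a.Q_simps H_simps opens_in_def)
qed

text \<open>The j-th coordinate for a local basis of M_(m-l), multiplied by u, is a section of the
  sheaf of homomorphisms. Surjectivity of the canonical map makes it multiplication by a section of
  A_l, whose representative at x is the multiplier for position j.\<close>

lemma dual_basis_exists:
 assumes x: "x \<in> T" and iso: "mod_sheaf_iso Z (A_piece Z Y \<pi> m l) H mu"
  and u: "opn N'" "x \<in> N'" "u \<in> F m N'"
 shows "\<exists>n g. basis (m - l) x g n \<and>
   (\<forall>j<n. \<exists>t\<in>carrier (B x). (\<forall>b\<in>st (F (Suc (m - l))) x. t \<otimes>\<^sub>x b = \<zero>\<^sub>x) \<and>
    (\<forall>i<j. t \<otimes>\<^sub>x g i = \<zero>\<^sub>x) \<and> t \<otimes>\<^sub>x g j = germ Y x N' u)"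
proof -
 obtain U n \<theta> where U: "local_trivialization Y Z \<pi> (F (m - l)) (F (Suc (m - l))) U n \<theta>" "x \<in> U"
  by (rule trivialization_at[OF _ x, of "m - l"]) auto
 interpret tr: local_trivialization Y Z \<pi> "F (m - l)" "F (Suc (m - l))" U n \<theta> by (rule U)
 obtain V s where V: "opn V" "x \<in> V" "V \<subseteq> U"
  "!!i. i < n ==> s i \<in> F (m - l) V" "!!i y. i < n ==> y \<in> V ==> germ Y y V (s i) \<in> \<theta> U (tr.unit_vec U i) y"
  using tr.basis_sections[OF U(2) order_refl] by blast
 let ?g = "\<lambda>i. germ Y x V (s i)" and ?u = "germ Y x N' u" and ?\<upsilon> = "t.sclass N' u"
 interpret B: cring "B x" by (rule B_facts[OF x])
 define N where "N = V \<inter> N'"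
 have N: "opn N" "x \<in> N" "N \<subseteq> U" "N \<subseteq> N'" using V u by (auto simp: N_def)
 note \<upsilon> = t.sclass_in[OF u(1,3)]
 define co where "co W = the_inv_into (tr.vec W) (\<theta> W)" for W
 have co: "co W \<mu> \<in> tr.vec W" "\<theta> W (co W \<mu>) = \<mu>" if W: "opn W" "W \<subseteq> N" "\<mu> \<in> q.Qsec W" for W \<mu>
 proof -
  have bij: "bij_betw (\<theta> W) (tr.vec W) (q.Qsec W)" by (rule tr.\<theta>_facts(4)[OF W(1)]) (use W(2) N(3) in blast)
  show "co W \<mu> \<in> tr.vec W" "\<theta> W (co W \<mu>) = \<mu>"
   unfolding co_def using bij_betw_apply[OF bij_betw_the_inv_into[OF bij] W(3)] f_the_inv_into_f_bij_betw[OF bij W(3)] .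
 qed
 have co_eq: "co W \<mu> = v" if "opn W" "W \<subseteq> N" "v \<in> tr.vec W" "\<theta> W v = \<mu>" for W v \<mu>
  using the_inv_into_f_f[OF bij_betw_imp_inj_on[OF tr.\<theta>_facts(4)[OF that(1)]] that(3)] that N unfolding co_def by blast
 have dual: "\<exists>t\<in>carrier (B x). (\<forall>b\<in>st (F (Suc (m - l))) x. t \<otimes>\<^sub>x b = \<zero>\<^sub>x) \<and>
    (\<forall>i<j. t \<otimes>\<^sub>x ?g i = \<zero>\<^sub>x) \<and> t \<otimes>\<^sub>x ?g j = ?u" if j: "j < n" for j
 proof -
  define \<phi> where "\<phi> = (\<lambda>W\<in>opens_in Y N. \<lambda>\<mu>\<in>q.Qsec W. co W \<mu> j \<odot>\<^bsub>msect t.Q W\<^esub> restrict ?\<upsilon> W)"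
  have coj: "co W \<mu> j \<in> Z.sec W" if "opn W" "W \<subseteq> N" "\<mu> \<in> q.Qsec W" for W \<mu>
   using co(1)[OF that] j by auto
  have \<upsilon>W: "restrict ?\<upsilon> W \<in> t.Qsec W" "!!y. y \<in> W ==> germ Y y N' u \<in> restrict ?\<upsilon> W y" if "opn W" "W \<subseteq> N" for W
   using t.restrict_in[OF \<upsilon> u(1) that(1)] t.sclass_mem[OF u(1,3)] that N by auto
  have \<phi>W: "\<phi> W \<mu> = co W \<mu> j \<odot>\<^bsub>msect t.Q W\<^esub> restrict ?\<upsilon> W" if "opn W" "W \<subseteq> N" "\<mu> \<in> q.Qsec W" for W \<mu>
   using that by (simp add: \<phi>_def opens_in_def)
  have \<phi>_in: "\<phi> W \<mu> \<in> t.Qsec W" if "opn W" "W \<subseteq> N" "\<mu> \<in> q.Qsec W" for W \<mu>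
   unfolding \<phi>W[OF that] by (rule t.smult_in[OF \<upsilon>W(1)[OF that(1,2)] that(1) coj[OF that]])
  have "\<phi> \<in> carrier (msect H N)"
   unfolding H_iff
  proof (intro conjI ballI IntI)
   show "\<phi> \<in> extensional (opens_in Y N)" by (simp add: \<phi>_def)
   fix W assume "W \<in> opens_in Y N"
   then have W: "opn W" "W \<subseteq> N" "W \<subseteq> U" using N by (auto simp: opens_in_def)
   interpret zw: cring "sect Z W" by (rule tr.zcring[OF W(1)])
   show "\<phi> W \<in> extensional (q.Qsec W)" using W by (simp add: \<phi>_def opens_in_def)
   note \<upsilon>W' = \<upsilon>W(1)[OF W(1,2)] and coW = coj[OF W(1,2)]
   show "\<phi> W \<in> mod_hom (sect Z W) (msect q.Q W) (msect t.Q W)"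
   proof (rule mod_homI)
    fix \<mu> assume \<mu>: "\<mu> \<in> q.Qsec W"
    show "\<phi> W \<mu> \<in> t.Qsec W" by (rule \<phi>_in[OF W(1,2) \<mu>])
    fix \<nu> assume \<nu>: "\<nu> \<in> q.Qsec W"
    have "co W (\<mu> \<oplus>\<^bsub>msect q.Q W\<^esub> \<nu>) = (\<lambda>i\<in>{..<n}. co W \<mu> i \<oplus>\<^bsub>sect Z W\<^esub> co W \<nu> i)"
     by (rule co_eq[OF W(1,2)])
      (use tr.\<theta>_facts(2)[OF W(1,3) co(1)[OF W(1,2) \<mu>] co(1)[OF W(1,2) \<nu>]] co[OF W(1,2)] \<mu> \<nu> in auto)
    then show "\<phi> W (\<mu> \<oplus>\<^bsub>msect q.Q W\<^esub> \<nu>) = \<phi> W \<mu> \<oplus>\<^bsub>msect t.Q W\<^esub> \<phi> W \<nu>"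
     using t.smult_distrib(1)[OF \<upsilon>W' W(1) coW[OF \<mu>] coW[OF \<nu>]] q.add_in[OF \<mu> \<nu> W(1)] \<mu> \<nu> W(1,2) j by (simp add: \<phi>W)
   next
    fix c \<mu> assume c: "c \<in> Z.sec W" and \<mu>: "\<mu> \<in> q.Qsec W"
    have "co W (c \<odot>\<^bsub>msect q.Q W\<^esub> \<mu>) = (\<lambda>i\<in>{..<n}. c \<otimes>\<^bsub>sect Z W\<^esub> co W \<mu> i)"
     by (rule co_eq[OF W(1,2)])
      (use tr.\<theta>_facts(3)[OF W(1,3) c co(1)[OF W(1,2) \<mu>]] co[OF W(1,2) \<mu>] c in auto)
    then show "\<phi> W (c \<odot>\<^bsub>msect q.Q W\<^esub> \<mu>) = c \<odot>\<^bsub>msect t.Q W\<^esub> \<phi> W \<mu>"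
     using t.smult_distrib(2)[OF \<upsilon>W' W(1) c coW[OF \<mu>]] q.smult_in[OF \<mu> W(1) c] \<mu> W(1,2) j by (simp add: \<phi>W)
   qed
   fix W' \<mu> assume "W' \<in> opens_in Y W" and \<mu>: "\<mu> \<in> q.Qsec W"
   then have W': "opn W'" "W' \<subseteq> W" "W' \<subseteq> N" using W by (auto simp: opens_in_def)
   have "co W' (restrict \<mu> W') = tr.vrestr W W' (co W \<mu>)"
    by (rule co_eq[OF W'(1,3)])
     (use tr.vrestr_in[OF W(1) W'(1,2) co(1)[OF W(1,2) \<mu>]] tr.\<theta>_facts(5)[OF W(1,3) W'(1,2) co(1)[OF W(1,2) \<mu>]] co[OF W(1,2) \<mu>] in auto)
   moreover have "restrict (restrict ?\<upsilon> W) W' = restrict ?\<upsilon> W'" using W' by (simp add: Int_absorb1)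
   ultimately show "\<phi> W' (restrict \<mu> W') = restrict (\<phi> W \<mu>) W'"
    using t.restrict_smult[OF \<upsilon>W' W(1) coW[OF \<mu>] W'(1,2)] q.restrict_in[OF \<mu> W(1) W'(1,2)] \<mu> W(1,2) W'(1,3) j
    by (simp add: \<phi>W)
  qed
  moreover have "bij_betw (mu N) (a.Qsec N) (carrier (msect H N))"
   using iso[unfolded mod_sheaf_iso_def A_piece_eq Z_opn, THEN spec, THEN mp, OF N(1)] by (elim conjE)
  ultimately have "\<phi> \<in> mu N ` a.Qsec N" by (simp only: bij_betw_def)
  then obtain \<alpha> where "\<phi> = mu N \<alpha>" "\<alpha> \<in> a.Qsec N" by (rule imageE)
  then have \<alpha>: "\<alpha> \<in> a.Qsec N" "mu N \<alpha> = \<phi>" by simp_all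
  obtain t where t: "t \<in> \<alpha> x" by (rule a.section_ne[OF \<alpha>(1) N(1,2)])
  note tv = a.section_val(1,2)[OF \<alpha>(1) N(1,2) t]
  \<comment> \<open>The i-th basis germ represents the image of the i-th unit vector, whose j-th
    coordinate is 1 or 0; \<open>t_val\<close> turns the equality of cosets into one in the
    stalk.\<close>
  have tg: "t \<otimes>\<^sub>x ?g i = (if i = j then ?u else \<zero>\<^sub>x)" if i: "i < n" for i
  proof -
   let ?e = "tr.unit_vec N i"
   interpret s: surjective_ring_hom "B x" "stalk Z x" "stalk_map x" by (rule stalk_map_surjective[OF x])
   have e: "?e \<in> tr.vec N" by (rule tr.unit_vec_in[OF N(1)])
   have \<mu>: "\<theta> N ?e \<in> q.Qsec N" by (rule tr.\<theta>_facts(1)[OF N(1,3) e])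
   have gi: "?g i \<in> \<theta> N ?e x"
    using tr.\<theta>_facts(5)[OF tr.U order_refl N(1,3) tr.unit_vec_in[OF tr.U], of i] tr.unit_vec_restr[OF tr.U N(1,3), of i] V(5)[OF i V(2)] N(2)
    by simp
   have c: "co N (\<theta> N ?e) j = (if i = j then \<one>\<^bsub>sect Z N\<^esub> else \<zero>\<^bsub>sect Z N\<^esub>)"
    using co_eq[OF N(1) order_refl e HOL.refl] j by (simp add: tr.unit_vec_def)
   let ?b = "if i = j then \<one>\<^sub>x else \<zero>\<^sub>x"
   have b: "?b \<in> carrier (B x)" "stalk_map x ?b = germ Z x N (co N (\<theta> N ?e) j)"
    unfolding c using N Z.germ_one[of N x] Z.germ_zero[of N x] by auto
   have "t \<otimes>\<^sub>x ?g i \<in> \<phi> N (\<theta> N ?e) x"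
    using mult_mem[OF N(1) \<alpha>(1) N(1) order_refl \<mu> N(2) t gi] \<alpha>(2) by simp
   moreover have "?b \<otimes>\<^sub>x ?u \<in> \<phi> N (\<theta> N ?e) x"
    unfolding \<phi>W[OF N(1) order_refl \<mu>]
    by (rule t.smult_mem[OF \<upsilon>W(1)[OF N(1) order_refl] N(1,2) \<upsilon>W(2)[OF N(1) order_refl N(2)] coj[OF N(1) order_refl \<mu>] b])
   ultimately have "t \<otimes>\<^sub>x ?g i = ?b \<otimes>\<^sub>x ?u" by (intro t_val[OF \<phi>_in[OF N(1) order_refl \<mu>] N(1,2)])
   then show ?thesis using F_car[OF x Y.germ_in_st[where F = "F m", OF u]] by auto
  qed
  have "\<forall>b\<in>st (F (Suc (m - l))) x. t \<otimes>\<^sub>x b = \<zero>\<^sub>x"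
   using J_kills[OF x tv(1)] by (simp add: Suc_diff_le[OF l])
  then show ?thesis using tv(2) tg j by (intro bexI[of _ t]) auto
 qed
 show ?thesis by (rule exI[of _ n], rule exI[of _ ?g]) (use tr.stage_basis[OF V(1,3-5,2)] dual in blast)
qed

end

end

lemma quot_sheaf_cong:
 assumes "!!U. openin (space_of Y) U ==> F U = F' U" "!!U. openin (space_of Y) U ==> G U = G' U"
 shows "quot_sheaf Z Y \<pi> F G = quot_sheaf Z Y \<pi> F' G'"
proof -
 have st: "ideal_stalk Y G = ideal_stalk Y G'" unfolding ideal_stalk_def fun_eq_iff using assms(2) by blast
 have F: "(\<exists>V\<in>nhds_in Y U x. \<exists>s\<in>F V. P V s) \<longleftrightarrow> (\<exists>V\<in>nhds_in Y U x. \<exists>s\<in>F' V. P V s)" for U x P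
  using assms(1) by (auto simp: nhds_in_def)
 show ?thesis unfolding quot_sheaf_def st F ..
qed

section \<open>Condition (b) and the global equivalence\<close>

context free_multiple_structure
begin

lemma A_piece_m: "A_piece Z Y \<pi> m m = M_piece Z Y \<pi> m m"
 unfolding A_piece_eq M_piece_eq by (rule quot_sheaf_cong) (use F_m_eq_J_m F_top_eq_J_top in auto)

text \<open>By \<open>A_piece_m\<close> source and target are the same sheaf, and the map adds the
  stalk of F (m + 1), which is zero; so it is the identity on sections.\<close>

lemma A_to_M_iso: "mod_sheaf_iso Z (A_piece Z Y \<pi> m m) (M_piece Z Y \<pi> m m) (A_to_M Z Y \<pi> m m)"
proof -
 interpret t: quotient_sheaf Y Z \<pi> "F m" "F (Suc m)" by (rule quotient_F) simp
 have id: "A_to_M Z Y \<pi> m m U \<mu> = \<mu>" if U: "opn U" and \<mu>: "\<mu> \<in> t.Qsec U" for U \<mu>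
 proof (rule extensionalityI[of _ U])
  show "A_to_M Z Y \<pi> m m U \<mu> \<in> extensional U" by (simp add: A_to_M_def)
  show "\<mu> \<in> extensional U" using \<mu> by (simp add: t.Qsec_iff)
  fix x assume x: "x \<in> U"
  have xT: "x \<in> T" by (rule Y.opn_topspace[OF U x])
  interpret B: cring "B x" by (rule B_facts[OF xT])
  obtain s where s: "s \<in> \<mu> x" by (rule t.section_ne[OF \<mu> U x])
  note v = t.section_val[OF \<mu> U x s]
  have "set_add (B x) (\<mu> x) (st (F (Suc m)) x) = st (F (Suc m)) x +>\<^sub>x (s \<oplus>\<^sub>x \<zero>\<^sub>x)"
   by (rule t.set_add_coset[OF xT v(2) B.zero_closed equalityD1[OF v(3)] s])
    (simp add: coset_zero[OF t.st_facts(1,3)[OF xT]])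
  then show "A_to_M Z Y \<pi> m m U \<mu> x = \<mu> x" using x v(2,3) by (simp add: A_to_M_def)
 qed
 show ?thesis
  unfolding A_piece_m unfolding M_piece_eq mod_sheaf_iso_def opens_in_Z
 proof (intro allI impI conjI ballI)
  fix U assume "Z.opn U"
  then have U: "opn U" by simp
  show "A_to_M Z Y \<pi> m m U \<in> mod_hom (sect Z U) (msect t.Q U) (msect t.Q U)"
   by (rule mod_homI) (simp_all add: id[OF U] t.add_in[OF _ _ U] t.smult_in[OF _ U])
  show "bij_betw (A_to_M Z Y \<pi> m m U) (t.Qsec U) (t.Qsec U)"
   by (rule bij_betw_cong[THEN iffD2, OF _ bij_betw_id]) (simp add: id[OF U])
  show "A_to_M Z Y \<pi> m m V (mrestr t.Q U V \<mu>) = mrestr t.Q U V (A_to_M Z Y \<pi> m m U \<mu>)"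
   if "V \<in> opens_in Y U" "\<mu> \<in> t.Qsec U" for V \<mu>
   using that id[OF U that(2)] id[of V] t.restrict_in[OF that(2) U] by (simp add: t.Q_simps opens_in_def)
 qed
qed

lemma gorenstein_iff:
 fixes k :: "'k ring"
 assumes k: "field k" and \<kappa>: "\<kappa> \<in> ring_hom k (sect Y T)"
 shows "gorenstein Y \<longleftrightarrow> line_bundle Z (M_piece Z Y \<pi> m m) \<and>
  (\<forall>l\<le>m. mod_sheaf_iso Z (A_piece Z Y \<pi> m l)
   (hom_sheaf Z (M_piece Z Y \<pi> m (m - l)) (M_piece Z Y \<pi> m m)) (mult_map Z Y \<pi> m l))"
  (is "_ \<longleftrightarrow> ?a \<and> ?c")
proof (intro iffI conjI)
 have gor: "gorenstein Y \<longleftrightarrow> (\<forall>x\<in>T. finite_self_injective_dimension (B x))"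
  using Y_local by (auto simp: gorenstein_def gorenstein_local_ring_def)
 {
  assume "gorenstein Y"
  then have fin: "finite_self_injective_dimension (B x)" if "x \<in> T" for x using gor that by blast
  show ?a
   unfolding line_bundle_def
  proof
   fix x assume "x \<in> topspace (space_of Z)"
   then have x: "x \<in> T" by (simp add: space_eq)
   obtain U n \<theta> where U: "local_trivialization Y Z \<pi> (F m) (F (Suc m)) U n \<theta>" "x \<in> U"
    "mod_sheaf_iso (open_subspace Z U) (free_mod_sheaf Z n) (M_piece Z Y \<pi> m m) \<theta>"
    by (rule trivialization_at[OF order_refl x])
   then show "\<exists>U. Z.opn U \<and> x \<in> U \<and> (\<exists>\<theta>. mod_sheaf_iso (open_subspace Z U) (free_mod_sheaf Z 1) (M_piece Z Y \<pi> m m) \<theta>)"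
    using rank_one[OF U(1,2) fin[OF x]] local_trivialization.U[OF U(1)] by auto
  qed
  show ?c using mult_map_iso hom_extends_F'[OF _ fin] by simp
 next
  assume ac: "?a \<and> ?c"
  have "finite_self_injective_dimension (B x)" if x: "x \<in> T" for x
  proof (rule finite_self_injective_dimension_stalk[OF x k])
   \<comment> \<open>The field acts on each stalk through germs of global sections; the coinduced
     modules are formed over this structure.\<close>
   show "(\<lambda>c. germ Y x T (\<kappa> c)) \<in> ring_hom k (B x)"
    using ring_hom_trans[OF \<kappa> Y.germ_hom[OF T_opn x]] by (simp add: comp_def)
   obtain U \<theta> where U: "opn U" "x \<in> U" "mod_sheaf_iso (open_subspace Z U) (free_mod_sheaf Z 1) (M_piece Z Y \<pi> m m) \<theta>"
    using ac x unfolding line_bundle_def by (auto simp: space_eq)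
   interpret t: local_trivialization Y Z \<pi> "F m" "F (Suc m)" U 1 \<theta>
    by (intro local_trivialization.intro local_trivialization_axioms.intro quotient_F order_refl U(1) U(3)[unfolded M_piece_eq])
   obtain V s where V: "opn V" "x \<in> V" "V \<subseteq> U"
    "!!i. i < 1 ==> s i \<in> F m V" "!!i y. i < 1 ==> y \<in> V ==> germ Y y V (s i) \<in> \<theta> U (t.unit_vec U i) y"
    using t.basis_sections[OF U(2) order_refl] by blast
   have u: "st (F m) x = adjoin_ideal (B x) {\<zero>\<^sub>x} (germ Y x V (s 0))"
    using quotient_basisD(3)[OF t.stage_basis[OF V(1,3-5,2)]] by (simp add: F_top[OF x])
   have "hom_extends (B x) (st (F 1) x) (self_module (B x))"
   proof (rule hom_extends_of_dual[OF x u])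
    fix l assume "l \<le> m"
    \<comment> \<open>Condition (c) in degree m - l pairs A_(m-l) with M_l, and so yields the
      multipliers for F l.\<close>
    then have e: "m - (m - l) = l" by simp
    have "mod_sheaf_iso Z (A_piece Z Y \<pi> m (m - l))
     (hom_sheaf Z (M_piece Z Y \<pi> m (m - (m - l))) (M_piece Z Y \<pi> m m)) (mult_map Z Y \<pi> m (m - l))"
     using ac by simp
    from dual_basis_exists[OF diff_le_self x this V(1,2) V(4)[OF zero_less_one]]
    show "\<exists>n g. basis l x g n \<and>
     (\<forall>j<n. \<exists>t\<in>carrier (B x). (\<forall>b\<in>st (F (Suc l)) x. t \<otimes>\<^sub>x b = \<zero>\<^sub>x) \<and>
      (\<forall>i<j. t \<otimes>\<^sub>x g i = \<zero>\<^sub>x) \<and> t \<otimes>\<^sub>x g j = germ Y x V (s 0))"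
     unfolding e .
   qed simp
   then show "hom_extends (B x) (st I x) (self_module (B x))" unfolding F_1[OF x] .
  qed
  then show "gorenstein Y" using gor by blast
 }
qed

end

theorem mainTheorem1:
  fixes k :: "'k ring"
    and Z :: "('p, 's) ringed_space" and \<kappa>Z :: "'k \<Rightarrow> 's"
    and Y :: "('p, 'r) ringed_space" and \<kappa>Y :: "'k \<Rightarrow> 'r"
    and \<pi> :: "'p set \<Rightarrow> 'r \<Rightarrow> 's" and m :: nat
  assumes "algebraically_closed k"
    and "smooth_connected_variety k Z \<kappa>Z"
    and "multiple_structure k Z \<kappa>Z Y \<kappa>Y \<pi>"
    and "\<not> zero_ideal_sheaf Y (ideal_sheaf_pow Y (kernel_sheaf Y Z \<pi>) m)"
    and "zero_ideal_sheaf Y (ideal_sheaf_pow Y (kernel_sheaf Y Z \<pi>) (m + 1))"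
    and "free_type Z Y \<pi> m"
  shows "gorenstein Y \<longleftrightarrow>
    (line_bundle Z (A_piece Z Y \<pi> m m) \<and> line_bundle Z (M_piece Z Y \<pi> m m)) \<and>
    mod_sheaf_iso Z (A_piece Z Y \<pi> m m) (M_piece Z Y \<pi> m m) (A_to_M Z Y \<pi> m m) \<and>
    (\<forall>l\<le>m. mod_sheaf_iso Z (A_piece Z Y \<pi> m l)
       (hom_sheaf Z (M_piece Z Y \<pi> m (m - l)) (M_piece Z Y \<pi> m m))
       (mult_map Z Y \<pi> m l))"
proof -
 have Z: "is_ringed_space Z" "connected_space (space_of Z)" "!!x. x \<in> topspace (space_of Z) ==> regular_local_ring (stalk Z x)"
  using assms(2) by (auto simp: smooth_connected_variety_def is_scheme_over_def is_scheme_def)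
 have Y: "is_ringed_space Y" "\<kappa>Y \<in> ring_hom k (sect Y (topspace (space_of Y)))"
  "!!x. x \<in> topspace (space_of Y) ==> noetherian_local_ring (stalk Y x)" and red: "is_reduced_scheme_of Z Y \<pi>"
  using assms(3) by (auto simp: multiple_structure_def is_scheme_over_def is_scheme_def
    locally_cohen_macaulay_def cohen_macaulay_local_ring_def)
 have space: "space_of Z = space_of Y" using red by (simp add: is_reduced_scheme_of_def)
 interpret free_multiple_structure Y Z \<pi> m
 proof (intro free_multiple_structure.intro free_multiple_structure_axioms.intro ringed_surjection.intro
   ringed_surjection_axioms.intro ringed.intro)
  show "\<exists>V\<in>nhds_in Y U x. restr Z U V s \<in> \<pi> V ` carrier (sect Y V)"
   if "openin (space_of Y) U" "s \<in> carrier (sect Z U)" "x \<in> U" for U s x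
   using red that unfolding is_reduced_scheme_of_def by blast
 qed (insert Z Y red space assms(4-6), auto simp: is_reduced_scheme_of_def regular_local_ring_def
   noetherian_local_ring_def free_type_def)
 have "field k" using assms(1) by (simp add: algebraically_closed_def)
 from gorenstein_iff[OF this Y(2)] show ?thesis using A_piece_m A_to_M_iso by auto
qed

end
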